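(* Let $\widetilde{R}\cong S[x_0]$ be the truncated integral closure of $R$ in its homogeneous ring of quotients (setting and notation as in the context). Then: (a) There is an isomorphism of graded $K[x_0]$-modules $\Omega^1_{\widetilde{R}/K}\cong S[x_0]\,dx_0\oplus K[x_0]\otimes_K\Omega^1_{S/K}$. (b) The Hilbert function of $\Omega^1_{\widetilde{R}/K}$ is given by $\mathrm{HF}(i)=0$ for $i<0$, $\mathrm{HF}(0)=\dim_K(\Omega^1_{S/K})$, and $\mathrm{HF}(i)=\deg(\mathbb{X})+\dim_K(\Omega^1_{S/K})$ for $i>0$. (c) We have $\mathrm{HP}(\Omega^1_{\widetilde{R}/K})=\deg(\mathbb{X})+\dim_K(\Omega^1_{S/K})$ and $\mathrm{ri}(\Omega^1_{\widetilde{R}/K})=1$.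
   Context: Let $K$ be a perfect field, $n\ge 1$, $P=K[X_0,\dots,X_n]$ with the standard grading, and $\mathbb{X}\subseteq\mathbb{P}^n$ a $0$-dimensional subscheme over $K$ with saturated homogeneous vanishing ideal $I_{\mathbb{X}}$. Put $R=P/I_{\mathbb{X}}$ and let $x_i$ be the image of $X_i$ in $R$. Assume no point of the support of $\mathbb{X}$ lies on the hyperplane $X_0=0$; then $x_0$ is a non-zerodivisor of $R$. Let $S=R/\langle x_0-1\rangle$ (a finite dimensional $K$-algebra), let $f^{\rm deh}\in S$ be the image of $f\in R$, and $\deg(\mathbb{X})=\dim_K S$. The homogeneous ring of quotients is $Q^h(R)=\{a/b\mid a,b\in R,\ b \text{ homogeneous non-zerodivisor}\}$. The truncated integral closure $\widetilde{R}$ is the subring of $Q^h(R)$ generated by all homogeneous elements of non-negative degree; it is identified as a graded ring with $S[x_0]$, where $S$ has degree $0$ and $x_0$ has degree $1$, by $f\mapsto f^{\rm deh}x_0^d$ for homogeneous $f$ of degree $d$. Modules of Kähler differentials are graded so that $\deg(df)=\deg(f)$ for homogeneous $f$. For a finitely generated graded module $M$: $\mathrm{HF}_M(i)=\dim_K M_i$, $\mathrm{HP}(M)$ is the constant value of $\mathrm{HF}_M(i)$ for $i\gg0$, and $\mathrm{ri}(M)=\min\{i\in\mathbb{Z}\mid \mathrm{HF}_M(j)=\mathrm{HP}(M)\text{ for all }j\ge i\}$. *)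

theory Defs
  imports
    "HOL-Library.Poly_Mapping"
    "HOL-Library.Extended_Nat"
    "HOL-Algebra.QuotRing"
    "HOL-Algebra.UnivPoly"
    "HOL-Algebra.Generated_Rings"
    "HOL-Algebra.Generated_Groups"
    "Jordan_Normal_Form.VS_Connect"
begin

section \<open>Modules\<close>

text \<open>
  Modules are the module records of HOL-Algebra; their ring multiplication and unit are never
  used. A \<open>K\<close>-algebra is a ring record \<open>A\<close> together with its structure map \<open>\<phi> : K \<rightarrow> A\<close>.
  A grading of a module (or ring) is the family of its homogeneous components, indexed by
  the integers.
\<close>

definition regular_module :: "('a, 'z) ring_scheme \<Rightarrow> ('a, 'a) module" where
  "regular_module A = \<lparr>carrier = carrier A, mult = mult A, one = one A, zero = zero A,
     add = add A, smult = mult A\<rparr>"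

definition restrict_scalars ::
  "('c \<Rightarrow> 'a) \<Rightarrow> ('a, 'm, 'z) module_scheme \<Rightarrow> ('c, 'm) module" where
  "restrict_scalars \<phi> M = \<lparr>carrier = carrier M, mult = mult M, one = one M, zero = zero M,
     add = add M, smult = (\<lambda>c. smult M (\<phi> c))\<rparr>"

definition free_module :: "('a, 'z) ring_scheme \<Rightarrow> 'x set \<Rightarrow> ('a, 'x \<Rightarrow> 'a) module" where
  "free_module A X = \<lparr>
     carrier = {f. (\<forall>x. f x \<in> carrier A) \<and> (\<forall>x. x \<notin> X \<longrightarrow> f x = \<zero>\<^bsub>A\<^esub>) \<and> finite {x. f x \<noteq> \<zero>\<^bsub>A\<^esub>}},
     mult = (\<lambda>f g x. \<zero>\<^bsub>A\<^esub>),
     one = (\<lambda>x. \<zero>\<^bsub>A\<^esub>),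
     zero = (\<lambda>x. \<zero>\<^bsub>A\<^esub>),
     add = (\<lambda>f g x. f x \<oplus>\<^bsub>A\<^esub> g x),
     smult = (\<lambda>a f x. a \<otimes>\<^bsub>A\<^esub> f x)\<rparr>"

definition free_gen :: "('a, 'z) ring_scheme \<Rightarrow> 'x \<Rightarrow> 'x \<Rightarrow> 'a" where
  "free_gen A x = (\<lambda>y. if y = x then \<one>\<^bsub>A\<^esub> else \<zero>\<^bsub>A\<^esub>)"

definition gen_submodule ::
  "('a, 'z) ring_scheme \<Rightarrow> ('a, 'm, 'w) module_scheme \<Rightarrow> 'm set \<Rightarrow> 'm set" where
  "gen_submodule A M G = \<Inter>{N. submodule A N M \<and> G \<subseteq> N}"

definition quot_module :: "('a, 'm, 'w) module_scheme \<Rightarrow> 'm set \<Rightarrow> ('a, 'm set) module" where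
  "quot_module M N = \<lparr>
     carrier = a_rcosets\<^bsub>M\<^esub> N,
     mult = (\<lambda>X Y. N),
     one = N,
     zero = N,
     add = (\<lambda>X Y. X <+>\<^bsub>M\<^esub> Y),
     smult = (\<lambda>a X. \<Union>x\<in>X. N +>\<^bsub>M\<^esub> (a \<odot>\<^bsub>M\<^esub> x))\<rparr>"

definition graded_module_iso ::
  "('a, 'z) ring_scheme \<Rightarrow> ('a, 'm, 'v) module_scheme \<Rightarrow> (int \<Rightarrow> 'm set) \<Rightarrow>
   ('a, 'p, 'w) module_scheme \<Rightarrow> (int \<Rightarrow> 'p set) \<Rightarrow> ('m \<Rightarrow> 'p) \<Rightarrow> bool" where
  "graded_module_iso A M G N H f \<longleftrightarrow>
     f \<in> module_hom A M N \<and> bij_betw f (carrier M) (carrier N) \<and> (\<forall>i. f ` G i = H i)"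

subsection \<open>Tensor products\<close>

definition tensor_rels ::
  "('a, 'z) ring_scheme \<Rightarrow> ('a, 'm, 'v) module_scheme \<Rightarrow> ('a, 'p, 'w) module_scheme \<Rightarrow>
   ('m \<times> 'p \<Rightarrow> 'a) set" where
  "tensor_rels A M N =
    (let F = free_module A (carrier M \<times> carrier N); e = (\<lambda>x y. free_gen A (x, y)) in
       {e (x \<oplus>\<^bsub>M\<^esub> x') y \<ominus>\<^bsub>F\<^esub> (e x y \<oplus>\<^bsub>F\<^esub> e x' y) | x x' y.
          x \<in> carrier M \<and> x' \<in> carrier M \<and> y \<in> carrier N}
     \<union> {e x (y \<oplus>\<^bsub>N\<^esub> y') \<ominus>\<^bsub>F\<^esub> (e x y \<oplus>\<^bsub>F\<^esub> e x y') | x y y'.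
          x \<in> carrier M \<and> y \<in> carrier N \<and> y' \<in> carrier N}
     \<union> {e (a \<odot>\<^bsub>M\<^esub> x) y \<ominus>\<^bsub>F\<^esub> a \<odot>\<^bsub>F\<^esub> e x y | a x y.
          a \<in> carrier A \<and> x \<in> carrier M \<and> y \<in> carrier N}
     \<union> {e x (a \<odot>\<^bsub>N\<^esub> y) \<ominus>\<^bsub>F\<^esub> a \<odot>\<^bsub>F\<^esub> e x y | a x y.
          a \<in> carrier A \<and> x \<in> carrier M \<and> y \<in> carrier N})"

definition tensor_kernel ::
  "('a, 'z) ring_scheme \<Rightarrow> ('a, 'm, 'v) module_scheme \<Rightarrow> ('a, 'p, 'w) module_scheme \<Rightarrow>
   ('m \<times> 'p \<Rightarrow> 'a) set" where
  "tensor_kernel A M N =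
     gen_submodule A (free_module A (carrier M \<times> carrier N)) (tensor_rels A M N)"

definition tensor_module ::
  "('a, 'z) ring_scheme \<Rightarrow> ('a, 'm, 'v) module_scheme \<Rightarrow> ('a, 'p, 'w) module_scheme \<Rightarrow>
   ('a, ('m \<times> 'p \<Rightarrow> 'a) set) module" where
  "tensor_module A M N =
     quot_module (free_module A (carrier M \<times> carrier N)) (tensor_kernel A M N)"

definition pure_tensor ::
  "('a, 'z) ring_scheme \<Rightarrow> ('a, 'm, 'v) module_scheme \<Rightarrow> ('a, 'p, 'w) module_scheme \<Rightarrow>
   'm \<Rightarrow> 'p \<Rightarrow> ('m \<times> 'p \<Rightarrow> 'a) set" where
  "pure_tensor A M N x y =
     tensor_kernel A M N +>\<^bsub>free_module A (carrier M \<times> carrier N)\<^esub> free_gen A (x, y)"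

text \<open>
  The \<open>B\<close>-module \<open>B \<otimes>\<^sub>A N\<close> for an \<open>A\<close>-algebra \<open>\<phi> : A \<rightarrow> B\<close>. Scalar multiplication by \<open>b\<close> is the
  map \<open>x \<otimes> y \<mapsto> bx \<otimes> y\<close>, extended linearly to representatives in the free module.
\<close>

definition scalar_extension ::
  "('a, 'z) ring_scheme \<Rightarrow> ('b, 'v) ring_scheme \<Rightarrow> ('a \<Rightarrow> 'b) \<Rightarrow> ('a, 'p, 'w) module_scheme \<Rightarrow>
   ('b, ('b \<times> 'p \<Rightarrow> 'a) set) module" where
  "scalar_extension A B \<phi> N =
    (let M = restrict_scalars \<phi> (regular_module B);
         F = free_module A (carrier M \<times> carrier N);
         T = tensor_module A M N
     in \<lparr>carrier = carrier T, mult = mult T, one = one T, zero = zero T, add = add T,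
         smult = (\<lambda>b X. \<Union>f\<in>X. tensor_kernel A M N +>\<^bsub>F\<^esub>
           (\<Oplus>\<^bsub>F\<^esub>z\<in>{z. f z \<noteq> \<zero>\<^bsub>A\<^esub>}. f z \<odot>\<^bsub>F\<^esub> free_gen A (b \<otimes>\<^bsub>B\<^esub> fst z, snd z)))\<rparr>)"

subsection \<open>Kaehler differentials\<close>

text \<open>
  \<open>\<Omega>\<^sup>1\<close> of the algebra \<open>\<phi> : K \<rightarrow> A\<close>: the \<open>A\<close>-module on generators \<open>da\<close> with the relations
  \<open>d(a+b) = da + db\<close>, \<open>d(ab) = a db + b da\<close> and \<open>d(\<phi> c) = 0\<close>.
\<close>

definition kaehler_rels ::
  "('k, 'v) ring_scheme \<Rightarrow> ('a, 'z) ring_scheme \<Rightarrow> ('k \<Rightarrow> 'a) \<Rightarrow> ('a \<Rightarrow> 'a) set" where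
  "kaehler_rels K A \<phi> =
    (let F = free_module A (carrier A); e = free_gen A in
       {e (a \<oplus>\<^bsub>A\<^esub> b) \<ominus>\<^bsub>F\<^esub> (e a \<oplus>\<^bsub>F\<^esub> e b) | a b. a \<in> carrier A \<and> b \<in> carrier A}
     \<union> {e (a \<otimes>\<^bsub>A\<^esub> b) \<ominus>\<^bsub>F\<^esub> (a \<odot>\<^bsub>F\<^esub> e b \<oplus>\<^bsub>F\<^esub> b \<odot>\<^bsub>F\<^esub> e a) | a b. a \<in> carrier A \<and> b \<in> carrier A}
     \<union> {e (\<phi> c) | c. c \<in> carrier K})"

definition kaehler_kernel ::
  "('k, 'v) ring_scheme \<Rightarrow> ('a, 'z) ring_scheme \<Rightarrow> ('k \<Rightarrow> 'a) \<Rightarrow> ('a \<Rightarrow> 'a) set" where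
  "kaehler_kernel K A \<phi> = gen_submodule A (free_module A (carrier A)) (kaehler_rels K A \<phi>)"

definition kaehler ::
  "('k, 'v) ring_scheme \<Rightarrow> ('a, 'z) ring_scheme \<Rightarrow> ('k \<Rightarrow> 'a) \<Rightarrow> ('a, ('a \<Rightarrow> 'a) set) module" where
  "kaehler K A \<phi> = quot_module (free_module A (carrier A)) (kaehler_kernel K A \<phi>)"

definition kaehler_d ::
  "('k, 'v) ring_scheme \<Rightarrow> ('a, 'z) ring_scheme \<Rightarrow> ('k \<Rightarrow> 'a) \<Rightarrow> 'a \<Rightarrow> ('a \<Rightarrow> 'a) set" where
  "kaehler_d K A \<phi> a = kaehler_kernel K A \<phi> +>\<^bsub>free_module A (carrier A)\<^esub> free_gen A a"

text \<open>For graded \<open>A\<close>, the grading of \<open>\<Omega>\<^sup>1\<close> as a graded \<open>A\<close>-module in which \<open>deg (da) = deg a\<close>.\<close>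

definition kaehler_grade ::
  "('k, 'v) ring_scheme \<Rightarrow> ('a, 'z) ring_scheme \<Rightarrow> ('k \<Rightarrow> 'a) \<Rightarrow> (int \<Rightarrow> 'a set) \<Rightarrow>
   int \<Rightarrow> ('a \<Rightarrow> 'a) set set" where
  "kaehler_grade K A \<phi> G i = generate (add_monoid (kaehler K A \<phi>))
     {a \<odot>\<^bsub>kaehler K A \<phi>\<^esub> kaehler_d K A \<phi> b | a b j k. a \<in> G j \<and> b \<in> G k \<and> j + k = i}"

subsection \<open>Dimension and Hilbert functions\<close>

definition vdim :: "('k, 'v) ring_scheme \<Rightarrow> ('k, 'm, 'w) module_scheme \<Rightarrow> enat" where
  "vdim K V = (if vectorspace.fin_dim K V then enat (vectorspace.dim K V) else \<infinity>)"

definition hilbert_fun ::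
  "('k, 'v) ring_scheme \<Rightarrow> ('k, 'm) module \<Rightarrow> (int \<Rightarrow> 'm set) \<Rightarrow> int \<Rightarrow> enat" where
  "hilbert_fun K M G i = vdim K (M\<lparr>carrier := G i\<rparr>)"

definition hilbert_const :: "(int \<Rightarrow> enat) \<Rightarrow> enat" where
  "hilbert_const h = (THE c. \<exists>i0. \<forall>i\<ge>i0. h i = c)"

definition regularity_index :: "(int \<Rightarrow> enat) \<Rightarrow> int" where
  "regularity_index h = (LEAST i. \<forall>j\<ge>i. h j = hilbert_const h)"

section \<open>Homogeneous rings of quotients\<close>

definition hom_nonzerodivisors :: "('a, 'z) ring_scheme \<Rightarrow> (int \<Rightarrow> 'a set) \<Rightarrow> 'a set" where
  "hom_nonzerodivisors A G =
     {b \<in> carrier A. (\<exists>e. b \<in> G e) \<and> (\<forall>a\<in>carrier A. a \<otimes>\<^bsub>A\<^esub> b = \<zero>\<^bsub>A\<^esub> \<longrightarrow> a = \<zero>\<^bsub>A\<^esub>)}"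

text \<open>The fraction \<open>a/b\<close> is the set of all pairs \<open>(a', b')\<close> with \<open>ab' = a'b\<close>.\<close>

definition hfrac ::
  "('a, 'z) ring_scheme \<Rightarrow> (int \<Rightarrow> 'a set) \<Rightarrow> 'a \<Rightarrow> 'a \<Rightarrow> ('a \<times> 'a) set" where
  "hfrac A G a b = {(a', b'). a' \<in> carrier A \<and> b' \<in> hom_nonzerodivisors A G \<and>
     a \<otimes>\<^bsub>A\<^esub> b' = a' \<otimes>\<^bsub>A\<^esub> b}"

definition hom_quotient_ring ::
  "('a, 'z) ring_scheme \<Rightarrow> (int \<Rightarrow> 'a set) \<Rightarrow> ('a \<times> 'a) set ring" where
  "hom_quotient_ring A G = \<lparr>
     carrier = {hfrac A G a b | a b. a \<in> carrier A \<and> b \<in> hom_nonzerodivisors A G},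
     mult = (\<lambda>X Y. \<Union>(a, b)\<in>X. \<Union>(c, e)\<in>Y. hfrac A G (a \<otimes>\<^bsub>A\<^esub> c) (b \<otimes>\<^bsub>A\<^esub> e)),
     one = hfrac A G \<one>\<^bsub>A\<^esub> \<one>\<^bsub>A\<^esub>,
     zero = hfrac A G \<zero>\<^bsub>A\<^esub> \<one>\<^bsub>A\<^esub>,
     add = (\<lambda>X Y. \<Union>(a, b)\<in>X. \<Union>(c, e)\<in>Y.
       hfrac A G (a \<otimes>\<^bsub>A\<^esub> e \<oplus>\<^bsub>A\<^esub> c \<otimes>\<^bsub>A\<^esub> b) (b \<otimes>\<^bsub>A\<^esub> e))\<rparr>"

definition hom_quotient_grade ::
  "('a, 'z) ring_scheme \<Rightarrow> (int \<Rightarrow> 'a set) \<Rightarrow> int \<Rightarrow> ('a \<times> 'a) set set" where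
  "hom_quotient_grade A G d =
     {hfrac A G a b | a b e. a \<in> G (d + e) \<and> b \<in> G e \<and> b \<in> hom_nonzerodivisors A G}"

definition truncated_closure ::
  "('a, 'z) ring_scheme \<Rightarrow> (int \<Rightarrow> 'a set) \<Rightarrow> ('a \<times> 'a) set ring" where
  "truncated_closure A G = (hom_quotient_ring A G)\<lparr>carrier :=
     generate_ring (hom_quotient_ring A G) (\<Union>d\<in>{0..}. hom_quotient_grade A G d)\<rparr>"

definition truncated_closure_grade ::
  "('a, 'z) ring_scheme \<Rightarrow> (int \<Rightarrow> 'a set) \<Rightarrow> int \<Rightarrow> ('a \<times> 'a) set set" where
  "truncated_closure_grade A G d = carrier (truncated_closure A G) \<inter> hom_quotient_grade A G d"

section \<open>Zero-dimensional subschemes of projective space\<close>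

definition perfect_field :: "'k::field itself \<Rightarrow> bool" where
  "perfect_field _ \<longleftrightarrow> CHAR('k) = 0 \<or> surj (\<lambda>x::'k. x ^ CHAR('k))"

type_synonym 'k mpoly = "(nat \<Rightarrow>\<^sub>0 nat) \<Rightarrow>\<^sub>0 'k"

definition X :: "nat \<Rightarrow> 'k::field mpoly" where
  "X i = Poly_Mapping.single (Poly_Mapping.single i 1) 1"

definition Const :: "'k \<Rightarrow> 'k::field mpoly" where
  "Const c = Poly_Mapping.single 0 c"

text \<open>\<open>K[X\<^sub>0,\<dots>,X\<^sub>n]\<close> is cut out of the polynomials in countably many indeterminates.\<close>

definition poly_ring :: "nat \<Rightarrow> 'k::field mpoly ring" where
  "poly_ring n = \<lparr>carrier = {p. \<forall>m\<in>Poly_Mapping.keys p. Poly_Mapping.keys m \<subseteq> {..n}},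
     mult = (*), one = 1, zero = 0, add = (+)\<rparr>"

definition mdegree :: "(nat \<Rightarrow>\<^sub>0 nat) \<Rightarrow> nat" where
  "mdegree m = (\<Sum>i\<in>Poly_Mapping.keys m. Poly_Mapping.lookup m i)"

definition poly_grade :: "nat \<Rightarrow> int \<Rightarrow> 'k::field mpoly set" where
  "poly_grade n d = {p \<in> carrier (poly_ring n). \<forall>m\<in>Poly_Mapping.keys p. int (mdegree m) = d}"

definition homogeneous_ideal :: "nat \<Rightarrow> 'k::field mpoly set \<Rightarrow> bool" where
  "homogeneous_ideal n I \<longleftrightarrow> ideal I (poly_ring n) \<and>
     (\<exists>H \<subseteq> (\<Union>d. poly_grade n d). I = Idl\<^bsub>poly_ring n\<^esub> H)"

definition saturation :: "nat \<Rightarrow> 'k::field mpoly set \<Rightarrow> 'k mpoly set" where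
  "saturation n I = {f \<in> carrier (poly_ring n). \<forall>i\<le>n. \<exists>N. X i ^ N * f \<in> I}"

text \<open>
  A closed subscheme of \<open>\<PP>\<^sup>n\<close> is given by its saturated homogeneous vanishing ideal \<open>I\<close>; the points
  of its underlying space are the homogeneous primes above \<open>I\<close> that do not contain the irrelevant
  ideal. The scheme has dimension zero iff this space is non-empty and there is no proper
  specialization between its points.
\<close>

definition scheme_ideal :: "nat \<Rightarrow> 'k::field mpoly set \<Rightarrow> bool" where
  "scheme_ideal n I \<longleftrightarrow> homogeneous_ideal n I \<and> saturation n I = I"

definition scheme_points :: "nat \<Rightarrow> 'k::field mpoly set \<Rightarrow> 'k mpoly set set" where
  "scheme_points n I = {p. primeideal p (poly_ring n) \<and> homogeneous_ideal n p \<and> I \<subseteq> p \<and>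
     \<not> (\<forall>i\<le>n. X i \<in> p)}"

definition zero_dimensional :: "nat \<Rightarrow> 'k::field mpoly set \<Rightarrow> bool" where
  "zero_dimensional n I \<longleftrightarrow> scheme_points n I \<noteq> {} \<and>
     (\<forall>p\<in>scheme_points n I. \<forall>q\<in>scheme_points n I. p \<subseteq> q \<longrightarrow> p = q)"

subsection \<open>The homogeneous coordinate ring \<open>R\<close>\<close>

definition coord_ring :: "nat \<Rightarrow> 'k::field mpoly set \<Rightarrow> 'k mpoly set ring" where
  "coord_ring n I = poly_ring n Quot I"

definition coord_class :: "nat \<Rightarrow> 'k::field mpoly set \<Rightarrow> 'k mpoly \<Rightarrow> 'k mpoly set" where
  "coord_class n I p = I +>\<^bsub>poly_ring n\<^esub> p"

definition coord_grade :: "nat \<Rightarrow> 'k::field mpoly set \<Rightarrow> int \<Rightarrow> 'k mpoly set set" where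
  "coord_grade n I d = coord_class n I ` poly_grade n d"

subsection \<open>The affine coordinate ring \<open>S = R/\<langle>x\<^sub>0 - 1\<rangle>\<close>\<close>

definition affine_ideal :: "nat \<Rightarrow> 'k::field mpoly set \<Rightarrow> 'k mpoly set set" where
  "affine_ideal n I = Idl\<^bsub>coord_ring n I\<^esub>
     {coord_class n I (X 0) \<ominus>\<^bsub>coord_ring n I\<^esub> \<one>\<^bsub>coord_ring n I\<^esub>}"

definition affine_ring :: "nat \<Rightarrow> 'k::field mpoly set \<Rightarrow> 'k mpoly set set ring" where
  "affine_ring n I = coord_ring n I Quot affine_ideal n I"

definition affine_const :: "nat \<Rightarrow> 'k::field mpoly set \<Rightarrow> 'k \<Rightarrow> 'k mpoly set set" where
  "affine_const n I c = affine_ideal n I +>\<^bsub>coord_ring n I\<^esub> coord_class n I (Const c)"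

definition scheme_degree :: "nat \<Rightarrow> 'k::field mpoly set \<Rightarrow> enat" where
  "scheme_degree n I = vdim class_ring
     (restrict_scalars (affine_const n I) (regular_module (affine_ring n I)))"

text \<open>\<open>\<Omega>\<^sup>1\<close> of \<open>S\<close> over \<open>K\<close>, as a \<open>K\<close>-module.\<close>

definition affine_omega ::
  "nat \<Rightarrow> 'k::field mpoly set \<Rightarrow> ('k, ('k mpoly set set \<Rightarrow> 'k mpoly set set) set) module" where
  "affine_omega n I =
     restrict_scalars (affine_const n I) (kaehler class_ring (affine_ring n I) (affine_const n I))"

subsection \<open>The truncated integral closure of \<open>R\<close> and its differentials\<close>

type_synonym 'k frac = "('k mpoly set \<times> 'k mpoly set) set"

definition closure_ring :: "nat \<Rightarrow> 'k::field mpoly set \<Rightarrow> 'k frac ring" where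
  "closure_ring n I = truncated_closure (coord_ring n I) (coord_grade n I)"

definition closure_grade :: "nat \<Rightarrow> 'k::field mpoly set \<Rightarrow> int \<Rightarrow> 'k frac set" where
  "closure_grade n I = truncated_closure_grade (coord_ring n I) (coord_grade n I)"

text \<open>The canonical map \<open>R \<rightarrow> Q\<^sup>h(R)\<close>, \<open>r \<mapsto> r/1\<close>, evaluated at the class of \<open>p\<close>.\<close>

definition closure_class :: "nat \<Rightarrow> 'k::field mpoly set \<Rightarrow> 'k mpoly \<Rightarrow> 'k frac" where
  "closure_class n I p =
     hfrac (coord_ring n I) (coord_grade n I) (coord_class n I p) \<one>\<^bsub>coord_ring n I\<^esub>"

definition closure_const :: "nat \<Rightarrow> 'k::field mpoly set \<Rightarrow> 'k \<Rightarrow> 'k frac" where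
  "closure_const n I c = closure_class n I (Const c)"

definition closure_omega ::
  "nat \<Rightarrow> 'k::field mpoly set \<Rightarrow> ('k frac, ('k frac \<Rightarrow> 'k frac) set) module" where
  "closure_omega n I = kaehler class_ring (closure_ring n I) (closure_const n I)"

definition closure_omega_grade ::
  "nat \<Rightarrow> 'k::field mpoly set \<Rightarrow> int \<Rightarrow> ('k frac \<Rightarrow> 'k frac) set set" where
  "closure_omega_grade n I =
     kaehler_grade class_ring (closure_ring n I) (closure_const n I) (closure_grade n I)"

definition closure_omega_hilbert :: "nat \<Rightarrow> 'k::field mpoly set \<Rightarrow> int \<Rightarrow> enat" where
  "closure_omega_hilbert n I = hilbert_fun class_ring
     (restrict_scalars (closure_const n I) (closure_omega n I)) (closure_omega_grade n I)"

text \<open>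
  The \<open>K[x\<^sub>0]\<close>-module structure comes from the \<open>K\<close>-algebra homomorphism from \<open>K[x\<^sub>0]\<close> to the closure
  sending the indeterminate to \<open>x\<^sub>0\<close>.
\<close>

abbreviation K_poly :: "('k::field, nat \<Rightarrow> 'k) up_ring" where
  "K_poly \<equiv> UP class_ring"

definition closure_omega_Kpoly ::
  "nat \<Rightarrow> 'k::field mpoly set \<Rightarrow> (nat \<Rightarrow> 'k, ('k frac \<Rightarrow> 'k frac) set) module" where
  "closure_omega_Kpoly n I = restrict_scalars
     (UnivPoly.eval class_ring (closure_ring n I) (closure_const n I) (closure_class n I (X 0)))
     (closure_omega n I)"

subsection \<open>The graded \<open>K[x\<^sub>0]\<close>-modules \<open>S[x\<^sub>0] dx\<^sub>0\<close> and \<open>K[x\<^sub>0] \<otimes>\<^sub>K \<Omega>\<^sup>1\<close>\<close>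

definition up_const :: "('a, 'z) ring_scheme \<Rightarrow> 'a \<Rightarrow> nat \<Rightarrow> 'a" where
  "up_const A a = up_ring.monom (UP A) a 0"

definition up_var :: "('a, 'z) ring_scheme \<Rightarrow> nat \<Rightarrow> 'a" where
  "up_var A = up_ring.monom (UP A) \<one>\<^bsub>A\<^esub> 1"

definition up_grade :: "('a, 'z) ring_scheme \<Rightarrow> int \<Rightarrow> (nat \<Rightarrow> 'a) set" where
  "up_grade A d = (if d < 0 then {\<zero>\<^bsub>UP A\<^esub>}
     else {up_ring.monom (UP A) a (nat d) | a. a \<in> carrier A})"

text \<open>
  \<open>S[x\<^sub>0] dx\<^sub>0\<close> is free of rank one over \<open>S[x\<^sub>0]\<close> with a basis element of degree one;
  \<open>p dx\<^sub>0\<close> is represented by its coefficient \<open>p\<close>.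
\<close>

definition dx0_module ::
  "nat \<Rightarrow> 'k::field mpoly set \<Rightarrow> (nat \<Rightarrow> 'k, nat \<Rightarrow> 'k mpoly set set) module" where
  "dx0_module n I = restrict_scalars
     (UnivPoly.eval class_ring (UP (affine_ring n I))
        (\<lambda>c. up_const (affine_ring n I) (affine_const n I c)) (up_var (affine_ring n I)))
     (regular_module (UP (affine_ring n I)))"

definition dx0_grade ::
  "nat \<Rightarrow> 'k::field mpoly set \<Rightarrow> int \<Rightarrow> (nat \<Rightarrow> 'k mpoly set set) set" where
  "dx0_grade n I i = up_grade (affine_ring n I) (i - 1)"

type_synonym 'k omega_tensor =
  "((nat \<Rightarrow> 'k) \<times> ('k mpoly set set \<Rightarrow> 'k mpoly set set) set \<Rightarrow> 'k) set"

definition omega_tensor_module ::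
  "nat \<Rightarrow> 'k::field mpoly set \<Rightarrow> (nat \<Rightarrow> 'k, 'k omega_tensor) module" where
  "omega_tensor_module n I =
     scalar_extension class_ring K_poly (up_const class_ring) (affine_omega n I)"

text \<open>\<open>S\<close>, and hence its module of differentials, is concentrated in degree zero.\<close>

definition omega_tensor_grade ::
  "nat \<Rightarrow> 'k::field mpoly set \<Rightarrow> int \<Rightarrow> 'k omega_tensor set" where
  "omega_tensor_grade n I i = generate (add_monoid (omega_tensor_module n I))
     {pure_tensor class_ring (restrict_scalars (up_const class_ring) (regular_module K_poly))
        (affine_omega n I) p w | p w. p \<in> up_grade class_ring i \<and> w \<in> carrier (affine_omega n I)}"

end

theory Submission
  imports Defs "HOL-Computational_Algebra.Polynomial"
begin

text \<open>Since the scheme has dimension zero and misses \<open>X\<^sub>0 = 0\<close>, avoidance of multiplicative sets by primes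
  shows that \<open>x\<^sub>0\<close> is a non-zerodivisor of \<open>R\<close> and that every homogeneous non-zerodivisor divides a
  power of \<open>x\<^sub>0\<close>. Hence every homogeneous fraction of degree \<open>d \<ge> 0\<close> is some \<open>q/x\<^sub>0\<^sup>k\<close> with \<open>q\<close> homogeneous of
  degree \<open>k + d\<close>, and the closure is the polynomial ring \<open>S[x\<^sub>0]\<close>.

  For a polynomial ring, \<open>d(s x\<^sup>i) = x\<^sup>i ds + i s x\<^bsup>i-1\<^esup> dx\<close> splits the differentials into \<open>S[x] dx\<close> and the
  polynomials with coefficients in \<open>\<Omega>\<^sub>S\<close>; the latter form \<open>K[x] \<otimes>\<^sub>K \<Omega>\<^sub>S\<close>. The homogeneous components are
  therefore \<open>0\<close>, \<open>\<Omega>\<^sub>S\<close> and \<open>S \<oplus> \<Omega>\<^sub>S\<close> in negative, zero and positive degree. By Zariski's lemma every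
  polynomial is algebraic modulo \<open>I + (X\<^sub>0 - 1)\<close>, so \<open>S\<close> and \<open>\<Omega>\<^sub>S\<close> are finite-dimensional, and since
  \<open>S \<noteq> 0\<close> the Hilbert function really jumps at \<open>1\<close>.\<close>

section \<open>Prime ideals avoiding a multiplicative set\<close>

text \<open>All primes come from Zorn's lemma, applied to ideals that miss a multiplicative set, so
  they need not be homogeneous. \<open>homog_core\<close> repairs this: it keeps a prime prime and
  yields a point of the scheme as soon as the prime contains \<open>I\<close> and misses a variable.
  Dimension zero then enters as the equality of two nested points. Subrings and ideals are plain
  subsets of one type, and a residue ring is expressed by membership in the prime, so type-class
  arithmetic applies throughout. Zariski's lemma is accordingly proved by passing the Goldman
  property down a chain of subrings of the polynomial ring. Elements of the closure are sets of
  pairs of cosets. The differentials are therefore computed for any ring with a bijective evaluation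
  map from \<open>UP S\<close>, and the closure enters through that map and its grading. Finite
  dimension of \<open>S\<close> is a real issue because dimensions are extended naturals: additivity
  over direct sums is proved for finite dimension, and the jump of the Hilbert function at
  \<open>1\<close> would disappear if the differentials of \<open>S\<close> had infinite
  dimension.\<close>

definition subring_set :: "'a::comm_ring_1 set \<Rightarrow> bool" where
  "subring_set P \<longleftrightarrow> 1 \<in> P \<and> (\<forall>a\<in>P. \<forall>b\<in>P. a - b \<in> P \<and> a * b \<in> P)"

definition ideal_set :: "'a::comm_ring_1 set \<Rightarrow> 'a set \<Rightarrow> bool" where
  "ideal_set P J \<longleftrightarrow> J \<subseteq> P \<and> 0 \<in> J \<and> (\<forall>a\<in>J. \<forall>b\<in>J. a + b \<in> J) \<and> (\<forall>r\<in>P. \<forall>a\<in>J. r * a \<in> J)"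

definition prime_set :: "'a::comm_ring_1 set \<Rightarrow> 'a set \<Rightarrow> bool" where
  "prime_set P Q \<longleftrightarrow> ideal_set P Q \<and> 1 \<notin> Q \<and> (\<forall>a\<in>P. \<forall>b\<in>P. a * b \<in> Q \<longrightarrow> a \<in> Q \<or> b \<in> Q)"

lemma subring_set_one: "subring_set P \<Longrightarrow> 1 \<in> P"
  and subring_set_diff: "subring_set P \<Longrightarrow> a \<in> P \<Longrightarrow> b \<in> P \<Longrightarrow> a - b \<in> P"
  and subring_set_mult: "subring_set P \<Longrightarrow> a \<in> P \<Longrightarrow> b \<in> P \<Longrightarrow> a * b \<in> P"
  by (auto simp: subring_set_def)

lemma subring_set_zero: "subring_set P \<Longrightarrow> 0 \<in> P"
  using subring_set_diff[of P 1 1] by (simp add: subring_set_one)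

lemma subring_set_uminus: "subring_set P \<Longrightarrow> a \<in> P \<Longrightarrow> - a \<in> P"
  using subring_set_diff[of P 0 a] by (simp add: subring_set_zero)

lemma subring_set_add: "subring_set P \<Longrightarrow> a \<in> P \<Longrightarrow> b \<in> P \<Longrightarrow> a + b \<in> P"
  using subring_set_diff[of P a "- b"] by (simp add: subring_set_uminus)

lemma subring_set_power: "subring_set P \<Longrightarrow> a \<in> P \<Longrightarrow> a ^ k \<in> P"
  by (induction k) (auto simp: subring_set_one subring_set_mult)

lemma subring_set_sum: "subring_set P \<Longrightarrow> (\<And>i. i \<in> F \<Longrightarrow> f i \<in> P) \<Longrightarrow> sum f F \<in> P"
  by (induction F rule: infinite_finite_induct) (auto simp: subring_set_zero subring_set_add)

lemmas subring_set_closed = subring_set_one subring_set_diff subring_set_mult subring_set_zero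
  subring_set_uminus subring_set_add subring_set_power subring_set_sum

lemma ideal_set_sub: "ideal_set P J \<Longrightarrow> a \<in> J \<Longrightarrow> a \<in> P"
  and ideal_set_zero: "ideal_set P J \<Longrightarrow> 0 \<in> J"
  and ideal_set_add: "ideal_set P J \<Longrightarrow> a \<in> J \<Longrightarrow> b \<in> J \<Longrightarrow> a + b \<in> J"
  and ideal_set_mult: "ideal_set P J \<Longrightarrow> r \<in> P \<Longrightarrow> a \<in> J \<Longrightarrow> r * a \<in> J"
  by (auto simp: ideal_set_def)

lemma ideal_set_mult2: "ideal_set P J \<Longrightarrow> r \<in> P \<Longrightarrow> a \<in> J \<Longrightarrow> a * r \<in> J"
  using ideal_set_mult[of P J r a] by (simp add: mult.commute)

lemma ideal_set_uminus: "subring_set P \<Longrightarrow> ideal_set P J \<Longrightarrow> a \<in> J \<Longrightarrow> - a \<in> J"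
  using ideal_set_mult[of P J "- 1" a] by (simp add: subring_set_closed)

lemma ideal_set_diff: "subring_set P \<Longrightarrow> ideal_set P J \<Longrightarrow> a \<in> J \<Longrightarrow> b \<in> J \<Longrightarrow> a - b \<in> J"
  using ideal_set_add[of P J a "- b"] ideal_set_uminus[of P J b] by simp

lemma ideal_set_sum: "ideal_set P J \<Longrightarrow> (\<And>i. i \<in> F \<Longrightarrow> f i \<in> J) \<Longrightarrow> sum f F \<in> J"
  by (induction F rule: infinite_finite_induct) (auto simp: ideal_set_zero ideal_set_add)

lemma ideal_set_cong:
  "subring_set P \<Longrightarrow> ideal_set P J \<Longrightarrow> a - b \<in> J \<Longrightarrow> a \<in> J \<longleftrightarrow> b \<in> J"
  using ideal_set_add[of P J "a - b" b] ideal_set_diff[of P J a "a - b"] by auto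

lemma prime_set_ideal: "prime_set P Q \<Longrightarrow> ideal_set P Q"
  and prime_set_one: "prime_set P Q \<Longrightarrow> 1 \<notin> Q"
  and prime_set_mult: "prime_set P Q \<Longrightarrow> a \<in> P \<Longrightarrow> b \<in> P \<Longrightarrow> a * b \<in> Q \<Longrightarrow> a \<in> Q \<or> b \<in> Q"
  by (auto simp: prime_set_def)

lemma prime_set_power:
  assumes "subring_set P" "prime_set P Q" "a \<in> P" "a ^ k \<in> Q" shows "a \<in> Q"
  using assms(4)
proof (induction k)
  case 0 then show ?case using prime_set_one[OF assms(2)] by simp
next
  case (Suc k) then show ?case
    using prime_set_mult[OF assms(2,3), of "a ^ k"] assms(1,3) by (auto simp: subring_set_closed)
qed

text \<open>The ideal \<open>J + bP\<close>. It serves for enlarging a maximal ideal in the Zorn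
  argument, for \<open>I + (b)\<close> with a homogeneous \<open>b\<close>, and for
  \<open>I + (X 0 - 1)\<close>.\<close>

lemma ideal_set_adjoin:
  assumes P: "subring_set P" and J: "ideal_set P J" and b: "b \<in> P"
  shows "ideal_set P {a + b * r | a r. a \<in> J \<and> r \<in> P}" (is "ideal_set P ?J")
    and "J \<subseteq> {a + b * r | a r. a \<in> J \<and> r \<in> P}" and "b \<in> {a + b * r | a r. a \<in> J \<and> r \<in> P}"
proof -
  show "ideal_set P ?J"
    unfolding ideal_set_def
  proof (intro conjI ballI subsetI)
    fix x assume "x \<in> ?J" then show "x \<in> P"
      using P J b by (auto intro!: subring_set_closed dest: ideal_set_sub)
  next
    show "0 \<in> ?J" using ideal_set_zero[OF J] subring_set_zero[OF P] by force
  next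
    fix x y assume "x \<in> ?J" "y \<in> ?J"
    then obtain a r a' r' where "x = a + b * r" "y = a' + b * r'" "a \<in> J" "a' \<in> J" "r \<in> P" "r' \<in> P" by auto
    then have "x + y = (a + a') + b * (r + r')" "a + a' \<in> J" "r + r' \<in> P"
      using P J by (auto simp: algebra_simps subring_set_closed ideal_set_add)
    then show "x + y \<in> ?J" by blast
  next
    fix s x assume s: "s \<in> P" and "x \<in> ?J"
    then obtain a r where "x = a + b * r" "a \<in> J" "r \<in> P" by auto
    then have "s * x = s * a + b * (s * r)" "s * a \<in> J" "s * r \<in> P"
      using subring_set_mult[OF P s] ideal_set_mult[OF J s] by (simp_all add: algebra_simps)
    then show "s * x \<in> ?J" by blast
  qed
  show "J \<subseteq> ?J" using subring_set_zero[OF P] by force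
  show "b \<in> ?J" using ideal_set_zero[OF J] subring_set_one[OF P] by force
qed

text \<open>An ideal that is maximal among those containing \<open>J\<close> and missing
  \<open>M\<close> is prime: if \<open>a\<close> and \<open>b\<close> lie outside it, adjoining
  either one meets \<open>M\<close>, and the product of the two elements of \<open>M\<close> found
  this way falls into the ideal once \<open>a * b\<close> does.\<close>

lemma prime_set_avoiding:
  assumes P: "subring_set P" and J: "ideal_set P J"
    and M: "M \<subseteq> P" "1 \<in> M" "\<And>a b. a \<in> M \<Longrightarrow> b \<in> M \<Longrightarrow> a * b \<in> M" and JM: "J \<inter> M = {}"
  obtains Q where "prime_set P Q" "J \<subseteq> Q" "Q \<inter> M = {}"
proof -
  define Z where "Z = {Q. ideal_set P Q \<and> J \<subseteq> Q \<and> Q \<inter> M = {}}"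
  have "\<exists>Q\<in>Z. \<forall>X\<in>Z. Q \<subseteq> X \<longrightarrow> X = Q"
  proof (rule subset_Zorn_nonempty)
    show "Z \<noteq> {}" using J JM by (auto simp: Z_def)
  next
    fix C assume C: "C \<noteq> {}" "subset.chain Z C"
    then have CZ: "\<And>c. c \<in> C \<Longrightarrow> ideal_set P c \<and> J \<subseteq> c \<and> c \<inter> M = {}"
      and tot: "\<And>c d. c \<in> C \<Longrightarrow> d \<in> C \<Longrightarrow> c \<subseteq> d \<or> d \<subseteq> c"
      unfolding subset.chain_def Z_def by (blast, fast)
    have "ideal_set P (\<Union>C)"
      unfolding ideal_set_def
    proof (intro conjI ballI subsetI)
      fix x assume "x \<in> \<Union>C" then show "x \<in> P" using CZ by (meson UnionE ideal_set_sub)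
    next
      show "0 \<in> \<Union>C" using C(1) CZ by (meson UnionI ex_in_conv ideal_set_zero)
    next
      fix a b assume "a \<in> \<Union>C" "b \<in> \<Union>C"
      then obtain c d where "a \<in> c" "b \<in> d" "c \<in> C" "d \<in> C" by auto
      then show "a + b \<in> \<Union>C" using tot[of c d] CZ by (metis UnionI ideal_set_add subsetD)
    next
      fix r a assume "r \<in> P" "a \<in> \<Union>C"
      then show "r * a \<in> \<Union>C" using CZ by (meson UnionE UnionI ideal_set_mult)
    qed
    moreover have "J \<subseteq> \<Union>C" using C(1) CZ by blast
    moreover have "\<Union>C \<inter> M = {}" using CZ by blast
    ultimately show "\<Union>C \<in> Z" by (auto simp: Z_def)
  qed
  then obtain Q where Q: "ideal_set P Q" "J \<subseteq> Q" "Q \<inter> M = {}"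
    and max: "\<And>X. ideal_set P X \<Longrightarrow> J \<subseteq> X \<Longrightarrow> X \<inter> M = {} \<Longrightarrow> Q \<subseteq> X \<Longrightarrow> X = Q"
    by (auto simp: Z_def)
  have meets: "\<exists>m a r. m \<in> M \<and> a \<in> Q \<and> r \<in> P \<and> m = a + b * r" if b: "b \<in> P" "b \<notin> Q" for b
  proof -
    note adj = ideal_set_adjoin[OF P Q(1) b(1)]
    have "{a + b * r | a r. a \<in> Q \<and> r \<in> P} \<inter> M \<noteq> {}"
      using max[OF adj(1)] adj(2,3) Q(2) b(2) by blast
    then show ?thesis by blast
  qed
  have "prime_set P Q"
    unfolding prime_set_def
  proof (intro conjI ballI impI)
    show "ideal_set P Q" by fact
    show "1 \<notin> Q" using Q(3) M(2) by blast
    fix a b assume a: "a \<in> P" and b: "b \<in> P" and ab: "a * b \<in> Q"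
    show "a \<in> Q \<or> b \<in> Q"
    proof (rule ccontr)
      assume "\<not> (a \<in> Q \<or> b \<in> Q)"
      then obtain m u r m' u' r' where m: "m \<in> M" "u \<in> Q" "r \<in> P" "m = u + a * r"
        and m': "m' \<in> M" "u' \<in> Q" "r' \<in> P" "m' = u' + b * r'"
        using meets[of a] meets[of b] a b by blast
      \<comment> \<open>In the expansion each summand has a factor in \<open>Q\<close>: the first
        \<open>u'\<close>, the second \<open>u\<close>, the last \<open>a * b\<close>.\<close>
      have "m * m' = m * u' + (b * r') * u + (r * r') * (a * b)"
        using m m' by (simp add: algebra_simps)
      moreover have "m * u' \<in> Q" "(b * r') * u \<in> Q" "(r * r') * (a * b) \<in> Q"
        using m(1,3) m'(3) M(1) b ab m(2) m'(2) ideal_set_mult[OF Q(1)] subring_set_mult[OF P]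
        by blast+
      ultimately have "m * m' \<in> Q" using Q(1) by (simp add: ideal_set_add)
      then show False using Q(3) M(3)[OF m(1) m'(1)] by blast
    qed
  qed
  then show ?thesis using that Q by blast
qed

section \<open>Goldman domains\<close>

text \<open>For a subring this is \<open>A[T]\<close>. It is also applied to an ideal
  \<open>J\<close>, where it is the set of polynomials that vanish after reducing the coefficients
  modulo \<open>J\<close>.\<close>

definition polys :: "'a::comm_ring_1 set \<Rightarrow> 'a poly set" where
  "polys A = {f. \<forall>i. coeff f i \<in> A}"

definition adjoin :: "'a::comm_ring_1 set \<Rightarrow> 'a \<Rightarrow> 'a set" where
  "adjoin A x = (\<lambda>f. poly f x) ` polys A"

lemma polysI: "(\<And>i. coeff f i \<in> A) \<Longrightarrow> f \<in> polys A"
  and polysD: "f \<in> polys A \<Longrightarrow> coeff f i \<in> A"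
  by (auto simp: polys_def)

lemma polys_ideal_mult: "ideal_set A J \<Longrightarrow> f \<in> polys J \<Longrightarrow> g \<in> polys A \<Longrightarrow> f * g \<in> polys J"
  by (auto intro!: polysI ideal_set_sum ideal_set_mult2 dest: polysD simp: coeff_mult)

lemma polys_ideal_mult2: "ideal_set A J \<Longrightarrow> f \<in> polys J \<Longrightarrow> g \<in> polys A \<Longrightarrow> g * f \<in> polys J"
  using polys_ideal_mult[of A J f g] by (simp add: mult.commute)

lemma subring_set_polys: "subring_set A \<Longrightarrow> subring_set (polys A)"
  unfolding subring_set_def[of "polys A"]
  by (auto intro!: polysI subring_set_sum simp: coeff_mult subring_set_closed polysD coeff_1)

lemma polys_pCons: "c \<in> A \<Longrightarrow> f \<in> polys A \<Longrightarrow> pCons c f \<in> polys A"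
  by (auto simp: polys_def coeff_pCons split: nat.splits)

lemma polys_monom: "subring_set A \<Longrightarrow> c \<in> A \<Longrightarrow> monom c k \<in> polys A"
  by (auto simp: polys_def subring_set_closed)

lemma polys_smult: "subring_set A \<Longrightarrow> c \<in> A \<Longrightarrow> f \<in> polys A \<Longrightarrow> Polynomial.smult c f \<in> polys A"
  by (auto simp: polys_def subring_set_closed)

lemma polys_mono: "A \<subseteq> B \<Longrightarrow> polys A \<subseteq> polys B"
  by (auto simp: polys_def)

lemma polys_ideal_diff:
  "subring_set A \<Longrightarrow> ideal_set A J \<Longrightarrow> f \<in> polys J \<Longrightarrow> g \<in> polys J \<Longrightarrow> f - g \<in> polys J"
  by (auto simp: polys_def ideal_set_diff)

lemma polys_ideal_add: "ideal_set A J \<Longrightarrow> f \<in> polys J \<Longrightarrow> g \<in> polys J \<Longrightarrow> f + g \<in> polys J"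
  by (auto simp: polys_def ideal_set_add)

lemma poly_in_ideal: "subring_set P \<Longrightarrow> ideal_set P J \<Longrightarrow> f \<in> polys J \<Longrightarrow> x \<in> P \<Longrightarrow> poly f x \<in> J"
  by (auto simp: poly_altdef polys_def intro!: ideal_set_sum ideal_set_mult2 subring_set_power)

lemma subring_set_adjoin:
  assumes A: "subring_set A" shows "subring_set (adjoin A x)"
proof -
  have "poly f x - poly g x \<in> adjoin A x" "poly f x * poly g x \<in> adjoin A x"
    if "f \<in> polys A" "g \<in> polys A" for f g
    using that subring_set_polys[OF A] by (auto simp: adjoin_def subring_set_closed simp flip: poly_diff poly_mult)
  moreover have "1 \<in> adjoin A x"
    unfolding adjoin_def using subring_set_one[OF subring_set_polys[OF A]] by (metis image_eqI poly_1)
  ultimately show ?thesis by (auto simp: subring_set_def adjoin_def)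
qed

lemma adjoin_subset: "subring_set P \<Longrightarrow> A \<subseteq> P \<Longrightarrow> x \<in> P \<Longrightarrow> adjoin A x \<subseteq> P"
  by (auto simp: adjoin_def polys_def poly_altdef intro!: subring_set_closed)

lemma subset_adjoin: "subring_set A \<Longrightarrow> A \<subseteq> adjoin A x"
proof
  fix c assume "subring_set A" "c \<in> A"
  then have "[:c:] \<in> polys A" by (auto simp: polys_def coeff_pCons subring_set_closed split: nat.splits)
  then show "c \<in> adjoin A x" unfolding adjoin_def by force
qed

lemma mem_adjoin: "subring_set A \<Longrightarrow> x \<in> adjoin A x"
proof -
  assume "subring_set A"
  then have "[:0, 1:] \<in> polys A" by (auto simp: polys_def coeff_pCons subring_set_closed split: nat.splits)
  then show "x \<in> adjoin A x" unfolding adjoin_def by force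
qed

text \<open>The leading coefficient of \<open>h\<close> may not be invertible, so every elimination
  step costs one multiplication by it. The degree bound on \<open>q\<close> lets a minimality
  argument be applied to the quotient later, not only to the remainder.\<close>

lemma pseudo_division:
  assumes A: "subring_set A" and f: "f \<in> polys A" and h: "h \<in> polys A"
  shows "\<exists>k q r. q \<in> polys A \<and> r \<in> polys A \<and> Polynomial.smult (lead_coeff h ^ k) f = q * h + r \<and>
    (r = 0 \<or> degree r < degree h) \<and> degree q \<le> degree f - degree h"
  using f
proof (induction "degree f" arbitrary: f rule: less_induct)
  case less
  note PA = subring_set_closed[OF subring_set_polys[OF A]]
  show ?case
  proof (cases "f = 0 \<or> degree f < degree h")
    case True
    then show ?thesis using less.prems by (intro exI[of _ 0] exI[of _ f]) (auto simp: PA)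
  next
    case False
    define c where "c = lead_coeff h"
    define t where "t = monom (lead_coeff f) (degree f - degree h)"
    define f' where "f' = Polynomial.smult c f - t * h"
    have cA: "c \<in> A" "lead_coeff f \<in> A" using h less.prems by (auto simp: c_def polysD)
    have tA: "t \<in> polys A" using cA by (simp add: t_def polys_monom A)
    have f'A: "f' \<in> polys A" using cA h tA less.prems by (simp add: f'_def PA polys_smult A)
    have "degree (t * h) \<le> degree f"
      using degree_mult_le[of t h] degree_monom_le[of "lead_coeff f" "degree f - degree h"] False
      unfolding t_def by linarith
    then have "degree f' \<le> degree f"
      unfolding f'_def using degree_diff_le degree_smult_le by blast
    moreover have "coeff f' (degree f) = 0"
      using False by (simp add: f'_def t_def c_def coeff_monom_mult)
    ultimately have "f' = 0 \<or> degree f' < degree f" by (rule eq_zero_or_degree_less)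
    then have "\<exists>k q r. q \<in> polys A \<and> r \<in> polys A \<and> Polynomial.smult (c ^ k) f' = q * h + r \<and>
      (r = 0 \<or> degree r < degree h) \<and> degree q \<le> degree f - degree h"
    proof
      assume "f' = 0"
      then show ?thesis by (intro exI[of _ 0]) (auto simp: PA)
    next
      assume lt: "degree f' < degree f"
      have "degree f' - degree h \<le> degree f - degree h" using lt by simp
      obtain k q r where "q \<in> polys A" "r \<in> polys A" "Polynomial.smult (c ^ k) f' = q * h + r"
        "r = 0 \<or> degree r < degree h" "degree q \<le> degree f' - degree h"
        using less.hyps[OF lt f'A] unfolding c_def by blast
      then show ?thesis using \<open>degree f' - degree h \<le> degree f - degree h\<close>
        by (intro exI[of _ k] exI[of _ q] exI[of _ r]) auto
    qed
    then obtain k q r where kqr: "q \<in> polys A" "r \<in> polys A" "Polynomial.smult (c ^ k) f' = q * h + r"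
      "r = 0 \<or> degree r < degree h" "degree q \<le> degree f - degree h" by blast
    have "Polynomial.smult (c ^ Suc k) f = (q + Polynomial.smult (c ^ k) t) * h + r"
      using kqr(3) by (simp add: f'_def smult_diff_right algebra_simps)
    moreover have "degree (q + Polynomial.smult (c ^ k) t) \<le> degree f - degree h"
      by (intro degree_add_le kqr(5) order.trans[OF degree_smult_le]) (simp add: t_def degree_monom_le)
    moreover have "q + Polynomial.smult (c ^ k) t \<in> polys A"
      using kqr(1) tA cA by (auto intro!: PA(6) polys_smult A subring_set_power[OF A])
    ultimately show ?thesis using kqr(2,4) unfolding c_def by blast
  qed
qed

text \<open>If \<open>Q\<close> is a prime ideal of a ring containing \<open>A\<close>, this says that inverting the class of one
  element turns \<open>A/(Q \<inter> A)\<close> into a field.\<close>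

definition G_domain :: "'a::comm_ring_1 set \<Rightarrow> 'a set \<Rightarrow> bool" where
  "G_domain Q A \<longleftrightarrow> (\<exists>a\<in>A - Q. \<forall>r\<in>A - Q. \<exists>h\<in>A. \<exists>m. r * h - a ^ m \<in> Q)"

context
  fixes P Q A :: "'a::comm_ring_1 set"
  assumes P: "subring_set P" and Q: "prime_set P Q" and A: "subring_set A" and AP: "A \<subseteq> P"
begin

private lemmas QI = prime_set_ideal[OF Q]
private lemmas PC = subring_set_closed[OF P] and AC = subring_set_closed[OF A]
  and PA = subring_set_closed[OF subring_set_polys[OF A]]
  and PP = subring_set_closed[OF subring_set_polys[OF P]]
private lemma PAP: "f \<in> polys A \<Longrightarrow> f \<in> polys P"
  using polys_mono[OF AP] by blast

text \<open>Leading terms with coefficient in \<open>Q\<close> are removed until one survives. The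
  degree of \<open>g\<close> is then the degree of the image of \<open>f\<close> over the domain
  \<open>A / (Q \<inter> A)\<close>.\<close>

lemma strip_mod_prime:
  assumes "f \<in> polys A" "f \<notin> polys Q"
  obtains g where "g \<in> polys A" "lead_coeff g \<notin> Q" "degree g \<le> degree f" "f - g \<in> polys Q"
proof -
  have "\<exists>g\<in>polys A. lead_coeff g \<notin> Q \<and> degree g \<le> degree f \<and> f - g \<in> polys Q"
    using assms
  proof (induction "degree f" arbitrary: f rule: less_induct)
    case less
    show ?case
    proof (cases "lead_coeff f \<in> Q")
      case False
      then show ?thesis using less.prems
        by (intro bexI[of _ f]) (auto simp: polys_def ideal_set_zero[OF QI])
    next
      case True
      define p where "p = f - monom (lead_coeff f) (degree f)"
      have fp: "f - p \<in> polys Q"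
        using True by (auto simp: p_def polys_def ideal_set_zero[OF QI])
      have pA: "p \<in> polys A" using less.prems unfolding p_def by (auto intro!: PA polys_monom A polysD)
      have pQ: "p \<notin> polys Q"
        using less.prems(2) polys_ideal_add[OF QI fp, of p] by auto
      have "degree p \<le> degree f" unfolding p_def by (intro degree_diff_le degree_monom_le order.refl)
      moreover have "coeff p (degree f) = 0" by (simp add: p_def)
      ultimately have "p = 0 \<or> degree p < degree f" by (rule eq_zero_or_degree_less)
      moreover have "p \<noteq> 0" using pQ by (auto simp: polys_def ideal_set_zero[OF QI])
      ultimately have lt: "degree p < degree f" by blast
      obtain g where g: "g \<in> polys A" "lead_coeff g \<notin> Q" "degree g \<le> degree p" "p - g \<in> polys Q"
        using less.hyps[OF lt pA pQ] by blast
      have "f - g \<in> polys Q" using polys_ideal_add[OF QI fp g(4)] by simp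
      then show ?thesis using g lt by auto
    qed
  qed
  then show ?thesis using that by blast
qed

text \<open>Units of a polynomial ring over a domain are constant. After stripping \<open>f\<close>
  and \<open>u\<close>, the product of their leading coefficients is nonzero modulo
  \<open>Q\<close>, so a product congruent to \<open>1\<close> forces both degrees to be
  zero.\<close>

lemma unit_mod_prime:
  assumes f: "f \<in> polys A" and u: "u \<in> polys A" and fu: "f * u - 1 \<in> polys Q" and i: "i > 0"
  shows "coeff f i \<in> Q"
proof -
  have 1: "f * u \<notin> polys Q"
  proof
    assume "f * u \<in> polys Q"
    then have "f * u - (f * u - 1) \<in> polys Q" using fu by (rule polys_ideal_diff[OF P QI])
    then show False using prime_set_one[OF Q] polysD[of 1 Q 0] by simp
  qed
  have fQ: "f \<notin> polys Q" using polys_ideal_mult[OF QI _ PAP[OF u], of f] 1 by blast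
  have uQ: "u \<notin> polys Q" using polys_ideal_mult2[OF QI _ PAP[OF f], of u] 1 by blast
  obtain f' where f': "f' \<in> polys A" "lead_coeff f' \<notin> Q" "f - f' \<in> polys Q"
    using strip_mod_prime[OF f fQ] by blast
  obtain u' where u': "u' \<in> polys A" "lead_coeff u' \<notin> Q" "u - u' \<in> polys Q"
    using strip_mod_prime[OF u uQ] by blast
  have "f' * u' - 1 = (f * u - 1) - ((f - f') * u' + (u - u') * f)" by (simp add: algebra_simps)
  also have "\<dots> \<in> polys Q"
    by (rule polys_ideal_diff[OF P QI fu polys_ideal_add[OF QI]])
      (rule polys_ideal_mult[OF QI f'(3) PAP[OF u'(1)]], rule polys_ideal_mult[OF QI u'(3) PAP[OF f]])
  finally have 2: "f' * u' - 1 \<in> polys Q" .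
  have l: "lead_coeff f' * lead_coeff u' \<notin> Q"
    using prime_set_mult[OF Q] f' u' AP by (meson polysD subsetD)
  have "degree f' + degree u' = 0"
  proof (rule ccontr)
    assume "degree f' + degree u' \<noteq> 0"
    then have "coeff (f' * u' - 1) (degree f' + degree u') = lead_coeff f' * lead_coeff u'"
      by (simp add: coeff_mult_degree_sum coeff_1)
    then show False using l polysD[OF 2] by metis
  qed
  then have "coeff (f - f') i = coeff f i" using i by (simp add: coeff_eq_0)
  then show ?thesis using polysD[OF f'(3), of i] by simp
qed

text \<open>For \<open>x\<close> transcendental modulo \<open>Q\<close>, the ring
  \<open>A[x]\<close> modulo \<open>Q\<close> is a polynomial ring over a domain. If inverting
  \<open>b\<close> made it a field, then \<open>1 + x b\<close> would divide a power of
  \<open>b\<close>; being coprime to \<open>b\<close>, it would be a unit, although it is not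
  constant.\<close>

lemma G_domain_transcendental:
  assumes x: "x \<in> P" and tr: "\<And>f. f \<in> polys A \<Longrightarrow> poly f x \<in> Q \<Longrightarrow> f \<in> polys Q"
  shows "\<not> G_domain Q (adjoin A x)"
proof
  assume "G_domain Q (adjoin A x)"
  then obtain b where b: "b \<in> adjoin A x" "b \<notin> Q"
    and inv: "\<And>r. r \<in> adjoin A x \<Longrightarrow> r \<notin> Q \<Longrightarrow> \<exists>h\<in>adjoin A x. \<exists>m. r * h - b ^ m \<in> Q"
    unfolding G_domain_def by blast
  obtain fb where fb: "fb \<in> polys A" "b = poly fb x" using b(1) by (auto simp: adjoin_def)
  have fbQ: "fb \<notin> polys Q" using poly_in_ideal[OF P QI _ x] b(2) fb(2) by blast
  \<comment> \<open>The factor \<open>T\<close> in \<open>1 + T fb\<close> moves all coefficients of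
    \<open>fb\<close> to positive positions, so some coefficient of \<open>f\<close> at a positive
    position lies outside \<open>Q\<close>.\<close>
  define f where "f = 1 + pCons 0 fb"
  have fA: "f \<in> polys A" using fb(1) by (auto simp: f_def intro!: PA polys_pCons AC)
  have not_all: "\<not> (\<forall>i>0. coeff f i \<in> Q)"
  proof
    assume "\<forall>i>0. coeff f i \<in> Q"
    then have "coeff f (Suc i) \<in> Q" for i by blast
    then show False using fbQ by (simp add: f_def polys_def coeff_1)
  qed
  have "poly f x \<notin> Q"
    using tr[OF fA] not_all polysD by blast
  moreover have "poly f x \<in> adjoin A x" using fA by (auto simp: adjoin_def)
  ultimately obtain fh m where fh: "fh \<in> polys A" and hm: "poly f x * poly fh x - b ^ m \<in> Q"
    using inv[of "poly f x"] by (auto simp: adjoin_def)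
  have 1: "f * fh - fb ^ m \<in> polys Q"
    by (rule tr) (use hm fb fh fA in \<open>auto intro!: PA\<close>)
  \<comment> \<open>This is the congruence of \<open>(f - 1) ^ k\<close> and
    \<open>(- 1) ^ k\<close> modulo \<open>f\<close>, with an explicit cofactor.\<close>
  have "\<exists>w\<in>polys A. (f - 1) ^ k = f * w + (- 1) ^ k" for k
  proof (induction k)
    case 0 then show ?case using PA(4) by force
  next
    case (Suc k)
    then obtain w where w: "w \<in> polys A" "(f - 1) ^ k = f * w + (- 1) ^ k" by blast
    have "(f - 1) ^ Suc k = f * ((f - 1) * w + (- 1) ^ k) + (- 1) ^ Suc k"
      by (simp add: w(2) algebra_simps)
    moreover have "(f - 1) * w + (- 1) ^ k \<in> polys A" using fA w(1) by (intro PA)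
    ultimately show ?case by blast
  qed
  then obtain w where w: "w \<in> polys A" "(f - 1) ^ m = f * w + (- 1) ^ m" by blast
  define t :: "'a poly" where "t = [:0, 1:] ^ m"
  have tA: "t \<in> polys A" unfolding t_def by (intro PA polys_pCons AC)
  have "f - 1 = [:0, 1:] * fb" by (simp add: f_def)
  then have tb: "t * fb ^ m = (f - 1) ^ m" unfolding t_def by (simp only: power_mult_distrib)
  \<comment> \<open>An explicit inverse of \<open>f\<close> modulo \<open>Q\<close>:
    \<open>f * fh\<close> is congruent to \<open>fb ^ m\<close>, and
    \<open>t * fb ^ m = (f - 1) ^ m = f * w + (- 1) ^ m\<close>.\<close>
  define u where "u = (- 1) ^ m * (fh * t - w)"
  have "f * u - 1 = ((- 1) ^ m * t) * (f * fh - fb ^ m) + (- 1) ^ m * ((f - 1) ^ m - f * w) - 1"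
    by (simp add: u_def algebra_simps flip: tb)
  also have "\<dots> = ((- 1) ^ m * t) * (f * fh - fb ^ m)"
    unfolding w(2) by (simp flip: power_mult_distrib)
  also have "\<dots> \<in> polys Q"
    using tA by (intro polys_ideal_mult2[OF QI 1] PAP PA)
  finally have "f * u - 1 \<in> polys Q" .
  moreover have "u \<in> polys A" unfolding u_def using tA fh w(1) by (intro PA)
  ultimately show False using unit_mod_prime[OF fA] not_all by blast
qed

text \<open>Pseudo-division by a relation \<open>f\<close> of least degree \<open>d\<close> for
  \<open>x\<close> writes every element of \<open>A[x]\<close>, up to a power of the leading
  coefficient \<open>c1\<close>, as a polynomial in \<open>x\<close> of degree below
  \<open>d\<close>; the coefficients of such polynomials can be compared modulo \<open>Q\<close>.
  Some multiple of \<open>b\<close> is congruent to a constant \<open>c2\<close> outside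
  \<open>Q\<close>. Then \<open>c1 * c2\<close> is an element of \<open>A\<close> whose inversion
  suffices for \<open>A\<close>.\<close>

lemma G_domain_algebraic:
  assumes x: "x \<in> P" and alg: "\<exists>f\<in>polys A. poly f x \<in> Q \<and> f \<notin> polys Q"
    and G: "G_domain Q (adjoin A x)"
  shows "G_domain Q A"
proof -
  note BC = subring_set_closed[OF subring_set_adjoin[OF A, of x]]
  have BP: "adjoin A x \<subseteq> P" by (rule adjoin_subset[OF P AP x])
  have px: "poly f x \<in> adjoin A x" if "f \<in> polys A" for f using that by (auto simp: adjoin_def)
  \<comment> \<open>A member of least degree replaces the minimal polynomial of \<open>x\<close>
    over the fraction field of \<open>A / (Q \<inter> A)\<close>.\<close>
  define F where "F = {f \<in> polys A. poly f x \<in> Q \<and> lead_coeff f \<notin> Q}"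
  obtain f0 where "f0 \<in> polys A" "poly f0 x \<in> Q" "f0 \<notin> polys Q" using alg by blast
  then obtain f1 where f1: "f1 \<in> polys A" "lead_coeff f1 \<notin> Q" "f0 - f1 \<in> polys Q"
    using strip_mod_prime by blast
  have "poly f0 x - poly f1 x \<in> Q"
    using poly_in_ideal[OF P QI f1(3) x] by simp
  then have "f1 \<in> F"
    using f1 \<open>poly f0 x \<in> Q\<close> ideal_set_cong[OF P QI] by (auto simp: F_def)
  then obtain f where fF: "f \<in> F" and min: "\<And>g. g \<in> F \<Longrightarrow> degree f \<le> degree g"
    using arg_min_natI[of "\<lambda>g. g \<in> F" f1 degree] arg_min_nat_le[of "\<lambda>g. g \<in> F" _ degree] by metis
  define d where "d = degree f"
  define c1 where "c1 = lead_coeff f"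
  have fA: "f \<in> polys A" and fQ: "poly f x \<in> Q" and c1Q: "c1 \<notin> Q" and c1A: "c1 \<in> A"
    using fF by (auto simp: F_def c1_def polysD)
  \<comment> \<open>The powers of \<open>x\<close> below \<open>d\<close> are independent modulo
    \<open>Q\<close>.\<close>
  have small: "r \<in> polys Q" if r: "r \<in> polys A" "degree r < d" "poly r x \<in> Q" for r
  proof (rule ccontr)
    assume "r \<notin> polys Q"
    then obtain g where g: "g \<in> polys A" "lead_coeff g \<notin> Q" "degree g \<le> degree r" "r - g \<in> polys Q"
      using strip_mod_prime r(1) by blast
    have "poly r x - poly g x \<in> Q" using poly_in_ideal[OF P QI g(4) x] by simp
    then have "g \<in> F" using g r(3) ideal_set_cong[OF P QI] by (auto simp: F_def)
    then show False using min[of g] g(3) r(2) by (simp add: d_def)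
  qed
  have d: "d > 0"
  proof (rule ccontr)
    assume "\<not> d > 0"
    then have "poly f x = c1" unfolding d_def c1_def
      by (metis degree_eq_zeroE gr0I lead_coeff_pCons(2) mult_zero_right add.right_neutral poly_0 poly_pCons)
    then show False using fQ c1Q by simp
  qed
  have reduce: "\<exists>k r. r \<in> polys A \<and> degree r < d \<and> c1 ^ k * poly g x - poly r x \<in> Q"
    if g: "g \<in> polys A" for g
  proof -
    obtain k q r where kqr: "q \<in> polys A" "r \<in> polys A" "Polynomial.smult (c1 ^ k) g = q * f + r"
      "r = 0 \<or> degree r < d"
      using pseudo_division[OF A g fA] unfolding c1_def d_def by blast
    have "c1 ^ k * poly g x - poly r x = poly q x * poly f x"
      using arg_cong[OF kqr(3), of "\<lambda>p. poly p x"] by simp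
    also have "\<dots> \<in> Q" using px[OF kqr(1)] BP by (intro ideal_set_mult[OF QI _ fQ]) auto
    finally show ?thesis using kqr(2,4) d by (intro exI[of _ k] exI[of _ r]) auto
  qed
  obtain b where b: "b \<in> adjoin A x" "b \<notin> Q"
    and inv: "\<And>r. r \<in> adjoin A x \<Longrightarrow> r \<notin> Q \<Longrightarrow> \<exists>h\<in>adjoin A x. \<exists>m. r * h - b ^ m \<in> Q"
    using G unfolding G_domain_def by blast
  \<comment> \<open>\<open>H\<close> consists of short representatives of multiples of
    \<open>b\<close>, nonzero modulo \<open>Q\<close>. An element of least degree will turn out to
    be the constant \<open>c2\<close>.\<close>
  define H where "H = {h \<in> polys A. lead_coeff h \<notin> Q \<and> degree h < d \<and> (\<exists>u\<in>adjoin A x. u * b - poly h x \<in> Q)}"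
  have HI: "\<exists>g\<in>H. degree g \<le> degree r"
    if r: "r \<in> polys A" "degree r < d" "r \<notin> polys Q" and u: "u \<in> adjoin A x" "u * b - poly r x \<in> Q" for r u
  proof -
    obtain g where g: "g \<in> polys A" "lead_coeff g \<notin> Q" "degree g \<le> degree r" "r - g \<in> polys Q"
      using strip_mod_prime r by blast
    have "poly r x - poly g x \<in> Q" using poly_in_ideal[OF P QI g(4) x] by simp
    then have "u * b - poly g x \<in> Q" using ideal_set_add[OF QI u(2)] by fastforce
    then show ?thesis using g r(2) u(1) by (auto simp: H_def)
  qed
  obtain gb where gb: "gb \<in> polys A" "b = poly gb x" using b(1) by (auto simp: adjoin_def)
  obtain k0 r0 where r0: "r0 \<in> polys A" "degree r0 < d" "c1 ^ k0 * b - poly r0 x \<in> Q"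
    using reduce[OF gb(1)] gb(2) by blast
  have c1k: "c1 ^ k \<notin> Q" for k using prime_set_power[OF P Q] c1Q c1A AP by blast
  have c1B: "c1 \<in> adjoin A x" using subset_adjoin[OF A] c1A by blast
  have "c1 ^ k0 * b \<notin> Q" using prime_set_mult[OF Q] c1k b BP c1B BC(7) by blast
  then have "poly r0 x \<notin> Q" using ideal_set_cong[OF P QI r0(3)] by blast
  then have "r0 \<notin> polys Q" using poly_in_ideal[OF P QI _ x] by blast
  then obtain h1 where "h1 \<in> H" using HI[OF r0(1,2) _ _ r0(3)] BC(7)[OF c1B] by blast
  then obtain h where hH: "h \<in> H" and hmin: "\<And>g. g \<in> H \<Longrightarrow> degree h \<le> degree g"
    using arg_min_natI[of "\<lambda>g. g \<in> H" h1 degree] arg_min_nat_le[of "\<lambda>g. g \<in> H" _ degree] by metis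
  obtain u where hA: "h \<in> polys A" and hl: "lead_coeff h \<notin> Q" and hd: "degree h < d"
    and u: "u \<in> adjoin A x" "u * b - poly h x \<in> Q"
    using hH by (auto simp: H_def)
  have "degree h = 0"
  proof (rule ccontr)
    assume h0: "degree h \<noteq> 0"
    define c where "c = lead_coeff h"
    obtain k q r where kqr: "q \<in> polys A" "r \<in> polys A" "Polynomial.smult (c ^ k) f = q * h + r"
      "r = 0 \<or> degree r < degree h" "degree q \<le> d - degree h"
      using pseudo_division[OF A fA hA] unfolding c_def d_def by blast
    have cA: "c \<in> A" using hA by (simp add: c_def polysD)
    have ckP: "c ^ k \<in> P" using AC(7)[OF cA] AP by blast
    have qP: "poly q x \<in> P" using px[OF kqr(1)] BP by blast
    have "(- poly q x * u) * b - poly r x = - poly q x * (u * b - poly h x) - c ^ k * poly f x"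
      using arg_cong[OF kqr(3), of "\<lambda>p. poly p x"] by (simp add: algebra_simps)
    also have "\<dots> \<in> Q"
      by (intro ideal_set_diff[OF P QI] ideal_set_mult[OF QI] u(2) fQ ckP PC(5)[OF qP])
    finally have 1: "(- poly q x * u) * b - poly r x \<in> Q" .
    have rd: "degree r < degree h" using kqr(4) h0 by auto
    have rQ: "r \<in> polys Q"
    proof (rule ccontr)
      assume "r \<notin> polys Q"
      then obtain g where "g \<in> H" "degree g \<le> degree r"
        using HI[OF kqr(2) _ _ _ 1] rd hd px[OF kqr(1)] u(1) BC(3,5) by (meson order.strict_trans)
      then show False using hmin[of g] rd by simp
    qed
    have "poly q x * poly h x = c ^ k * poly f x - poly r x"
      using arg_cong[OF kqr(3), of "\<lambda>p. poly p x"] by simp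
    also have "\<dots> \<in> Q"
      by (intro ideal_set_diff[OF P QI] ideal_set_mult[OF QI] ckP fQ poly_in_ideal[OF P QI rQ x])
    finally have "poly q x \<in> Q \<or> poly h x \<in> Q"
      using prime_set_mult[OF Q] qP px[OF hA] BP by blast
    moreover have "poly h x \<notin> Q" using small[OF hA hd] hl polysD by blast
    ultimately have "q \<in> polys Q" using small[OF kqr(1)] kqr(5) h0 d by auto
    then have "Polynomial.smult (c ^ k) f \<in> polys Q"
      unfolding kqr(3) by (intro polys_ideal_add[OF QI polys_ideal_mult[OF QI] rQ] PAP hA)
    then have "c ^ k * c1 \<in> Q" using polysD[of _ Q "degree f"] by (fastforce simp: c1_def)
    then show False using prime_set_mult[OF Q ckP] prime_set_power[OF P Q] c1Q c1A cA AP hl c_def by blast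
  qed
  then obtain c2 where c2: "h = [:c2:]" using degree_eq_zeroE by blast
  then have c2A: "c2 \<in> A" and c2Q: "c2 \<notin> Q" using hA hl by (auto simp: polys_def split: nat.splits dest: spec[of _ 0])
  have uc2: "u * b - c2 \<in> Q" using u(2) c2 by simp
  have "\<exists>h\<in>A. \<exists>m. r * h - (c1 * c2) ^ m \<in> Q" if r: "r \<in> A" "r \<notin> Q" for r
  proof -
    obtain h m where h: "h \<in> adjoin A x" "r * h - b ^ m \<in> Q"
      using inv[of r] r subset_adjoin[OF A, of x] by blast
    have "h * u ^ m \<in> adjoin A x" using h(1) u(1) by (intro BC)
    then obtain g where g: "g \<in> polys A" "h * u ^ m = poly g x" by (auto simp: adjoin_def)
    obtain k s where s: "s \<in> polys A" "degree s < d" "c1 ^ k * (h * u ^ m) - poly s x \<in> Q"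
      using reduce[OF g(1)] g(2) by auto
    have "\<exists>w. (u * b) ^ m - c2 ^ m = (u * b - c2) * w \<and> w \<in> P"
    proof (induction m)
      case 0 show ?case using PC(4) by (intro exI[of _ 0]) auto
    next
      case (Suc m)
      then obtain w where w: "(u * b) ^ m - c2 ^ m = (u * b - c2) * w" "w \<in> P" by blast
      have "(u * b) ^ Suc m - c2 ^ Suc m = u * b * ((u * b) ^ m - c2 ^ m) + (u * b - c2) * c2 ^ m"
        by (simp add: algebra_simps)
      also have "\<dots> = (u * b - c2) * (u * b * w + c2 ^ m)"
        unfolding w(1) by (simp add: algebra_simps)
      finally show ?case using w(2) u(1) b(1) c2A BP AP by (blast intro: PC)
    qed
    then obtain w where w: "(u * b) ^ m - c2 ^ m = (u * b - c2) * w" "w \<in> P" by blast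
    have mem: "c1 ^ k \<in> P" "u ^ m \<in> P" "r \<in> P"
      using c1A u(1) r AP BP by (blast intro: PC)+
    \<comment> \<open>Modulo \<open>Q\<close>, \<open>r s(x)\<close> is \<open>c1^k r h u^m\<close>,
      hence \<open>c1^k (u b)^m\<close>, hence \<open>c1^k c2^m\<close>.\<close>
    have "r * poly s x - c1 ^ k * c2 ^ m = c1 ^ k * u ^ m * (r * h - b ^ m) + c1 ^ k * ((u * b) ^ m - c2 ^ m)
        - r * (c1 ^ k * (h * u ^ m) - poly s x)"
      by (simp add: algebra_simps)
    also have "\<dots> \<in> Q" unfolding w(1)
      by (intro ideal_set_diff[OF P QI] ideal_set_add[OF QI] ideal_set_mult[OF QI] ideal_set_mult2[OF QI]
          mem PC(3) w(2) h(2) s(3) uc2)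
    finally have "poly (Polynomial.smult r s - [:c1 ^ k * c2 ^ m:]) x \<in> Q" by simp
    moreover have "Polynomial.smult r s - [:c1 ^ k * c2 ^ m:] \<in> polys A"
      using r(1) s(1) c1A c2A PA(4) by (intro PA(2) polys_smult[OF A] polys_pCons AC(3) AC(7)) auto
    moreover have "degree (Polynomial.smult r s - [:c1 ^ k * c2 ^ m:]) < d"
      using degree_smult_le[of r s] s(2) by (intro degree_diff_less) auto
    ultimately have "Polynomial.smult r s - [:c1 ^ k * c2 ^ m:] \<in> polys Q" by (intro small)
    \<comment> \<open>The relation has degree below \<open>d\<close>, so it holds coefficientwise;
      its constant term involves elements of \<open>A\<close> only.\<close>
    from polysD[OF this, of 0] have 2: "r * coeff s 0 - c1 ^ k * c2 ^ m \<in> Q" by simp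
    \<comment> \<open>The factor \<open>v\<close> equalises the exponents:
      \<open>v c1^k c2^m = (c1 c2)^(k+m)\<close>.\<close>
    define v where "v = c1 ^ m * c2 ^ k"
    have vA: "v \<in> A" using c1A c2A by (auto simp: v_def intro!: AC(3) AC(7))
    have "r * (v * coeff s 0) - (c1 * c2) ^ (k + m) = v * (r * coeff s 0 - c1 ^ k * c2 ^ m)"
      by (simp add: v_def power_add power_mult_distrib algebra_simps)
    also have "\<dots> \<in> Q" using vA AP by (intro ideal_set_mult[OF QI _ 2]) auto
    finally show ?thesis using vA s(1) by (meson AC(3) polysD)
  qed
  moreover have "c1 * c2 \<in> A - Q"
    using prime_set_mult[OF Q, of c1 c2] c1A c2A c1Q c2Q AP AC(3) by blast
  ultimately show ?thesis unfolding G_domain_def by blast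
qed

lemma G_domain_adjoinD:
  assumes "x \<in> P" "G_domain Q (adjoin A x)" shows "G_domain Q A"
  using G_domain_transcendental[of x] G_domain_algebraic[of x] assms by blast

end

section \<open>Polynomial rings\<close>

abbreviation pcar :: "nat \<Rightarrow> 'k::field mpoly set" where
  "pcar n \<equiv> carrier (poly_ring n)"

lemma pcar_iff: "p \<in> pcar n \<longleftrightarrow> (\<forall>m\<in>Poly_Mapping.keys p. Poly_Mapping.keys m \<subseteq> {..n})"
  by (simp add: poly_ring_def)

lemma subring_set_pcar: "subring_set (pcar n :: 'k::field mpoly set)"
  unfolding subring_set_def
proof (intro conjI ballI)
  show "1 \<in> pcar n" by (simp add: pcar_iff)
  fix p q :: "'k mpoly" assume p: "p \<in> pcar n" and q: "q \<in> pcar n"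
  show "p - q \<in> pcar n"
    using p q keys_diff[of p q] unfolding pcar_iff by blast
  show "p * q \<in> pcar n"
    unfolding pcar_iff
  proof
    fix m assume "m \<in> Poly_Mapping.keys (p * q)"
    then obtain a b where "m = a + b" "a \<in> Poly_Mapping.keys p" "b \<in> Poly_Mapping.keys q"
      using keys_mult[of p q] by blast
    then show "Poly_Mapping.keys m \<subseteq> {..n}"
      using p q Poly_Mapping.keys_add[of a b] unfolding pcar_iff by blast
  qed
qed

lemmas pcar_closed = subring_set_closed[OF subring_set_pcar]

lemma X_in_pcar: "i \<le> n \<Longrightarrow> X i \<in> pcar n"
  by (auto simp: pcar_iff X_def)

lemma Const_in_pcar: "Const c \<in> pcar n"
  by (auto simp: pcar_iff Const_def split: if_splits)

lemma Const_add: "Const (a + b) = Const a + Const b"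
  and Const_mult: "Const (a * b) = Const a * Const b"
  and Const_0: "Const 0 = 0" and Const_1: "Const 1 = 1"
  by (simp_all add: Const_def single_add mult_single)

lemma Const_diff: "Const (a - b) = Const a - Const b"
  by (simp add: Const_def single_diff)

text \<open>Constants and the variables up to \<open>n\<close> generate the ring. This form of
  induction is what identifies it with an iterated adjunction of variables.\<close>

lemma pcar_induct [consumes 1, case_names Const X add mult]:
  fixes p :: "'k::field mpoly"
  assumes p: "p \<in> pcar n"
    and C: "\<And>c. R (Const c)" and X: "\<And>i. i \<le> n \<Longrightarrow> R (X i)"
    and add: "\<And>p q. p \<in> pcar n \<Longrightarrow> q \<in> pcar n \<Longrightarrow> R p \<Longrightarrow> R q \<Longrightarrow> R (p + q)"
    and mult: "\<And>p q. p \<in> pcar n \<Longrightarrow> q \<in> pcar n \<Longrightarrow> R p \<Longrightarrow> R q \<Longrightarrow> R (p * q)"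
  shows "R p"
proof -
  have pw: "R (X i ^ k)" if "i \<le> n" for i k
  proof (induction k)
    case 0 then show ?case using C[of 1] by (simp add: Const_1)
  next
    case (Suc k) then show ?case
      using mult[OF X_in_pcar[OF that] pcar_closed(7)[OF X_in_pcar[OF that]] X[OF that], of k] by simp
  qed
  have mono: "R (Poly_Mapping.single m c)" if "Poly_Mapping.keys m \<subseteq> {..n}" for m c
  proof -
    have *: "Poly_Mapping.single m c = Const c * (\<Prod>i\<in>Poly_Mapping.keys m. X i ^ Poly_Mapping.lookup m i)"
    proof -
      have Xp: "X i ^ k = Poly_Mapping.single (Poly_Mapping.single i k) (1::'k)" for i k
      proof (induction k)
        case 0 then show ?case by (simp add: single_one)
      next
        case (Suc k) then show ?case by (simp add: X_def mult_single flip: single_add)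
      qed
      have "(\<Prod>i\<in>F. X i ^ Poly_Mapping.lookup m i) =
          Poly_Mapping.single (\<Sum>i\<in>F. Poly_Mapping.single i (Poly_Mapping.lookup m i)) (1::'k)" if "finite F" for F
        using that by induction (auto simp: Xp mult_single single_one)
      moreover have "(\<Sum>i\<in>Poly_Mapping.keys m. Poly_Mapping.single i (Poly_Mapping.lookup m i)) = m"
        by (rule poly_mapping_eqI) (auto simp: lookup_sum lookup_single when_def in_keys_iff)
      ultimately show ?thesis by (simp add: Const_def mult_single)
    qed
    define T :: "nat set \<Rightarrow> 'k mpoly" where "T F = (\<Prod>i\<in>F. X i ^ Poly_Mapping.lookup m i)" for F
    have "R (T F) \<and> T F \<in> pcar n" if "finite F" "F \<subseteq> {..n}" for F
      using that
    proof induction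
      case empty then show ?case using C[of 1] by (simp add: Const_1 pcar_closed T_def)
    next
      case (insert i F)
      then have i: "i \<le> n" and F: "R (T F)" "T F \<in> pcar n" by auto
      have "T (insert i F) = X i ^ Poly_Mapping.lookup m i * T F" using insert by (simp add: T_def)
      then show ?case using F i by (simp add: mult pw pcar_closed(7) X_in_pcar pcar_closed(3))
    qed
    then have "R (T (Poly_Mapping.keys m))" "T (Poly_Mapping.keys m) \<in> pcar n" using that by auto
    then have "R (Const c * T (Poly_Mapping.keys m))" by (intro mult C Const_in_pcar)
    then show ?thesis by (simp add: * T_def)
  qed
  have "finite (Poly_Mapping.keys p)" by simp
  have *: "(\<Sum>m\<in>Poly_Mapping.keys p. Poly_Mapping.single m (Poly_Mapping.lookup p m)) = p"
    by (rule poly_mapping_eqI) (auto simp: lookup_sum lookup_single when_def in_keys_iff)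
  have "R (\<Sum>m\<in>F. Poly_Mapping.single m (Poly_Mapping.lookup p m)) \<and>
      (\<Sum>m\<in>F. Poly_Mapping.single m (Poly_Mapping.lookup p m)) \<in> pcar n"
    if "finite F" "F \<subseteq> Poly_Mapping.keys p" for F
    using that
  proof induction
    case empty then show ?case using C[of 0] by (simp add: Const_0 pcar_closed)
  next
    case (insert m F)
    then have "Poly_Mapping.keys m \<subseteq> {..n}" using p by (auto simp: pcar_iff)
    moreover from this have "Poly_Mapping.single m (Poly_Mapping.lookup p m) \<in> pcar n"
      by (auto simp: pcar_iff split: if_splits)
    ultimately show ?case using insert by (auto intro!: add mono pcar_closed)
  qed
  from this[of "Poly_Mapping.keys p"] show ?thesis by (simp add: *)
qed

section \<open>Homogeneous components\<close>

lemma mdegree_superset: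
  "finite F \<Longrightarrow> Poly_Mapping.keys m \<subseteq> F \<Longrightarrow> mdegree m = (\<Sum>i\<in>F. Poly_Mapping.lookup m i)"
  unfolding mdegree_def by (rule sum.mono_neutral_left) (auto simp: in_keys_iff)

lemma mdegree_add: "mdegree (a + b) = mdegree a + mdegree b"
proof -
  let ?F = "Poly_Mapping.keys a \<union> Poly_Mapping.keys b"
  have "mdegree (a + b) = (\<Sum>i\<in>?F. Poly_Mapping.lookup (a + b) i)"
    by (rule mdegree_superset) (use Poly_Mapping.keys_add[of a b] in auto)
  then show ?thesis
    by (simp add: mdegree_superset[of ?F a] mdegree_superset[of ?F b] lookup_add sum.distrib)
qed

definition hcomp :: "nat \<Rightarrow> 'k::field mpoly \<Rightarrow> 'k mpoly" where
  "hcomp d p = Abs_poly_mapping (\<lambda>m. if mdegree m = d then Poly_Mapping.lookup p m else 0)"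

lemma lookup_hcomp: "Poly_Mapping.lookup (hcomp d p) m = (if mdegree m = d then Poly_Mapping.lookup p m else 0)"
  unfolding hcomp_def
  by (subst Abs_poly_mapping_inverse)
    (auto intro: finite_subset[OF _ finite_keys[of p]] simp: in_keys_iff)

text \<open>The zero polynomial is homogeneous of every degree, in agreement with
  \<open>poly_grade\<close>, but degrees are natural numbers here.\<close>

definition homog :: "nat \<Rightarrow> 'k::field mpoly \<Rightarrow> bool" where
  "homog d p \<longleftrightarrow> (\<forall>m\<in>Poly_Mapping.keys p. mdegree m = d)"

lemma homog_hcomp: "homog d (hcomp d p)"
  by (auto simp: homog_def in_keys_iff lookup_hcomp split: if_splits)

lemma hcomp_in_pcar: "p \<in> pcar n \<Longrightarrow> hcomp d p \<in> pcar n"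
  by (auto simp: pcar_iff in_keys_iff lookup_hcomp split: if_splits)

lemma hcomp_add: "hcomp d (p + q) = hcomp d p + hcomp d q"
  by (rule poly_mapping_eqI) (simp add: lookup_hcomp lookup_add)

lemma hcomp_diff: "hcomp d (p - q) = hcomp d p - hcomp d q"
  by (rule poly_mapping_eqI) (simp add: lookup_hcomp lookup_minus)

lemma hcomp_0: "hcomp d 0 = 0"
  by (rule poly_mapping_eqI) (simp add: lookup_hcomp)

lemma hcomp_sum: "hcomp d (sum f F) = (\<Sum>i\<in>F. hcomp d (f i))"
  by (induction F rule: infinite_finite_induct) (auto simp: hcomp_0 hcomp_add)

lemma hcomp_homog: "homog e p \<Longrightarrow> hcomp d p = (if d = e then p else 0)"
  by (rule poly_mapping_eqI) (auto simp: lookup_hcomp homog_def in_keys_iff)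

lemma homog_mult: "homog d p \<Longrightarrow> homog e q \<Longrightarrow> homog (d + e) (p * q)"
  unfolding homog_def using keys_mult[of p q] by (fastforce simp: mdegree_add)

lemma homog_add: "homog d p \<Longrightarrow> homog d q \<Longrightarrow> homog d (p + q)"
  unfolding homog_def using Poly_Mapping.keys_add[of p q] by blast

lemma homog_diff: "homog d p \<Longrightarrow> homog d q \<Longrightarrow> homog d (p - q)"
  unfolding homog_def using Poly_Mapping.keys_diff[of p q] by blast

lemma homog_0: "homog d 0" by (simp add: homog_def)

lemma homog_1: "homog 0 1" by (simp add: homog_def mdegree_def)

lemma homog_Const: "homog 0 (Const c)"
  by (auto simp: homog_def mdegree_def Const_def split: if_splits)

lemma homog_X: "homog 1 (X i)"
  by (auto simp: homog_def mdegree_def X_def)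

lemma homog_X_power: "homog k (X i ^ k)"
  by (induction k) (use homog_1 homog_mult[OF homog_X, of _ "X i ^ _"] in auto)

lemma homog_sum: "(\<And>i. i \<in> F \<Longrightarrow> homog d (f i)) \<Longrightarrow> homog d (sum f F)"
  by (induction F rule: infinite_finite_induct) (auto simp: homog_0 homog_add)

lemma hcomp_decomposition:
  fixes p :: "'k::field mpoly"
  obtains N where "p = (\<Sum>d\<le>N. hcomp d p)" "\<And>d. d > N \<Longrightarrow> hcomp d p = 0"
proof
  define N where "N = Max (insert 0 (mdegree ` Poly_Mapping.keys p))"
  have N: "mdegree m \<le> N" if "m \<in> Poly_Mapping.keys p" for m
    using that by (auto simp: N_def)
  show "p = (\<Sum>d\<le>N. hcomp d p)"
    by (rule poly_mapping_eqI) (use N in \<open>auto simp: lookup_sum lookup_hcomp in_keys_iff\<close>)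
  show "hcomp d p = 0" if "d > N" for d
    by (rule poly_mapping_eqI) (use N that in \<open>fastforce simp: lookup_hcomp in_keys_iff\<close>)
qed

text \<open>The case distinction is needed because \<open>d - e\<close> is truncated: below degree
  \<open>e\<close> the product has no component at all.\<close>

lemma hcomp_mult_homog:
  assumes q: "homog e q" shows "hcomp d (p * q) = (if e \<le> d then hcomp (d - e) p * q else 0)"
proof -
  obtain N where N: "p = (\<Sum>i\<le>N. hcomp i p)" "\<And>i. i > N \<Longrightarrow> hcomp i p = 0" using hcomp_decomposition[of p] by blast
  have "hcomp d (p * q) = (\<Sum>i\<le>N. hcomp d (hcomp i p * q))"
    by (subst N(1)) (simp add: sum_distrib_right hcomp_sum)
  also have "\<dots> = (\<Sum>i\<le>N. if i + e = d then hcomp i p * q else 0)"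
    by (intro sum.cong refl) (simp add: hcomp_homog[OF homog_mult[OF homog_hcomp q]])
  also have "\<dots> = (\<Sum>i\<le>N. if i = d - e then (if e \<le> d then hcomp (d - e) p * q else 0) else 0)"
    by (intro sum.cong refl) auto
  also have "\<dots> = (if e \<le> d then hcomp (d - e) p * q else 0)"
    using N(2) by (auto simp: not_le)
  finally show ?thesis .
qed

lemma poly_grade_nat: "p \<in> poly_grade n (int d) \<longleftrightarrow> p \<in> pcar n \<and> homog d p"
  by (auto simp: poly_grade_def homog_def)

lemma poly_grade_neg: "d < 0 \<Longrightarrow> p \<in> poly_grade n d \<longleftrightarrow> p = 0"
  by (auto simp: poly_grade_def poly_ring_def)

section \<open>Homogeneous ideals\<close>

lemma poly_ring_simps [simp]:
  "mult (poly_ring n) = (*)" "one (poly_ring n) = 1" "zero (poly_ring n) = 0" "add (poly_ring n) = (+)"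
  by (simp_all add: poly_ring_def)

lemma cring_poly_ring: "cring (poly_ring n :: 'k::field mpoly ring)"
proof (rule cringI)
  show "abelian_group (poly_ring n :: 'k mpoly ring)"
    by (rule abelian_groupI)
      (auto simp: pcar_closed ac_simps intro!: bexI[of _ "- x" for x])
  show "comm_monoid (poly_ring n :: 'k mpoly ring)"
    by (rule comm_monoidI) (auto simp: pcar_closed ac_simps)
qed (auto simp: algebra_simps)

lemma ideal_poly_ring: "ideal J (poly_ring n) \<longleftrightarrow> ideal_set (pcar n) (J :: 'k::field mpoly set)"
proof
  interpret cring "poly_ring n :: 'k mpoly ring" by (rule cring_poly_ring)
  assume "ideal J (poly_ring n)"
  then interpret J: ideal J "poly_ring n" .
  show "ideal_set (pcar n) J"
    using J.a_subset J.zero_closed J.a_closed J.I_l_closed by (auto simp: ideal_set_def)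
next
  interpret cring "poly_ring n :: 'k mpoly ring" by (rule cring_poly_ring)
  assume J: "ideal_set (pcar n) J"
  show "ideal J (poly_ring n)"
  proof (rule idealI)
    show "ring (poly_ring n :: 'k mpoly ring)" by (rule ring_axioms)
    show "subgroup J (add_monoid (poly_ring n))"
    proof (rule subgroup.intro)
      fix x assume x: "x \<in> J"
      have "x \<in> pcar n" using x J ideal_set_sub by blast
      then have "inv\<^bsub>add_monoid (poly_ring n)\<^esub> x = - x"
        unfolding a_inv_def[symmetric] using minus_equality[of "- x" x] by (simp add: pcar_closed)
      then show "inv\<^bsub>add_monoid (poly_ring n)\<^esub> x \<in> J"
        using ideal_set_uminus[OF subring_set_pcar J x] by simp
    qed (use J in \<open>auto simp: ideal_set_def\<close>)
  qed (use J in \<open>auto simp: ideal_set_mult ideal_set_mult2\<close>)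
qed

lemma primeideal_poly_ring: "primeideal J (poly_ring n) \<longleftrightarrow> prime_set (pcar n) (J :: 'k::field mpoly set)"
proof
  assume J: "primeideal J (poly_ring n)"
  then interpret J: primeideal J "poly_ring n" .
  have "1 \<notin> J" using J.one_imp_carrier J.I_notcarr by auto
  then show "prime_set (pcar n) J"
    using J.I_prime J.is_ideal by (auto simp: prime_set_def ideal_poly_ring)
next
  assume J: "prime_set (pcar n) J"
  show "primeideal J (poly_ring n)"
    by (rule primeidealI) (use J in \<open>auto simp: ideal_poly_ring cring_poly_ring prime_set_def pcar_closed\<close>)
qed

text \<open>Generation by homogeneous elements is traded for closure under components. The elements
  of \<open>I\<close> with all components in \<open>I\<close> form an ideal that contains the
  homogeneous generators, hence all of \<open>I\<close>; conversely \<open>I\<close> is generated by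
  its homogeneous elements, because every element is the sum of its components.\<close>

lemma homogeneous_ideal_iff:
  "homogeneous_ideal n I \<longleftrightarrow> ideal_set (pcar n) I \<and> (\<forall>p\<in>I. \<forall>d. hcomp d p \<in> I)" for I :: "'k::field mpoly set"
proof
  interpret cring "poly_ring n :: 'k mpoly ring" by (rule cring_poly_ring)
  assume "homogeneous_ideal n I"
  then obtain H where I: "ideal_set (pcar n) I" and H: "H \<subseteq> (\<Union>d. poly_grade n d)" "I = Idl\<^bsub>poly_ring n\<^esub> H"
    by (auto simp: homogeneous_ideal_def ideal_poly_ring)
  have HP: "H \<subseteq> pcar n" using H(1) by (auto simp: poly_grade_def)
  have HI: "H \<subseteq> I" unfolding H(2) by (rule genideal_self[OF HP])
  let ?J = "{p \<in> I. \<forall>d. hcomp d p \<in> I}"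
  have "ideal_set (pcar n) ?J"
    unfolding ideal_set_def
  proof (intro conjI ballI subsetI)
    fix x assume "x \<in> ?J" then show "x \<in> pcar n" using I ideal_set_sub by blast
  next
    show "0 \<in> ?J" using I by (simp add: ideal_set_zero hcomp_0)
  next
    fix a b assume "a \<in> ?J" "b \<in> ?J" then show "a + b \<in> ?J" using I by (auto simp: ideal_set_add hcomp_add)
  next
    fix r a :: "'k mpoly" assume r: "r \<in> pcar n" and a: "a \<in> ?J"
    obtain N where N: "a = (\<Sum>i\<le>N. hcomp i a)" using hcomp_decomposition[of a] by blast
    have eq: "hcomp d (r * a) = (\<Sum>i\<le>N. hcomp d (r * hcomp i a))" for d
      by (subst N) (simp add: sum_distrib_left hcomp_sum)
    have "hcomp d (r * hcomp i a) \<in> I" for d i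
      using r a by (auto simp: hcomp_mult_homog[OF homog_hcomp]
          intro!: ideal_set_mult[OF I] ideal_set_zero[OF I] hcomp_in_pcar)
    then have "hcomp d (r * a) \<in> I" for d
      unfolding eq by (intro ideal_set_sum[OF I])
    then show "r * a \<in> ?J" using r a I by (auto simp: ideal_set_mult)
  qed
  moreover have "H \<subseteq> ?J"
  proof
    fix h assume h: "h \<in> H"
    then obtain d where d: "h \<in> poly_grade n d" using H(1) by blast
    show "h \<in> ?J"
    proof (cases "d < 0")
      case True then show ?thesis using d I by (simp add: poly_grade_neg hcomp_0 ideal_set_zero)
    next
      case False
      then have "homog (nat d) h" using d poly_grade_nat[of h n "nat d"] by simp
      then show ?thesis using h HI I by (auto simp: hcomp_homog ideal_set_zero)
    qed
  qed
  ultimately have "I \<subseteq> ?J" unfolding H(2)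
    by (intro genideal_minimal) (simp_all add: ideal_poly_ring flip: H(2))
  then show "ideal_set (pcar n) I \<and> (\<forall>p\<in>I. \<forall>d. hcomp d p \<in> I)" using I by blast
next
  interpret cring "poly_ring n :: 'k mpoly ring" by (rule cring_poly_ring)
  assume I: "ideal_set (pcar n) I \<and> (\<forall>p\<in>I. \<forall>d. hcomp d p \<in> I)"
  let ?H = "I \<inter> (\<Union>d. poly_grade n d)"
  have HP: "?H \<subseteq> pcar n" by (auto simp: poly_grade_def)
  have id: "ideal (Idl\<^bsub>poly_ring n\<^esub> ?H) (poly_ring n)" by (rule genideal_ideal[OF HP])
  have "I \<subseteq> Idl\<^bsub>poly_ring n\<^esub> ?H"
  proof
    fix p assume p: "p \<in> I"
    obtain N where N: "p = (\<Sum>i\<le>N. hcomp i p)" using hcomp_decomposition[of p] by blast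
    have "hcomp i p \<in> poly_grade n (int i)" for i
      unfolding poly_grade_nat using p I by (auto simp: homog_hcomp ideal_set_sub hcomp_in_pcar)
    then have "hcomp i p \<in> Idl\<^bsub>poly_ring n\<^esub> ?H" for i
      using p I by (intro subsetD[OF genideal_self[OF HP]]) blast
    then show "p \<in> Idl\<^bsub>poly_ring n\<^esub> ?H"
      using id unfolding ideal_poly_ring by (subst N) (rule ideal_set_sum)
  qed
  moreover have "Idl\<^bsub>poly_ring n\<^esub> ?H \<subseteq> I"
    using I by (intro genideal_minimal) (auto simp: ideal_poly_ring)
  ultimately show "homogeneous_ideal n I"
    unfolding homogeneous_ideal_def using I by (auto simp: ideal_poly_ring)
qed

text \<open>For an ideal \<open>Q\<close> this is the largest homogeneous ideal contained in
  \<open>Q\<close>.\<close>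

definition homog_core :: "nat \<Rightarrow> 'k::field mpoly set \<Rightarrow> 'k mpoly set" where
  "homog_core n Q = {p \<in> pcar n. \<forall>d. hcomp d p \<in> Q}"

lemma homog_core_subset: "ideal_set (pcar n) Q \<Longrightarrow> homog_core n Q \<subseteq> Q"
  by (metis (no_types, lifting) hcomp_decomposition homog_core_def ideal_set_sum mem_Collect_eq subsetI)

lemma homog_in_core: "ideal_set (pcar n) Q \<Longrightarrow> p \<in> Q \<Longrightarrow> homog d p \<Longrightarrow> p \<in> homog_core n Q"
  by (auto simp: homog_core_def hcomp_homog ideal_set_zero ideal_set_sub)

lemma ideal_homog_core:
  fixes Q :: "'k::field mpoly set"
  assumes Q: "ideal_set (pcar n) Q" shows "ideal_set (pcar n) (homog_core n Q)"
  unfolding ideal_set_def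
proof (intro conjI ballI subsetI)
  fix r a :: "'k mpoly" assume r: "r \<in> pcar n" and a: "a \<in> homog_core n Q"
  obtain N where N: "a = (\<Sum>i\<le>N. hcomp i a)" using hcomp_decomposition[of a] by blast
  have eq: "hcomp d (r * a) = (\<Sum>i\<le>N. hcomp d (r * hcomp i a))" for d
    by (subst N) (simp add: sum_distrib_left hcomp_sum)
  have "hcomp d (r * hcomp i a) \<in> Q" for d i
    using r a by (auto simp: hcomp_mult_homog[OF homog_hcomp] homog_core_def
        intro!: ideal_set_mult[OF Q] ideal_set_zero[OF Q] hcomp_in_pcar)
  then have "hcomp d (r * a) \<in> Q" for d
    unfolding eq by (intro ideal_set_sum[OF Q])
  then show "r * a \<in> homog_core n Q" using r a by (auto simp: homog_core_def pcar_closed)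
qed (use Q in \<open>auto simp: homog_core_def pcar_closed hcomp_0 hcomp_add ideal_set_zero ideal_set_add\<close>)

lemma homogeneous_homog_core:
  "ideal_set (pcar n) Q \<Longrightarrow> homogeneous_ideal n (homog_core n Q)"
  unfolding homogeneous_ideal_iff
  by (auto simp: ideal_homog_core, auto simp: homog_core_def hcomp_in_pcar hcomp_homog[OF homog_hcomp] ideal_set_zero)

text \<open>For \<open>a\<close> and \<open>b\<close> outside the core, let \<open>d\<close> and
  \<open>e\<close> be the top degrees in which their components leave \<open>Q\<close>. In degree
  \<open>d + e\<close> of \<open>a * b\<close> every summand except
  \<open>hcomp d a * hcomp e b\<close> has a factor in \<open>Q\<close>, so this product would lie
  in \<open>Q\<close>, against primality.\<close>

lemma prime_homog_core:
  fixes Q :: "'k::field mpoly set"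
  assumes Q: "prime_set (pcar n) Q" shows "prime_set (pcar n) (homog_core n Q)"
  unfolding prime_set_def
proof (intro conjI ballI impI)
  note QI = prime_set_ideal[OF Q]
  show "ideal_set (pcar n) (homog_core n Q)" by (rule ideal_homog_core[OF QI])
  show "1 \<notin> homog_core n Q" using homog_core_subset[OF QI] prime_set_one[OF Q] by blast
  have top: "\<exists>d. hcomp d a \<notin> Q \<and> (\<forall>i>d. hcomp i a \<in> Q)" if a': "a \<in> pcar n" "a \<notin> homog_core n Q" for a
  proof -
    obtain N where N: "\<And>d. d > N \<Longrightarrow> hcomp d a = 0" using hcomp_decomposition[of a] by blast
    obtain d0 where d0: "hcomp d0 a \<notin> Q" using a' by (auto simp: homog_core_def)
    have bd: "hcomp d a \<notin> Q \<Longrightarrow> d \<le> N" for d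
      using N[of d] ideal_set_zero[OF QI] by (metis not_le)
    then have "hcomp (GREATEST d. hcomp d a \<notin> Q) a \<notin> Q"
      using GreatestI_nat[of "\<lambda>d. hcomp d a \<notin> Q" d0 N] d0 by blast
    moreover have "hcomp i a \<in> Q" if "i > (GREATEST d. hcomp d a \<notin> Q)" for i
      using Greatest_le_nat[of "\<lambda>d. hcomp d a \<notin> Q" i N] bd that by (meson not_le)
    ultimately show ?thesis by blast
  qed
  fix a b assume a: "a \<in> pcar n" and b: "b \<in> pcar n" and ab: "a * b \<in> homog_core n Q"
  show "a \<in> homog_core n Q \<or> b \<in> homog_core n Q"
  proof (rule ccontr)
    assume "\<not> ?thesis"
    then obtain d e where d: "hcomp d a \<notin> Q" "\<And>i. i > d \<Longrightarrow> hcomp i a \<in> Q"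
      and e: "hcomp e b \<notin> Q" "\<And>i. i > e \<Longrightarrow> hcomp i b \<in> Q"
      using top a b by meson
    obtain N where N: "b = (\<Sum>i\<le>N. hcomp i b)" "\<And>i. i > N \<Longrightarrow> hcomp i b = 0" using hcomp_decomposition[of b] by blast
    have "e \<le> N" using N(2)[of e] e(1) ideal_set_zero[OF QI] by (metis not_le)
    define t where "t i = (if i \<le> d + e then hcomp (d + e - i) a * hcomp i b else 0)" for i
    have "hcomp (d + e) (a * b) = (\<Sum>i\<le>N. hcomp (d + e) (a * hcomp i b))"
      by (subst N(1)) (simp add: sum_distrib_left hcomp_sum)
    also have "\<dots> = (\<Sum>i\<le>N. t i)"
      by (intro sum.cong refl) (simp add: hcomp_mult_homog[OF homog_hcomp] t_def)
    also have "\<dots> = t e + (\<Sum>i\<in>{..N} - {e}. t i)" using \<open>e \<le> N\<close> by (simp add: sum.remove)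
    finally have 1: "hcomp (d + e) (a * b) = hcomp d a * hcomp e b + (\<Sum>i\<in>{..N} - {e}. t i)"
      by (simp add: t_def)
    have "t i \<in> Q" if "i \<noteq> e" for i
    proof (cases "i > e")
      case True then show ?thesis using e(2) a b
        by (auto simp: t_def ideal_set_zero[OF QI] intro!: ideal_set_mult[OF QI] hcomp_in_pcar)
    next
      case False then have "d + e - i > d" using that by simp
      then show ?thesis using d(2) a b
        by (auto simp: t_def ideal_set_zero[OF QI] intro!: ideal_set_mult2[OF QI] hcomp_in_pcar)
    qed
    then have "(\<Sum>i\<in>{..N} - {e}. t i) \<in> Q" by (intro ideal_set_sum[OF QI]) auto
    moreover have "hcomp (d + e) (a * b) \<in> Q" using ab by (simp add: homog_core_def)
    ultimately have "hcomp (d + e) (a * b) - (\<Sum>i\<in>{..N} - {e}. t i) \<in> Q"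
      using ideal_set_diff[OF subring_set_pcar QI] by blast
    then have "hcomp d a * hcomp e b \<in> Q" unfolding 1 by simp
    then show False using prime_set_mult[OF Q] d(1) e(1) a b hcomp_in_pcar by blast
  qed
qed

section \<open>Zero-dimensional schemes\<close>

text \<open>Turns a prime produced by Zorn's lemma, homogeneous or not, into a point of the scheme.
  The core misses \<open>X i\<close> since it is contained in \<open>Q\<close>, and it contains
  \<open>I\<close> since \<open>I\<close> is homogeneous.\<close>

lemma homog_core_in_points:
  assumes Q: "prime_set (pcar n) Q" and IQ: "I \<subseteq> Q" and I: "homogeneous_ideal n I"
    and i: "i \<le> n" "X i \<notin> Q"
  shows "homog_core n Q \<in> scheme_points n I"
proof -
  note QI = prime_set_ideal[OF Q]
  have "I \<subseteq> homog_core n Q"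
    using I IQ unfolding homogeneous_ideal_iff by (auto simp: homog_core_def ideal_set_sub)
  moreover have "X i \<notin> homog_core n Q" using homog_core_subset[OF QI] i by blast
  ultimately show ?thesis
    using i prime_homog_core[OF Q] homogeneous_homog_core[OF QI]
    by (auto simp: scheme_points_def primeideal_poly_ring)
qed

text \<open>The preimage in the polynomial ring of the kernel of \<open>R \<rightarrow> S\<close>,
  so that \<open>S\<close> is the quotient by this single ideal.\<close>

definition deh_ideal :: "nat \<Rightarrow> 'k::field mpoly set \<Rightarrow> 'k mpoly set" where
  "deh_ideal n I = {a + (X 0 - 1) * r | a r. a \<in> I \<and> r \<in> pcar n}"

lemma X0_minus_1: "X 0 - 1 \<in> pcar n"
  by (simp add: X_in_pcar pcar_closed)

lemma X0_power_minus_1: "\<exists>r\<in>pcar n. X 0 ^ k - 1 = (X 0 - 1) * (r :: 'k::field mpoly)"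
proof (induction k)
  case 0 show ?case by (intro bexI[of _ 0]) (simp_all add: pcar_closed)
next
  case (Suc k)
  then obtain r :: "'k mpoly" where r: "r \<in> pcar n" "X 0 ^ k - 1 = (X 0 - 1) * r" by blast
  have "X 0 ^ Suc k - 1 = X 0 * (X 0 ^ k - 1) + (X 0 - 1 :: 'k mpoly)" by (simp add: algebra_simps)
  also have "\<dots> = (X 0 - 1) * (X 0 * r + 1)" unfolding r(2) by (simp add: algebra_simps)
  finally show ?case using r(1) by (intro bexI[of _ "X 0 * r + 1"]) (auto simp: X_in_pcar pcar_closed)
qed

text \<open>Multiplying the component of degree \<open>d\<close> by \<open>X 0 ^ (D - d)\<close>
  changes it only by a multiple of \<open>X 0 - 1\<close>. All large \<open>D\<close> are offered,
  so that several polynomials can be brought to one common degree.\<close>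

lemma homogenize:
  fixes p :: "'k::field mpoly"
  assumes p: "p \<in> pcar n"
  obtains N where "\<And>D. D \<ge> N \<Longrightarrow> \<exists>q r. q \<in> pcar n \<and> homog D q \<and> r \<in> pcar n \<and> q - p = (X 0 - 1) * r"
proof -
  obtain N where N: "p = (\<Sum>d\<le>N. hcomp d p)" using hcomp_decomposition[of p] by blast
  have "\<exists>q r. q \<in> pcar n \<and> homog D q \<and> r \<in> pcar n \<and> q - p = (X 0 - 1) * r" if "D \<ge> N" for D
  proof -
    obtain r :: "nat \<Rightarrow> 'k mpoly" where r: "\<And>k. r k \<in> pcar n" "\<And>k. X 0 ^ k - 1 = (X 0 - 1) * r k"
      using X0_power_minus_1[of n, where 'k='k] by metis
    define q where "q = (\<Sum>d\<le>N. X 0 ^ (D - d) * hcomp d p)"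
    have "q \<in> pcar n" unfolding q_def using p
      by (intro pcar_closed(8) pcar_closed(3) pcar_closed(7)) (simp_all add: X_in_pcar hcomp_in_pcar)
    moreover have "homog D q" unfolding q_def
    proof (rule homog_sum)
      fix d assume "d \<in> {..N}"
      then show "homog D (X 0 ^ (D - d) * hcomp d p)"
        using homog_mult[OF homog_X_power homog_hcomp, of "D - d" d 0 p] that by simp
    qed
    moreover have "(\<Sum>d\<le>N. r (D - d) * hcomp d p) \<in> pcar n"
      using p r by (intro pcar_closed(8) pcar_closed(3)) (simp_all add: hcomp_in_pcar)
    moreover have "q - p = (X 0 - 1) * (\<Sum>d\<le>N. r (D - d) * hcomp d p)"
    proof -
      have "q - p = (\<Sum>d\<le>N. X 0 ^ (D - d) * hcomp d p) - (\<Sum>d\<le>N. hcomp d p)"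
        using N by (simp add: q_def)
      also have "\<dots> = (\<Sum>d\<le>N. (X 0 ^ (D - d) - 1) * hcomp d p)"
        by (simp add: sum_subtractf algebra_simps)
      finally show ?thesis unfolding r(2) by (simp add: sum_distrib_left mult.assoc)
    qed
    ultimately show ?thesis by blast
  qed
  then show ?thesis using that by blast
qed

section \<open>Evaluation of univariate polynomials, and the polynomial ring as a chain of
  adjunctions\<close>

definition eval_at :: "'k::field mpoly \<Rightarrow> 'k poly \<Rightarrow> 'k mpoly" where
  "eval_at x g = poly (map_poly Const g) x"

lemma eval_at_pCons: "eval_at x (pCons a g) = Const a + x * eval_at x g"
  by (simp add: eval_at_def map_poly_pCons Const_0)

lemma eval_at_0: "eval_at x 0 = 0" by (simp add: eval_at_def)

lemma eval_at_1: "eval_at x 1 = 1"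
  unfolding one_pCons eval_at_pCons by (simp add: Const_1 eval_at_0)

lemma eval_at_add: "eval_at x (g + h) = eval_at x g + eval_at x h"
proof (induction g arbitrary: h)
  case 0 then show ?case by (simp add: eval_at_0)
next
  case (pCons a g) then show ?case
    by (cases h) (simp add: eval_at_pCons Const_add algebra_simps)
qed

lemma eval_at_smult: "eval_at x (Polynomial.smult c g) = Const c * eval_at x g"
  by (induction g) (simp_all add: eval_at_0 eval_at_pCons Const_mult algebra_simps)

lemma eval_at_mult: "eval_at x (g * h) = eval_at x g * eval_at x h"
  by (induction g) (simp_all add: eval_at_0 eval_at_pCons eval_at_add eval_at_smult Const_0 algebra_simps)

lemma eval_at_diff: "eval_at x (g - h) = eval_at x g - eval_at x h"
  using eval_at_add[of x "g - h" h] by simp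

lemma eval_at_power: "eval_at x (g ^ k) = eval_at x g ^ k"
  by (induction k) (simp_all add: eval_at_1 eval_at_mult)

lemma eval_at_in_pcar: "x \<in> pcar n \<Longrightarrow> eval_at x g \<in> pcar n"
  by (induction g) (simp_all add: eval_at_0 eval_at_pCons pcar_closed Const_in_pcar)

lemma subring_set_range_eval_at: "subring_set (range (eval_at x))"
  unfolding subring_set_def
  by (auto simp flip: eval_at_diff eval_at_mult eval_at_1[of x])

text \<open>The index counts adjoined variables: stage \<open>j\<close> is
  \<open>A[X 0, ..., X (j - 1)]\<close>, and the whole ring is reached at
  \<open>Suc n\<close>.\<close>

fun adjoin_X :: "'k::field mpoly set \<Rightarrow> nat \<Rightarrow> 'k mpoly set" where
  "adjoin_X A 0 = A"
| "adjoin_X A (Suc j) = adjoin (adjoin_X A j) (X j)"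

lemma subring_set_adjoin_X: "subring_set A \<Longrightarrow> subring_set (adjoin_X A j)"
  by (induction j) (auto simp: subring_set_adjoin)

lemma adjoin_X_subset: "A \<subseteq> pcar n \<Longrightarrow> j \<le> Suc n \<Longrightarrow> adjoin_X A j \<subseteq> pcar n"
proof (induction j)
  case (Suc j)
  then show ?case using adjoin_subset[OF subring_set_pcar _ X_in_pcar, of _ n j] by simp
qed simp

lemma X_in_adjoin_X: "subring_set A \<Longrightarrow> i < j \<Longrightarrow> X i \<in> adjoin_X A j"
proof (induction j)
  case (Suc j)
  then show ?case using mem_adjoin[OF subring_set_adjoin_X[OF Suc.prems(1)], of "X j" j]
      subset_adjoin[OF subring_set_adjoin_X[OF Suc.prems(1)], of j "X j"] by (auto simp: less_Suc_eq)
qed simp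

lemma subset_adjoin_X: "subring_set A \<Longrightarrow> A \<subseteq> adjoin_X A j"
proof (induction j)
  case (Suc j)
  then show ?case using subset_adjoin[OF subring_set_adjoin_X[OF Suc.prems], of j "X j"] by simp
qed simp

lemma pcar_eq_adjoin_X:
  assumes A: "subring_set A" "A \<subseteq> pcar n" "range Const \<subseteq> A"
  shows "adjoin_X A (Suc n) = pcar n"
proof
  show "adjoin_X A (Suc n) \<subseteq> pcar n" by (rule adjoin_X_subset[OF A(2)]) simp
  note S = subring_set_adjoin_X[OF A(1), of "Suc n"]
  show "pcar n \<subseteq> adjoin_X A (Suc n)"
  proof
    fix p :: "'a mpoly" assume "p \<in> pcar n"
    then show "p \<in> adjoin_X A (Suc n)"
    proof (induction rule: pcar_induct)
      case (Const c) then show ?case using subset_adjoin_X[OF A(1)] A(3) by blast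
    next
      case (X i) then show ?case using X_in_adjoin_X[OF A(1), of i "Suc n"] by simp
    qed (use S in \<open>simp_all add: subring_set_closed del: adjoin_X.simps\<close>)
  qed
qed

text \<open>Being a Goldman domain descends along the generators \<open>X\<^sub>j\<close> to \<open>K[x]\<close>. There \<open>1 + x g\<close>, with \<open>g\<close>
  the element to be inverted, would have to divide a power of \<open>g\<close>.\<close>

lemma not_field_over_polynomials:
  fixes Q :: "'k::field mpoly set"
  assumes Q: "prime_set (pcar n) Q" and x: "x \<in> pcar n"
    and inj: "\<And>g. eval_at x g \<in> Q \<Longrightarrow> g = 0"
    and field: "\<And>p. p \<in> pcar n \<Longrightarrow> p \<notin> Q \<Longrightarrow> \<exists>c\<in>pcar n. p * c - 1 \<in> Q"
  shows False
proof -
  let ?A = "range (eval_at x)"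
  have A: "subring_set ?A" "?A \<subseteq> pcar n" using subring_set_range_eval_at x eval_at_in_pcar by auto
  have "Const c \<in> ?A" for c
    using eval_at_pCons[of x c 0] by (metis add.right_neutral eval_at_0 mult_zero_right rangeI)
  then have P: "adjoin_X ?A (Suc n) = pcar n" by (intro pcar_eq_adjoin_X A) auto
  \<comment> \<open>When the residue ring is a field, \<open>1\<close> serves as the element to be
    inverted.\<close>
  have "G_domain Q (pcar n)"
    unfolding G_domain_def
    using field by (intro bexI[of _ 1]) (auto simp: pcar_closed prime_set_one[OF Q])
  then have "G_domain Q (adjoin_X ?A (Suc n))" unfolding P .
  moreover have "G_domain Q (adjoin_X ?A j) \<Longrightarrow> j \<le> Suc n \<Longrightarrow> G_domain Q ?A" for j
  proof (induction j)
    case (Suc j)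
    have "G_domain Q (adjoin_X ?A j)"
      by (rule G_domain_adjoinD[OF subring_set_pcar Q subring_set_adjoin_X[OF A(1)] adjoin_X_subset[OF A(2)]])
        (use Suc.prems in \<open>auto simp: X_in_pcar\<close>)
    then show ?case using Suc by simp
  qed simp
  ultimately have "G_domain Q ?A" by blast
  then obtain g where g: "eval_at x g \<notin> Q"
    and inv: "\<And>r. eval_at x r \<notin> Q \<Longrightarrow> \<exists>h m. eval_at x r * eval_at x h - eval_at x g ^ m \<in> Q"
    unfolding G_domain_def by blast
  have g0: "g \<noteq> 0" using g ideal_set_zero[OF prime_set_ideal[OF Q]] by (auto simp: eval_at_0)
  define r where "r = 1 + pCons 0 g"
  have dr: "degree r = Suc (degree g)"
    using g0 by (simp add: r_def degree_add_eq_right)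
  have "eval_at x r \<notin> Q" using inj[of r] dr by auto
  then obtain h m where "eval_at x r * eval_at x h - eval_at x g ^ m \<in> Q" using inv by blast
  then have "eval_at x (r * h - g ^ m) \<in> Q"
    by (simp add: eval_at_diff eval_at_mult eval_at_power)
  then have rh: "r * h = g ^ m" using inj by fastforce
  \<comment> \<open>\<open>r - 1\<close> is \<open>T g\<close> and \<open>r\<close> divides
    \<open>g ^ m\<close>, so \<open>r\<close> divides \<open>(r - 1) ^ m\<close>. Modulo
    \<open>r\<close> this power equals \<open>(- 1) ^ m\<close>, hence \<open>r\<close> divides a
    unit despite its positive degree.\<close>
  have "r dvd (r - 1) ^ m"
  proof -
    have "(r - 1) ^ m = [:0, 1:] ^ m * g ^ m" by (simp add: r_def flip: power_mult_distrib)
    then show ?thesis using rh by (metis dvd_mult dvd_triv_left)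
  qed
  moreover have "r dvd (r - 1) ^ m - (- 1) ^ m"
    using power_diff_sumr2[of "r - 1" m "- 1"] by simp
  ultimately have "r dvd (- 1) ^ m" using dvd_diff_right_iff by blast
  then have "is_unit r" by (meson dvd_trans is_unit_power_iff dvd_refl dvd_minus_iff one_dvd unit_imp_dvd minus_dvd_iff)
  moreover have "r \<noteq> 0" using dr by auto
  ultimately show False using dr is_unit_iff_degree[of r] by simp
qed

locale zero_dim_scheme =
  fixes n :: nat and I :: "'k::field mpoly set"
  assumes scheme: "scheme_ideal n I" and zero_dim: "zero_dimensional n I"
    and no_points_at_infinity: "\<forall>p\<in>scheme_points n I. X 0 \<notin> p"
begin

lemma homogeneous: "homogeneous_ideal n I"
  using scheme by (simp add: scheme_ideal_def)

lemma I_ideal: "ideal_set (pcar n) I" and hcomp_in_I: "p \<in> I \<Longrightarrow> hcomp d p \<in> I"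
  using homogeneous by (auto simp: homogeneous_ideal_iff)

lemmas I_closed = ideal_set_zero[OF I_ideal] ideal_set_add[OF I_ideal] ideal_set_mult[OF I_ideal]
  ideal_set_mult2[OF I_ideal] ideal_set_diff[OF subring_set_pcar I_ideal] ideal_set_uminus[OF subring_set_pcar I_ideal]
  ideal_set_sum[OF I_ideal]

lemma I_sub: "p \<in> I \<Longrightarrow> p \<in> pcar n" by (rule ideal_set_sub[OF I_ideal])

text \<open>If \<open>f \<notin> I\<close>, then by saturatedness the annihilator of \<open>f\<close> modulo \<open>I\<close> contains no power of some
  \<open>X\<^sub>i\<close>. The homogeneous core of a prime above it that avoids these powers is a point on \<open>X\<^sub>0 = 0\<close>.\<close>

lemma X0_nonzerodivisor:
  assumes f: "f \<in> pcar n" and X0f: "X 0 * f \<in> I" shows "f \<in> I"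
proof (rule ccontr)
  assume fI: "f \<notin> I"
  then have "f \<notin> saturation n I" using scheme by (simp add: scheme_ideal_def)
  then obtain i where i: "i \<le> n" "\<And>N. X i ^ N * f \<notin> I" using f by (auto simp: saturation_def)
  define J where "J = {r \<in> pcar n. r * f \<in> I}"
  have J: "ideal_set (pcar n) J"
    by (auto simp: ideal_set_def J_def pcar_closed I_closed distrib_right mult.assoc)
  have Xp: "X i ^ a \<in> pcar n" for a using i(1) by (simp add: X_in_pcar pcar_closed)
  obtain Q where Q: "prime_set (pcar n) Q" "J \<subseteq> Q" "Q \<inter> range (\<lambda>N. X i ^ N) = {}"
  proof (rule prime_set_avoiding[OF subring_set_pcar J, of "range (\<lambda>N. X i ^ N)"])
    show "range (\<lambda>N. X i ^ N) \<subseteq> pcar n" using Xp by auto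
    show "1 \<in> range (\<lambda>N. X i ^ N :: 'k mpoly)" by (auto intro: range_eqI[of _ _ 0])
    show "a * b \<in> range (\<lambda>N. X i ^ N)" if "a \<in> range (\<lambda>N. X i ^ N)" "b \<in> range (\<lambda>N. X i ^ N)" for a b :: "'k mpoly"
      using that by (auto simp flip: power_add)
    show "J \<inter> range (\<lambda>N. X i ^ N) = {}" using i(2) by (auto simp: J_def)
  qed
  have "I \<subseteq> J" using f by (auto simp: J_def I_sub I_closed)
  moreover have "X i \<notin> Q" using Q(3) by (metis disjoint_iff power_one_right rangeI)
  ultimately have "homog_core n Q \<in> scheme_points n I"
    using homog_core_in_points[OF Q(1) _ homogeneous i(1)] Q(2) by blast
  moreover have "X 0 \<in> J" using X0f by (simp add: J_def X_in_pcar)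
  then have "X 0 \<in> homog_core n Q"
    using homog_in_core[OF prime_set_ideal[OF Q(1)] _ homog_X] Q(2) by blast
  ultimately show False using no_points_at_infinity by blast
qed

text \<open>If \<open>b\<close> divides no power of \<open>X\<^sub>0\<close> modulo \<open>I\<close>, it vanishes at a point \<open>p\<close>; a prime above \<open>I\<close> avoiding
  the multiplicative set of all \<open>b\<^sup>j s\<close> with \<open>s \<notin> p\<close> then gives a point strictly below \<open>p\<close>.\<close>

lemma nonzerodivisor_dvd_X0_power:
  assumes b: "b \<in> pcar n" "homog e b" and nzd: "\<And>s. s \<in> pcar n \<Longrightarrow> b * s \<in> I \<Longrightarrow> s \<in> I"
  shows "\<exists>k c. e \<le> k \<and> c \<in> pcar n \<and> homog (k - e) c \<and> X 0 ^ k - b * c \<in> I"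
proof -
  define J where "J = {a + b * r | a r. a \<in> I \<and> r \<in> pcar n}"
  note J = ideal_set_adjoin[OF subring_set_pcar I_ideal b(1), folded J_def]
  have "\<exists>k. X 0 ^ k \<in> J"
  proof (rule ccontr)
    assume none: "\<nexists>k. X 0 ^ k \<in> J"
    obtain Q where Q: "prime_set (pcar n) Q" "J \<subseteq> Q" "Q \<inter> range (\<lambda>N. X 0 ^ N) = {}"
    proof (rule prime_set_avoiding[OF subring_set_pcar J(1), of "range (\<lambda>N. X 0 ^ N)"])
      show "range (\<lambda>N. X 0 ^ N) \<subseteq> pcar n" by (auto simp: X_in_pcar pcar_closed)
      show "1 \<in> range (\<lambda>N. X 0 ^ N :: 'k mpoly)" by (auto intro: range_eqI[of _ _ 0])
      show "a * b \<in> range (\<lambda>N. X 0 ^ N)" if "a \<in> range (\<lambda>N. X 0 ^ N)" "b \<in> range (\<lambda>N. X 0 ^ N)" for a b :: "'k mpoly"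
        using that by (auto simp flip: power_add)
      show "J \<inter> range (\<lambda>N. X 0 ^ N) = {}" using none by auto
    qed
    define p where "p = homog_core n Q"
    have X0Q: "X 0 \<notin> Q" using Q(3) by (metis disjoint_iff power_one_right rangeI)
    have pS: "p \<in> scheme_points n I"
      unfolding p_def using Q J(2) X0Q by (intro homog_core_in_points[OF Q(1) _ homogeneous, of 0]) auto
    have bp: "b \<in> p" unfolding p_def
      using Q(2) J(3) b(2) by (intro homog_in_core[OF prime_set_ideal[OF Q(1)]]) auto
    have p: "prime_set (pcar n) p" "I \<subseteq> p" using pS by (auto simp: scheme_points_def primeideal_poly_ring)
    have X0p: "X 0 \<notin> p" using pS no_points_at_infinity by blast
    define M where "M = {b ^ j * s | j s. s \<in> pcar n \<and> s \<notin> p}"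
    have cancel: "s \<in> I" if "s \<in> pcar n" "b ^ j * s \<in> I" for j s
      using that
    proof (induction j arbitrary: s)
      case (Suc j)
      have "b ^ j * (b * s) \<in> I" using Suc.prems(2) by (simp add: ac_simps)
      then have "b * s \<in> I" using Suc.IH[of "b * s"] Suc.prems(1) b(1) by (simp add: pcar_closed)
      then show ?case using nzd Suc.prems(1) by blast
    qed simp
    obtain Q2 where Q2: "prime_set (pcar n) Q2" "I \<subseteq> Q2" "Q2 \<inter> M = {}"
    proof (rule prime_set_avoiding[OF subring_set_pcar I_ideal, of M])
      show "M \<subseteq> pcar n" using b(1) by (auto simp: M_def pcar_closed)
      have "1 = b ^ 0 * 1" "1 \<in> pcar n" by (simp_all add: pcar_closed)
      then show "1 \<in> M" unfolding M_def using prime_set_one[OF p(1)] by blast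
      show "x * y \<in> M" if xy: "x \<in> M" "y \<in> M" for x y
      proof -
        obtain j s j' s' where *: "x = b ^ j * s" "y = b ^ j' * s'" "s \<in> pcar n" "s \<notin> p" "s' \<in> pcar n" "s' \<notin> p"
          using xy by (auto simp: M_def)
        then have "x * y = b ^ (j + j') * (s * s')" by (simp add: power_add ac_simps)
        moreover have "s * s' \<in> pcar n" "s * s' \<notin> p"
          using * prime_set_mult[OF p(1)] by (auto simp: pcar_closed)
        ultimately show ?thesis unfolding M_def by blast
      qed
      show "I \<inter> M = {}" using cancel p(2) by (auto simp: M_def)
    qed
    \<comment> \<open>Elements of \<open>M\<close> with exponent \<open>0\<close> are the complement
      of \<open>p\<close>, which gives the inclusion; the element \<open>b\<close> itself is the
      case of exponent \<open>1\<close>, and it makes the inclusion strict.\<close>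
    have "Q2 \<subseteq> p"
    proof
      fix s assume "s \<in> Q2"
      then have "s \<in> pcar n" "b ^ 0 * s \<in> Q2" using ideal_set_sub[OF prime_set_ideal[OF Q2(1)]] by auto
      then show "s \<in> p" using Q2(3) unfolding M_def by blast
    qed
    moreover have "b \<notin> Q2"
    proof -
      have "b ^ 1 * 1 \<in> M" unfolding M_def using prime_set_one[OF p(1)] pcar_closed(1) by blast
      then show ?thesis using Q2(3) by auto
    qed
    moreover note sub = homog_core_subset[OF prime_set_ideal[OF Q2(1)]]
    ultimately have "homog_core n Q2 \<subseteq> p" "homog_core n Q2 \<noteq> p" using bp by blast+
    moreover have "homog_core n Q2 \<in> scheme_points n I"
      using X0p \<open>Q2 \<subseteq> p\<close> by (intro homog_core_in_points[OF Q2(1,2) homogeneous, of 0]) auto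
    ultimately show False using zero_dim pS by (auto simp: zero_dimensional_def)
  qed
  then obtain k a r where k: "X 0 ^ k = a + b * r" "a \<in> I" "r \<in> pcar n" by (auto simp: J_def)
  \<comment> \<open>Only one component of the cofactor matters after passing to degree
    \<open>k + e\<close>. The extra factor \<open>X 0 ^ e\<close> raises the exponent to
    \<open>k + e\<close>, which secures the bound by \<open>e\<close> demanded in the claim.\<close>
  define c where "c = hcomp k (X 0 ^ e * r)"
  have eq: "X 0 ^ (k + e) - (X 0 ^ e * r) * b = X 0 ^ e * a"
    by (simp add: power_add k(1) algebra_simps)
  have "X 0 ^ (k + e) - c * b = hcomp (k + e) (X 0 ^ (k + e) - (X 0 ^ e * r) * b)"
    by (simp add: hcomp_diff hcomp_mult_homog[OF b(2)] c_def hcomp_homog[OF homog_X_power])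
  also have "\<dots> \<in> I"
    unfolding eq by (intro hcomp_in_I I_closed(3) k(2)) (simp add: X_in_pcar pcar_closed)
  finally have "X 0 ^ (k + e) - b * c \<in> I" by (simp add: mult.commute)
  moreover have "c \<in> pcar n" "homog k c"
    using k(3) by (auto simp: c_def homog_hcomp intro!: hcomp_in_pcar pcar_closed(3) pcar_closed(7) X_in_pcar)
  ultimately show ?thesis by (intro exI[of _ "k + e"] exI[of _ c]) auto
qed

lemma ideal_deh: "ideal_set (pcar n) (deh_ideal n I)"
  and I_subset_deh: "I \<subseteq> deh_ideal n I" and X0_minus_1_in_deh: "X 0 - 1 \<in> deh_ideal n I"
  unfolding deh_ideal_def by (rule ideal_set_adjoin[OF subring_set_pcar I_ideal X0_minus_1])+

text \<open>Dehomogenisation is injective on each degree. Write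
  \<open>q = a + (X 0 - 1) * r\<close>; modulo \<open>I\<close>, the component of \<open>q\<close>
  in degree \<open>d\<close> is \<open>X 0\<close> times the component of \<open>r\<close> in degree
  \<open>d - 1\<close> minus that in degree \<open>d\<close>. Below \<open>D\<close> the components
  of \<open>r\<close> lie in \<open>I\<close> by upward induction. From \<open>D\<close> on they lie
  in \<open>I\<close> by descent from a degree where \<open>r\<close> vanishes, cancelling
  \<open>X 0\<close> each time. Degree \<open>D\<close> then gives the claim.\<close>

lemma homog_in_deh:
  assumes q: "homog D q" "q \<in> deh_ideal n I" shows "q \<in> I"
proof -
  obtain a r where ar: "q = a + (X 0 - 1) * r" "a \<in> I" "r \<in> pcar n" using q(2) by (auto simp: deh_ideal_def)
  have rel: "hcomp d q - ((if 1 \<le> d then X 0 * hcomp (d - 1) r else 0) - hcomp d r) \<in> I" for d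
  proof -
    have "hcomp d q = hcomp d a + (hcomp d (r * X 0) - hcomp d r)"
      unfolding ar(1) by (simp add: hcomp_add left_diff_distrib hcomp_diff mult.commute[of r])
    then show ?thesis using hcomp_in_I[OF ar(2), of d]
      by (simp add: hcomp_mult_homog[OF homog_X] mult.commute)
  qed
  have rP: "hcomp d r \<in> pcar n" for d using ar(3) by (rule hcomp_in_pcar)
  have low: "d < D \<Longrightarrow> hcomp d r \<in> I" for d
  proof (induction d)
    case 0 then show ?case using rel[of 0] by (simp add: hcomp_homog[OF q(1)])
  next
    case (Suc d)
    then have "X 0 * hcomp d r \<in> I" by (intro I_closed(3)) (auto simp: X_in_pcar)
    moreover have "hcomp (Suc d) r - X 0 * hcomp d r \<in> I"
      using rel[of "Suc d"] Suc.prems by (simp add: hcomp_homog[OF q(1)])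
    ultimately show ?case using I_closed(2) by fastforce
  qed
  obtain N where N: "\<And>d. d > N \<Longrightarrow> hcomp d r = 0" using hcomp_decomposition[of r] by blast
  have high: "hcomp d r \<in> I" if "D \<le> d" for d
  proof -
    have "hcomp (d + k) r \<in> I \<Longrightarrow> hcomp d r \<in> I" for k
    proof (induction k)
      case (Suc k)
      have "X 0 * hcomp (d + k) r - hcomp (Suc (d + k)) r \<in> I"
        using I_closed(6)[OF rel[of "Suc (d + k)"]] that by (simp add: hcomp_homog[OF q(1)])
      then have "X 0 * hcomp (d + k) r \<in> I" using I_closed(2) Suc.prems by fastforce
      then show ?case using X0_nonzerodivisor[OF rP] Suc.IH by blast
    qed simp
    from this[of "Suc N"] show ?thesis using N[of "d + Suc N"] I_closed(1) by simp
  qed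
  have "q - ((if 1 \<le> D then X 0 * hcomp (D - 1) r else 0) - hcomp D r) \<in> I"
    using rel[of D] by (simp add: hcomp_homog[OF q(1)])
  moreover have "(if 1 \<le> D then X 0 * hcomp (D - 1) r else 0) - hcomp D r \<in> I"
    using low[of "D - 1"] high[of D]
    by (auto intro!: I_closed(5) I_closed(3) I_closed(6) simp: X_in_pcar)
  ultimately show ?thesis using I_closed(2) by fastforce
qed

text \<open>Otherwise some prime above \<open>I + (X\<^sub>0 - 1)\<close> meets \<open>K[x]\<close> only in zero. By dimension zero it is
  maximal, which Zariski's lemma excludes.\<close>

lemma X_algebraic:
  assumes x: "x \<in> pcar n" shows "\<exists>g. g \<noteq> 0 \<and> eval_at x g \<in> deh_ideal n I"
proof (rule ccontr)
  assume "\<nexists>g. g \<noteq> 0 \<and> eval_at x g \<in> deh_ideal n I"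
  then have tr: "\<And>g. g \<noteq> 0 \<Longrightarrow> eval_at x g \<notin> deh_ideal n I" by blast
  obtain Q where Q: "prime_set (pcar n) Q" "deh_ideal n I \<subseteq> Q" "Q \<inter> eval_at x ` (UNIV - {0}) = {}"
  proof (rule prime_set_avoiding[OF subring_set_pcar ideal_deh, of "eval_at x ` (UNIV - {0})"])
    show "eval_at x ` (UNIV - {0}) \<subseteq> pcar n" using x eval_at_in_pcar by blast
    show "1 \<in> eval_at x ` (UNIV - {0})" using eval_at_1[of x] by (metis DiffI UNIV_I image_eqI singletonD zero_neq_one)
    show "a * b \<in> eval_at x ` (UNIV - {0})" if "a \<in> eval_at x ` (UNIV - {0})" "b \<in> eval_at x ` (UNIV - {0})" for a b
      using that by (auto simp flip: eval_at_mult)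
    show "deh_ideal n I \<inter> eval_at x ` (UNIV - {0}) = {}" using tr by blast
  qed
  have point: "homog_core n Q' \<in> scheme_points n I" if Q': "prime_set (pcar n) Q'" "Q \<subseteq> Q'" for Q'
  proof -
    have "X 0 \<notin> Q'"
    proof
      assume "X 0 \<in> Q'"
      then have "X 0 - (X 0 - 1) \<in> Q'"
        using ideal_set_diff[OF subring_set_pcar prime_set_ideal[OF Q'(1)]] X0_minus_1_in_deh Q(2) Q'(2) by blast
      then show False using prime_set_one[OF Q'(1)] by simp
    qed
    then show ?thesis
      using I_subset_deh Q(2) Q'(2) by (intro homog_core_in_points[OF Q'(1) _ homogeneous, of 0]) auto
  qed
  \<comment> \<open>A prime \<open>Q'\<close> above \<open>Q\<close> and \<open>p\<close> has a core
    above that of \<open>Q\<close>; both are points, so dimension zero makes the cores equal. A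
    homogeneous \<open>q\<close> congruent to \<open>p\<close> modulo \<open>X 0 - 1\<close> lies in
    \<open>Q'\<close>, hence in the common core, hence in \<open>Q\<close>, and this drags
    \<open>p\<close> into \<open>Q\<close>.\<close>
  have field: "\<exists>c\<in>pcar n. p * c - 1 \<in> Q" if p: "p \<in> pcar n" "p \<notin> Q" for p
  proof (rule ccontr)
    assume none: "\<not> ?thesis"
    note QI = prime_set_ideal[OF Q(1)]
    define J where "J = {a + p * r | a r. a \<in> Q \<and> r \<in> pcar n}"
    note J = ideal_set_adjoin[OF subring_set_pcar QI p(1), folded J_def]
    have "1 \<notin> J"
    proof
      assume "1 \<in> J"
      then obtain a r where ar: "1 = a + p * r" "a \<in> Q" "r \<in> pcar n" by (auto simp: J_def)
      then have "p * r - 1 = - a" by (simp add: algebra_simps)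
      then show False using none ar ideal_set_uminus[OF subring_set_pcar QI] by metis
    qed
    then obtain Q' where Q': "prime_set (pcar n) Q'" "J \<subseteq> Q'"
      using prime_set_avoiding[OF subring_set_pcar J(1), of "{1}"] by (auto simp: pcar_closed)
    have "Q \<subseteq> Q'" using J(2) Q'(2) by blast
    moreover have "homog_core n Q \<subseteq> homog_core n Q'" using \<open>Q \<subseteq> Q'\<close> by (auto simp: homog_core_def)
    ultimately have eq: "homog_core n Q = homog_core n Q'"
      using zero_dim point[OF Q(1)] point[OF Q'(1)] by (auto simp: zero_dimensional_def)
    obtain D q r where q: "homog D q" "r \<in> pcar n" "q - p = (X 0 - 1) * r"
      using homogenize[OF p(1)] by (metis order.refl)
    have qp: "q - p \<in> Q" unfolding q(3)
      using X0_minus_1_in_deh Q(2) q(2) by (intro ideal_set_mult2[OF QI]) auto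
    have "p \<in> Q'" using J(3) Q'(2) by blast
    then have "q \<in> Q'"
      using ideal_set_cong[OF subring_set_pcar prime_set_ideal[OF Q'(1)]] qp \<open>Q \<subseteq> Q'\<close> by blast
    then have "q \<in> homog_core n Q" unfolding eq by (rule homog_in_core[OF prime_set_ideal[OF Q'(1)] _ q(1)])
    then have "q \<in> Q" using homog_core_subset[OF QI] by blast
    then show False using p(2) ideal_set_cong[OF subring_set_pcar QI qp] by blast
  qed
  show False
    by (rule not_field_over_polynomials[OF Q(1) x _ field]) (use Q(3) in blast)
qed

section \<open>Finite dimension of the polynomial ring modulo \<open>deh_ideal n I\<close>\<close>

definition span_mod :: "'k mpoly set \<Rightarrow> 'k mpoly set" where
  "span_mod F = {p. \<exists>c. p - (\<Sum>f\<in>F. Const (c f) * f) \<in> deh_ideal n I}"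

lemmas deh_closed = ideal_set_zero[OF ideal_deh] ideal_set_add[OF ideal_deh] ideal_set_mult[OF ideal_deh]
  ideal_set_mult2[OF ideal_deh] ideal_set_diff[OF subring_set_pcar ideal_deh]
  ideal_set_uminus[OF subring_set_pcar ideal_deh]

lemma span_mod_add: "p \<in> span_mod F \<Longrightarrow> q \<in> span_mod F \<Longrightarrow> p + q \<in> span_mod F"
proof -
  assume "p \<in> span_mod F" "q \<in> span_mod F"
  then obtain c d where "p - (\<Sum>f\<in>F. Const (c f) * f) \<in> deh_ideal n I" "q - (\<Sum>f\<in>F. Const (d f) * f) \<in> deh_ideal n I"
    by (auto simp: span_mod_def)
  from deh_closed(2)[OF this] have "p + q - (\<Sum>f\<in>F. Const (c f + d f) * f) \<in> deh_ideal n I"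
    by (simp add: Const_add distrib_right sum.distrib algebra_simps)
  then show ?thesis unfolding span_mod_def by (auto intro!: exI[of _ "\<lambda>f. c f + d f"])
qed

lemma span_mod_scale: "p \<in> span_mod F \<Longrightarrow> Const a * p \<in> span_mod F"
proof -
  assume "p \<in> span_mod F"
  then obtain c where "p - (\<Sum>f\<in>F. Const (c f) * f) \<in> deh_ideal n I" by (auto simp: span_mod_def)
  from deh_closed(3)[OF Const_in_pcar this, of a]
  have "Const a * p - (\<Sum>f\<in>F. Const (a * c f) * f) \<in> deh_ideal n I"
    by (simp add: Const_mult right_diff_distrib sum_distrib_left mult.assoc)
  then show ?thesis unfolding span_mod_def by (auto intro!: exI[of _ "\<lambda>f. a * c f"])
qed

lemma deh_subset_span_mod: "p \<in> deh_ideal n I \<Longrightarrow> p \<in> span_mod F"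
  unfolding span_mod_def by (auto intro!: exI[of _ "\<lambda>_. 0"] simp: Const_0)

lemma span_mod_sum: "(\<And>i. i \<in> G \<Longrightarrow> p i \<in> span_mod F) \<Longrightarrow> sum p G \<in> span_mod F"
  by (induction G rule: infinite_finite_induct) (auto intro: span_mod_add deh_subset_span_mod deh_closed(1))

lemma span_mod_self: "finite F \<Longrightarrow> f \<in> F \<Longrightarrow> f \<in> span_mod F"
proof -
  assume f: "finite F" "f \<in> F"
  have "(\<Sum>u\<in>F. Const (if u = f then 1 else 0) * u) = (\<Sum>u\<in>F. if u = f then f else 0)"
    by (intro sum.cong refl) (simp add: Const_0 Const_1)
  also have "\<dots> = f" using f by simp
  finally show ?thesis unfolding span_mod_def
    using deh_closed(1) by (auto intro!: exI[of _ "\<lambda>u. if u = f then 1 else 0"])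
qed

lemma eval_at_altdef: "eval_at x g = (\<Sum>i\<le>degree g. Const (coeff g i) * x ^ i)"
proof -
  have "degree (map_poly Const g) = degree g"
    by (rule degree_map_poly) (metis Const_def lookup_single_eq lookup_zero)
  then show ?thesis by (simp add: eval_at_def poly_altdef coeff_map_poly Const_0)
qed

text \<open>By \<open>X_algebraic\<close> the element \<open>x\<close> satisfies a relation of some
  degree \<open>d\<close> over the field, so products of members of \<open>F\<close> with powers of
  \<open>x\<close> below \<open>d\<close> suffice.\<close>

lemma span_mod_adjoin:
  assumes F: "finite F" "F \<subseteq> pcar n" and A: "A \<subseteq> span_mod F" "A \<subseteq> pcar n" and x: "x \<in> pcar n"
  obtains F' where "finite F'" "F' \<subseteq> pcar n" "adjoin A x \<subseteq> span_mod F'"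
proof -
  obtain g where g: "g \<noteq> 0" "eval_at x g \<in> deh_ideal n I" using X_algebraic[OF x] by blast
  define d where "d = degree g"
  define F' where "F' = (\<lambda>(u, l). u * x ^ l) ` (F \<times> {..<d})"
  have fin: "finite F'" using F by (simp add: F'_def)
  have F'P: "F' \<subseteq> pcar n" using F(2) x by (auto simp: F'_def pcar_closed)
  have pw: "u * x ^ l \<in> span_mod F'" if u: "u \<in> F" for u l
  proof (induction l rule: less_induct)
    case (less l)
    show ?case
    proof (cases "l < d")
      case True
      then have "u * x ^ l \<in> F'" using u by (auto simp: F'_def)
      then show ?thesis by (rule span_mod_self[OF fin])
    next
      case False
      then obtain m where m: "l = d + m" using le_iff_add by (metis not_less)
      define a where "a = lead_coeff g"
      have a: "a \<noteq> 0" using g(1) by (simp add: a_def)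
      have sp: "eval_at x g = Const a * x ^ d + (\<Sum>i<d. Const (coeff g i) * x ^ i)"
        by (simp add: eval_at_altdef a_def d_def flip: lessThan_Suc_atMost)
      \<comment> \<open>Solve the relation for \<open>x ^ d\<close>, divide by its leading
        coefficient \<open>a\<close>, and multiply by \<open>u * x ^ m\<close>; only smaller
        exponents remain.\<close>
      have "u * x ^ l = Const (1 / a) * (u * x ^ m * (Const a * x ^ d))"
        using a by (simp add: m power_add Const_1 ac_simps flip: Const_mult)
      also have "\<dots> = Const (1 / a) * (u * x ^ m * eval_at x g + Const (- 1) * (\<Sum>i<d. Const (coeff g i) * (u * x ^ (m + i))))"
        by (simp add: sp Const_def[of "- 1"] single_uminus single_one algebra_simps sum_distrib_left power_add sum_negf)
      also have "\<dots> \<in> span_mod F'"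
        using u F(2) x g(2) m
        by (intro span_mod_scale span_mod_add span_mod_sum less deh_subset_span_mod deh_closed(3))
          (auto simp: pcar_closed)
      finally show ?thesis .
    qed
  qed
  have Apw: "a * x ^ l \<in> span_mod F'" if a: "a \<in> A" for a l
  proof -
    obtain c where c: "a - (\<Sum>f\<in>F. Const (c f) * f) \<in> deh_ideal n I" using a A by (auto simp: span_mod_def)
    have "a * x ^ l = (a - (\<Sum>f\<in>F. Const (c f) * f)) * x ^ l + (\<Sum>f\<in>F. Const (c f) * (f * x ^ l))"
      by (simp add: algebra_simps sum_distrib_left)
    also have "\<dots> \<in> span_mod F'"
      using pw by (intro span_mod_add[OF deh_subset_span_mod[OF deh_closed(4)[OF _ c]]]
        span_mod_sum span_mod_scale) (auto simp: pcar_closed x)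
    finally show ?thesis .
  qed
  have "adjoin A x \<subseteq> span_mod F'"
    by (auto simp: adjoin_def poly_altdef polys_def intro!: span_mod_sum Apw)
  then show ?thesis using that fin F'P by blast
qed

lemma finite_span_mod:
  obtains F where "finite F" "F \<subseteq> pcar n" "pcar n \<subseteq> span_mod F"
proof -
  let ?A = "range Const :: 'k mpoly set"
  have A: "subring_set ?A" "?A \<subseteq> pcar n"
    by (auto simp: subring_set_def Const_in_pcar simp flip: Const_diff Const_mult Const_1)
  have "\<exists>F. finite F \<and> F \<subseteq> pcar n \<and> adjoin_X ?A j \<subseteq> span_mod F" if "j \<le> Suc n" for j
    using that
  proof (induction j)
    case 0
    have "Const c \<in> span_mod {1}" for c
      using span_mod_scale[OF span_mod_self[of "{1}" 1], of c] by simp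
    then show ?case by (intro exI[of _ "{1}"]) (auto simp: pcar_closed)
  next
    case (Suc j)
    then obtain F where F: "finite F" "F \<subseteq> pcar n" "adjoin_X ?A j \<subseteq> span_mod F" by auto
    obtain F' where "finite F'" "F' \<subseteq> pcar n" "adjoin (adjoin_X ?A j) (X j) \<subseteq> span_mod F'"
      by (rule span_mod_adjoin[OF F(1,2,3) adjoin_X_subset[OF A(2)] X_in_pcar]) (use Suc.prems in auto)
    then show ?case by auto
  qed
  from this[of "Suc n"] show ?thesis using that pcar_eq_adjoin_X[OF A] by auto
qed

text \<open>This is where existence of a point is used: \<open>1\<close> is homogeneous, so it would
  lie in \<open>I\<close> and thus in a prime. It makes \<open>S\<close> nonzero.\<close>

lemma one_notin_deh: "1 \<notin> deh_ideal n I"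
proof
  assume "1 \<in> deh_ideal n I"
  then have "1 \<in> I" by (rule homog_in_deh[OF homog_1])
  moreover obtain p where "p \<in> scheme_points n I" using zero_dim by (auto simp: zero_dimensional_def)
  ultimately show False by (auto simp: scheme_points_def primeideal_poly_ring prime_set_def)
qed

end

section \<open>Modules\<close>

lemma cring_regular_module: "cring A \<Longrightarrow> module A (regular_module A)"
proof -
  assume "cring A"
  then interpret cring A .
  show ?thesis unfolding regular_module_def
    by (rule module_criteria) (auto simp: a_ac m_ac l_distr r_distr cring_axioms intro: l_neg r_neg)
qed

lemma module_restrict_scalars:
  assumes C: "cring C" and A: "module A M" and \<phi>: "\<phi> \<in> Ring.ring_hom C A"
  shows "module C (restrict_scalars \<phi> M)"
proof -
  interpret module A M by fact
  interpret C: cring C by fact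
  show ?thesis unfolding restrict_scalars_def
    by (rule module_criteria)
      (use \<phi> in \<open>auto simp: C M.a_ac Ring.ring_hom_closed Ring.ring_hom_mult Ring.ring_hom_add Ring.ring_hom_one
        smult_l_distr smult_r_distr smult_assoc1 intro: M.r_neg\<close>)
qed

lemma mod_homI:
  assumes "module A M" "module A N" "\<And>m. m \<in> carrier M \<Longrightarrow> f m \<in> carrier N"
    "\<And>m m'. m \<in> carrier M \<Longrightarrow> m' \<in> carrier M \<Longrightarrow> f (m \<oplus>\<^bsub>M\<^esub> m') = f m \<oplus>\<^bsub>N\<^esub> f m'"
    "\<And>a m. a \<in> carrier A \<Longrightarrow> m \<in> carrier M \<Longrightarrow> f (a \<odot>\<^bsub>M\<^esub> m) = a \<odot>\<^bsub>N\<^esub> f m"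
  shows "mod_hom A M N f"
  using assms by (simp add: mod_hom_def mod_hom_axioms_def module_hom_def)

lemma mod_homD:
  assumes "mod_hom A M N f"
  shows "\<And>m. m \<in> carrier M \<Longrightarrow> f m \<in> carrier N"
    "\<And>m m'. m \<in> carrier M \<Longrightarrow> m' \<in> carrier M \<Longrightarrow> f (m \<oplus>\<^bsub>M\<^esub> m') = f m \<oplus>\<^bsub>N\<^esub> f m'"
    "\<And>a m. a \<in> carrier A \<Longrightarrow> m \<in> carrier M \<Longrightarrow> f (a \<odot>\<^bsub>M\<^esub> m) = a \<odot>\<^bsub>N\<^esub> f m"
    "f \<zero>\<^bsub>M\<^esub> = \<zero>\<^bsub>N\<^esub>" "module A M" "module A N"
proof -
  interpret mod_hom A M N f by fact
  show "\<And>m. m \<in> carrier M \<Longrightarrow> f m \<in> carrier N"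
    "\<And>m m'. m \<in> carrier M \<Longrightarrow> m' \<in> carrier M \<Longrightarrow> f (m \<oplus>\<^bsub>M\<^esub> m') = f m \<oplus>\<^bsub>N\<^esub> f m'"
    "\<And>a m. a \<in> carrier A \<Longrightarrow> m \<in> carrier M \<Longrightarrow> f (a \<odot>\<^bsub>M\<^esub> m) = a \<odot>\<^bsub>N\<^esub> f m"
    "f \<zero>\<^bsub>M\<^esub> = \<zero>\<^bsub>N\<^esub>" "module A M" "module A N"
    by (auto simp: f_add f_smult intro: M.module_axioms N.module_axioms)
qed

lemma mod_hom_finsum:
  assumes f: "mod_hom A M N f" and g: "\<And>i. i \<in> S \<Longrightarrow> g i \<in> carrier M"
  shows "f (\<Oplus>\<^bsub>M\<^esub>i\<in>S. g i) = (\<Oplus>\<^bsub>N\<^esub>i\<in>S. f (g i))"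
proof -
  interpret f: mod_hom A M N f by fact
  show ?thesis
  proof (cases "finite S")
    case True
    then show ?thesis using g
    proof (induction S)
      case empty then show ?case by simp
    next
      case (insert x S)
      then have "g \<in> S \<rightarrow> carrier M" "g x \<in> carrier M" "(\<lambda>i. f (g i)) \<in> S \<rightarrow> carrier N" "f (g x) \<in> carrier N"
        by auto
      then show ?case using insert by (simp add: f.f_add f.M.M.finsum_closed)
    qed
  qed (simp add: f.M.M.finsum_infinite f.N.M.finsum_infinite)
qed

section \<open>Free modules\<close>

lemma free_module_simps [simp]:
  "zero (free_module A Y) = (\<lambda>x. \<zero>\<^bsub>A\<^esub>)"
  "add (free_module A Y) = (\<lambda>f g x. f x \<oplus>\<^bsub>A\<^esub> g x)"
  "smult (free_module A Y) = (\<lambda>a f x. a \<otimes>\<^bsub>A\<^esub> f x)"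
  by (simp_all add: free_module_def)

lemma free_module_carrier:
  "f \<in> carrier (free_module A Y) \<longleftrightarrow>
    (\<forall>x. f x \<in> carrier A) \<and> (\<forall>x. x \<notin> Y \<longrightarrow> f x = \<zero>\<^bsub>A\<^esub>) \<and> finite {x. f x \<noteq> \<zero>\<^bsub>A\<^esub>}"
  by (simp add: free_module_def)

lemma module_free_module:
  fixes A (structure) shows "cring A \<Longrightarrow> module A (free_module A Y)"
proof -
  assume "cring A"
  then interpret cring A .
  show ?thesis
  proof (rule module_criteria)
    show "\<forall>v w. v \<in> carrier (free_module A Y) \<and> w \<in> carrier (free_module A Y) \<longrightarrow>
        v \<oplus>\<^bsub>free_module A Y\<^esub> w \<in> carrier (free_module A Y)"
    proof (intro allI impI, elim conjE)
      fix v w assume v: "v \<in> carrier (free_module A Y)" and w: "w \<in> carrier (free_module A Y)"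
      have "finite {x. v x \<oplus> w x \<noteq> \<zero>}"
        by (rule finite_subset[of _ "{x. v x \<noteq> \<zero>} \<union> {x. w x \<noteq> \<zero>}"]) (use v w in \<open>auto simp: free_module_carrier\<close>)
      then show "v \<oplus>\<^bsub>free_module A Y\<^esub> w \<in> carrier (free_module A Y)"
        using v w by (auto simp: free_module_carrier)
    qed
    show "\<forall>v\<in>carrier (free_module A Y). \<exists>u\<in>carrier (free_module A Y). v \<oplus>\<^bsub>free_module A Y\<^esub> u = \<zero>\<^bsub>free_module A Y\<^esub>"
    proof
      fix v assume v: "v \<in> carrier (free_module A Y)"
      have "finite {x. \<ominus> v x \<noteq> \<zero>}"
        by (rule finite_subset[of _ "{x. v x \<noteq> \<zero>}"]) (use v in \<open>auto simp: free_module_carrier\<close>)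
      then have "(\<lambda>x. \<ominus> v x) \<in> carrier (free_module A Y)" using v by (auto simp: free_module_carrier)
      moreover have "v \<oplus>\<^bsub>free_module A Y\<^esub> (\<lambda>x. \<ominus> v x) = \<zero>\<^bsub>free_module A Y\<^esub>"
        using v by (auto simp: free_module_carrier r_neg)
      ultimately show "\<exists>u\<in>carrier (free_module A Y). v \<oplus>\<^bsub>free_module A Y\<^esub> u = \<zero>\<^bsub>free_module A Y\<^esub>" by blast
    qed
    show "\<forall>c v. c \<in> carrier A \<and> v \<in> carrier (free_module A Y) \<longrightarrow> c \<odot>\<^bsub>free_module A Y\<^esub> v \<in> carrier (free_module A Y)"
    proof (intro allI impI, elim conjE)
      fix c v assume c: "c \<in> carrier A" and v: "v \<in> carrier (free_module A Y)"
      have "finite {x. c \<otimes> v x \<noteq> \<zero>}"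
        by (rule finite_subset[of _ "{x. v x \<noteq> \<zero>}"]) (use v c in \<open>auto simp: free_module_carrier\<close>)
      then show "c \<odot>\<^bsub>free_module A Y\<^esub> v \<in> carrier (free_module A Y)"
        using v c by (auto simp: free_module_carrier)
    qed
  qed (auto simp: cring_axioms free_module_carrier a_ac m_ac l_distr r_distr)
qed

lemma free_gen_closed:
  fixes A (structure) shows "cring A \<Longrightarrow> x \<in> Y \<Longrightarrow> free_gen A x \<in> carrier (free_module A Y)"
proof -
  assume "cring A" "x \<in> Y"
  then interpret cring A by simp
  have "finite {y. free_gen A x y \<noteq> \<zero>}"
    by (rule finite_subset[of _ "{x}"]) (auto simp: free_gen_def)
  then show ?thesis using \<open>x \<in> Y\<close> by (auto simp: free_module_carrier free_gen_def)
qed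

definition lin_ext :: "('a, 'z) ring_scheme \<Rightarrow> ('a, 'm, 'w) module_scheme \<Rightarrow> ('x \<Rightarrow> 'm) \<Rightarrow> ('x \<Rightarrow> 'a) \<Rightarrow> 'm" where
  "lin_ext A N g f = (\<Oplus>\<^bsub>N\<^esub>x\<in>{x. f x \<noteq> \<zero>\<^bsub>A\<^esub>}. f x \<odot>\<^bsub>N\<^esub> g x)"

context
  fixes A :: "('a, 'z) ring_scheme" and N :: "('a, 'm, 'w) module_scheme" and Y :: "'x set" and g :: "'x \<Rightarrow> 'm"
  assumes N: "module A N" and g: "\<And>x. x \<in> Y \<Longrightarrow> g x \<in> carrier N"
begin

interpretation N: module A N by (rule N)

lemma lin_ext_superset:
  assumes f: "f \<in> carrier (free_module A Y)" and B: "finite B" "{x. f x \<noteq> \<zero>\<^bsub>A\<^esub>} \<subseteq> B" "B \<subseteq> Y"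
  shows "lin_ext A N g f = (\<Oplus>\<^bsub>N\<^esub>x\<in>B. f x \<odot>\<^bsub>N\<^esub> g x)"
  unfolding lin_ext_def
  by (rule N.M.add.finprod_mono_neutral_cong_left) (use f B g in \<open>auto simp: free_module_carrier\<close>)

lemma lin_ext_mod_hom: "mod_hom A (free_module A Y) N (lin_ext A N g)"
proof (rule mod_homI)
  show "module A (free_module A Y)" by (rule module_free_module[OF N.R.cring_axioms])
  show "module A N" by (rule N)
  fix f assume f: "f \<in> carrier (free_module A Y)"
  have sf: "finite {x. f x \<noteq> \<zero>\<^bsub>A\<^esub>}" "{x. f x \<noteq> \<zero>\<^bsub>A\<^esub>} \<subseteq> Y" "\<And>x. f x \<in> carrier A"
    using f by (auto simp: free_module_carrier)
  show "lin_ext A N g f \<in> carrier N"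
    unfolding lin_ext_def using sf g by (intro N.M.finsum_closed) auto
  interpret F: module A "free_module A Y" by (rule module_free_module[OF N.R.cring_axioms])
  {
    fix f' assume f': "f' \<in> carrier (free_module A Y)"
    have sf': "finite {x. f' x \<noteq> \<zero>\<^bsub>A\<^esub>}" "{x. f' x \<noteq> \<zero>\<^bsub>A\<^esub>} \<subseteq> Y" "\<And>x. f' x \<in> carrier A"
      using f' by (auto simp: free_module_carrier)
    let ?B = "{x. f x \<noteq> \<zero>\<^bsub>A\<^esub>} \<union> {x. f' x \<noteq> \<zero>\<^bsub>A\<^esub>}"
    have B: "finite ?B" "?B \<subseteq> Y" using sf sf' by auto
    have "lin_ext A N g (f \<oplus>\<^bsub>free_module A Y\<^esub> f') = (\<Oplus>\<^bsub>N\<^esub>x\<in>?B. (f x \<oplus>\<^bsub>A\<^esub> f' x) \<odot>\<^bsub>N\<^esub> g x)"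
      by (subst lin_ext_superset[OF F.M.a_closed[OF f f'] B(1) _ B(2)]) auto
    also have "\<dots> = (\<Oplus>\<^bsub>N\<^esub>x\<in>?B. f x \<odot>\<^bsub>N\<^esub> g x \<oplus>\<^bsub>N\<^esub> f' x \<odot>\<^bsub>N\<^esub> g x)"
      by (intro N.M.finsum_cong') (use sf sf' g B in \<open>auto simp: N.smult_l_distr\<close>)
    also have "\<dots> = (\<Oplus>\<^bsub>N\<^esub>x\<in>?B. f x \<odot>\<^bsub>N\<^esub> g x) \<oplus>\<^bsub>N\<^esub> (\<Oplus>\<^bsub>N\<^esub>x\<in>?B. f' x \<odot>\<^bsub>N\<^esub> g x)"
      by (intro N.M.finsum_addf) (use sf sf' g B in auto)
    also have "\<dots> = lin_ext A N g f \<oplus>\<^bsub>N\<^esub> lin_ext A N g f'"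
      using lin_ext_superset[OF f B(1) _ B(2)] lin_ext_superset[OF f' B(1) _ B(2)] by auto
    finally show "lin_ext A N g (f \<oplus>\<^bsub>free_module A Y\<^esub> f') = lin_ext A N g f \<oplus>\<^bsub>N\<^esub> lin_ext A N g f'" .
  }
  {
    fix a assume a: "a \<in> carrier A"
    have "lin_ext A N g (a \<odot>\<^bsub>free_module A Y\<^esub> f) = (\<Oplus>\<^bsub>N\<^esub>x\<in>{x. f x \<noteq> \<zero>\<^bsub>A\<^esub>}. (a \<otimes>\<^bsub>A\<^esub> f x) \<odot>\<^bsub>N\<^esub> g x)"
      by (subst lin_ext_superset[OF F.smult_closed[OF a f] sf(1) _ sf(2)]) (use a in auto)
    also have "\<dots> = (\<Oplus>\<^bsub>N\<^esub>x\<in>{x. f x \<noteq> \<zero>\<^bsub>A\<^esub>}. a \<odot>\<^bsub>N\<^esub> (f x \<odot>\<^bsub>N\<^esub> g x))"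
      by (intro N.M.finsum_cong') (use sf g a in \<open>auto simp: N.smult_assoc1\<close>)
    also have "\<dots> = a \<odot>\<^bsub>N\<^esub> lin_ext A N g f"
      unfolding lin_ext_def by (rule N.finsum_smult_ldistr[symmetric]) (use sf g a in auto)
    finally show "lin_ext A N g (a \<odot>\<^bsub>free_module A Y\<^esub> f) = a \<odot>\<^bsub>N\<^esub> lin_ext A N g f" .
  }
qed

lemma lin_ext_free_gen: "x \<in> Y \<Longrightarrow> lin_ext A N g (free_gen A x) = g x"
proof -
  assume x: "x \<in> Y"
  have "lin_ext A N g (free_gen A x) = (\<Oplus>\<^bsub>N\<^esub>y\<in>{x}. free_gen A x y \<odot>\<^bsub>N\<^esub> g y)"
    by (rule lin_ext_superset[OF free_gen_closed[OF N.R.cring_axioms x]]) (use x in \<open>auto simp: free_gen_def\<close>)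
  then show ?thesis using g[OF x] by (simp add: free_gen_def)
qed

end

lemma free_module_induct [consumes 2, case_names zero gen]:
  fixes A (structure)
  assumes A: "cring A" and f: "f \<in> carrier (free_module A Y)"
    and zero: "P \<zero>\<^bsub>free_module A Y\<^esub>"
    and step: "\<And>a x f. a \<in> carrier A \<Longrightarrow> x \<in> Y \<Longrightarrow> f \<in> carrier (free_module A Y) \<Longrightarrow> P f \<Longrightarrow>
      P (a \<odot>\<^bsub>free_module A Y\<^esub> free_gen A x \<oplus>\<^bsub>free_module A Y\<^esub> f)"
  shows "P f"
proof -
  interpret cring A by fact
  have "finite B \<Longrightarrow> f \<in> carrier (free_module A Y) \<Longrightarrow> {x. f x \<noteq> \<zero>} \<subseteq> B \<Longrightarrow> B \<subseteq> Y \<Longrightarrow> P f" for B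
  proof (induction B arbitrary: f rule: finite_induct)
    case empty
    then have "f = (\<lambda>x. \<zero>)" by auto
    then show ?case using zero by simp
  next
    case (insert b B)
    define f' where "f' = f(b := \<zero>)"
    have "finite {x. f' x \<noteq> \<zero>}" by (rule finite_subset[OF _ insert.hyps(1)]) (use insert.prems in \<open>auto simp: f'_def\<close>)
    then have f': "f' \<in> carrier (free_module A Y)"
      using insert.prems by (auto simp: free_module_carrier f'_def)
    have "f = f b \<odot>\<^bsub>free_module A Y\<^esub> free_gen A b \<oplus>\<^bsub>free_module A Y\<^esub> f'"
      using insert.prems by (auto simp: f'_def free_gen_def free_module_carrier)
    moreover have "P f'" by (rule insert.IH[OF f']) (use insert.prems in \<open>auto simp: f'_def\<close>)
    ultimately show ?case using step[of "f b" b f'] f' insert.prems by (auto simp: free_module_carrier)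
  qed
  then show ?thesis using f by (auto simp: free_module_carrier)
qed

section \<open>Generated submodules and quotients\<close>

lemma submodule_gen_submodule:
  assumes M: "module A M" and G: "G \<subseteq> carrier M"
  shows "submodule A (gen_submodule A M G) M" and "G \<subseteq> gen_submodule A M G"
proof -
  interpret module A M by fact
  have top: "submodule A (carrier M) M" by (rule submodule.intro) (auto simp: M)
  show "submodule A (gen_submodule A M G) M"
  proof (rule submodule.intro)
    show "gen_submodule A M G \<subseteq> carrier M" unfolding gen_submodule_def using top G by blast
  qed (auto simp: M gen_submodule_def submodule.m_closed submodule.zero_closed submodule.smult_closed)
  show "G \<subseteq> gen_submodule A M G" unfolding gen_submodule_def by blast
qed

lemma gen_submodule_ker:
  assumes f: "mod_hom A M N f" and G: "\<And>x. x \<in> G \<Longrightarrow> x \<in> carrier M \<and> f x = \<zero>\<^bsub>N\<^esub>"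
    and x: "x \<in> gen_submodule A M G"
  shows "f x = \<zero>\<^bsub>N\<^esub>"
proof -
  interpret mod_hom A M N f by fact
  have "G \<subseteq> ker" using G by (auto simp: ker_def)
  then have "gen_submodule A M G \<subseteq> ker" unfolding gen_submodule_def using ker_is_submodule by blast
  then show ?thesis using x by (auto simp: ker_def)
qed

locale quotient_module = module A M for A :: "('a, 'z) ring_scheme" and M :: "('a, 'm, 'w) module_scheme" (structure) +
  fixes N assumes sub: "submodule A N M"
begin

lemma N_subgroup: "additive_subgroup N M"
proof (rule additive_subgroup.intro, rule subgroup.intro)
  interpret N: submodule A N M by (rule sub)
  show "N \<subseteq> carrier (add_monoid M)" using N.subset by simp
  show "inv\<^bsub>add_monoid M\<^esub> x \<in> N" if "x \<in> N" for x
  proof -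
    have "x \<in> carrier M" using that N.subset by blast
    then have "(\<ominus>\<^bsub>A\<^esub> \<one>\<^bsub>A\<^esub>) \<odot> x = \<ominus> x" by (simp add: smult_l_minus)
    then show ?thesis using N.smult_closed[OF R.a_inv_closed[OF R.one_closed] that] by (simp add: a_inv_def)
  qed
qed (use sub in \<open>auto simp: submodule.m_closed submodule.zero_closed\<close>)

sublocale N: abelian_subgroup N M
  by (rule abelian_subgroupI3[OF N_subgroup M.abelian_group_axioms])

lemma coset_self: "x \<in> carrier M \<Longrightarrow> x \<in> N +> x"
  by (auto simp: a_r_coset_def' intro!: bexI[of _ \<zero>] N.zero_closed)

lemma coset_eq_iff:
  assumes x: "x \<in> carrier M" and y: "y \<in> carrier M" shows "N +> x = N +> y \<longleftrightarrow> x \<ominus> y \<in> N"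
proof
  assume "N +> x = N +> y"
  then have "x \<in> N +> y" using coset_self[OF x] by simp
  then obtain m where m: "m \<in> N" "x = m \<oplus> y" by (auto simp: a_r_coset_def')
  moreover have "m \<in> carrier M" using m N.a_subset by blast
  ultimately show "x \<ominus> y \<in> N" using y by (simp add: M.minus_eq M.a_assoc M.r_neg)
next
  assume n: "x \<ominus> y \<in> N"
  have "x = (x \<ominus> y) \<oplus> y" using x y by (simp add: M.minus_eq M.a_assoc M.l_neg)
  then have "x \<in> N +> y" using n by (auto simp: a_r_coset_def')
  then show "N +> x = N +> y" using M.a_repr_independence[OF _ y N.a_subgroup] by simp
qed

abbreviation "Q \<equiv> quot_module M N"

lemma quot_carrier: "carrier Q = (\<lambda>x. N +> x) ` carrier M"
  by (auto simp: quot_module_def A_RCOSETS_def')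

lemma quot_zero: "\<zero>\<^bsub>Q\<^esub> = N +> \<zero>"
  using M.a_coset_add_zero[OF N.a_subset] by (simp add: quot_module_def)

lemma quot_add: "x \<in> carrier M \<Longrightarrow> y \<in> carrier M \<Longrightarrow> (N +> x) \<oplus>\<^bsub>Q\<^esub> (N +> y) = N +> (x \<oplus> y)"
  by (simp add: quot_module_def N.a_rcos_sum)

lemma quot_smult:
  assumes a: "a \<in> carrier A" and x: "x \<in> carrier M" shows "a \<odot>\<^bsub>Q\<^esub> (N +> x) = N +> (a \<odot> x)"
proof -
  have "N +> (a \<odot> y) = N +> (a \<odot> x)" if y: "y \<in> N +> x" for y
  proof -
    obtain m where m: "m \<in> N" "y = m \<oplus> x" using y by (auto simp: a_r_coset_def')
    have mM: "m \<in> carrier M" using m N.a_subset by blast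
    have "a \<odot> y \<ominus> a \<odot> x = a \<odot> m"
      using m(2) mM a x by (simp add: smult_r_distr M.minus_eq M.a_assoc M.r_neg)
    then show ?thesis using submodule.smult_closed[OF sub a m(1)] m(2) mM a x
      by (subst coset_eq_iff) auto
  qed
  then have "(\<Union>y\<in>N +> x. N +> (a \<odot> y)) = (\<Union>y\<in>N +> x. N +> (a \<odot> x))" by (intro SUP_cong refl)
  also have "\<dots> = N +> (a \<odot> x)" using coset_self[OF x] by blast
  finally show ?thesis by (simp add: quot_module_def)
qed

lemma quot_mod_hom: "mod_hom A M Q (\<lambda>x. N +> x)" and quot_module: "module A Q"
proof -
  show m: "module A Q"
  proof (rule module_criteria)
    show "\<forall>v\<in>carrier Q. \<exists>u\<in>carrier Q. v \<oplus>\<^bsub>Q\<^esub> u = \<zero>\<^bsub>Q\<^esub>"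
    proof
      fix v assume "v \<in> carrier Q"
      then obtain x where x: "x \<in> carrier M" "v = N +> x" by (auto simp: quot_carrier)
      then have "v \<oplus>\<^bsub>Q\<^esub> (N +> (\<ominus> x)) = \<zero>\<^bsub>Q\<^esub>" by (simp add: quot_add quot_zero M.r_neg)
      then show "\<exists>u\<in>carrier Q. v \<oplus>\<^bsub>Q\<^esub> u = \<zero>\<^bsub>Q\<^esub>" using x by (auto simp: quot_carrier)
    qed
  next
    show "\<forall>v w. v \<in> carrier Q \<and> w \<in> carrier Q \<longrightarrow> v \<oplus>\<^bsub>Q\<^esub> w = w \<oplus>\<^bsub>Q\<^esub> v"
      by (auto simp: quot_carrier quot_add M.a_comm)
    show "\<forall>v w x. v \<in> carrier Q \<and> w \<in> carrier Q \<and> x \<in> carrier Q \<longrightarrow> v \<oplus>\<^bsub>Q\<^esub> w \<oplus>\<^bsub>Q\<^esub> x = v \<oplus>\<^bsub>Q\<^esub> (w \<oplus>\<^bsub>Q\<^esub> x)"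
      by (auto simp: quot_carrier quot_add M.a_assoc)
    show "cring A" by (rule R.cring_axioms)
    show "\<zero>\<^bsub>Q\<^esub> \<in> carrier Q" unfolding quot_zero quot_carrier by blast
    show "\<forall>v w. v \<in> carrier Q \<and> w \<in> carrier Q \<longrightarrow> v \<oplus>\<^bsub>Q\<^esub> w \<in> carrier Q"
      by (auto simp: quot_carrier quot_add)
    show "\<forall>c v. c \<in> carrier A \<and> v \<in> carrier Q \<longrightarrow> c \<odot>\<^bsub>Q\<^esub> v \<in> carrier Q"
      by (auto simp: quot_carrier quot_smult)
    show "\<forall>v\<in>carrier Q. v \<oplus>\<^bsub>Q\<^esub> \<zero>\<^bsub>Q\<^esub> = v"
      unfolding quot_zero quot_carrier by (auto simp: quot_add simp del: M.a_coset_add_zero)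
    show "\<forall>a b v. a \<in> carrier A \<and> b \<in> carrier A \<and> v \<in> carrier Q \<longrightarrow> (a \<otimes>\<^bsub>A\<^esub> b) \<odot>\<^bsub>Q\<^esub> v = a \<odot>\<^bsub>Q\<^esub> (b \<odot>\<^bsub>Q\<^esub> v)"
      by (auto simp: quot_carrier quot_smult smult_assoc1)
    show "\<forall>v\<in>carrier Q. \<one>\<^bsub>A\<^esub> \<odot>\<^bsub>Q\<^esub> v = v" by (auto simp: quot_carrier quot_smult)
    show "\<forall>a b v. a \<in> carrier A \<and> b \<in> carrier A \<and> v \<in> carrier Q \<longrightarrow> (a \<oplus>\<^bsub>A\<^esub> b) \<odot>\<^bsub>Q\<^esub> v = a \<odot>\<^bsub>Q\<^esub> v \<oplus>\<^bsub>Q\<^esub> b \<odot>\<^bsub>Q\<^esub> v"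
      by (auto simp: quot_carrier quot_smult quot_add smult_l_distr)
    show "\<forall>a v w. a \<in> carrier A \<and> v \<in> carrier Q \<and> w \<in> carrier Q \<longrightarrow> a \<odot>\<^bsub>Q\<^esub> (v \<oplus>\<^bsub>Q\<^esub> w) = a \<odot>\<^bsub>Q\<^esub> v \<oplus>\<^bsub>Q\<^esub> a \<odot>\<^bsub>Q\<^esub> w"
      by (auto simp: quot_carrier quot_smult quot_add smult_r_distr)
  qed
  show "mod_hom A M Q (\<lambda>x. N +> x)"
    by (rule mod_homI[OF module_axioms m]) (simp_all add: quot_carrier quot_add quot_smult)
qed

end

text \<open>Universal property of the quotient. The factor map evaluates \<open>f\<close> at a
  chosen representative of the coset, and vanishing on \<open>N\<close> makes the choice
  immaterial.\<close>

lemma quot_module_factor: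
  fixes M (structure)
  assumes f: "mod_hom A M L f" and N: "submodule A N M" and ker: "\<And>x. x \<in> N \<Longrightarrow> f x = \<zero>\<^bsub>L\<^esub>"
  shows "\<exists>g. mod_hom A (quot_module M N) L g \<and> (\<forall>x\<in>carrier M. g (N +>\<^bsub>M\<^esub> x) = f x)"
proof -
  note f' = mod_homD[OF f]
  interpret L: module A L by (rule f'(6))
  interpret quotient_module A M N using f'(5) N by (simp add: quotient_module_def quotient_module_axioms_def)
  define s where "s C = (SOME x. x \<in> C \<and> x \<in> carrier M)" for C
  define g where "g C = f (s C)" for C
  have g: "g (N +> x) = f x" if x: "x \<in> carrier M" for x
  proof -
    have "s (N +> x) \<in> N +> x \<and> s (N +> x) \<in> carrier M"
      unfolding s_def by (rule someI[of _ x]) (intro conjI coset_self x)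
    then have "s (N +> x) \<in> N +> x" ..
    then obtain m where m: "m \<in> N" "s (N +> x) = m \<oplus> x" unfolding a_r_coset_def' by blast
    have "m \<in> carrier M" using m(1) N.a_subset by blast
    then have "f (m \<oplus> x) = f m \<oplus>\<^bsub>L\<^esub> f x" using x by (rule f'(2))
    also have "\<dots> = f x" unfolding ker[OF m(1)] by (rule L.M.l_zero) (rule f'(1)[OF x])
    finally show ?thesis unfolding g_def m(2) .
  qed
  have "mod_hom A Q L g"
  proof (rule mod_homI)
    show "module A Q" by (rule quot_module)
    show "module A L" by (rule f'(6))
  next
    fix u assume "u \<in> carrier Q"
    then obtain x where x: "x \<in> carrier M" "u = N +> x" unfolding quot_carrier by blast
    show "g u \<in> carrier L" unfolding x(2) g[OF x(1)] by (rule f'(1)[OF x(1)])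
    show "g (a \<odot>\<^bsub>Q\<^esub> u) = a \<odot>\<^bsub>L\<^esub> g u" if a: "a \<in> carrier A" for a
      unfolding x(2) quot_smult[OF a x(1)] g[OF x(1)] g[OF smult_closed[OF a x(1)]] by (rule f'(3)[OF a x(1)])
    fix v assume "v \<in> carrier Q"
    then obtain y where y: "y \<in> carrier M" "v = N +> y" unfolding quot_carrier by blast
    show "g (u \<oplus>\<^bsub>Q\<^esub> v) = g u \<oplus>\<^bsub>L\<^esub> g v"
      unfolding x(2) y(2) quot_add[OF x(1) y(1)] g[OF x(1)] g[OF y(1)] g[OF M.a_closed[OF x(1) y(1)]]
      by (rule f'(2)[OF x(1) y(1)])
  qed
  then show ?thesis using g by blast
qed

section \<open>Kaehler differentials\<close>

locale kaehler_diff =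
  fixes K :: "('k, 'v) ring_scheme" and A :: "('a, 'z) ring_scheme" (structure) and \<phi> :: "'k \<Rightarrow> 'a"
  assumes A_cring: "cring A" and K_cring: "cring K" and \<phi>_hom: "\<phi> \<in> Ring.ring_hom K A"
begin

abbreviation "F \<equiv> free_module A (carrier A)"
abbreviation "\<Omega> \<equiv> kaehler K A \<phi>"
abbreviation "d \<equiv> kaehler_d K A \<phi>"
abbreviation "e \<equiv> free_gen A"

sublocale A: cring A by (rule A_cring)
sublocale F: module A F by (rule module_free_module[OF A_cring])

lemma e_closed: "a \<in> carrier A \<Longrightarrow> e a \<in> carrier F"
  by (rule free_gen_closed[OF A_cring])

lemma phi_closed: "c \<in> carrier K \<Longrightarrow> \<phi> c \<in> carrier A"
  by (rule Ring.ring_hom_closed[OF \<phi>_hom])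

lemma rels_closed: "kaehler_rels K A \<phi> \<subseteq> carrier F"
  unfolding kaehler_rels_def Let_def
  by (auto intro!: F.M.minus_closed F.M.a_closed F.smult_closed e_closed phi_closed simp del: free_module_simps)

sublocale quotient_module A F "kaehler_kernel K A \<phi>"
  unfolding quotient_module_def quotient_module_axioms_def kaehler_kernel_def
  by (intro conjI F.module_axioms submodule_gen_submodule[OF _ rels_closed])

lemma rels_kernel: "r \<in> kaehler_rels K A \<phi> \<Longrightarrow> r \<in> kaehler_kernel K A \<phi>"
  unfolding kaehler_kernel_def using submodule_gen_submodule(2)[OF F.module_axioms rels_closed] by blast

lemma omega_eq: "\<Omega> = Q" by (simp add: kaehler_def)

lemma omega_module: "module A \<Omega>" unfolding omega_eq by (rule quot_module)

sublocale \<Omega>: module A \<Omega> by (rule omega_module)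

lemma d_eq: "d a = kaehler_kernel K A \<phi> +>\<^bsub>F\<^esub> e a" by (simp add: kaehler_d_def)

lemma d_closed [simp, intro]: "a \<in> carrier A \<Longrightarrow> d a \<in> carrier \<Omega>"
  unfolding d_eq omega_eq quot_carrier using e_closed by blast

lemma d_add: "a \<in> carrier A \<Longrightarrow> b \<in> carrier A \<Longrightarrow> d (a \<oplus> b) = d a \<oplus>\<^bsub>\<Omega>\<^esub> d b"
proof -
  assume a: "a \<in> carrier A" and b: "b \<in> carrier A"
  have "e (a \<oplus> b) \<ominus>\<^bsub>F\<^esub> (e a \<oplus>\<^bsub>F\<^esub> e b) \<in> kaehler_kernel K A \<phi>"
    by (rule rels_kernel) (use a b in \<open>auto simp: kaehler_rels_def Let_def simp del: free_module_simps\<close>)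
  then have "d (a \<oplus> b) = kaehler_kernel K A \<phi> +>\<^bsub>F\<^esub> (e a \<oplus>\<^bsub>F\<^esub> e b)"
    unfolding d_eq using a b e_closed by (subst coset_eq_iff) (auto simp del: free_module_simps intro: F.M.a_closed)
  then show ?thesis unfolding d_eq omega_eq using a b by (simp add: quot_add e_closed del: free_module_simps)
qed

lemma d_mult: "a \<in> carrier A \<Longrightarrow> b \<in> carrier A \<Longrightarrow> d (a \<otimes> b) = a \<odot>\<^bsub>\<Omega>\<^esub> d b \<oplus>\<^bsub>\<Omega>\<^esub> b \<odot>\<^bsub>\<Omega>\<^esub> d a"
proof -
  assume a: "a \<in> carrier A" and b: "b \<in> carrier A"
  have "e (a \<otimes> b) \<ominus>\<^bsub>F\<^esub> (a \<odot>\<^bsub>F\<^esub> e b \<oplus>\<^bsub>F\<^esub> b \<odot>\<^bsub>F\<^esub> e a) \<in> kaehler_kernel K A \<phi>"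
    by (rule rels_kernel) (use a b in \<open>auto simp: kaehler_rels_def Let_def simp del: free_module_simps\<close>)
  then have "d (a \<otimes> b) = kaehler_kernel K A \<phi> +>\<^bsub>F\<^esub> (a \<odot>\<^bsub>F\<^esub> e b \<oplus>\<^bsub>F\<^esub> b \<odot>\<^bsub>F\<^esub> e a)"
    unfolding d_eq using a b e_closed
    by (subst coset_eq_iff) (auto simp del: free_module_simps intro!: F.M.a_closed F.smult_closed)
  then show ?thesis unfolding d_eq omega_eq using a b
    by (simp add: quot_add quot_smult e_closed F.smult_closed del: free_module_simps)
qed

lemma d_const: "c \<in> carrier K \<Longrightarrow> d (\<phi> c) = \<zero>\<^bsub>\<Omega>\<^esub>"
proof -
  assume c: "c \<in> carrier K"
  have 1: "e (\<phi> c) \<in> kaehler_kernel K A \<phi>"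
    by (rule rels_kernel) (use c in \<open>auto simp: kaehler_rels_def Let_def\<close>)
  have "e (\<phi> c) \<ominus>\<^bsub>F\<^esub> \<zero>\<^bsub>F\<^esub> = e (\<phi> c)"
    using e_closed[OF phi_closed[OF c]] by (simp add: F.M.minus_eq del: free_module_simps)
  then show ?thesis
    unfolding d_eq omega_eq quot_zero using 1 e_closed[OF phi_closed[OF c]] coset_eq_iff[of "e (\<phi> c)" "\<zero>\<^bsub>F\<^esub>"]
    by (simp del: free_module_simps F.M.a_coset_add_zero)
qed

text \<open>Every differential is a finite sum of terms \<open>a db\<close>.\<close>

lemma omega_induct [consumes 1, case_names zero gen]:
  assumes w: "w \<in> carrier \<Omega>" and zero: "P \<zero>\<^bsub>\<Omega>\<^esub>"
    and gen: "\<And>a b w. a \<in> carrier A \<Longrightarrow> b \<in> carrier A \<Longrightarrow> w \<in> carrier \<Omega> \<Longrightarrow> P w \<Longrightarrow> P (a \<odot>\<^bsub>\<Omega>\<^esub> d b \<oplus>\<^bsub>\<Omega>\<^esub> w)"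
  shows "P w"
proof -
  let ?\<pi> = "\<lambda>x. kaehler_kernel K A \<phi> +>\<^bsub>F\<^esub> x"
  obtain f where f: "f \<in> carrier F" "w = ?\<pi> f" using w unfolding omega_eq quot_carrier by blast
  have "P (?\<pi> f)" using A_cring f(1)
  proof (induction rule: free_module_induct)
    case zero then show ?case using assms(2) unfolding omega_eq quot_zero by simp
  next
    case (gen a x f)
    have "?\<pi> f \<in> carrier \<Omega>" unfolding omega_eq quot_carrier using gen(3) by blast
    from assms(3)[OF gen(1,2) this gen(4)]
    show ?case using gen(1-3) unfolding d_eq omega_eq
      by (simp add: quot_add quot_smult e_closed F.smult_closed del: free_module_simps)
  qed
  then show ?thesis using f by simp
qed

text \<open>Universal property of differentials; together with \<open>Dm\<close>, condition
  \<open>Dc\<close> makes \<open>D\<close> linear over \<open>K\<close>. Both \<Phi> and \<iota>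
  below are obtained from it.\<close>

lemma omega_universal:
  assumes L: "module A L" and D: "\<And>a. a \<in> carrier A \<Longrightarrow> D a \<in> carrier L"
    and Da: "\<And>a b. a \<in> carrier A \<Longrightarrow> b \<in> carrier A \<Longrightarrow> D (a \<oplus> b) = D a \<oplus>\<^bsub>L\<^esub> D b"
    and Dm: "\<And>a b. a \<in> carrier A \<Longrightarrow> b \<in> carrier A \<Longrightarrow> D (a \<otimes> b) = a \<odot>\<^bsub>L\<^esub> D b \<oplus>\<^bsub>L\<^esub> b \<odot>\<^bsub>L\<^esub> D a"
    and Dc: "\<And>c. c \<in> carrier K \<Longrightarrow> D (\<phi> c) = \<zero>\<^bsub>L\<^esub>"
  obtains g where "mod_hom A \<Omega> L g" "\<And>a. a \<in> carrier A \<Longrightarrow> g (d a) = D a"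
proof -
  interpret L: module A L by (rule L)
  have hom: "mod_hom A F L (lin_ext A L D)" by (rule lin_ext_mod_hom[OF L D])
  interpret hom: mod_hom A F L "lin_ext A L D" by (rule hom)
  have De: "lin_ext A L D (e a) = D a" if "a \<in> carrier A" for a
    by (rule lin_ext_free_gen[OF L D that])
  have "lin_ext A L D r = \<zero>\<^bsub>L\<^esub>" if r: "r \<in> kaehler_kernel K A \<phi>" for r
  proof (rule gen_submodule_ker[OF hom _ r[unfolded kaehler_kernel_def]])
    fix r assume r: "r \<in> kaehler_rels K A \<phi>"
    then have "lin_ext A L D r = \<zero>\<^bsub>L\<^esub>"
      unfolding kaehler_rels_def Let_def
      by (auto simp: De Da Dm Dc D phi_closed e_closed F.smult_closed L.M.r_neg L.M.minus_eq hom.f_minus hom.f_add hom.f_smult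
          F.M.a_closed simp del: free_module_simps)
    then show "r \<in> carrier F \<and> lin_ext A L D r = \<zero>\<^bsub>L\<^esub>" using r rels_closed by blast
  qed
  then obtain g where "mod_hom A Q L g" "\<forall>x\<in>carrier F. g (kaehler_kernel K A \<phi> +>\<^bsub>F\<^esub> x) = lin_ext A L D x"
    using quot_module_factor[OF hom sub] by blast
  then show ?thesis using that[of g] De e_closed unfolding omega_eq d_eq by auto
qed

end

section \<open>Tensor products\<close>

locale tensor_product =
  fixes K :: "('k, 'v) ring_scheme" and M :: "('k, 'm, 'w) module_scheme" and N :: "('k, 'n, 'u) module_scheme"
  assumes M_module: "module K M" and N_module: "module K N"
begin

sublocale M: module K M by (rule M_module)
sublocale N: module K N by (rule N_module)

abbreviation "F \<equiv> free_module K (carrier M \<times> carrier N)"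
abbreviation "T \<equiv> tensor_module K M N"
abbreviation "pure \<equiv> pure_tensor K M N"
abbreviation "e \<equiv> free_gen K"

lemma K_cring: "cring K" by (rule M.R.cring_axioms)

sublocale F: module K F by (rule module_free_module[OF K_cring])

lemma e_closed: "x \<in> carrier M \<Longrightarrow> y \<in> carrier N \<Longrightarrow> e (x, y) \<in> carrier F"
  by (rule free_gen_closed[OF K_cring]) simp

lemma rels_closed: "tensor_rels K M N \<subseteq> carrier F"
  unfolding tensor_rels_def Let_def
  by (auto intro!: F.M.minus_closed F.M.a_closed F.smult_closed e_closed simp del: free_module_simps)

sublocale quotient_module K F "tensor_kernel K M N"
  unfolding quotient_module_def quotient_module_axioms_def tensor_kernel_def
  by (intro conjI F.module_axioms submodule_gen_submodule[OF _ rels_closed])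

lemma rels_kernel: "r \<in> tensor_rels K M N \<Longrightarrow> r \<in> tensor_kernel K M N"
  unfolding tensor_kernel_def using submodule_gen_submodule(2)[OF F.module_axioms rels_closed] by blast

lemma tensor_eq: "T = Q" by (simp add: tensor_module_def)

lemma tensor_is_module: "module K T" unfolding tensor_eq by (rule quot_module)

sublocale T: module K T by (rule tensor_is_module)

lemma pure_eq: "pure x y = tensor_kernel K M N +>\<^bsub>F\<^esub> e (x, y)" by (simp add: pure_tensor_def)

lemma pure_closed [simp, intro]: "x \<in> carrier M \<Longrightarrow> y \<in> carrier N \<Longrightarrow> pure x y \<in> carrier T"
  unfolding pure_eq tensor_eq quot_carrier using e_closed by blast

lemma pure_add_left:
  assumes "x \<in> carrier M" "x' \<in> carrier M" "y \<in> carrier N"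
  shows "pure (x \<oplus>\<^bsub>M\<^esub> x') y = pure x y \<oplus>\<^bsub>T\<^esub> pure x' y"
proof -
  have "e (x \<oplus>\<^bsub>M\<^esub> x', y) \<ominus>\<^bsub>F\<^esub> (e (x, y) \<oplus>\<^bsub>F\<^esub> e (x', y)) \<in> tensor_kernel K M N"
    by (rule rels_kernel) (unfold tensor_rels_def Let_def, use assms in blast)
  then have "pure (x \<oplus>\<^bsub>M\<^esub> x') y = tensor_kernel K M N +>\<^bsub>F\<^esub> (e (x, y) \<oplus>\<^bsub>F\<^esub> e (x', y))"
    unfolding pure_eq using assms e_closed
    by (subst coset_eq_iff) (auto simp del: free_module_simps intro: F.M.a_closed)
  then show ?thesis unfolding pure_eq tensor_eq using assms by (simp add: quot_add e_closed del: free_module_simps)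
qed

lemma pure_add_right:
  assumes "x \<in> carrier M" "y \<in> carrier N" "y' \<in> carrier N"
  shows "pure x (y \<oplus>\<^bsub>N\<^esub> y') = pure x y \<oplus>\<^bsub>T\<^esub> pure x y'"
proof -
  have "e (x, y \<oplus>\<^bsub>N\<^esub> y') \<ominus>\<^bsub>F\<^esub> (e (x, y) \<oplus>\<^bsub>F\<^esub> e (x, y')) \<in> tensor_kernel K M N"
    by (rule rels_kernel) (unfold tensor_rels_def Let_def, use assms in blast)
  then have "pure x (y \<oplus>\<^bsub>N\<^esub> y') = tensor_kernel K M N +>\<^bsub>F\<^esub> (e (x, y) \<oplus>\<^bsub>F\<^esub> e (x, y'))"
    unfolding pure_eq using assms e_closed
    by (subst coset_eq_iff) (auto simp del: free_module_simps intro: F.M.a_closed)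
  then show ?thesis unfolding pure_eq tensor_eq using assms by (simp add: quot_add e_closed del: free_module_simps)
qed

lemma pure_smult_left:
  assumes "a \<in> carrier K" "x \<in> carrier M" "y \<in> carrier N"
  shows "pure (a \<odot>\<^bsub>M\<^esub> x) y = a \<odot>\<^bsub>T\<^esub> pure x y"
proof -
  have "e (a \<odot>\<^bsub>M\<^esub> x, y) \<ominus>\<^bsub>F\<^esub> a \<odot>\<^bsub>F\<^esub> e (x, y) \<in> tensor_kernel K M N"
    by (rule rels_kernel) (unfold tensor_rels_def Let_def, use assms in blast)
  then have "pure (a \<odot>\<^bsub>M\<^esub> x) y = tensor_kernel K M N +>\<^bsub>F\<^esub> (a \<odot>\<^bsub>F\<^esub> e (x, y))"
    unfolding pure_eq using assms e_closed
    by (subst coset_eq_iff) (auto simp del: free_module_simps intro: F.smult_closed)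
  then show ?thesis unfolding pure_eq tensor_eq using assms by (simp add: quot_smult e_closed del: free_module_simps)
qed

lemma pure_smult_right:
  assumes "a \<in> carrier K" "x \<in> carrier M" "y \<in> carrier N"
  shows "pure x (a \<odot>\<^bsub>N\<^esub> y) = a \<odot>\<^bsub>T\<^esub> pure x y"
proof -
  have "e (x, a \<odot>\<^bsub>N\<^esub> y) \<ominus>\<^bsub>F\<^esub> a \<odot>\<^bsub>F\<^esub> e (x, y) \<in> tensor_kernel K M N"
    by (rule rels_kernel) (unfold tensor_rels_def Let_def, use assms in blast)
  then have "pure x (a \<odot>\<^bsub>N\<^esub> y) = tensor_kernel K M N +>\<^bsub>F\<^esub> (a \<odot>\<^bsub>F\<^esub> e (x, y))"
    unfolding pure_eq using assms e_closed
    by (subst coset_eq_iff) (auto simp del: free_module_simps intro: F.smult_closed)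
  then show ?thesis unfolding pure_eq tensor_eq using assms by (simp add: quot_smult e_closed del: free_module_simps)
qed

lemma tensor_induct [consumes 1, case_names zero gen]:
  assumes w: "w \<in> carrier T" and zero: "P \<zero>\<^bsub>T\<^esub>"
    and gen: "\<And>x y w. x \<in> carrier M \<Longrightarrow> y \<in> carrier N \<Longrightarrow> w \<in> carrier T \<Longrightarrow> P w \<Longrightarrow> P (pure x y \<oplus>\<^bsub>T\<^esub> w)"
  shows "P w"
proof -
  let ?\<pi> = "\<lambda>x. tensor_kernel K M N +>\<^bsub>F\<^esub> x"
  obtain f where f: "f \<in> carrier F" "w = ?\<pi> f" using w unfolding tensor_eq quot_carrier by blast
  have "P (?\<pi> f)" using K_cring f(1)
  proof (induction rule: free_module_induct)
    case zero then show ?case using assms(2) unfolding tensor_eq quot_zero by simp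
  next
    case (gen a z f)
    obtain x y where z: "z = (x, y)" "x \<in> carrier M" "y \<in> carrier N" using gen(2) by auto
    have "?\<pi> f \<in> carrier T" unfolding tensor_eq quot_carrier using gen(3) by blast
    from assms(3)[OF M.smult_closed[OF gen(1) z(2)] z(3) this gen(4)]
    show ?case unfolding pure_smult_left[OF gen(1) z(2,3)] using gen(1,3) z unfolding pure_eq tensor_eq
      by (simp add: quot_add quot_smult e_closed F.smult_closed del: free_module_simps)
  qed
  then show ?thesis using f by simp
qed

text \<open>Besides pure tensors, the conclusion records the value of \<open>g\<close> at each coset
  representative, because scalar multiplication in \<open>scalar_extension\<close> is defined
  through representatives.\<close>

lemma tensor_universal:
  assumes L: "module K L" and B: "\<And>x y. x \<in> carrier M \<Longrightarrow> y \<in> carrier N \<Longrightarrow> B x y \<in> carrier L"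
    and Bl: "\<And>x x' y. x \<in> carrier M \<Longrightarrow> x' \<in> carrier M \<Longrightarrow> y \<in> carrier N \<Longrightarrow> B (x \<oplus>\<^bsub>M\<^esub> x') y = B x y \<oplus>\<^bsub>L\<^esub> B x' y"
    and Br: "\<And>x y y'. x \<in> carrier M \<Longrightarrow> y \<in> carrier N \<Longrightarrow> y' \<in> carrier N \<Longrightarrow> B x (y \<oplus>\<^bsub>N\<^esub> y') = B x y \<oplus>\<^bsub>L\<^esub> B x y'"
    and Bsl: "\<And>a x y. a \<in> carrier K \<Longrightarrow> x \<in> carrier M \<Longrightarrow> y \<in> carrier N \<Longrightarrow> B (a \<odot>\<^bsub>M\<^esub> x) y = a \<odot>\<^bsub>L\<^esub> B x y"
    and Bsr: "\<And>a x y. a \<in> carrier K \<Longrightarrow> x \<in> carrier M \<Longrightarrow> y \<in> carrier N \<Longrightarrow> B x (a \<odot>\<^bsub>N\<^esub> y) = a \<odot>\<^bsub>L\<^esub> B x y"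
  shows "\<exists>g. mod_hom K T L g \<and> (\<forall>f\<in>carrier F. g (tensor_kernel K M N +>\<^bsub>F\<^esub> f) = lin_ext K L (\<lambda>(x, y). B x y) f) \<and>
    (\<forall>x\<in>carrier M. \<forall>y\<in>carrier N. g (pure x y) = B x y)"
proof -
  interpret L: module K L by (rule L)
  let ?B = "\<lambda>(x, y). B x y"
  have BB: "\<And>z. z \<in> carrier M \<times> carrier N \<Longrightarrow> ?B z \<in> carrier L" using B by auto
  have hom: "mod_hom K F L (lin_ext K L ?B)" by (rule lin_ext_mod_hom[OF L BB])
  interpret hom: mod_hom K F L "lin_ext K L ?B" by (rule hom)
  have Be: "lin_ext K L ?B (e (x, y)) = B x y" if "x \<in> carrier M" "y \<in> carrier N" for x y
    using lin_ext_free_gen[of K L "carrier M \<times> carrier N" ?B "(x, y)", OF L BB] that by simp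
  have "lin_ext K L ?B r = \<zero>\<^bsub>L\<^esub>" if r: "r \<in> tensor_kernel K M N" for r
  proof (rule gen_submodule_ker[OF hom _ r[unfolded tensor_kernel_def]])
    fix r assume r: "r \<in> tensor_rels K M N"
    then have "lin_ext K L ?B r = \<zero>\<^bsub>L\<^esub>"
      unfolding tensor_rels_def Let_def
      by (auto simp: Be Bl Br Bsl Bsr B e_closed F.smult_closed L.M.r_neg L.M.minus_eq hom.f_minus hom.f_add
          hom.f_smult F.M.a_closed simp del: free_module_simps)
    then show "r \<in> carrier F \<and> lin_ext K L ?B r = \<zero>\<^bsub>L\<^esub>" using r rels_closed by blast
  qed
  then obtain g where "mod_hom K Q L g" "\<forall>x\<in>carrier F. g (tensor_kernel K M N +>\<^bsub>F\<^esub> x) = lin_ext K L ?B x"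
    using quot_module_factor[OF hom sub] by blast
  then show ?thesis using Be e_closed unfolding tensor_eq pure_eq by (intro exI[of _ g]) auto
qed

end

section \<open>Extension of scalars\<close>

locale scalar_ext =
  fixes K :: "('k, 'v) ring_scheme" and B :: "('b, 'w) ring_scheme" and \<phi> :: "'k \<Rightarrow> 'b"
    and N :: "('k, 'n, 'u) module_scheme"
  assumes B_cring: "cring B" and \<phi>_hom: "\<phi> \<in> Ring.ring_hom K B" and NN: "module K N"
begin

abbreviation "M \<equiv> restrict_scalars \<phi> (regular_module B)"

sublocale B: cring B by (rule B_cring)

sublocale tensor_product K M N
  unfolding tensor_product_def
  using module_restrict_scalars[OF module.axioms(1)[OF NN] cring_regular_module[OF B_cring] \<phi>_hom] NN by blast

abbreviation "E \<equiv> scalar_extension K B \<phi> N"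

lemma M_simps: "carrier M = carrier B" "x \<oplus>\<^bsub>M\<^esub> y = x \<oplus>\<^bsub>B\<^esub> y" "a \<odot>\<^bsub>M\<^esub> x = \<phi> a \<otimes>\<^bsub>B\<^esub> x"
  by (simp_all add: restrict_scalars_def regular_module_def)

lemma E_simps: "carrier E = carrier T" "add E = add T" "zero E = zero T"
  by (simp_all add: scalar_extension_def Let_def)

text \<open>Multiplication by \<open>b\<close> is defined as a union over all representatives of a
  tensor. The bilinear map sending \<open>(x, y)\<close> to the tensor of \<open>bx\<close> and
  \<open>y\<close> induces a linear \<open>g\<close>, and each representative \<open>f\<close> of
  \<open>X\<close> contributes exactly the coset \<open>g X\<close>, so the union collapses to
  it.\<close>

lemma E_smult:
  assumes b: "b \<in> carrier B"
  shows "\<exists>g. mod_hom K T T g \<and> (\<forall>X\<in>carrier T. b \<odot>\<^bsub>E\<^esub> X = g X) \<and>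
    (\<forall>x\<in>carrier B. \<forall>y\<in>carrier N. g (pure x y) = pure (b \<otimes>\<^bsub>B\<^esub> x) y)"
proof -
  let ?k = "tensor_kernel K M N"
  let ?G = "\<lambda>z. e (b \<otimes>\<^bsub>B\<^esub> fst z, snd z)"
  have \<phi>c: "\<phi> a \<in> carrier B" if "a \<in> carrier K" for a using Ring.ring_hom_closed[OF \<phi>_hom that] .
  have "\<exists>g. mod_hom K T T g \<and> (\<forall>f\<in>carrier F. g (?k +>\<^bsub>F\<^esub> f) = lin_ext K T (\<lambda>(x, y). pure (b \<otimes>\<^bsub>B\<^esub> x) y) f) \<and>
    (\<forall>x\<in>carrier M. \<forall>y\<in>carrier N. g (pure x y) = pure (b \<otimes>\<^bsub>B\<^esub> x) y)"
  proof (rule tensor_universal[OF tensor_is_module])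
    fix a x x' y assume *: "x \<in> carrier M" "x' \<in> carrier M" "y \<in> carrier N"
    then show "pure (b \<otimes>\<^bsub>B\<^esub> (x \<oplus>\<^bsub>M\<^esub> x')) y = pure (b \<otimes>\<^bsub>B\<^esub> x) y \<oplus>\<^bsub>T\<^esub> pure (b \<otimes>\<^bsub>B\<^esub> x') y"
      using b pure_add_left[of "b \<otimes>\<^bsub>B\<^esub> x" "b \<otimes>\<^bsub>B\<^esub> x'" y] by (simp add: M_simps B.r_distr)
  next
    fix a x y assume "a \<in> carrier K" "x \<in> carrier M" "y \<in> carrier N"
    then show "pure (b \<otimes>\<^bsub>B\<^esub> (a \<odot>\<^bsub>M\<^esub> x)) y = a \<odot>\<^bsub>T\<^esub> pure (b \<otimes>\<^bsub>B\<^esub> x) y"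
      using b pure_smult_left[of a "b \<otimes>\<^bsub>B\<^esub> x" y] by (simp add: M_simps B.m_lcomm \<phi>c)
  qed (use b in \<open>simp_all add: M_simps pure_add_right pure_smult_right\<close>)
  then obtain g where g: "mod_hom K T T g"
    "\<And>f. f \<in> carrier F \<Longrightarrow> g (?k +>\<^bsub>F\<^esub> f) = lin_ext K T (\<lambda>(x, y). pure (b \<otimes>\<^bsub>B\<^esub> x) y) f"
    "\<And>x y. x \<in> carrier B \<Longrightarrow> y \<in> carrier N \<Longrightarrow> g (pure x y) = pure (b \<otimes>\<^bsub>B\<^esub> x) y"
    unfolding M_simps by blast
  have "b \<odot>\<^bsub>E\<^esub> X = g X" if X: "X \<in> carrier T" for X
  proof -
    obtain f0 where f0: "f0 \<in> carrier F" "X = ?k +>\<^bsub>F\<^esub> f0" using X unfolding tensor_eq quot_carrier by blast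
    have eq: "?k +>\<^bsub>F\<^esub> (\<Oplus>\<^bsub>F\<^esub>z\<in>{z. f z \<noteq> \<zero>\<^bsub>K\<^esub>}. f z \<odot>\<^bsub>F\<^esub> ?G z) = g X" if f: "f \<in> X" for f
    proof -
      have "?k +>\<^bsub>F\<^esub> f0 \<subseteq> carrier F" using F.M.a_r_coset_subset_G[OF N.a_subset f0(1)] .
      then have fF: "f \<in> carrier F" using f f0(2) by blast
      have fX: "?k +>\<^bsub>F\<^esub> f = X"
        using F.M.a_repr_independence[OF f[unfolded f0(2)] f0(1) N.a_subgroup] f0(2) by simp
      let ?S = "{z. f z \<noteq> \<zero>\<^bsub>K\<^esub>}"
      have S: "?S \<subseteq> carrier B \<times> carrier N" "\<And>z. f z \<in> carrier K"
        using fF by (auto simp: free_module_carrier M_simps)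
      have G: "?G z \<in> carrier F" if "z \<in> ?S" for z
        using that S b by (intro e_closed) (auto simp: M_simps)
      have "?k +>\<^bsub>F\<^esub> (\<Oplus>\<^bsub>F\<^esub>z\<in>?S. f z \<odot>\<^bsub>F\<^esub> ?G z) = (\<Oplus>\<^bsub>Q\<^esub>z\<in>?S. ?k +>\<^bsub>F\<^esub> (f z \<odot>\<^bsub>F\<^esub> ?G z))"
        by (rule mod_hom_finsum[OF quot_mod_hom]) (rule F.smult_closed[OF S(2) G])
      also have "\<dots> = (\<Oplus>\<^bsub>T\<^esub>z\<in>?S. f z \<odot>\<^bsub>T\<^esub> (case z of (x, y) \<Rightarrow> pure (b \<otimes>\<^bsub>B\<^esub> x) y))"
        unfolding tensor_eq[symmetric]
      proof (rule T.M.finsum_cong'[OF refl])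
        fix z assume z: "z \<in> ?S"
        then have "?k +>\<^bsub>F\<^esub> (f z \<odot>\<^bsub>F\<^esub> ?G z) = f z \<odot>\<^bsub>T\<^esub> (?k +>\<^bsub>F\<^esub> ?G z)"
          unfolding tensor_eq by (rule quot_smult[OF S(2) G, symmetric])
        then show "?k +>\<^bsub>F\<^esub> (f z \<odot>\<^bsub>F\<^esub> ?G z) = f z \<odot>\<^bsub>T\<^esub> (case z of (x, y) \<Rightarrow> pure (b \<otimes>\<^bsub>B\<^esub> x) y)"
          by (simp add: pure_eq split_beta)
      next
        show "(\<lambda>z. f z \<odot>\<^bsub>T\<^esub> (case z of (x, y) \<Rightarrow> pure (b \<otimes>\<^bsub>B\<^esub> x) y)) \<in> ?S \<rightarrow> carrier T"
          using S b by (auto simp: M_simps intro!: T.smult_closed pure_closed)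
      qed
      also have "\<dots> = g X" using g(2)[OF fF] unfolding fX lin_ext_def by simp
      finally show ?thesis .
    qed
    have "b \<odot>\<^bsub>E\<^esub> X = (\<Union>f\<in>X. ?k +>\<^bsub>F\<^esub> (\<Oplus>\<^bsub>F\<^esub>z\<in>{z. f z \<noteq> \<zero>\<^bsub>K\<^esub>}. f z \<odot>\<^bsub>F\<^esub> ?G z))"
      by (simp add: scalar_extension_def Let_def)
    also have "\<dots> = (\<Union>f\<in>X. g X)" by (intro SUP_cong refl) (rule eq)
    also have "\<dots> = g X" using coset_self[OF f0(1)] f0(2) by blast
    finally show ?thesis .
  qed
  then show ?thesis using g by blast
qed

lemma E_smult_pure: "b \<in> carrier B \<Longrightarrow> x \<in> carrier B \<Longrightarrow> y \<in> carrier N \<Longrightarrow> b \<odot>\<^bsub>E\<^esub> pure x y = pure (b \<otimes>\<^bsub>B\<^esub> x) y"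
  using E_smult[of b] pure_closed[of x y] unfolding M_simps by metis

lemma E_smult_closed: "b \<in> carrier B \<Longrightarrow> u \<in> carrier T \<Longrightarrow> b \<odot>\<^bsub>E\<^esub> u \<in> carrier T"
  using E_smult[of b] mod_homD(1) by metis

lemma E_smult_add:
  assumes "b \<in> carrier B" and u: "u \<in> carrier T" and v: "v \<in> carrier T"
  shows "b \<odot>\<^bsub>E\<^esub> (u \<oplus>\<^bsub>T\<^esub> v) = b \<odot>\<^bsub>E\<^esub> u \<oplus>\<^bsub>T\<^esub> b \<odot>\<^bsub>E\<^esub> v"
proof -
  obtain g where g: "mod_hom K T T g" "\<And>X. X \<in> carrier T \<Longrightarrow> b \<odot>\<^bsub>E\<^esub> X = g X" using E_smult[OF assms(1)] by blast
  show ?thesis unfolding g(2)[OF u] g(2)[OF v] g(2)[OF T.M.a_closed[OF u v]] by (rule mod_homD(2)[OF g(1) u v])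
qed

lemma E_smult_zero:
  assumes "b \<in> carrier B" shows "b \<odot>\<^bsub>E\<^esub> \<zero>\<^bsub>T\<^esub> = \<zero>\<^bsub>T\<^esub>"
proof -
  obtain g where g: "mod_hom K T T g" "\<And>X. X \<in> carrier T \<Longrightarrow> b \<odot>\<^bsub>E\<^esub> X = g X" using E_smult[OF assms(1)] by blast
  show ?thesis unfolding g(2)[OF T.M.zero_closed] by (rule mod_homD(4)[OF g(1)])
qed

end

section \<open>Polynomials with coefficients in a module\<close>

text \<open>The module \<open>M[x]\<close> over \<open>S[x]\<close>, with scalars acting by
  convolution. For the differentials of \<open>S\<close> it mediates between the differentials of
  \<open>S[x]\<close> and the tensor product in the claim.\<close>

definition poly_module :: "('s, 'v) ring_scheme \<Rightarrow> ('s, 'm, 'w) module_scheme \<Rightarrow> (nat \<Rightarrow> 's, nat \<Rightarrow> 'm) module" where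
  "poly_module S M = \<lparr>
     carrier = {f. (\<forall>i. f i \<in> carrier M) \<and> finite {i. f i \<noteq> \<zero>\<^bsub>M\<^esub>}},
     mult = (\<lambda>f g i. \<zero>\<^bsub>M\<^esub>), one = (\<lambda>i. \<zero>\<^bsub>M\<^esub>), zero = (\<lambda>i. \<zero>\<^bsub>M\<^esub>),
     add = (\<lambda>f g i. f i \<oplus>\<^bsub>M\<^esub> g i),
     smult = (\<lambda>p f n. \<Oplus>\<^bsub>M\<^esub>i\<in>{..n}. up_ring.coeff (UP S) p i \<odot>\<^bsub>M\<^esub> f (n - i))\<rparr>"

text \<open>The element \<open>m x^i\<close> of \<open>M[x]\<close>.\<close>

definition single_coeff :: "('s, 'm, 'w) module_scheme \<Rightarrow> 'm \<Rightarrow> nat \<Rightarrow> nat \<Rightarrow> 'm" where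
  "single_coeff M m i = (\<lambda>n. if n = i then m else \<zero>\<^bsub>M\<^esub>)"

lemma (in UP_ring) UP_induct [consumes 1, case_names add monom]:
  assumes p: "p \<in> carrier P"
    and add: "\<And>p q. p \<in> carrier P \<Longrightarrow> q \<in> carrier P \<Longrightarrow> Q p \<Longrightarrow> Q q \<Longrightarrow> Q (p \<oplus>\<^bsub>P\<^esub> q)"
    and monom: "\<And>a i. a \<in> carrier R \<Longrightarrow> Q (up_ring.monom P a i)"
  shows "Q p"
proof -
  have "Q (\<Oplus>\<^bsub>P\<^esub>i\<in>F. up_ring.monom P (up_ring.coeff P p i) i) \<and>
      (\<Oplus>\<^bsub>P\<^esub>i\<in>F. up_ring.monom P (up_ring.coeff P p i) i) \<in> carrier P" if "finite F" for F :: "nat set"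
    using that
  proof (induction F)
    case empty then show ?case using monom[of \<zero> 0] by (simp add: monom_zero)
  next
    case (insert i F) then show ?case using p by (simp add: P.finsum_insert add monom)
  qed
  from this[of "{..deg R p}"] show ?thesis using up_repr[OF p] by simp
qed

locale poly_module_loc =
  fixes S :: "('s, 'v) ring_scheme" (structure) and M :: "('s, 'm, 'w) module_scheme"
  assumes SM: "module S M"
begin

sublocale M: module S M by (rule SM)

abbreviation "P \<equiv> UP S"
abbreviation "PM \<equiv> poly_module S M"
abbreviation "cf \<equiv> up_ring.coeff P"
abbreviation "mnm \<equiv> up_ring.monom P"
abbreviation "sgl \<equiv> single_coeff M"

lemma S_cring: "cring S" by (rule M.R.cring_axioms)

sublocale UP: UP_cring S P
  unfolding UP_cring_def by (simp_all add: S_cring)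

lemma P_cring: "cring P" by (rule UP.P.cring_axioms)

lemma PM_simps [simp]: "\<zero>\<^bsub>PM\<^esub> = (\<lambda>i. \<zero>\<^bsub>M\<^esub>)" "f \<oplus>\<^bsub>PM\<^esub> g = (\<lambda>i. f i \<oplus>\<^bsub>M\<^esub> g i)"
  by (simp_all add: poly_module_def)

lemma PM_smult: "p \<odot>\<^bsub>PM\<^esub> f = (\<lambda>n. \<Oplus>\<^bsub>M\<^esub>i\<in>{..n}. cf p i \<odot>\<^bsub>M\<^esub> f (n - i))"
  by (simp add: poly_module_def)

lemma PM_carrier: "f \<in> carrier PM \<longleftrightarrow> (\<forall>i. f i \<in> carrier M) \<and> (\<exists>N. \<forall>i>N. f i = \<zero>\<^bsub>M\<^esub>)"
proof -
  have "finite {i. f i \<noteq> \<zero>\<^bsub>M\<^esub>} \<longleftrightarrow> (\<exists>N. \<forall>i>N. f i = \<zero>\<^bsub>M\<^esub>)"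
    unfolding finite_nat_set_iff_bounded_le by (auto simp: not_le[symmetric])
  then show ?thesis by (simp add: poly_module_def)
qed

lemma PM_finite: "f \<in> carrier PM \<Longrightarrow> finite {i. f i \<noteq> \<zero>\<^bsub>M\<^esub>}"
  by (simp add: poly_module_def)

lemma PM_coeff: "f \<in> carrier PM \<Longrightarrow> f i \<in> carrier M"
  by (simp add: PM_carrier)

lemma PM_add_closed: "f \<in> carrier PM \<Longrightarrow> g \<in> carrier PM \<Longrightarrow> f \<oplus>\<^bsub>PM\<^esub> g \<in> carrier PM"
proof -
  assume f: "f \<in> carrier PM" and g: "g \<in> carrier PM"
  then obtain N N' where "\<forall>i>N. f i = \<zero>\<^bsub>M\<^esub>" "\<forall>i>N'. g i = \<zero>\<^bsub>M\<^esub>" by (auto simp: PM_carrier)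
  then have "\<forall>i>max N N'. f i \<oplus>\<^bsub>M\<^esub> g i = \<zero>\<^bsub>M\<^esub>" by simp
  then have "\<exists>N. \<forall>i>N. f i \<oplus>\<^bsub>M\<^esub> g i = \<zero>\<^bsub>M\<^esub>" by blast
  then show ?thesis using f g by (auto simp: PM_carrier)
qed

lemma sgl_closed: "m \<in> carrier M \<Longrightarrow> sgl m i \<in> carrier PM"
  by (auto simp: PM_carrier single_coeff_def intro!: exI[of _ i])

lemma sgl_add: "m \<in> carrier M \<Longrightarrow> m' \<in> carrier M \<Longrightarrow> sgl (m \<oplus>\<^bsub>M\<^esub> m') i = sgl m i \<oplus>\<^bsub>PM\<^esub> sgl m' i"
  by (auto simp: single_coeff_def)

lemma sgl_zero: "sgl \<zero>\<^bsub>M\<^esub> i = \<zero>\<^bsub>PM\<^esub>" by (auto simp: single_coeff_def)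

lemma PM_induct [consumes 1, case_names add sgl]:
  assumes f: "f \<in> carrier PM"
    and add: "\<And>f g. f \<in> carrier PM \<Longrightarrow> g \<in> carrier PM \<Longrightarrow> Q f \<Longrightarrow> Q g \<Longrightarrow> Q (f \<oplus>\<^bsub>PM\<^esub> g)"
    and sgl: "\<And>m i. m \<in> carrier M \<Longrightarrow> Q (sgl m i)"
  shows "Q f"
proof -
  have "Q f" if "f \<in> carrier PM" "\<forall>i\<ge>N. f i = \<zero>\<^bsub>M\<^esub>" for N f
    using that
  proof (induction N arbitrary: f)
    case 0
    then have "f = sgl \<zero>\<^bsub>M\<^esub> 0" by (auto simp: single_coeff_def)
    then show ?case using sgl[of "\<zero>\<^bsub>M\<^esub>" 0] by simp
  next
    case (Suc N)
    define g where "g = f(N := \<zero>\<^bsub>M\<^esub>)"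
    have g: "g \<in> carrier PM" using Suc.prems by (auto simp: PM_carrier g_def)
    have "\<forall>i\<ge>N. g i = \<zero>\<^bsub>M\<^esub>" using Suc.prems(2) by (auto simp: g_def Suc_le_eq)
    then have "Q g" using Suc.IH g by blast
    moreover have "f = g \<oplus>\<^bsub>PM\<^esub> sgl (f N) N"
      using Suc.prems(1) by (auto simp: g_def single_coeff_def PM_carrier)
    moreover have "f N \<in> carrier M" using Suc.prems(1) by (rule PM_coeff)
    ultimately show ?case using add[OF g sgl_closed] sgl by metis
  qed
  moreover obtain N where "\<forall>i>N. f i = \<zero>\<^bsub>M\<^esub>" using f by (auto simp: PM_carrier)
  ultimately show ?thesis using f by (metis Suc_le_eq)
qed

lemma PM_smult_closed: "p \<in> carrier P \<Longrightarrow> f \<in> carrier PM \<Longrightarrow> p \<odot>\<^bsub>PM\<^esub> f \<in> carrier PM"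
proof -
  assume p: "p \<in> carrier P" and f: "f \<in> carrier PM"
  obtain N where N: "\<And>i. i > N \<Longrightarrow> cf p i = \<zero>" using UP.deg_aboveD[OF _ p] by blast
  obtain N' where N': "\<forall>i>N'. f i = \<zero>\<^bsub>M\<^esub>" using f by (auto simp: PM_carrier)
  have "(p \<odot>\<^bsub>PM\<^esub> f) n = \<zero>\<^bsub>M\<^esub>" if n: "n > N + N'" for n
  proof -
    have "cf p i \<odot>\<^bsub>M\<^esub> f (n - i) = \<zero>\<^bsub>M\<^esub>" for i
    proof (cases "i > N")
      case True then show ?thesis using N f PM_coeff by simp
    next
      case False then show ?thesis using N' n p UP.coeff_closed by auto
    qed
    then show ?thesis by (simp add: PM_smult)
  qed
  then show ?thesis
    using p f by (auto simp: PM_carrier PM_smult intro!: M.M.finsum_closed exI[of _ "N + N'"])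
qed

lemma PM_smult_l_distr:
  assumes "p \<in> carrier P" "q \<in> carrier P" "f \<in> carrier PM"
  shows "(p \<oplus>\<^bsub>P\<^esub> q) \<odot>\<^bsub>PM\<^esub> f = p \<odot>\<^bsub>PM\<^esub> f \<oplus>\<^bsub>PM\<^esub> q \<odot>\<^bsub>PM\<^esub> f"
  using assms by (auto simp: PM_smult M.smult_l_distr PM_coeff intro!: M.M.finsum_addf)

lemma PM_smult_r_distr:
  assumes "p \<in> carrier P" "f \<in> carrier PM" "g \<in> carrier PM"
  shows "p \<odot>\<^bsub>PM\<^esub> (f \<oplus>\<^bsub>PM\<^esub> g) = p \<odot>\<^bsub>PM\<^esub> f \<oplus>\<^bsub>PM\<^esub> p \<odot>\<^bsub>PM\<^esub> g"
  using assms by (auto simp: PM_smult M.smult_r_distr PM_coeff intro!: M.M.finsum_addf)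

lemma PM_smult_mnm:
  assumes a: "a \<in> carrier S" and f: "f \<in> carrier PM"
  shows "mnm a i \<odot>\<^bsub>PM\<^esub> f = (\<lambda>n. if i \<le> n then a \<odot>\<^bsub>M\<^esub> f (n - i) else \<zero>\<^bsub>M\<^esub>)"
proof
  fix n
  have "(mnm a i \<odot>\<^bsub>PM\<^esub> f) n = (\<Oplus>\<^bsub>M\<^esub>k\<in>{..n}. if i = k then a \<odot>\<^bsub>M\<^esub> f (n - k) else \<zero>\<^bsub>M\<^esub>)"
    unfolding PM_smult by (intro M.M.finsum_cong') (use a f PM_coeff in auto)
  also have "\<dots> = (if i \<le> n then a \<odot>\<^bsub>M\<^esub> f (n - i) else \<zero>\<^bsub>M\<^esub>)"
  proof (cases "i \<le> n")
    case True
    then show ?thesis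
      by (subst M.M.finsum_singleton) (use a f PM_coeff in auto)
  next
    case False
    then have "(\<Oplus>\<^bsub>M\<^esub>k\<in>{..n}. if i = k then a \<odot>\<^bsub>M\<^esub> f (n - k) else \<zero>\<^bsub>M\<^esub>) = (\<Oplus>\<^bsub>M\<^esub>k\<in>{..n}. \<zero>\<^bsub>M\<^esub>)"
      by (intro M.M.finsum_cong') auto
    then show ?thesis using False by simp
  qed
  finally show "(mnm a i \<odot>\<^bsub>PM\<^esub> f) n = (if i \<le> n then a \<odot>\<^bsub>M\<^esub> f (n - i) else \<zero>\<^bsub>M\<^esub>)" .
qed

lemma mnm_smult_sgl: "a \<in> carrier S \<Longrightarrow> m \<in> carrier M \<Longrightarrow> mnm a i \<odot>\<^bsub>PM\<^esub> sgl m j = sgl (a \<odot>\<^bsub>M\<^esub> m) (i + j)"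
  by (subst PM_smult_mnm) (auto simp: sgl_closed, auto simp: single_coeff_def fun_eq_iff)

text \<open>Both sides are additive in either polynomial, so monomials suffice, and for these the
  convolution is a mere shift of the coefficients.\<close>

lemma PM_smult_assoc:
  assumes p: "p \<in> carrier P" and q: "q \<in> carrier P" and f: "f \<in> carrier PM"
  shows "(p \<otimes>\<^bsub>P\<^esub> q) \<odot>\<^bsub>PM\<^esub> f = p \<odot>\<^bsub>PM\<^esub> (q \<odot>\<^bsub>PM\<^esub> f)"
  using p
proof (induction rule: UP.UP_induct)
  case (add p p')
  then show ?case using q f by (simp add: UP.P.l_distr PM_smult_l_distr PM_smult_closed del: PM_simps)
next
  case (monom a i)
  show ?case using q
  proof (induction rule: UP.UP_induct)
    case (add q q')
    then show ?case using monom f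
      by (simp add: UP.P.r_distr PM_smult_l_distr PM_smult_r_distr PM_smult_closed del: PM_simps)
  next
    case (monom b j)
    have "mnm a i \<otimes>\<^bsub>P\<^esub> mnm b j = mnm (a \<otimes> b) (i + j)" using \<open>a \<in> carrier S\<close> monom by simp
    moreover have "mnm (a \<otimes> b) (i + j) \<odot>\<^bsub>PM\<^esub> f = mnm a i \<odot>\<^bsub>PM\<^esub> (mnm b j \<odot>\<^bsub>PM\<^esub> f)"
      using \<open>a \<in> carrier S\<close> monom f PM_smult_closed[of "mnm b j" f]
      by (simp add: PM_smult_mnm M.smult_assoc1 PM_coeff fun_eq_iff del: UP.monom_mult) (auto simp: PM_coeff)
    ultimately show ?case by simp
  qed
qed

lemma PM_module: "module P PM"
proof (rule module_criteria)
  show "\<forall>v\<in>carrier PM. \<exists>u\<in>carrier PM. v \<oplus>\<^bsub>PM\<^esub> u = \<zero>\<^bsub>PM\<^esub>"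
  proof
    fix v assume v: "v \<in> carrier PM"
    then have "(\<lambda>i. \<ominus>\<^bsub>M\<^esub> v i) \<in> carrier PM" "v \<oplus>\<^bsub>PM\<^esub> (\<lambda>i. \<ominus>\<^bsub>M\<^esub> v i) = \<zero>\<^bsub>PM\<^esub>"
      by (auto simp: PM_carrier M.M.r_neg)
    then show "\<exists>u\<in>carrier PM. v \<oplus>\<^bsub>PM\<^esub> u = \<zero>\<^bsub>PM\<^esub>" by blast
  qed
  show "\<forall>v\<in>carrier PM. \<one>\<^bsub>P\<^esub> \<odot>\<^bsub>PM\<^esub> v = v"
    unfolding UP.monom_one[symmetric] by (auto simp: PM_smult_mnm PM_coeff simp del: UP.monom_one)
  show "\<forall>v w. v \<in> carrier PM \<and> w \<in> carrier PM \<longrightarrow> v \<oplus>\<^bsub>PM\<^esub> w = w \<oplus>\<^bsub>PM\<^esub> v"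
    by (auto simp: PM_coeff M.M.a_comm)
  show "\<forall>v w x. v \<in> carrier PM \<and> w \<in> carrier PM \<and> x \<in> carrier PM \<longrightarrow> v \<oplus>\<^bsub>PM\<^esub> w \<oplus>\<^bsub>PM\<^esub> x = v \<oplus>\<^bsub>PM\<^esub> (w \<oplus>\<^bsub>PM\<^esub> x)"
    by (auto simp: PM_coeff M.M.a_assoc)
  show "\<forall>v\<in>carrier PM. v \<oplus>\<^bsub>PM\<^esub> \<zero>\<^bsub>PM\<^esub> = v" by (simp add: PM_coeff)
  show "\<zero>\<^bsub>PM\<^esub> \<in> carrier PM" by (simp add: PM_carrier)
qed (auto simp: P_cring PM_smult_closed PM_add_closed PM_smult_assoc PM_smult_l_distr PM_smult_r_distr
    simp del: PM_simps)

sublocale PM: module P PM by (rule PM_module)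

text \<open>Assembles additive maps on the single coefficients into an additive map on
  \<open>M[x]\<close>. The maps \<kappa> and \<theta> are of this form.\<close>

definition coeff_sum :: "('n, 'x) ring_scheme \<Rightarrow> (nat \<Rightarrow> 'm \<Rightarrow> 'n) \<Rightarrow> (nat \<Rightarrow> 'm) \<Rightarrow> 'n" where
  "coeff_sum N g f = (\<Oplus>\<^bsub>N\<^esub>i\<in>{i. f i \<noteq> \<zero>\<^bsub>M\<^esub>}. g i (f i))"

context
  fixes N :: "('n, 'x) ring_scheme" and g :: "nat \<Rightarrow> 'm \<Rightarrow> 'n"
  assumes N: "abelian_group N" and g: "\<And>i m. m \<in> carrier M \<Longrightarrow> g i m \<in> carrier N"
    and ga: "\<And>i m m'. m \<in> carrier M \<Longrightarrow> m' \<in> carrier M \<Longrightarrow> g i (m \<oplus>\<^bsub>M\<^esub> m') = g i m \<oplus>\<^bsub>N\<^esub> g i m'"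
begin

interpretation N: abelian_group N by (rule N)

lemma coeff_sum_zero: "g i \<zero>\<^bsub>M\<^esub> = \<zero>\<^bsub>N\<^esub>"
  using ga[of "\<zero>\<^bsub>M\<^esub>" "\<zero>\<^bsub>M\<^esub>" i] g[of "\<zero>\<^bsub>M\<^esub>" i] N.add.l_cancel_one by simp

lemma coeff_sum_superset:
  assumes f: "f \<in> carrier PM" and B: "finite B" "{i. f i \<noteq> \<zero>\<^bsub>M\<^esub>} \<subseteq> B"
  shows "coeff_sum N g f = (\<Oplus>\<^bsub>N\<^esub>i\<in>B. g i (f i))"
  unfolding coeff_sum_def
  by (rule N.add.finprod_mono_neutral_cong_left) (use f B g PM_coeff coeff_sum_zero in auto)

lemma coeff_sum_closed: "f \<in> carrier PM \<Longrightarrow> coeff_sum N g f \<in> carrier N"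
  unfolding coeff_sum_def by (intro N.finsum_closed) (use g PM_coeff in auto)

lemma coeff_sum_add:
  assumes f: "f \<in> carrier PM" and f': "f' \<in> carrier PM"
  shows "coeff_sum N g (f \<oplus>\<^bsub>PM\<^esub> f') = coeff_sum N g f \<oplus>\<^bsub>N\<^esub> coeff_sum N g f'"
proof -
  let ?B = "{i. f i \<noteq> \<zero>\<^bsub>M\<^esub>} \<union> {i. f' i \<noteq> \<zero>\<^bsub>M\<^esub>}"
  have B: "finite ?B" using f f' PM_finite by auto
  have "coeff_sum N g (f \<oplus>\<^bsub>PM\<^esub> f') = (\<Oplus>\<^bsub>N\<^esub>i\<in>?B. g i (f i) \<oplus>\<^bsub>N\<^esub> g i (f' i))"
    by (subst coeff_sum_superset[OF PM_add_closed[OF f f'] B])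
      (use f f' PM_coeff g ga in \<open>auto intro!: N.finsum_cong'\<close>)
  also have "\<dots> = (\<Oplus>\<^bsub>N\<^esub>i\<in>?B. g i (f i)) \<oplus>\<^bsub>N\<^esub> (\<Oplus>\<^bsub>N\<^esub>i\<in>?B. g i (f' i))"
    by (rule N.finsum_addf) (use f f' PM_coeff g in auto)
  finally show ?thesis using coeff_sum_superset[OF f B] coeff_sum_superset[OF f' B] by simp
qed

lemma coeff_sum_sgl: "m \<in> carrier M \<Longrightarrow> coeff_sum N g (sgl m i) = g i m"
  by (subst coeff_sum_superset[where B = "{i}"])
    (auto simp: sgl_closed g, auto simp: single_coeff_def g split: if_splits)

end

end

section \<open>Differentials of a polynomial extension\<close>

text \<open>The polynomial ring \<open>S[x]\<close>, up to isomorphism.\<close>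

locale poly_extension =
  fixes K :: "('k, 'v) ring_scheme" and S :: "('s, 'w) ring_scheme" (structure) and A :: "('a, 'z) ring_scheme"
    and \<phi> :: "'k \<Rightarrow> 's" and \<alpha> :: "'k \<Rightarrow> 'a" and h :: "'s \<Rightarrow> 'a" and x :: 'a
  assumes K_cring: "cring K" and S_cring: "cring S" and A_cring: "cring A"
    and \<phi>_hom: "\<phi> \<in> Ring.ring_hom K S" and h_hom: "h \<in> Ring.ring_hom S A"
    and \<alpha>_eq: "\<And>k. k \<in> carrier K \<Longrightarrow> \<alpha> k = h (\<phi> k)" and x_closed [simp, intro]: "x \<in> carrier A"
    and bij: "bij_betw (UnivPoly.eval S A h x) (carrier (UP S)) (carrier A)"
begin

abbreviation "\<epsilon> \<equiv> UnivPoly.eval S A h x"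
abbreviation "P \<equiv> UP S"
abbreviation "mnm \<equiv> up_ring.monom P"
abbreviation "cf \<equiv> up_ring.coeff P"

sublocale A: cring A by (rule A_cring)
sublocale K: cring K by (rule K_cring)
sublocale UP: UP_cring S P unfolding UP_cring_def by (simp_all add: S_cring)
sublocale h: ring_hom_cring S A h
  by (rule ring_hom_cringI) (simp_all add: S_cring A_cring h_hom)
sublocale ev: UP_pre_univ_prop S A h P ..

lemma \<alpha>_hom: "\<alpha> \<in> Ring.ring_hom K A"
  using \<phi>_hom h_hom by (auto simp: Ring.ring_hom_def \<alpha>_eq Pi_def)

sublocale \<Omega>S: kaehler_diff K S \<phi> by unfold_locales (simp_all add: K_cring S_cring \<phi>_hom)
sublocale \<Omega>A: kaehler_diff K A \<alpha> by unfold_locales (simp_all add: K_cring A_cring \<alpha>_hom)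

abbreviation "M \<equiv> kaehler K S \<phi>"
abbreviation "\<Omega> \<equiv> kaehler K A \<alpha>"
abbreviation "dS \<equiv> kaehler_d K S \<phi>"
abbreviation "dA \<equiv> kaehler_d K A \<alpha>"

sublocale PMod: poly_module_loc S M ..

abbreviation "PM \<equiv> poly_module S M"
abbreviation "sgl \<equiv> single_coeff M"

lemma \<epsilon>_hom: "\<epsilon> \<in> Ring.ring_hom P A" by (rule ev.eval_ring_hom) simp

sublocale \<epsilon>: ring_hom_cring P A \<epsilon>
  by (rule ring_hom_cringI) (simp_all add: PMod.P_cring A_cring \<epsilon>_hom)

lemma \<epsilon>_monom: "s \<in> carrier S \<Longrightarrow> \<epsilon> (mnm s i) = h s \<otimes>\<^bsub>A\<^esub> x [^]\<^bsub>A\<^esub> i"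
  by (rule ev.eval_monom) simp_all

definition c :: "'a \<Rightarrow> nat \<Rightarrow> 's" where "c = inv_into (carrier P) \<epsilon>"

lemma c_closed [simp, intro]: "a \<in> carrier A \<Longrightarrow> c a \<in> carrier P"
  unfolding c_def using bij by (metis bij_betw_imp_surj_on inv_into_into)

lemma \<epsilon>_c: "a \<in> carrier A \<Longrightarrow> \<epsilon> (c a) = a"
  unfolding c_def using bij by (metis bij_betw_imp_surj_on f_inv_into_f)

lemma c_\<epsilon>: "p \<in> carrier P \<Longrightarrow> c (\<epsilon> p) = p"
  unfolding c_def using bij by (metis bij_betw_def inv_into_f_f)

lemma c_hom: "c \<in> Ring.ring_hom A P"
proof (rule ring_hom_memI)
  fix a b assume a: "a \<in> carrier A" and b: "b \<in> carrier A"
  have "c (\<epsilon> (c a \<otimes>\<^bsub>P\<^esub> c b)) = c a \<otimes>\<^bsub>P\<^esub> c b" using a b by (intro c_\<epsilon>) simp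
  then show "c (a \<otimes>\<^bsub>A\<^esub> b) = c a \<otimes>\<^bsub>P\<^esub> c b" using a b by (simp add: \<epsilon>_c)
  have "c (\<epsilon> (c a \<oplus>\<^bsub>P\<^esub> c b)) = c a \<oplus>\<^bsub>P\<^esub> c b" using a b by (intro c_\<epsilon>) simp
  then show "c (a \<oplus>\<^bsub>A\<^esub> b) = c a \<oplus>\<^bsub>P\<^esub> c b" using a b by (simp add: \<epsilon>_c)
next
  show "c \<one>\<^bsub>A\<^esub> = \<one>\<^bsub>P\<^esub>" using c_\<epsilon>[of "\<one>\<^bsub>P\<^esub>"] by simp
qed simp

sublocale c: ring_hom_cring A P c
  by (rule ring_hom_cringI) (simp_all add: PMod.P_cring A_cring c_hom)

section \<open>Two derivations of \<open>S[x]\<close>: with respect to \<open>x\<close>, and on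
  coefficients\<close>

definition up_deriv :: "(nat \<Rightarrow> 's) \<Rightarrow> nat \<Rightarrow> 's" where
  "up_deriv p = (\<lambda>i\<in>UNIV. [Suc i] \<cdot> cf p (Suc i))"

lemma up_deriv_closed: "p \<in> carrier P \<Longrightarrow> up_deriv p \<in> carrier P"
proof -
  assume p: "p \<in> carrier P"
  obtain N where N: "\<And>i. i > N \<Longrightarrow> cf p i = \<zero>" using UP.deg_aboveD[OF _ p] by blast
  have "bound \<zero> N (up_deriv p)" by (rule bound.intro) (simp add: up_deriv_def N)
  then have "up_deriv p \<in> up S" using p by (intro mem_upI exI[of _ N]) (auto simp: up_deriv_def)
  then show ?thesis by (simp add: UP_def)
qed

lemma cf_pd: "p \<in> carrier P \<Longrightarrow> cf (up_deriv p) i = [Suc i] \<cdot> cf p (Suc i)"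
  using up_deriv_closed[of p] by (simp add: UP_def up_deriv_def)

lemma up_deriv_add: "p \<in> carrier P \<Longrightarrow> q \<in> carrier P \<Longrightarrow> up_deriv (p \<oplus>\<^bsub>P\<^esub> q) = up_deriv p \<oplus>\<^bsub>P\<^esub> up_deriv q"
  by (rule UP.up_eqI) (simp_all add: up_deriv_closed cf_pd UP.R.add.nat_pow_distrib del: UP.R.add.nat_pow_Suc)

text \<open>For \<open>i = 0\<close> the exponent \<open>i - 1\<close> truncates to
  \<open>0\<close>, which is harmless because the coefficient is then the zero multiple of
  \<open>s\<close>.\<close>

lemma up_deriv_monom: "s \<in> carrier S \<Longrightarrow> up_deriv (mnm s i) = mnm ([i] \<cdot> s) (i - 1)"
  by (rule UP.up_eqI; cases i) (auto simp: up_deriv_closed cf_pd simp del: UP.R.add.nat_pow_Suc)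

text \<open>The derivation of \<open>S[x]\<close> into \<open>M[x]\<close> that extends
  \<open>dS\<close> and kills \<open>x\<close>.\<close>

definition coeff_d :: "(nat \<Rightarrow> 's) \<Rightarrow> nat \<Rightarrow> ('s \<Rightarrow> 's) set" where
  "coeff_d p = (\<lambda>i. dS (cf p i))"

lemma dS_zero: "dS \<zero> = \<zero>\<^bsub>M\<^esub>"
proof -
  have "\<phi> \<zero>\<^bsub>K\<^esub> = \<zero>" by (rule ring_hom_zero[OF \<phi>_hom K.ring_axioms UP.R.ring_axioms])
  then show ?thesis using \<Omega>S.d_const[of "\<zero>\<^bsub>K\<^esub>"] by simp
qed

lemma coeff_d_closed: "p \<in> carrier P \<Longrightarrow> coeff_d p \<in> carrier PM"
proof -
  assume p: "p \<in> carrier P"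
  obtain N where "\<And>i. i > N \<Longrightarrow> cf p i = \<zero>" using UP.deg_aboveD[OF _ p] by blast
  then show ?thesis using p by (auto simp: PMod.PM_carrier coeff_d_def dS_zero intro!: exI[of _ N])
qed

lemma coeff_d_add: "p \<in> carrier P \<Longrightarrow> q \<in> carrier P \<Longrightarrow> coeff_d (p \<oplus>\<^bsub>P\<^esub> q) = coeff_d p \<oplus>\<^bsub>PM\<^esub> coeff_d q"
  by (simp add: coeff_d_def \<Omega>S.d_add)

lemma coeff_d_monom: "s \<in> carrier S \<Longrightarrow> coeff_d (mnm s i) = sgl (dS s) i"
  by (auto simp: coeff_d_def single_coeff_def dS_zero fun_eq_iff)

text \<open>Both sides are additive in each argument, which leaves monomials, where the claim is
  \<open>i + j = j + i\<close> on coefficients.\<close>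

lemma up_deriv_mult:
  assumes p: "p \<in> carrier P" and q: "q \<in> carrier P"
  shows "up_deriv (p \<otimes>\<^bsub>P\<^esub> q) = p \<otimes>\<^bsub>P\<^esub> up_deriv q \<oplus>\<^bsub>P\<^esub> q \<otimes>\<^bsub>P\<^esub> up_deriv p"
  using p
proof (induction rule: UP.UP_induct)
  case (add p p')
  then show ?case using q
    by (simp add: UP.P.l_distr UP.P.r_distr up_deriv_add up_deriv_closed UP.P.a_ac)
next
  case (monom s i)
  note s = monom
  show ?case using q
  proof (induction rule: UP.UP_induct)
    case (add q q')
    then show ?case using s
      by (simp add: UP.P.l_distr UP.P.r_distr up_deriv_add up_deriv_closed UP.P.a_ac)
  next
    case (monom t j)
    have 1: "mnm s i \<otimes>\<^bsub>P\<^esub> mnm ([j] \<cdot> t) (j - 1) = mnm ([j] \<cdot> (s \<otimes> t)) (i + j - 1)"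
    proof (cases j)
      case 0 then show ?thesis using s monom by simp
    next
      case (Suc j')
      have "mnm s i \<otimes>\<^bsub>P\<^esub> mnm ([j] \<cdot> t) j' = mnm (s \<otimes> [j] \<cdot> t) (i + j')"
        using s monom by (intro UP.monom_mult[symmetric]) auto
      then show ?thesis using Suc s monom
        by (simp add: UP.R.add_pow_rdistr del: UP.monom_mult UP.R.add.nat_pow_Suc)
    qed
    have 2: "mnm t j \<otimes>\<^bsub>P\<^esub> mnm ([i] \<cdot> s) (i - 1) = mnm ([i] \<cdot> (s \<otimes> t)) (i + j - 1)"
    proof (cases i)
      case 0 then show ?thesis using s monom by simp
    next
      case (Suc i')
      have "mnm t j \<otimes>\<^bsub>P\<^esub> mnm ([i] \<cdot> s) i' = mnm (t \<otimes> [i] \<cdot> s) (j + i')"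
        using s monom by (intro UP.monom_mult[symmetric]) auto
      then show ?thesis using Suc s monom
        by (simp add: UP.R.add_pow_rdistr UP.R.m_comm[of t] add.commute[of j] del: UP.monom_mult UP.R.add.nat_pow_Suc)
    qed
    have "mnm s i \<otimes>\<^bsub>P\<^esub> mnm t j = mnm (s \<otimes> t) (i + j)" using s monom by simp
    then have "up_deriv (mnm s i \<otimes>\<^bsub>P\<^esub> mnm t j) = mnm ([(i + j)] \<cdot> (s \<otimes> t)) (i + j - 1)"
      using s monom by (simp only: up_deriv_monom UP.R.m_closed)
    also have "[(i + j)] \<cdot> (s \<otimes> t) = [j] \<cdot> (s \<otimes> t) \<oplus> [i] \<cdot> (s \<otimes> t)"
      using s monom by (simp add: UP.R.add.nat_pow_mult add.commute)
    also have "mnm ([j] \<cdot> (s \<otimes> t) \<oplus> [i] \<cdot> (s \<otimes> t)) (i + j - 1) =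
        mnm ([j] \<cdot> (s \<otimes> t)) (i + j - 1) \<oplus>\<^bsub>P\<^esub> mnm ([i] \<cdot> (s \<otimes> t)) (i + j - 1)"
      using s monom by (intro UP.monom_add) auto
    finally show ?case unfolding up_deriv_monom[OF s] up_deriv_monom[OF monom] 1 2 .
  qed
qed

lemma coeff_d_mult:
  assumes p: "p \<in> carrier P" and q: "q \<in> carrier P"
  shows "coeff_d (p \<otimes>\<^bsub>P\<^esub> q) = p \<odot>\<^bsub>PM\<^esub> coeff_d q \<oplus>\<^bsub>PM\<^esub> q \<odot>\<^bsub>PM\<^esub> coeff_d p"
  using p
proof (induction rule: UP.UP_induct)
  case (add p p')
  then show ?case using q
    by (simp add: UP.P.l_distr coeff_d_add coeff_d_closed PMod.PM_smult_l_distr PMod.PM_smult_r_distr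
        PMod.PM_smult_closed PMod.PM.M.a_ac del: PMod.PM_simps)
next
  case (monom s i)
  note s = monom
  show ?case using q
  proof (induction rule: UP.UP_induct)
    case (add q q')
    then show ?case using s
      by (simp add: UP.P.r_distr coeff_d_add coeff_d_closed PMod.PM_smult_l_distr PMod.PM_smult_r_distr
        PMod.PM_smult_closed PMod.PM.M.a_ac del: PMod.PM_simps)
  next
    case (monom t j)
    have "mnm s i \<otimes>\<^bsub>P\<^esub> mnm t j = mnm (s \<otimes> t) (i + j)" using s monom by simp
    then have "coeff_d (mnm s i \<otimes>\<^bsub>P\<^esub> mnm t j) = sgl (dS (s \<otimes> t)) (i + j)"
      using s monom by (simp only: coeff_d_monom UP.R.m_closed)
    then show ?case using s monom
      by (simp add: coeff_d_monom PMod.mnm_smult_sgl \<Omega>S.d_mult PMod.sgl_add add.commute[of j] del: PMod.PM_simps)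
  qed
qed

section \<open>Mutually inverse maps between the differentials of \<open>A\<close> and
  \<open>S[x] dx\<close> plus \<open>M[x]\<close>\<close>

abbreviation "DS \<equiv> direct_sum (regular_module P) PM"
text \<open>Scalars are transported along \<open>c\<close>, because the universal property of the
  differentials of \<open>A\<close> asks for an \<open>A\<close>-module as target.\<close>

abbreviation "L \<equiv> restrict_scalars c DS"

lemma DS_module: "module P DS"
  by (intro direct_sum_is_module cring_regular_module PMod.P_cring PMod.PM_module)

lemma L_module: "module A L"
  by (rule module_restrict_scalars[OF A_cring DS_module c_hom])

sublocale L: module A L by (rule L_module)

lemma L_simps: "carrier L = carrier P \<times> carrier PM" "u \<oplus>\<^bsub>L\<^esub> v = (fst u \<oplus>\<^bsub>P\<^esub> fst v, snd u \<oplus>\<^bsub>PM\<^esub> snd v)"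
  "\<zero>\<^bsub>L\<^esub> = (\<zero>\<^bsub>P\<^esub>, \<zero>\<^bsub>PM\<^esub>)" "a \<odot>\<^bsub>L\<^esub> u = (c a \<otimes>\<^bsub>P\<^esub> fst u, c a \<odot>\<^bsub>PM\<^esub> snd u)"
  by (simp_all add: restrict_scalars_def direct_sum_def regular_module_def)

text \<open>\<open>d(\<Sum> s\<^sub>i x\<^sup>i)\<close> is sent to \<open>(\<Sum> i s\<^sub>i x\<^bsup>i-1\<^esup>, \<Sum> (d s\<^sub>i) x\<^sup>i)\<close>; the first component is the coefficient of \<open>dx\<close>.\<close>

definition \<Phi> :: "('a \<Rightarrow> 'a) set \<Rightarrow> (nat \<Rightarrow> 's) \<times> (nat \<Rightarrow> ('s \<Rightarrow> 's) set)" where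
  "\<Phi> = (SOME g. mod_hom A \<Omega> L g \<and> (\<forall>a\<in>carrier A. g (dA a) = (up_deriv (c a), coeff_d (c a))))"

lemma \<Phi>: "mod_hom A \<Omega> L \<Phi>" and \<Phi>_d: "a \<in> carrier A \<Longrightarrow> \<Phi> (dA a) = (up_deriv (c a), coeff_d (c a))"
proof -
  have "\<exists>g. mod_hom A \<Omega> L g \<and> (\<forall>a\<in>carrier A. g (dA a) = (up_deriv (c a), coeff_d (c a)))"
  proof (rule \<Omega>A.omega_universal[OF L_module, of "\<lambda>a. (up_deriv (c a), coeff_d (c a))"])
    show "\<exists>g. mod_hom A \<Omega> L g \<and> (\<forall>a\<in>carrier A. g (dA a) = (up_deriv (c a), coeff_d (c a)))"
      if "mod_hom A \<Omega> L g" "\<And>a. a \<in> carrier A \<Longrightarrow> g (dA a) = (up_deriv (c a), coeff_d (c a))" for g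
      using that by blast
  next
    fix k assume k: "k \<in> carrier K"
    have "\<phi> k \<in> carrier S" by (rule \<Omega>S.phi_closed[OF k])
    then have "c (\<alpha> k) = mnm (\<phi> k) 0" using c_\<epsilon>[of "mnm (\<phi> k) 0"] k by (simp add: \<epsilon>_monom \<alpha>_eq)
    then show "(up_deriv (c (\<alpha> k)), coeff_d (c (\<alpha> k))) = \<zero>\<^bsub>L\<^esub>"
      using k \<open>\<phi> k \<in> carrier S\<close>
      by (simp add: up_deriv_monom coeff_d_monom \<Omega>S.d_const PMod.sgl_zero L_simps del: PMod.PM_simps)
  qed (auto simp: L_simps up_deriv_closed coeff_d_closed up_deriv_add coeff_d_add up_deriv_mult coeff_d_mult simp del: PMod.PM_simps)
  then have "mod_hom A \<Omega> L \<Phi> \<and> (\<forall>a\<in>carrier A. \<Phi> (dA a) = (up_deriv (c a), coeff_d (c a)))"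
    unfolding \<Phi>_def by (rule someI_ex)
  then show "mod_hom A \<Omega> L \<Phi>" "a \<in> carrier A \<Longrightarrow> \<Phi> (dA a) = (up_deriv (c a), coeff_d (c a))" by auto
qed

sublocale \<Phi>: mod_hom A \<Omega> L \<Phi> by (rule \<Phi>)

abbreviation "\<Omega>h \<equiv> restrict_scalars h \<Omega>"

lemma \<Omega>h_module: "module S \<Omega>h"
  by (rule module_restrict_scalars[OF S_cring \<Omega>A.omega_module h_hom])

lemma \<Omega>h_simps: "carrier \<Omega>h = carrier \<Omega>" "add \<Omega>h = add \<Omega>" "zero \<Omega>h = zero \<Omega>"
  "s \<odot>\<^bsub>\<Omega>h\<^esub> w = h s \<odot>\<^bsub>\<Omega>\<^esub> w"
  by (simp_all add: restrict_scalars_def)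

text \<open>The map of differentials induced by the ring homomorphism \<open>h\<close>; its target
  is the differentials of \<open>A\<close> regarded as an \<open>S\<close>-module.\<close>

definition \<iota> :: "('s \<Rightarrow> 's) set \<Rightarrow> ('a \<Rightarrow> 'a) set" where
  "\<iota> = (SOME g. mod_hom S M \<Omega>h g \<and> (\<forall>s\<in>carrier S. g (dS s) = dA (h s)))"

lemma \<iota>: "mod_hom S M \<Omega>h \<iota>" and \<iota>_d: "s \<in> carrier S \<Longrightarrow> \<iota> (dS s) = dA (h s)"
proof -
  have "\<exists>g. mod_hom S M \<Omega>h g \<and> (\<forall>s\<in>carrier S. g (dS s) = dA (h s))"
  proof (rule \<Omega>S.omega_universal[OF \<Omega>h_module, of "\<lambda>s. dA (h s)"])
    show "\<exists>g. mod_hom S M \<Omega>h g \<and> (\<forall>s\<in>carrier S. g (dS s) = dA (h s))"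
      if "mod_hom S M \<Omega>h g" "\<And>s. s \<in> carrier S \<Longrightarrow> g (dS s) = dA (h s)" for g
      using that by blast
    show "dA (h (\<phi> k)) = \<zero>\<^bsub>\<Omega>h\<^esub>" if k: "k \<in> carrier K" for k
      using \<Omega>A.d_const[OF k] k by (simp add: \<alpha>_eq \<Omega>h_simps)
  qed (auto simp: \<Omega>h_simps \<Omega>A.d_add \<Omega>A.d_mult)
  then have "mod_hom S M \<Omega>h \<iota> \<and> (\<forall>s\<in>carrier S. \<iota> (dS s) = dA (h s))"
    unfolding \<iota>_def by (rule someI_ex)
  then show "mod_hom S M \<Omega>h \<iota>" "s \<in> carrier S \<Longrightarrow> \<iota> (dS s) = dA (h s)" by auto
qed

lemma \<iota>_closed: "m \<in> carrier M \<Longrightarrow> \<iota> m \<in> carrier \<Omega>"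
  and \<iota>_add: "m \<in> carrier M \<Longrightarrow> m' \<in> carrier M \<Longrightarrow> \<iota> (m \<oplus>\<^bsub>M\<^esub> m') = \<iota> m \<oplus>\<^bsub>\<Omega>\<^esub> \<iota> m'"
  and \<iota>_smult: "s \<in> carrier S \<Longrightarrow> m \<in> carrier M \<Longrightarrow> \<iota> (s \<odot>\<^bsub>M\<^esub> m) = h s \<odot>\<^bsub>\<Omega>\<^esub> \<iota> m"
  using mod_homD[OF \<iota>] by (simp_all add: \<Omega>h_simps)

definition \<kappa> :: "(nat \<Rightarrow> ('s \<Rightarrow> 's) set) \<Rightarrow> ('a \<Rightarrow> 'a) set" where
  "\<kappa> = PMod.coeff_sum \<Omega> (\<lambda>i m. (x [^]\<^bsub>A\<^esub> i) \<odot>\<^bsub>\<Omega>\<^esub> \<iota> m)"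

lemma
  shows \<kappa>_closed: "f \<in> carrier PM \<Longrightarrow> \<kappa> f \<in> carrier \<Omega>"
    and \<kappa>_add: "f \<in> carrier PM \<Longrightarrow> g \<in> carrier PM \<Longrightarrow> \<kappa> (f \<oplus>\<^bsub>PM\<^esub> g) = \<kappa> f \<oplus>\<^bsub>\<Omega>\<^esub> \<kappa> g"
    and \<kappa>_sgl: "m \<in> carrier M \<Longrightarrow> \<kappa> (sgl m i) = (x [^]\<^bsub>A\<^esub> i) \<odot>\<^bsub>\<Omega>\<^esub> \<iota> m"
proof -
  have *: "abelian_group \<Omega>" "\<And>i m. m \<in> carrier M \<Longrightarrow> x [^]\<^bsub>A\<^esub> (i::nat) \<odot>\<^bsub>\<Omega>\<^esub> \<iota> m \<in> carrier \<Omega>"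
    "\<And>i m m'. m \<in> carrier M \<Longrightarrow> m' \<in> carrier M \<Longrightarrow> x [^]\<^bsub>A\<^esub> (i::nat) \<odot>\<^bsub>\<Omega>\<^esub> \<iota> (m \<oplus>\<^bsub>M\<^esub> m') =
      x [^]\<^bsub>A\<^esub> i \<odot>\<^bsub>\<Omega>\<^esub> \<iota> m \<oplus>\<^bsub>\<Omega>\<^esub> x [^]\<^bsub>A\<^esub> i \<odot>\<^bsub>\<Omega>\<^esub> \<iota> m'"
    by (auto simp: \<iota>_closed \<iota>_add \<Omega>A.\<Omega>.smult_r_distr \<Omega>A.\<Omega>.M.abelian_group_axioms)
  show "f \<in> carrier PM \<Longrightarrow> \<kappa> f \<in> carrier \<Omega>" unfolding \<kappa>_def by (rule PMod.coeff_sum_closed[OF *])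
  show "f \<in> carrier PM \<Longrightarrow> g \<in> carrier PM \<Longrightarrow> \<kappa> (f \<oplus>\<^bsub>PM\<^esub> g) = \<kappa> f \<oplus>\<^bsub>\<Omega>\<^esub> \<kappa> g"
    unfolding \<kappa>_def by (rule PMod.coeff_sum_add[OF *])
  show "m \<in> carrier M \<Longrightarrow> \<kappa> (sgl m i) = (x [^]\<^bsub>A\<^esub> i) \<odot>\<^bsub>\<Omega>\<^esub> \<iota> m"
    unfolding \<kappa>_def by (rule PMod.coeff_sum_sgl[OF *])
qed

lemma \<kappa>_smult: "p \<in> carrier P \<Longrightarrow> f \<in> carrier PM \<Longrightarrow> \<kappa> (p \<odot>\<^bsub>PM\<^esub> f) = \<epsilon> p \<odot>\<^bsub>\<Omega>\<^esub> \<kappa> f"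
proof (induction arbitrary: f rule: UP.UP_induct)
  case (add p q)
  then show ?case
    by (simp add: PMod.PM_smult_l_distr \<kappa>_add PMod.PM_smult_closed \<Omega>A.\<Omega>.smult_l_distr \<kappa>_closed del: PMod.PM_simps)
next
  case (monom a i)
  show ?case using monom(2)
  proof (induction rule: PMod.PM_induct)
    case (add f g)
    then show ?case using monom(1)
      by (simp add: PMod.PM_smult_r_distr \<kappa>_add PMod.PM_smult_closed \<Omega>A.\<Omega>.smult_r_distr \<kappa>_closed del: PMod.PM_simps)
  next
    case (sgl m j)
    have "h a \<otimes>\<^bsub>A\<^esub> (x [^]\<^bsub>A\<^esub> i \<otimes>\<^bsub>A\<^esub> x [^]\<^bsub>A\<^esub> j) = x [^]\<^bsub>A\<^esub> (i + j) \<otimes>\<^bsub>A\<^esub> h a"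
      using monom(1) by (simp add: A.nat_pow_mult A.m_comm)
    then show ?case using sgl monom(1)
      by (simp add: PMod.mnm_smult_sgl \<kappa>_sgl \<iota>_smult \<iota>_closed \<epsilon>_monom A.m_assoc flip: \<Omega>A.\<Omega>.smult_assoc1)
  qed
qed

text \<open>The inverse of \<open>\<Phi>\<close>.\<close>

definition \<Psi> :: "(nat \<Rightarrow> 's) \<times> (nat \<Rightarrow> ('s \<Rightarrow> 's) set) \<Rightarrow> ('a \<Rightarrow> 'a) set" where
  "\<Psi> u = \<epsilon> (fst u) \<odot>\<^bsub>\<Omega>\<^esub> dA x \<oplus>\<^bsub>\<Omega>\<^esub> \<kappa> (snd u)"

lemma \<Psi>_add: "u \<in> carrier L \<Longrightarrow> v \<in> carrier L \<Longrightarrow> \<Psi> (u \<oplus>\<^bsub>L\<^esub> v) = \<Psi> u \<oplus>\<^bsub>\<Omega>\<^esub> \<Psi> v"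
  by (auto simp: \<Psi>_def L_simps \<Omega>A.\<Omega>.smult_l_distr \<kappa>_add \<kappa>_closed \<Omega>A.\<Omega>.M.a_ac simp del: PMod.PM_simps)

lemma \<Psi>_smult: "a \<in> carrier A \<Longrightarrow> u \<in> carrier L \<Longrightarrow> \<Psi> (a \<odot>\<^bsub>L\<^esub> u) = a \<odot>\<^bsub>\<Omega>\<^esub> \<Psi> u"
  by (auto simp: \<Psi>_def L_simps \<Omega>A.\<Omega>.smult_r_distr \<Omega>A.\<Omega>.smult_assoc1 \<kappa>_smult \<kappa>_closed \<epsilon>_c)

text \<open>On monomials this is \<open>d(s x^j) = j s x^(j-1) dx + x^j ds\<close>, proved by
  induction on \<open>j\<close> from the product rule for \<open>x\<close> and \<open>s x^j\<close>.
  It says that \<Psi> undoes \<Phi> on exact differentials.\<close>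

lemma \<Psi>_D: "p \<in> carrier P \<Longrightarrow> \<Psi> (up_deriv p, coeff_d p) = dA (\<epsilon> p)"
proof (induction rule: UP.UP_induct)
  case (add p q)
  have "\<Psi> (up_deriv (p \<oplus>\<^bsub>P\<^esub> q), coeff_d (p \<oplus>\<^bsub>P\<^esub> q)) = \<Psi> ((up_deriv p, coeff_d p) \<oplus>\<^bsub>L\<^esub> (up_deriv q, coeff_d q))"
    using add by (simp add: L_simps up_deriv_add coeff_d_add)
  also have "\<dots> = dA (\<epsilon> p) \<oplus>\<^bsub>\<Omega>\<^esub> dA (\<epsilon> q)"
    using add by (subst \<Psi>_add) (auto simp: L_simps up_deriv_closed coeff_d_closed)
  finally show ?case using add by (simp add: \<Omega>A.d_add)
next
  case (monom s j)
  have hs: "h s \<in> carrier A" using monom by simp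
  have "\<epsilon> (mnm ([j] \<cdot> s) (j - 1)) \<odot>\<^bsub>\<Omega>\<^esub> dA x \<oplus>\<^bsub>\<Omega>\<^esub> x [^]\<^bsub>A\<^esub> j \<odot>\<^bsub>\<Omega>\<^esub> dA (h s) = dA (h s \<otimes>\<^bsub>A\<^esub> x [^]\<^bsub>A\<^esub> j)"
  proof (induction j)
    case 0 then show ?case using monom hs by simp
  next
    case (Suc j)
    \<comment> \<open>Multiplying by \<open>x\<close> restores the exponent lowered by
      differentiation; at \<open>j = 0\<close>, where the exponent is truncated, both sides
      vanish.\<close>
    have e: "x \<otimes>\<^bsub>A\<^esub> \<epsilon> (mnm ([j] \<cdot> s) (j - 1)) = h ([j] \<cdot> s) \<otimes>\<^bsub>A\<^esub> x [^]\<^bsub>A\<^esub> j"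
    proof (cases j)
      case 0 then show ?thesis using monom by simp
    next
      case (Suc i) then show ?thesis using monom
        by (simp add: \<epsilon>_monom A.m_assoc A.m_comm[of x] del: UP.R.add.nat_pow_Suc h.hom_add UP.monom_add)
    qed
    let ?\<omega> = "dA x" and ?\<eta> = "dA (h s)" and ?u = "\<epsilon> (mnm ([j] \<cdot> s) (j - 1))"
    have u: "?u \<in> carrier A" using monom by simp
    have "dA (h s \<otimes>\<^bsub>A\<^esub> x [^]\<^bsub>A\<^esub> Suc j) = dA (x \<otimes>\<^bsub>A\<^esub> (h s \<otimes>\<^bsub>A\<^esub> x [^]\<^bsub>A\<^esub> j))"
      using hs by (simp add: A.m_assoc A.m_comm[of x])
    also have "\<dots> = x \<odot>\<^bsub>\<Omega>\<^esub> (?u \<odot>\<^bsub>\<Omega>\<^esub> ?\<omega> \<oplus>\<^bsub>\<Omega>\<^esub> x [^]\<^bsub>A\<^esub> j \<odot>\<^bsub>\<Omega>\<^esub> ?\<eta>) \<oplus>\<^bsub>\<Omega>\<^esub> (h s \<otimes>\<^bsub>A\<^esub> x [^]\<^bsub>A\<^esub> j) \<odot>\<^bsub>\<Omega>\<^esub> ?\<omega>"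
      unfolding Suc.IH using hs by (simp add: \<Omega>A.d_mult)
    also have "\<dots> = (x \<otimes>\<^bsub>A\<^esub> ?u) \<odot>\<^bsub>\<Omega>\<^esub> ?\<omega> \<oplus>\<^bsub>\<Omega>\<^esub> (h s \<otimes>\<^bsub>A\<^esub> x [^]\<^bsub>A\<^esub> j) \<odot>\<^bsub>\<Omega>\<^esub> ?\<omega> \<oplus>\<^bsub>\<Omega>\<^esub> (x \<otimes>\<^bsub>A\<^esub> x [^]\<^bsub>A\<^esub> j) \<odot>\<^bsub>\<Omega>\<^esub> ?\<eta>"
      using hs u by (simp add: \<Omega>A.\<Omega>.smult_r_distr \<Omega>A.\<Omega>.smult_assoc1 \<Omega>A.\<Omega>.M.a_ac)
    also have "\<dots> = (h ([j] \<cdot> s) \<otimes>\<^bsub>A\<^esub> x [^]\<^bsub>A\<^esub> j \<oplus>\<^bsub>A\<^esub> h s \<otimes>\<^bsub>A\<^esub> x [^]\<^bsub>A\<^esub> j) \<odot>\<^bsub>\<Omega>\<^esub> ?\<omega> \<oplus>\<^bsub>\<Omega>\<^esub> x [^]\<^bsub>A\<^esub> Suc j \<odot>\<^bsub>\<Omega>\<^esub> ?\<eta>"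
      unfolding e using hs monom by (simp add: \<Omega>A.\<Omega>.smult_l_distr A.m_comm)
    also have "h ([j] \<cdot> s) \<otimes>\<^bsub>A\<^esub> x [^]\<^bsub>A\<^esub> j \<oplus>\<^bsub>A\<^esub> h s \<otimes>\<^bsub>A\<^esub> x [^]\<^bsub>A\<^esub> j = \<epsilon> (mnm ([Suc j] \<cdot> s) (Suc j - 1))"
      using monom hs by (simp add: \<epsilon>_monom A.l_distr)
    finally show ?case by simp
  qed
  then show ?case using monom
    by (simp add: \<Psi>_def up_deriv_monom coeff_d_monom \<kappa>_sgl \<iota>_d \<epsilon>_monom del: UP.R.add.nat_pow_Suc)
qed

text \<open>This composite yields injectivity of \<Phi>. Surjectivity is obtained separately, by
  hitting the monomials in both summands with homogeneous differentials.\<close>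

lemma \<Psi>_\<Phi>: "w \<in> carrier \<Omega> \<Longrightarrow> \<Psi> (\<Phi> w) = w"
proof (induction rule: \<Omega>A.omega_induct)
  case zero
  have "\<Psi> \<zero>\<^bsub>L\<^esub> = \<zero>\<^bsub>A\<^esub> \<odot>\<^bsub>\<Omega>\<^esub> \<Psi> \<zero>\<^bsub>L\<^esub>" using \<Psi>_smult[of "\<zero>\<^bsub>A\<^esub>" "\<zero>\<^bsub>L\<^esub>"] by simp
  moreover have "\<Psi> \<zero>\<^bsub>L\<^esub> \<in> carrier \<Omega>"
    by (simp add: \<Psi>_def L_simps \<kappa>_closed PMod.PM.M.zero_closed del: PMod.PM_simps)
  ultimately show ?case by simp
next
  case (gen a b w)
  have "\<Psi> (\<Phi> (a \<odot>\<^bsub>\<Omega>\<^esub> dA b \<oplus>\<^bsub>\<Omega>\<^esub> w)) = \<Psi> (a \<odot>\<^bsub>L\<^esub> (up_deriv (c b), coeff_d (c b)) \<oplus>\<^bsub>L\<^esub> \<Phi> w)"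
    using gen by (simp add: \<Phi>.f_add \<Phi>.f_smult \<Phi>_d)
  also have "\<dots> = a \<odot>\<^bsub>\<Omega>\<^esub> \<Psi> (up_deriv (c b), coeff_d (c b)) \<oplus>\<^bsub>\<Omega>\<^esub> w"
  proof -
    have v: "(up_deriv (c b), coeff_d (c b)) \<in> carrier L" using gen by (simp add: L_simps up_deriv_closed coeff_d_closed)
    show ?thesis
      unfolding \<Psi>_add[OF L.smult_closed[OF gen(1) v] \<Phi>.f_im[OF gen(3)]] \<Psi>_smult[OF gen(1) v] gen(4) ..
  qed
  finally show ?case using gen by (simp add: \<Psi>_D \<epsilon>_c)
qed

lemma c_monom: "s \<in> carrier S \<Longrightarrow> c (h s \<otimes>\<^bsub>A\<^esub> x [^]\<^bsub>A\<^esub> i) = mnm s i"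
  using c_\<epsilon>[of "mnm s i"] by (simp add: \<epsilon>_monom)

lemma \<Phi>_monom_dx: "s \<in> carrier S \<Longrightarrow> \<Phi> ((h s \<otimes>\<^bsub>A\<^esub> x [^]\<^bsub>A\<^esub> i) \<odot>\<^bsub>\<Omega>\<^esub> dA x) = (mnm s i, \<zero>\<^bsub>PM\<^esub>)"
proof -
  assume s: "s \<in> carrier S"
  have cx: "c x = mnm \<one> 1" using c_monom[of \<one> 1] by (simp del: c.hom_mult)
  have "\<phi> \<one>\<^bsub>K\<^esub> = \<one>" by (rule Ring.ring_hom_one[OF \<phi>_hom])
  then have d1: "dS \<one> = \<zero>\<^bsub>M\<^esub>" using \<Omega>S.d_const[of "\<one>\<^bsub>K\<^esub>"] by simp
  have "mnm s i \<otimes>\<^bsub>P\<^esub> mnm \<one> 0 = mnm (s \<otimes> \<one>) (i + 0)"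
    using s by (intro UP.monom_mult[symmetric]) auto
  then show ?thesis using s
    by (simp add: \<Phi>.f_smult \<Phi>_d cx up_deriv_monom coeff_d_monom L_simps c_monom d1 PMod.sgl_zero PMod.PM.smult_r_null
        del: UP.monom_mult UP.monom_one PMod.PM_simps c.hom_mult)
qed

lemma \<Phi>_monom_dS: "s \<in> carrier S \<Longrightarrow> t \<in> carrier S \<Longrightarrow>
  \<Phi> ((h s \<otimes>\<^bsub>A\<^esub> x [^]\<^bsub>A\<^esub> i) \<odot>\<^bsub>\<Omega>\<^esub> dA (h t)) = (\<zero>\<^bsub>P\<^esub>, sgl (s \<odot>\<^bsub>M\<^esub> dS t) i)"
  using c_monom[of t 0]
  by (simp add: \<Phi>.f_smult \<Phi>_d up_deriv_monom coeff_d_monom L_simps c_monom PMod.mnm_smult_sgl del: PMod.PM_simps c.hom_mult)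

section \<open>The gradings of \<open>A\<close>, of its differentials, and of the direct sum\<close>

definition grA :: "int \<Rightarrow> 'a set" where
  "grA i = (if i < 0 then {\<zero>\<^bsub>A\<^esub>} else {h s \<otimes>\<^bsub>A\<^esub> x [^]\<^bsub>A\<^esub> nat i | s. s \<in> carrier S})"

abbreviation "gr\<Omega> \<equiv> kaehler_grade K A \<alpha> grA"

text \<open>The general element \<open>s x^(i-1) dx + m x^i\<close> of degree \<open>i\<close>.
  Since \<open>dx\<close> has degree one, the first summand is absent up to degree \<open>0\<close>,
  and then the value does not depend on \<open>s\<close>.\<close>

definition hcL :: "int \<Rightarrow> 's \<Rightarrow> ('s \<Rightarrow> 's) set \<Rightarrow> (nat \<Rightarrow> 's) \<times> (nat \<Rightarrow> ('s \<Rightarrow> 's) set)" where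
  "hcL i s m = (if i \<le> 0 then \<zero>\<^bsub>P\<^esub> else mnm s (nat (i - 1)), if i < 0 then \<zero>\<^bsub>PM\<^esub> else sgl m (nat i))"

definition grL :: "int \<Rightarrow> ((nat \<Rightarrow> 's) \<times> (nat \<Rightarrow> ('s \<Rightarrow> 's) set)) set" where
  "grL i = {hcL i s m | s m. s \<in> carrier S \<and> m \<in> carrier M}"

lemma hcL_closed: "s \<in> carrier S \<Longrightarrow> m \<in> carrier M \<Longrightarrow> hcL i s m \<in> carrier L"
  by (auto simp: hcL_def L_simps PMod.sgl_closed PMod.PM.M.zero_closed simp del: PMod.PM_simps)

lemma hcL_add: "s \<in> carrier S \<Longrightarrow> s' \<in> carrier S \<Longrightarrow> m \<in> carrier M \<Longrightarrow> m' \<in> carrier M \<Longrightarrow>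
    hcL i (s \<oplus> s') (m \<oplus>\<^bsub>M\<^esub> m') = hcL i s m \<oplus>\<^bsub>L\<^esub> hcL i s' m'"
  by (simp add: hcL_def L_simps PMod.sgl_add PMod.PM.M.zero_closed del: PMod.PM_simps)

lemma hcL_zero: "hcL i \<zero> \<zero>\<^bsub>M\<^esub> = \<zero>\<^bsub>L\<^esub>"
  by (simp add: hcL_def L_simps PMod.sgl_zero del: PMod.PM_simps)

lemma grA_I: "s \<in> carrier S \<Longrightarrow> h s \<otimes>\<^bsub>A\<^esub> x [^]\<^bsub>A\<^esub> i \<in> grA (int i)" for i :: nat
proof -
  assume s: "s \<in> carrier S"
  have "nat (int i) = i" "\<not> int i < 0" by simp_all
  then show ?thesis unfolding grA_def using s by (simp only: if_False) blast
qed

lemma h_in_grA: "s \<in> carrier S \<Longrightarrow> h s \<in> grA 0"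
  using grA_I[of s 0] by simp

lemma x_in_grA: "x \<in> grA 1"
  using grA_I[of \<one> 1] by simp

lemma grA_closed: "a \<in> grA i \<Longrightarrow> a \<in> carrier A"
  by (auto simp: grA_def simp del: pow_nat split: if_splits)

lemma gr\<Omega>_gens_closed:
  "{a \<odot>\<^bsub>\<Omega>\<^esub> dA b | a b j k. a \<in> grA j \<and> b \<in> grA k \<and> j + k = i} \<subseteq> carrier \<Omega>"
  using grA_closed by blast

lemma gr\<Omega>_subgroup: "subgroup (gr\<Omega> i) (add_monoid \<Omega>)"
  unfolding kaehler_grade_def
  by (rule \<Omega>A.\<Omega>.M.add.generate_is_subgroup) (use gr\<Omega>_gens_closed in simp)

lemma gr\<Omega>_gen: "a \<in> grA j \<Longrightarrow> b \<in> grA k \<Longrightarrow> j + k = i \<Longrightarrow> a \<odot>\<^bsub>\<Omega>\<^esub> dA b \<in> gr\<Omega> i"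
  unfolding kaehler_grade_def by (rule generate.incl) blast

lemma gr\<Omega>_add: "u \<in> gr\<Omega> i \<Longrightarrow> v \<in> gr\<Omega> i \<Longrightarrow> u \<oplus>\<^bsub>\<Omega>\<^esub> v \<in> gr\<Omega> i"
  using subgroup.m_closed[OF gr\<Omega>_subgroup] by simp

lemma gr\<Omega>_zero: "\<zero>\<^bsub>\<Omega>\<^esub> \<in> gr\<Omega> i"
  using subgroup.one_closed[OF gr\<Omega>_subgroup] by simp

lemma gr\<Omega>_closed: "u \<in> gr\<Omega> i \<Longrightarrow> u \<in> carrier \<Omega>"
  using subgroup.subset[OF gr\<Omega>_subgroup] by auto

lemma grL_zero: "\<zero>\<^bsub>L\<^esub> \<in> grL i"
  unfolding grL_def hcL_zero[of i, symmetric] using \<Omega>S.\<Omega>.M.zero_closed by blast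

lemma grL_add: "u \<in> grL i \<Longrightarrow> v \<in> grL i \<Longrightarrow> u \<oplus>\<^bsub>L\<^esub> v \<in> grL i"
proof -
  assume "u \<in> grL i" "v \<in> grL i"
  then obtain s m s' m' where *: "s \<in> carrier S" "m \<in> carrier M" "s' \<in> carrier S" "m' \<in> carrier M"
    "u = hcL i s m" "v = hcL i s' m'" unfolding grL_def by blast
  then have "u \<oplus>\<^bsub>L\<^esub> v = hcL i (s \<oplus> s') (m \<oplus>\<^bsub>M\<^esub> m')" by (simp only: hcL_add)
  moreover have "s \<oplus> s' \<in> carrier S" "m \<oplus>\<^bsub>M\<^esub> m' \<in> carrier M" using * by auto
  ultimately show ?thesis unfolding grL_def by blast
qed

lemma grL_minus: "u \<in> grL i \<Longrightarrow> \<ominus>\<^bsub>L\<^esub> u \<in> grL i"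
proof -
  assume "u \<in> grL i"
  then obtain s m where u: "s \<in> carrier S" "m \<in> carrier M" "u = hcL i s m" by (auto simp: grL_def)
  have "hcL i (\<ominus> s) (\<ominus>\<^bsub>M\<^esub> m) \<oplus>\<^bsub>L\<^esub> u = \<zero>\<^bsub>L\<^esub>"
    using u by (simp add: UP.R.l_neg \<Omega>S.\<Omega>.M.l_neg hcL_zero flip: hcL_add)
  then have "\<ominus>\<^bsub>L\<^esub> u = hcL i (\<ominus> s) (\<ominus>\<^bsub>M\<^esub> m)"
    using u by (intro L.M.minus_equality hcL_closed) (simp_all add: hcL_closed)
  then show ?thesis using u by (auto simp: grL_def)
qed

text \<open>For nonnegative degrees the computation is
  \<open>s x^j d(t x^k) = k s t x^(j+k-1) dx + s x^(j+k) dt\<close>. In a negative degree one of the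
  two factors is zero.\<close>

lemma \<Phi>_gen:
  assumes a: "a \<in> grA j" and b: "b \<in> grA k" and i: "j + k = i"
  shows "\<Phi> (a \<odot>\<^bsub>\<Omega>\<^esub> dA b) \<in> grL i"
proof (cases "j < 0 \<or> k < 0")
  case True
  have d0: "dA \<zero>\<^bsub>A\<^esub> = \<zero>\<^bsub>\<Omega>\<^esub>" using \<Omega>A.d_mult[of "\<zero>\<^bsub>A\<^esub>" "\<zero>\<^bsub>A\<^esub>"] by simp
  have "a = \<zero>\<^bsub>A\<^esub> \<or> b = \<zero>\<^bsub>A\<^esub>" using True a b by (auto simp: grA_def split: if_splits)
  then have "a \<odot>\<^bsub>\<Omega>\<^esub> dA b = \<zero>\<^bsub>\<Omega>\<^esub>"
  proof
    assume "a = \<zero>\<^bsub>A\<^esub>"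
    then show ?thesis using \<Omega>A.\<Omega>.smult_l_null[OF \<Omega>A.d_closed[OF grA_closed[OF b]]] by simp
  next
    assume "b = \<zero>\<^bsub>A\<^esub>"
    then show ?thesis using \<Omega>A.\<Omega>.smult_r_null[OF grA_closed[OF a]] d0 by simp
  qed
  then show ?thesis using grL_zero by (simp only: \<Phi>.f0_is_0)
next
  case False
  then obtain j' k' where jk: "j = int j'" "k = int k'" by (metis nonneg_int_cases not_less)
  obtain s where s: "s \<in> carrier S" "a = h s \<otimes>\<^bsub>A\<^esub> x [^]\<^bsub>A\<^esub> j'"
    using a unfolding grA_def jk by (auto simp del: pow_nat)
  obtain t where t: "t \<in> carrier S" "b = h t \<otimes>\<^bsub>A\<^esub> x [^]\<^bsub>A\<^esub> k'"
    using b unfolding grA_def jk by (auto simp del: pow_nat)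
  note st = s(1) t(1)
  have ca: "c a = mnm s j'" unfolding s(2) by (rule c_monom[OF s(1)])
  have cb: "c b = mnm t k'" unfolding t(2) by (rule c_monom[OF t(1)])
  have 1: "\<Phi> (a \<odot>\<^bsub>\<Omega>\<^esub> dA b) = (mnm s j' \<otimes>\<^bsub>P\<^esub> mnm ([k'] \<cdot> t) (k' - 1), sgl (s \<odot>\<^bsub>M\<^esub> dS t) (j' + k'))"
    unfolding \<Phi>.f_smult[OF grA_closed[OF a] \<Omega>A.d_closed[OF grA_closed[OF b]]] \<Phi>_d[OF grA_closed[OF b]]
      cb up_deriv_monom[OF t(1)] coeff_d_monom[OF t(1)] L_simps ca fst_conv snd_conv
      PMod.mnm_smult_sgl[OF s(1) \<Omega>S.d_closed[OF t(1)]] ..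
  have 2: "mnm s j' \<otimes>\<^bsub>P\<^esub> mnm ([k'] \<cdot> t) (k' - 1) = (if i \<le> 0 then \<zero>\<^bsub>P\<^esub> else mnm (s \<otimes> [k'] \<cdot> t) (nat (i - 1)))"
  proof (cases k')
    case 0 then show ?thesis using st by simp
  next
    case (Suc l)
    have "nat (i - 1) = j' + l" "\<not> i \<le> 0" using i Suc jk by auto
    then show ?thesis using Suc st UP.monom_mult[of s "[k'] \<cdot> t" j' l]
      by (simp del: UP.monom_mult UP.R.add.nat_pow_Suc)
  qed
  have "nat i = j' + k'" "\<not> i < 0" using i jk by auto
  then have "\<Phi> (a \<odot>\<^bsub>\<Omega>\<^esub> dA b) = hcL i (s \<otimes> [k'] \<cdot> t) (s \<odot>\<^bsub>M\<^esub> dS t)"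
    unfolding 1 2 by (simp only: hcL_def if_False)
  moreover have "s \<otimes> [k'] \<cdot> t \<in> carrier S" "s \<odot>\<^bsub>M\<^esub> dS t \<in> carrier M" using st by auto
  ultimately show ?thesis unfolding grL_def by blast
qed

lemma \<Phi>_gr_subset: "w \<in> gr\<Omega> i \<Longrightarrow> \<Phi> w \<in> grL i"
proof -
  let ?H = "{w \<in> carrier \<Omega>. \<Phi> w \<in> grL i}"
  have "subgroup ?H (add_monoid \<Omega>)"
  proof (rule subgroup.intro)
    show "inv\<^bsub>add_monoid \<Omega>\<^esub> w \<in> ?H" if "w \<in> ?H" for w
      using that grL_minus \<Phi>.f_neg[of w] unfolding a_inv_def[symmetric] by simp
  qed (auto simp: \<Phi>.f_add grL_add grL_zero)
  moreover have "{a \<odot>\<^bsub>\<Omega>\<^esub> dA b | a b j k. a \<in> grA j \<and> b \<in> grA k \<and> j + k = i} \<subseteq> ?H"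
  proof
    fix w assume w: "w \<in> {a \<odot>\<^bsub>\<Omega>\<^esub> dA b | a b j k. a \<in> grA j \<and> b \<in> grA k \<and> j + k = i}"
    then obtain a b j k where "w = a \<odot>\<^bsub>\<Omega>\<^esub> dA b" "a \<in> grA j" "b \<in> grA k" "j + k = i" by blast
    then show "w \<in> ?H" using \<Phi>_gen[of a j b k i] grA_closed by simp
  qed
  ultimately have "gr\<Omega> i \<subseteq> ?H"
    unfolding kaehler_grade_def by (intro \<Omega>A.\<Omega>.M.add.generate_subgroup_incl)
  then show "w \<in> gr\<Omega> i \<Longrightarrow> \<Phi> w \<in> grL i" by blast
qed

text \<open>The coefficient \<open>m\<close> is a sum of terms \<open>s dt\<close>, and
  \<open>s dt\<close> at position \<open>i\<close> is the image of \<open>s x^i\<close> times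
  \<open>d (h t)\<close>, where \<open>h t\<close> has degree zero.\<close>

lemma \<Phi>_onto_sgl:
  assumes "m \<in> carrier M" shows "\<exists>w\<in>gr\<Omega> (int i). \<Phi> w = (\<zero>\<^bsub>P\<^esub>, sgl m i)"
  using assms
proof (induction rule: \<Omega>S.omega_induct)
  case zero
  then show ?case using gr\<Omega>_zero by (intro bexI[of _ "\<zero>\<^bsub>\<Omega>\<^esub>"]) (simp_all add: L_simps PMod.sgl_zero)
next
  case (gen s t m)
  then obtain w where w: "w \<in> gr\<Omega> (int i)" "\<Phi> w = (\<zero>\<^bsub>P\<^esub>, sgl m i)" by blast
  have g: "(h s \<otimes>\<^bsub>A\<^esub> x [^]\<^bsub>A\<^esub> i) \<odot>\<^bsub>\<Omega>\<^esub> dA (h t) \<in> gr\<Omega> (int i)"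
    by (rule gr\<Omega>_gen[OF grA_I[OF gen(1)] h_in_grA[OF gen(2)]]) simp
  have "\<Phi> ((h s \<otimes>\<^bsub>A\<^esub> x [^]\<^bsub>A\<^esub> i) \<odot>\<^bsub>\<Omega>\<^esub> dA (h t) \<oplus>\<^bsub>\<Omega>\<^esub> w) = (\<zero>\<^bsub>P\<^esub>, sgl (s \<odot>\<^bsub>M\<^esub> dS t) i) \<oplus>\<^bsub>L\<^esub> (\<zero>\<^bsub>P\<^esub>, sgl m i)"
    unfolding \<Phi>.f_add[OF gr\<Omega>_closed[OF g] gr\<Omega>_closed[OF w(1)]] \<Phi>_monom_dS[OF gen(1,2)] w(2) ..
  also have "\<dots> = (\<zero>\<^bsub>P\<^esub>, sgl (s \<odot>\<^bsub>M\<^esub> dS t \<oplus>\<^bsub>M\<^esub> m) i)"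
    using gen by (simp add: L_simps PMod.sgl_add del: PMod.PM_simps)
  finally show ?case by (rule bexI) (rule gr\<Omega>_add[OF g w(1)])
qed

lemma \<Phi>_onto_mnm:
  assumes "s \<in> carrier S" shows "\<exists>w\<in>gr\<Omega> (int i + 1). \<Phi> w = (mnm s i, \<zero>\<^bsub>PM\<^esub>)"
proof -
  have "(h s \<otimes>\<^bsub>A\<^esub> x [^]\<^bsub>A\<^esub> i) \<odot>\<^bsub>\<Omega>\<^esub> dA x \<in> gr\<Omega> (int i + 1)"
    by (rule gr\<Omega>_gen[OF grA_I[OF assms] x_in_grA]) simp
  from \<Phi>_monom_dx[OF assms, of i] this show ?thesis by (rule bexI)
qed

lemma \<Phi>_gr: "\<Phi> ` gr\<Omega> i = grL i"
proof
  show "\<Phi> ` gr\<Omega> i \<subseteq> grL i" using \<Phi>_gr_subset by blast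
  show "grL i \<subseteq> \<Phi> ` gr\<Omega> i"
  proof
    fix u assume "u \<in> grL i"
    then obtain s m where u: "s \<in> carrier S" "m \<in> carrier M" "u = hcL i s m" by (auto simp: grL_def)
    have 1: "\<exists>w\<in>gr\<Omega> i. \<Phi> w = (if i \<le> 0 then \<zero>\<^bsub>P\<^esub> else mnm s (nat (i - 1)), \<zero>\<^bsub>PM\<^esub>)"
    proof (cases "i \<le> 0")
      case True then show ?thesis using gr\<Omega>_zero[of i] by (intro bexI[of _ "\<zero>\<^bsub>\<Omega>\<^esub>"]) (simp_all add: L_simps)
    next
      case False then show ?thesis using \<Phi>_onto_mnm[OF u(1), of "nat (i - 1)"] by simp
    qed
    have 2: "\<exists>w\<in>gr\<Omega> i. \<Phi> w = (\<zero>\<^bsub>P\<^esub>, if i < 0 then \<zero>\<^bsub>PM\<^esub> else sgl m (nat i))"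
    proof (cases "i < 0")
      case True then show ?thesis using gr\<Omega>_zero[of i] by (intro bexI[of _ "\<zero>\<^bsub>\<Omega>\<^esub>"]) (simp_all add: L_simps)
    next
      case False then show ?thesis using \<Phi>_onto_sgl[OF u(2), of "nat i"] by simp
    qed
    obtain w w' where w: "w \<in> gr\<Omega> i" "\<Phi> w = (if i \<le> 0 then \<zero>\<^bsub>P\<^esub> else mnm s (nat (i - 1)), \<zero>\<^bsub>PM\<^esub>)"
      and w': "w' \<in> gr\<Omega> i" "\<Phi> w' = (\<zero>\<^bsub>P\<^esub>, if i < 0 then \<zero>\<^bsub>PM\<^esub> else sgl m (nat i))" using 1 2 by blast
    have "\<Phi> (w \<oplus>\<^bsub>\<Omega>\<^esub> w') = u"
      unfolding \<Phi>.f_add[OF gr\<Omega>_closed[OF w(1)] gr\<Omega>_closed[OF w'(1)]] w(2) w'(2) u(3) hcL_def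
      using u by (simp add: L_simps PMod.PM.M.zero_closed PMod.sgl_closed del: PMod.PM_simps)
    from image_eqI[where f = \<Phi>, OF this[symmetric] gr\<Omega>_add[OF w(1) w'(1)]] show "u \<in> \<Phi> ` gr\<Omega> i" .
  qed
qed

lemma \<Phi>_surj: "\<Phi> ` carrier \<Omega> = carrier L"
proof
  show "\<Phi> ` carrier \<Omega> \<subseteq> carrier L" using \<Phi>.f_im by blast
  have img_add: "u \<oplus>\<^bsub>L\<^esub> v \<in> \<Phi> ` carrier \<Omega>" if uv: "u \<in> \<Phi> ` carrier \<Omega>" "v \<in> \<Phi> ` carrier \<Omega>" for u v
  proof -
    obtain w where "w \<in> carrier \<Omega>" "u = \<Phi> w" using uv(1) by blast
    moreover obtain w' where "w' \<in> carrier \<Omega>" "v = \<Phi> w'" using uv(2) by blast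
    ultimately have w: "w \<in> carrier \<Omega>" "w' \<in> carrier \<Omega>" "u = \<Phi> w" "v = \<Phi> w'" by simp_all
    have "u \<oplus>\<^bsub>L\<^esub> v = \<Phi> (w \<oplus>\<^bsub>\<Omega>\<^esub> w')" "w \<oplus>\<^bsub>\<Omega>\<^esub> w' \<in> carrier \<Omega>" unfolding w(3,4) using w(1,2) by (simp_all only: \<Phi>.f_add \<Omega>A.\<Omega>.M.a_closed)
    then show ?thesis by (rule image_eqI[where f = \<Phi>])
  qed
  have 1: "(p, \<zero>\<^bsub>PM\<^esub>) \<in> \<Phi> ` carrier \<Omega>" if "p \<in> carrier P" for p
    using that
  proof (induction rule: UP.UP_induct)
    case (add p q)
    then show ?case using img_add[of "(p, \<zero>\<^bsub>PM\<^esub>)" "(q, \<zero>\<^bsub>PM\<^esub>)"] by (simp add: L_simps)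
  next
    case (monom s i)
    then obtain w where w: "w \<in> gr\<Omega> (int i + 1)" "\<Phi> w = (mnm s i, \<zero>\<^bsub>PM\<^esub>)" using \<Phi>_onto_mnm by blast
    show ?case by (rule image_eqI[where f = \<Phi>, OF w(2)[symmetric] gr\<Omega>_closed[OF w(1)]])
  qed
  have 2: "(\<zero>\<^bsub>P\<^esub>, f) \<in> \<Phi> ` carrier \<Omega>" if "f \<in> carrier PM" for f
    using that
  proof (induction rule: PMod.PM_induct)
    case (add f g)
    then show ?case using img_add[of "(\<zero>\<^bsub>P\<^esub>, f)" "(\<zero>\<^bsub>P\<^esub>, g)"] by (simp add: L_simps)
  next
    case (sgl m i)
    then obtain w where w: "w \<in> gr\<Omega> (int i)" "\<Phi> w = (\<zero>\<^bsub>P\<^esub>, sgl m i)" using \<Phi>_onto_sgl by blast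
    show ?case by (rule image_eqI[where f = \<Phi>, OF w(2)[symmetric] gr\<Omega>_closed[OF w(1)]])
  qed
  show "carrier L \<subseteq> \<Phi> ` carrier \<Omega>"
  proof
    fix u assume "u \<in> carrier L"
    then obtain p f where "u = (p, f)" "p \<in> carrier P" "f \<in> carrier PM" by (auto simp: L_simps)
    then show "u \<in> \<Phi> ` carrier \<Omega>"
      using img_add[OF 1[of p] 2[of f]] by (simp add: L_simps PMod.PM_coeff)
  qed
qed

lemma \<Phi>_inj: "inj_on \<Phi> (carrier \<Omega>)"
  by (rule inj_on_inverseI[of _ \<Psi>]) (rule \<Psi>_\<Phi>)

end

section \<open>Identification of \<open>M[x]\<close> with the tensor product of \<open>K[x]\<close>
  and \<open>M\<close> over \<open>K\<close>\<close>

lemma (in abelian_monoid) add_swap4: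
  "a \<in> carrier G \<Longrightarrow> b \<in> carrier G \<Longrightarrow> c \<in> carrier G \<Longrightarrow> d \<in> carrier G \<Longrightarrow>
    a \<oplus> b \<oplus> (c \<oplus> d) = a \<oplus> c \<oplus> (b \<oplus> d)"
  by (simp add: a_ac)

context scalar_ext
begin

lemma E_smult_l_distr:
  assumes b: "b \<in> carrier B" and b': "b' \<in> carrier B" and u: "u \<in> carrier T"
  shows "(b \<oplus>\<^bsub>B\<^esub> b') \<odot>\<^bsub>E\<^esub> u = b \<odot>\<^bsub>E\<^esub> u \<oplus>\<^bsub>T\<^esub> b' \<odot>\<^bsub>E\<^esub> u"
  using u
proof (induction rule: tensor_induct)
  case zero
  then show ?case using b b' by (simp add: E_smult_zero)
next
  case (gen x y w)
  have x: "x \<in> carrier B" using gen(1) by (simp add: M_simps)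
  have p: "pure (b \<otimes>\<^bsub>B\<^esub> x \<oplus>\<^bsub>B\<^esub> b' \<otimes>\<^bsub>B\<^esub> x) y = pure (b \<otimes>\<^bsub>B\<^esub> x) y \<oplus>\<^bsub>T\<^esub> pure (b' \<otimes>\<^bsub>B\<^esub> x) y"
    using pure_add_left[of "b \<otimes>\<^bsub>B\<^esub> x" "b' \<otimes>\<^bsub>B\<^esub> x" y] b b' x gen(2) by (simp add: M_simps)
  have cl: "pure (b \<otimes>\<^bsub>B\<^esub> x) y \<in> carrier T" "pure (b' \<otimes>\<^bsub>B\<^esub> x) y \<in> carrier T" "pure x y \<in> carrier T"
    "b \<odot>\<^bsub>E\<^esub> w \<in> carrier T" "b' \<odot>\<^bsub>E\<^esub> w \<in> carrier T"
    using b b' x gen by (auto simp: M_simps E_smult_closed intro!: pure_closed)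
  have xy: "pure x y \<in> carrier T" using gen(1,2) by simp
  note bb = B.a_closed[OF b b']
  have "(b \<oplus>\<^bsub>B\<^esub> b') \<odot>\<^bsub>E\<^esub> (pure x y \<oplus>\<^bsub>T\<^esub> w) =
      (pure (b \<otimes>\<^bsub>B\<^esub> x) y \<oplus>\<^bsub>T\<^esub> pure (b' \<otimes>\<^bsub>B\<^esub> x) y) \<oplus>\<^bsub>T\<^esub> (b \<odot>\<^bsub>E\<^esub> w \<oplus>\<^bsub>T\<^esub> b' \<odot>\<^bsub>E\<^esub> w)"
    unfolding E_smult_add[OF bb xy gen(3)] E_smult_pure[OF bb x gen(2)] B.l_distr[OF b b' x] p gen.IH ..
  also have "\<dots> = (pure (b \<otimes>\<^bsub>B\<^esub> x) y \<oplus>\<^bsub>T\<^esub> b \<odot>\<^bsub>E\<^esub> w) \<oplus>\<^bsub>T\<^esub> (pure (b' \<otimes>\<^bsub>B\<^esub> x) y \<oplus>\<^bsub>T\<^esub> b' \<odot>\<^bsub>E\<^esub> w)"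
    by (rule T.M.add_swap4[OF cl(1,2,4,5)])
  finally show ?case
    unfolding E_smult_add[OF b xy gen(3)] E_smult_add[OF b' xy gen(3)] E_smult_pure[OF b x gen(2)] E_smult_pure[OF b' x gen(2)] .
qed

end

context poly_extension
begin

abbreviation "Kx \<equiv> UP K"
abbreviation "N \<equiv> restrict_scalars \<phi> M"

sublocale UPK: UP_cring K Kx unfolding UP_cring_def by (simp_all add: K_cring)

lemma up_const_hom: "up_const K \<in> Ring.ring_hom K Kx"
  using UPK.const_ring_hom by (simp add: up_const_def[abs_def])

lemma N_module: "module K N"
  by (rule module_restrict_scalars[OF K_cring \<Omega>S.omega_module \<phi>_hom])

lemma N_simps: "carrier N = carrier M" "add N = add M" "k \<odot>\<^bsub>N\<^esub> m = \<phi> k \<odot>\<^bsub>M\<^esub> m"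
  by (simp_all add: restrict_scalars_def)

sublocale E: scalar_ext K Kx "up_const K" N
  unfolding scalar_ext_def by (intro conjI UPK.P.cring_axioms up_const_hom N_module)

abbreviation "mnmK \<equiv> up_ring.monom Kx"

definition \<theta> :: "(nat \<Rightarrow> ('s \<Rightarrow> 's) set) \<Rightarrow> ((nat \<Rightarrow> 'k) \<times> ('s \<Rightarrow> 's) set \<Rightarrow> 'k) set" where
  "\<theta> = PMod.coeff_sum E.T (\<lambda>i m. E.pure (mnmK \<one>\<^bsub>K\<^esub> i) m)"

lemma
  shows \<theta>_closed: "f \<in> carrier PM \<Longrightarrow> \<theta> f \<in> carrier E.T"
    and \<theta>_add: "f \<in> carrier PM \<Longrightarrow> g \<in> carrier PM \<Longrightarrow> \<theta> (f \<oplus>\<^bsub>PM\<^esub> g) = \<theta> f \<oplus>\<^bsub>E.T\<^esub> \<theta> g"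
    and \<theta>_sgl: "m \<in> carrier M \<Longrightarrow> \<theta> (sgl m i) = E.pure (mnmK \<one>\<^bsub>K\<^esub> i) m"
proof -
  have 1: "abelian_group E.T" by (rule E.T.M.abelian_group_axioms)
  have 2: "E.pure (mnmK \<one>\<^bsub>K\<^esub> i) m \<in> carrier E.T" if "m \<in> carrier M" for i m
    by (rule E.pure_closed) (use that in \<open>simp_all add: E.M_simps N_simps\<close>)
  have 3: "E.pure (mnmK \<one>\<^bsub>K\<^esub> i) (m \<oplus>\<^bsub>M\<^esub> m') = E.pure (mnmK \<one>\<^bsub>K\<^esub> i) m \<oplus>\<^bsub>E.T\<^esub> E.pure (mnmK \<one>\<^bsub>K\<^esub> i) m'"
    if "m \<in> carrier M" "m' \<in> carrier M" for i m m'
    using E.pure_add_right[of "mnmK \<one>\<^bsub>K\<^esub> i" m m'] that by (simp add: E.M_simps N_simps)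
  note * = 1 2 3
  show "f \<in> carrier PM \<Longrightarrow> \<theta> f \<in> carrier E.T" unfolding \<theta>_def by (rule PMod.coeff_sum_closed[OF *])
  show "f \<in> carrier PM \<Longrightarrow> g \<in> carrier PM \<Longrightarrow> \<theta> (f \<oplus>\<^bsub>PM\<^esub> g) = \<theta> f \<oplus>\<^bsub>E.T\<^esub> \<theta> g"
    unfolding \<theta>_def by (rule PMod.coeff_sum_add[OF *])
  show "m \<in> carrier M \<Longrightarrow> \<theta> (sgl m i) = E.pure (mnmK \<one>\<^bsub>K\<^esub> i) m"
    unfolding \<theta>_def by (rule PMod.coeff_sum_sgl[OF *])
qed

lemma mnmK_split: "k \<in> carrier K \<Longrightarrow> mnmK k i = up_const K k \<otimes>\<^bsub>Kx\<^esub> mnmK \<one>\<^bsub>K\<^esub> i"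
  using UPK.monom_mult[of k "\<one>\<^bsub>K\<^esub>" 0 i] by (simp add: up_const_def del: UPK.monom_mult)

text \<open>The scalar \<open>k\<close> moves across the tensor sign, which leaves a monic monomial
  on the left.\<close>

lemma pure_mnmK: "k \<in> carrier K \<Longrightarrow> m \<in> carrier M \<Longrightarrow> E.pure (mnmK k i) m = \<theta> (sgl (\<phi> k \<odot>\<^bsub>M\<^esub> m) i)"
proof -
  assume k: "k \<in> carrier K" and m: "m \<in> carrier M"
  have "E.pure (k \<odot>\<^bsub>E.M\<^esub> mnmK \<one>\<^bsub>K\<^esub> i) m = E.pure (mnmK \<one>\<^bsub>K\<^esub> i) (k \<odot>\<^bsub>N\<^esub> m)"
  proof -
    have a: "mnmK \<one>\<^bsub>K\<^esub> i \<in> carrier E.M" "m \<in> carrier N" using m by (simp_all add: E.M_simps N_simps)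
    show ?thesis unfolding E.pure_smult_left[OF k a] E.pure_smult_right[OF k a] ..
  qed
  then show ?thesis using k m by (simp add: E.M_simps N_simps \<theta>_sgl \<Omega>S.phi_closed mnmK_split[of k i])
qed

definition \<psi> :: "(nat \<Rightarrow> 'k) \<Rightarrow> nat \<Rightarrow> 's" where
  "\<psi> = UnivPoly.eval K P (\<lambda>k. up_const S (\<phi> k)) (up_var S)"

lemma const_phi_hom: "(\<lambda>k. up_const S (\<phi> k)) \<in> Ring.ring_hom K P"
proof -
  have u: "up_const S \<in> Ring.ring_hom S P" using UP.const_ring_hom by (simp add: up_const_def[abs_def])
  show ?thesis
    by (rule ring_hom_memI)
      (simp_all add: Ring.ring_hom_closed[OF u] Ring.ring_hom_mult[OF u] Ring.ring_hom_add[OF u] Ring.ring_hom_one[OF u]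
        Ring.ring_hom_closed[OF \<phi>_hom] Ring.ring_hom_mult[OF \<phi>_hom] Ring.ring_hom_add[OF \<phi>_hom] Ring.ring_hom_one[OF \<phi>_hom])
qed

sublocale cphi: ring_hom_cring K P "\<lambda>k. up_const S (\<phi> k)"
  by (rule ring_hom_cringI) (simp_all add: K_cring PMod.P_cring const_phi_hom)

sublocale evK: UP_pre_univ_prop K P "\<lambda>k. up_const S (\<phi> k)" Kx ..

lemma up_var_closed: "up_var S \<in> carrier P" by (simp add: up_var_def)

lemma \<psi>_hom: "\<psi> \<in> Ring.ring_hom Kx P"
  unfolding \<psi>_def by (rule evK.eval_ring_hom[OF up_var_closed])

lemma \<psi>_closed: "q \<in> carrier Kx \<Longrightarrow> \<psi> q \<in> carrier P"
  and \<psi>_add: "q \<in> carrier Kx \<Longrightarrow> q' \<in> carrier Kx \<Longrightarrow> \<psi> (q \<oplus>\<^bsub>Kx\<^esub> q') = \<psi> q \<oplus>\<^bsub>P\<^esub> \<psi> q'"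
  using \<psi>_hom by (simp_all add: Ring.ring_hom_closed Ring.ring_hom_add)

lemma \<psi>_monom: "k \<in> carrier K \<Longrightarrow> \<psi> (mnmK k i) = mnm (\<phi> k) i"
proof -
  assume k: "k \<in> carrier K"
  have pw: "up_var S [^]\<^bsub>P\<^esub> i = mnm \<one> i"
  proof (induction i)
    case 0 then show ?case by simp
  next
    case (Suc i)
    have "up_var S [^]\<^bsub>P\<^esub> Suc i = mnm \<one> i \<otimes>\<^bsub>P\<^esub> mnm \<one> 1"
      unfolding UP.P.nat_pow_Suc Suc.IH unfolding up_var_def ..
    also have "\<dots> = mnm (\<one> \<otimes> \<one>) (i + 1)" by (rule UP.monom_mult[symmetric]) simp_all
    finally show ?case by (simp del: UP.monom_mult)
  qed
  have "\<psi> (mnmK k i) = up_const S (\<phi> k) \<otimes>\<^bsub>P\<^esub> up_var S [^]\<^bsub>P\<^esub> i"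
    unfolding \<psi>_def by (rule evK.eval_monom[OF k up_var_closed])
  also have "\<dots> = mnm (\<phi> k) i"
  proof -
    have "mnm (\<phi> k \<otimes> \<one>) (0 + i) = mnm (\<phi> k) 0 \<otimes>\<^bsub>P\<^esub> mnm \<one> i"
      by (rule UP.monom_mult) (simp_all add: \<Omega>S.phi_closed[OF k])
    then show ?thesis unfolding pw up_const_def UP.R.r_one[OF \<Omega>S.phi_closed[OF k]] add_0 by (rule sym)
  qed
  finally show ?thesis .
qed

lemma ring_hom_cring_\<alpha>: "ring_hom_cring K A \<alpha>"
  by (rule ring_hom_cringI) (simp_all add: K_cring A_cring \<alpha>_hom)

sublocale ev\<alpha>: UP_pre_univ_prop K A \<alpha> Kx
  unfolding UP_pre_univ_prop_def using ring_hom_cring_\<alpha> UPK.UP_cring_axioms by blast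

abbreviation "\<beta> \<equiv> UnivPoly.eval K A \<alpha> x"

lemma \<beta>_hom: "\<beta> \<in> Ring.ring_hom Kx A" by (rule ev\<alpha>.eval_ring_hom[OF x_closed])

text \<open>The two \<open>K[x]\<close>-structures agree: going through \<open>S[x]\<close> gives
  the same map to \<open>A\<close> as evaluating directly at \<open>x\<close>. This makes \<Phi>
  linear over \<open>K[x]\<close>.\<close>

lemma \<epsilon>_\<psi>: "q \<in> carrier Kx \<Longrightarrow> \<epsilon> (\<psi> q) = \<beta> q"
proof (induction rule: UPK.UP_induct)
  case (add p q)
  then show ?case using \<beta>_hom by (simp add: \<psi>_add \<psi>_closed Ring.ring_hom_add)
next
  case (monom k i)
  then show ?case using ev\<alpha>.eval_monom[OF monom x_closed, of i]
    by (simp add: \<psi>_monom \<epsilon>_monom \<Omega>S.phi_closed \<alpha>_eq)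
qed

lemma c_\<beta>: "q \<in> carrier Kx \<Longrightarrow> c (\<beta> q) = \<psi> q"
  using c_\<epsilon>[OF \<psi>_closed] \<epsilon>_\<psi> by simp

lemma \<theta>_smult: "q \<in> carrier Kx \<Longrightarrow> f \<in> carrier PM \<Longrightarrow> \<theta> (\<psi> q \<odot>\<^bsub>PM\<^esub> f) = q \<odot>\<^bsub>E.E\<^esub> \<theta> f"
proof (induction arbitrary: f rule: UPK.UP_induct)
  case (add p q)
  note cl = PMod.PM_smult_closed[OF \<psi>_closed[OF add(1)] add(5)] PMod.PM_smult_closed[OF \<psi>_closed[OF add(2)] add(5)]
  have "\<theta> (\<psi> (p \<oplus>\<^bsub>Kx\<^esub> q) \<odot>\<^bsub>PM\<^esub> f) = \<theta> (\<psi> p \<odot>\<^bsub>PM\<^esub> f) \<oplus>\<^bsub>E.T\<^esub> \<theta> (\<psi> q \<odot>\<^bsub>PM\<^esub> f)"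
    unfolding \<psi>_add[OF add(1,2)] PMod.PM_smult_l_distr[OF \<psi>_closed[OF add(1)] \<psi>_closed[OF add(2)] add(5)]
    by (rule \<theta>_add[OF cl])
  then show ?case
    unfolding add(3)[OF add(5)] add(4)[OF add(5)] E.E_smult_l_distr[OF add(1,2) \<theta>_closed[OF add(5)]] .
next
  case (monom k i)
  show ?case using monom(2)
  proof (induction rule: PMod.PM_induct)
    case (add f g)
    have q: "mnmK k i \<in> carrier Kx" using monom(1) by simp
    note cl = PMod.PM_smult_closed[OF \<psi>_closed[OF q] add(1)] PMod.PM_smult_closed[OF \<psi>_closed[OF q] add(2)]
    have "\<theta> (\<psi> (mnmK k i) \<odot>\<^bsub>PM\<^esub> (f \<oplus>\<^bsub>PM\<^esub> g)) =
        \<theta> (\<psi> (mnmK k i) \<odot>\<^bsub>PM\<^esub> f) \<oplus>\<^bsub>E.T\<^esub> \<theta> (\<psi> (mnmK k i) \<odot>\<^bsub>PM\<^esub> g)"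
      unfolding PMod.PM_smult_r_distr[OF \<psi>_closed[OF q] add(1,2)] by (rule \<theta>_add[OF cl])
    then show ?case
      unfolding add(3,4) \<theta>_add[OF add(1,2)] E.E_smult_add[OF q \<theta>_closed[OF add(1)] \<theta>_closed[OF add(2)]] .
  next
    case (sgl m j)
    have "mnmK k i \<odot>\<^bsub>E.E\<^esub> \<theta> (sgl m j) = E.pure (mnmK k i \<otimes>\<^bsub>Kx\<^esub> mnmK \<one>\<^bsub>K\<^esub> j) m"
      unfolding \<theta>_sgl[OF sgl] using monom(1) sgl by (intro E.E_smult_pure) (simp_all add: N_simps)
    also have "mnmK k i \<otimes>\<^bsub>Kx\<^esub> mnmK \<one>\<^bsub>K\<^esub> j = mnmK k (i + j)"
      using UPK.monom_mult[of k "\<one>\<^bsub>K\<^esub>" i j] monom(1) by (simp del: UPK.monom_mult)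
    finally have "mnmK k i \<odot>\<^bsub>E.E\<^esub> \<theta> (sgl m j) = \<theta> (sgl (\<phi> k \<odot>\<^bsub>M\<^esub> m) (i + j))"
      using pure_mnmK[OF monom(1) sgl] by simp
    then show ?case using monom(1) sgl by (simp add: \<psi>_monom PMod.mnm_smult_sgl \<Omega>S.phi_closed)
  qed
qed

text \<open>The bilinear map sending \<open>(q, m)\<close> to \<open>q m\<close> in
  \<open>M[x]\<close>; the linear map it induces on the tensor product inverts \<theta>.\<close>

definition PB :: "(nat \<Rightarrow> 'k) \<Rightarrow> ('s \<Rightarrow> 's) set \<Rightarrow> nat \<Rightarrow> ('s \<Rightarrow> 's) set" where
  "PB q m = (\<lambda>i. \<phi> (up_ring.coeff Kx q i) \<odot>\<^bsub>M\<^esub> m)"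

abbreviation "PMK \<equiv> restrict_scalars (\<lambda>k. up_const S (\<phi> k)) PM"

lemma PMK_module: "module K PMK"
  by (rule module_restrict_scalars[OF K_cring PMod.PM_module const_phi_hom])

lemma PMK_simps: "carrier PMK = carrier PM" "add PMK = add PM" "k \<odot>\<^bsub>PMK\<^esub> f = up_const S (\<phi> k) \<odot>\<^bsub>PM\<^esub> f"
  by (simp_all add: restrict_scalars_def)

lemma PMK_smult: "k \<in> carrier K \<Longrightarrow> f \<in> carrier PM \<Longrightarrow> k \<odot>\<^bsub>PMK\<^esub> f = (\<lambda>i. \<phi> k \<odot>\<^bsub>M\<^esub> f i)"
  unfolding PMK_simps unfolding up_const_def by (rule PMod.PM_smult_mnm[of _ _ 0, simplified]) (simp_all add: \<Omega>S.phi_closed)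

lemma phi_zero: "\<phi> \<zero>\<^bsub>K\<^esub> = \<zero>" by (rule ring_hom_zero[OF \<phi>_hom K.ring_axioms UP.R.ring_axioms])

lemma PB_closed: "q \<in> carrier Kx \<Longrightarrow> m \<in> carrier M \<Longrightarrow> PB q m \<in> carrier PM"
proof -
  assume q: "q \<in> carrier Kx" and m: "m \<in> carrier M"
  obtain n where "\<And>i. i > n \<Longrightarrow> up_ring.coeff Kx q i = \<zero>\<^bsub>K\<^esub>" using UPK.deg_aboveD[OF _ q] by blast
  then show ?thesis using q m
    by (auto simp: PMod.PM_carrier PB_def phi_zero \<Omega>S.phi_closed intro!: exI[of _ n])
qed

lemma \<eta>_ex: "\<exists>g. mod_hom K E.T PMK g \<and> (\<forall>q\<in>carrier Kx. \<forall>m\<in>carrier M. g (E.pure q m) = PB q m)"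
proof -
  note \<phi>r = Ring.ring_hom_add[OF \<phi>_hom] Ring.ring_hom_mult[OF \<phi>_hom] \<Omega>S.phi_closed
  have "\<exists>g. mod_hom K E.T PMK g \<and> (\<forall>f\<in>carrier E.F. g (tensor_kernel K E.M N +>\<^bsub>E.F\<^esub> f) = lin_ext K PMK (\<lambda>(q, m). PB q m) f) \<and>
    (\<forall>q\<in>carrier E.M. \<forall>m\<in>carrier N. g (E.pure q m) = PB q m)"
  proof (rule E.tensor_universal[OF PMK_module])
    fix k q m assume *: "k \<in> carrier K" "q \<in> carrier E.M" "m \<in> carrier N"
    then have q: "q \<in> carrier Kx" and m: "m \<in> carrier M" by (simp_all add: E.M_simps N_simps)
    have cf: "up_ring.coeff Kx (up_const K k \<otimes>\<^bsub>Kx\<^esub> q) i = k \<otimes>\<^bsub>K\<^esub> up_ring.coeff Kx q i" for i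
      using *(1) q by (simp add: up_const_def UPK.monom_mult_is_smult)
    have "PB (up_const K k \<otimes>\<^bsub>Kx\<^esub> q) m = (\<lambda>i. \<phi> k \<odot>\<^bsub>M\<^esub> PB q m i)"
      using *(1) q m by (simp add: PB_def cf \<phi>r \<Omega>S.\<Omega>.smult_assoc1)
    then show "PB (k \<odot>\<^bsub>E.M\<^esub> q) m = k \<odot>\<^bsub>PMK\<^esub> PB q m"
      using PMK_smult[OF *(1) PB_closed[OF q m]] by (simp add: E.M_simps)
    have "PB q (\<phi> k \<odot>\<^bsub>M\<^esub> m) = (\<lambda>i. \<phi> k \<odot>\<^bsub>M\<^esub> PB q m i)"
      using *(1) q m by (simp add: PB_def \<phi>r UP.R.m_comm flip: \<Omega>S.\<Omega>.smult_assoc1)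
    then show "PB q (k \<odot>\<^bsub>N\<^esub> m) = k \<odot>\<^bsub>PMK\<^esub> PB q m"
      using PMK_smult[OF *(1) PB_closed[OF q m]] by (simp add: N_simps)
  qed (auto simp: E.M_simps N_simps PMK_simps PB_closed, auto simp: PB_def \<phi>r \<Omega>S.\<Omega>.smult_l_distr \<Omega>S.\<Omega>.smult_r_distr)
  then show ?thesis unfolding E.M_simps N_simps(1) by blast
qed

lemma \<theta>_PB: "q \<in> carrier Kx \<Longrightarrow> m \<in> carrier M \<Longrightarrow> \<theta> (PB q m) = E.pure q m"
proof (induction rule: UPK.UP_induct)
  case (add p q)
  have "PB (p \<oplus>\<^bsub>Kx\<^esub> q) m = PB p m \<oplus>\<^bsub>PM\<^esub> PB q m"
    using add by (simp add: PB_def Ring.ring_hom_add[OF \<phi>_hom] \<Omega>S.phi_closed \<Omega>S.\<Omega>.smult_l_distr)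
  then show ?case using add E.pure_add_left[of p q m]
    by (simp add: \<theta>_add PB_closed E.M_simps N_simps del: PMod.PM_simps)
next
  case (monom k i)
  have "PB (mnmK k i) m = sgl (\<phi> k \<odot>\<^bsub>M\<^esub> m) i"
    using monom by (auto simp: PB_def single_coeff_def phi_zero fun_eq_iff)
  then show ?case using monom pure_mnmK by simp
qed

lemma \<theta>_bij: "bij_betw \<theta> (carrier PM) (carrier E.T)"
proof -
  obtain \<eta> where \<eta>: "mod_hom K E.T PMK \<eta>" "\<And>q m. q \<in> carrier Kx \<Longrightarrow> m \<in> carrier M \<Longrightarrow> \<eta> (E.pure q m) = PB q m"
    using \<eta>_ex by blast
  note h = mod_homD[OF \<eta>(1)]
  have cl: "\<eta> u \<in> carrier PM" if "u \<in> carrier E.T" for u using h(1)[OF that] by (simp add: PMK_simps)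
  have \<eta>_add: "\<eta> (u \<oplus>\<^bsub>E.T\<^esub> v) = \<eta> u \<oplus>\<^bsub>PM\<^esub> \<eta> v" if "u \<in> carrier E.T" "v \<in> carrier E.T" for u v
    using h(2)[OF that] by (simp add: PMK_simps)
  have 1: "\<eta> (\<theta> f) = f" if "f \<in> carrier PM" for f
    using that
  proof (induction rule: PMod.PM_induct)
    case (add f g) then show ?case using \<eta>_add[OF \<theta>_closed \<theta>_closed]
      by (simp add: \<theta>_add del: PMod.PM_simps)
  next
    case (sgl m i)
    have "PB (mnmK \<one>\<^bsub>K\<^esub> i) m = sgl m i"
      using sgl by (auto simp: PB_def single_coeff_def phi_zero Ring.ring_hom_one[OF \<phi>_hom] fun_eq_iff)
    then show ?case using sgl \<eta>(2)[of "mnmK \<one>\<^bsub>K\<^esub> i" m] by (simp add: \<theta>_sgl)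
  qed
  have 2: "\<theta> (\<eta> u) = u" if "u \<in> carrier E.T" for u
    using that
  proof (induction rule: E.tensor_induct)
    case zero
    have "\<eta> \<zero>\<^bsub>E.T\<^esub> = \<zero>\<^bsub>PM\<^esub>" using h(4) by (simp add: restrict_scalars_def)
    moreover have "\<theta> \<zero>\<^bsub>PM\<^esub> = \<zero>\<^bsub>E.T\<^esub>" by (simp add: \<theta>_def PMod.coeff_sum_def)
    ultimately show ?case by simp
  next
    case (gen q m w)
    then have q: "q \<in> carrier Kx" and m: "m \<in> carrier M" by (simp_all add: E.M_simps N_simps)
    have p: "E.pure q m \<in> carrier E.T" using gen by simp
    have "\<theta> (\<eta> (E.pure q m \<oplus>\<^bsub>E.T\<^esub> w)) = \<theta> (\<eta> (E.pure q m)) \<oplus>\<^bsub>E.T\<^esub> \<theta> (\<eta> w)"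
      unfolding \<eta>_add[OF p gen(3)] by (rule \<theta>_add[OF cl[OF p] cl[OF gen(3)]])
    then show ?case unfolding gen.IH \<eta>(2)[OF q m] \<theta>_PB[OF q m] .
  qed
  show ?thesis
    by (rule bij_betw_byWitness[where f' = \<eta>]) (use 1 2 cl \<theta>_closed in auto)
qed

abbreviation "tensor_grade i \<equiv> generate (add_monoid E.E)
     {E.pure p w | p w. p \<in> up_grade K i \<and> w \<in> carrier N}"

definition grM :: "int \<Rightarrow> (nat \<Rightarrow> ('s \<Rightarrow> 's) set) set" where
  "grM i = (if i < 0 then {\<zero>\<^bsub>PM\<^esub>} else {sgl m (nat i) | m. m \<in> carrier M})"

lemma grL_eq: "grL i = up_grade S (i - 1) \<times> grM i"
proof -
  \<comment> \<open>In low degrees \<open>hcL\<close> ignores one or both of its arguments; zero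
    then serves as the missing witness.\<close>
  have z: "\<zero> \<in> carrier S" "\<zero>\<^bsub>M\<^esub> \<in> carrier M" by simp_all
  show ?thesis
    unfolding grL_def hcL_def grM_def up_grade_def using z by (auto; force)
qed

text \<open>The grading of the tensor product is defined by generation. The images of the elements
  \<open>m x^i\<close> are already closed under sums and negatives, and they contain every pure
  tensor of degree \<open>i\<close>.\<close>

lemma \<theta>_gr: "\<theta> ` grM i = tensor_grade i"
proof -
  have "abelian_group E.E"
    by (rule abelian_groupI, unfold E.E_simps)
      (auto simp: E.T.M.a_ac intro: E.T.M.l_neg)
  then have Eg: "group (add_monoid E.E)" "carrier (add_monoid E.E) = carrier E.T" "mult (add_monoid E.E) = add E.T"
    "one (add_monoid E.E) = zero E.T"
    by (rule abelian_group.a_group) (simp_all add: E.E_simps)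
  have \<theta>0: "\<theta> \<zero>\<^bsub>PM\<^esub> = \<zero>\<^bsub>E.T\<^esub>" by (simp add: \<theta>_def PMod.coeff_sum_def)
  let ?G = "{E.pure p w | p w. p \<in> up_grade K i \<and> w \<in> carrier N}"
  have gM: "grM i \<subseteq> carrier PM" by (auto simp: grM_def PMod.sgl_closed PMod.PM.M.zero_closed simp del: PMod.PM_simps)
  have gen: "?G \<subseteq> \<theta> ` grM i"
  proof
    fix u assume "u \<in> ?G"
    then obtain p w where u: "u = E.pure p w" "p \<in> up_grade K i" "w \<in> carrier M" by (auto simp: N_simps)
    show "u \<in> \<theta> ` grM i"
    proof (cases "i < 0")
      case True
      then have p: "p = mnmK \<zero>\<^bsub>K\<^esub> 0" using u by (simp add: up_grade_def)
      have "u = \<theta> \<zero>\<^bsub>PM\<^esub>" unfolding u(1) p pure_mnmK[OF K.zero_closed u(3)] phi_zero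
        using u(3) by (simp add: PMod.sgl_zero)
      then show ?thesis using True by (simp add: grM_def)
    next
      case False
      then obtain k where "k \<in> carrier K" "p = mnmK k (nat i)" using u by (auto simp: up_grade_def)
      then have "u = \<theta> (sgl (\<phi> k \<odot>\<^bsub>M\<^esub> w) (nat i))" "\<phi> k \<odot>\<^bsub>M\<^esub> w \<in> carrier M"
        using u pure_mnmK \<Omega>S.phi_closed by auto
      then show ?thesis using False by (auto simp: grM_def)
    qed
  qed
  have "subgroup (\<theta> ` grM i) (add_monoid E.E)"
  proof (rule group.subgroupI[OF Eg(1)])
    show "\<theta> ` grM i \<subseteq> carrier (add_monoid E.E)" using gM \<theta>_closed unfolding Eg by blast
    show "\<theta> ` grM i \<noteq> {}" using \<Omega>S.\<Omega>.M.zero_closed by (auto simp: grM_def)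
  next
    fix u assume "u \<in> \<theta> ` grM i"
    then obtain f where f: "f \<in> grM i" "u = \<theta> f" by blast
    have "\<exists>g\<in>grM i. g \<oplus>\<^bsub>PM\<^esub> f = \<zero>\<^bsub>PM\<^esub>"
    proof (cases "i < 0")
      case True then show ?thesis using f by (auto simp: grM_def)
    next
      case False
      then obtain m where m: "m \<in> carrier M" "f = sgl m (nat i)" using f by (auto simp: grM_def)
      have "sgl (\<ominus>\<^bsub>M\<^esub> m) (nat i) \<oplus>\<^bsub>PM\<^esub> f = \<zero>\<^bsub>PM\<^esub>"
        using m by (simp add: \<Omega>S.\<Omega>.M.l_neg PMod.sgl_zero del: PMod.PM_simps flip: PMod.sgl_add)
      moreover have "sgl (\<ominus>\<^bsub>M\<^esub> m) (nat i) \<in> grM i"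
        unfolding grM_def using False m(1) \<Omega>S.\<Omega>.M.a_inv_closed by auto
      ultimately show ?thesis by (rule bexI)
    qed
    then obtain g where g: "g \<in> grM i" "g \<oplus>\<^bsub>PM\<^esub> f = \<zero>\<^bsub>PM\<^esub>" by blast
    then have "\<theta> g \<oplus>\<^bsub>E.T\<^esub> u = \<zero>\<^bsub>E.T\<^esub>" using \<theta>_add[of g f] gM f \<theta>0 by (auto simp del: PMod.PM_simps)
    then have "inv\<^bsub>add_monoid E.E\<^esub> u = \<theta> g"
      using g f gM \<theta>_closed by (intro group.inv_equality[OF Eg(1)]) (auto simp: E.E_simps)
    then show "inv\<^bsub>add_monoid E.E\<^esub> u \<in> \<theta> ` grM i" using g by blast
  next
    fix u v assume "u \<in> \<theta> ` grM i" "v \<in> \<theta> ` grM i"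
    then obtain f g where f: "f \<in> grM i" "u = \<theta> f" "g \<in> grM i" "v = \<theta> g" by blast
    have "f \<oplus>\<^bsub>PM\<^esub> g \<in> grM i"
    proof (cases "i < 0")
      case True then show ?thesis using f by (simp add: grM_def)
    next
      case False
      then obtain m m' where m: "m \<in> carrier M" "f = sgl m (nat i)" "m' \<in> carrier M" "g = sgl m' (nat i)"
        using f by (auto simp: grM_def)
      have "f \<oplus>\<^bsub>PM\<^esub> g = sgl (m \<oplus>\<^bsub>M\<^esub> m') (nat i)" unfolding m(2,4) by (rule PMod.sgl_add[OF m(1,3), symmetric])
      then show ?thesis unfolding grM_def using False m(1,3) \<Omega>S.\<Omega>.M.a_closed by auto
    qed
    then show "u \<otimes>\<^bsub>add_monoid E.E\<^esub> v \<in> \<theta> ` grM i"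
      using f gM \<theta>_add[of f g] by (auto simp: E.E_simps subset_iff simp del: PMod.PM_simps)
  qed
  then have "tensor_grade i \<subseteq> \<theta> ` grM i"
    by (intro group.generate_subgroup_incl[OF Eg(1) gen])
  moreover have "\<theta> ` grM i \<subseteq> tensor_grade i"
  proof
    fix u assume "u \<in> \<theta> ` grM i"
    then obtain f where f: "f \<in> grM i" "u = \<theta> f" by blast
    show "u \<in> tensor_grade i"
    proof (cases "i < 0")
      case True
      then have "u = one (add_monoid E.E)" using f \<theta>0 unfolding Eg by (simp add: grM_def)
      then show ?thesis using generate.one[of "add_monoid E.E"] by simp
    next
      case False
      then obtain m where m: "m \<in> carrier M" "f = sgl m (nat i)" using f by (auto simp: grM_def)
      have "u = E.pure (mnmK \<one>\<^bsub>K\<^esub> (nat i)) m" using m f \<theta>_sgl by simp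
      then have "u \<in> ?G" using False m by (auto simp: up_grade_def N_simps)
      then show ?thesis by (rule generate.incl)
    qed
  qed
  ultimately show ?thesis by blast
qed

theorem omega_graded_iso:
  "graded_module_iso Kx (restrict_scalars \<beta> \<Omega>) gr\<Omega>
    (direct_sum (restrict_scalars \<psi> (regular_module P)) E.E)
    (\<lambda>i. up_grade S (i - 1) \<times> tensor_grade i) (\<lambda>w. (fst (\<Phi> w), \<theta> (snd (\<Phi> w))))"
proof -
  let ?T = "direct_sum (restrict_scalars \<psi> (regular_module P)) E.E" and ?f = "\<lambda>w. (fst (\<Phi> w), \<theta> (snd (\<Phi> w)))"
  have T: "carrier ?T = carrier P \<times> carrier E.T"
    "u \<oplus>\<^bsub>?T\<^esub> v = (fst u \<oplus>\<^bsub>P\<^esub> fst v, snd u \<oplus>\<^bsub>E.T\<^esub> snd v)"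
    "q \<odot>\<^bsub>?T\<^esub> u = (\<psi> q \<otimes>\<^bsub>P\<^esub> fst u, q \<odot>\<^bsub>E.E\<^esub> snd u)" for u v q
  proof -
    have "carrier (restrict_scalars \<psi> (regular_module P)) = carrier P" "add (restrict_scalars \<psi> (regular_module P)) = add P"
      "smult (restrict_scalars \<psi> (regular_module P)) = (\<lambda>q. mult P (\<psi> q))"
      by (simp_all add: restrict_scalars_def regular_module_def)
    then show "carrier ?T = carrier P \<times> carrier E.T"
      "u \<oplus>\<^bsub>?T\<^esub> v = (fst u \<oplus>\<^bsub>P\<^esub> fst v, snd u \<oplus>\<^bsub>E.T\<^esub> snd v)"
      "q \<odot>\<^bsub>?T\<^esub> u = (\<psi> q \<otimes>\<^bsub>P\<^esub> fst u, q \<odot>\<^bsub>E.E\<^esub> snd u)"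
      by (simp_all add: direct_sum_def E.E_simps)
  qed
  have O: "carrier (restrict_scalars \<beta> \<Omega>) = carrier \<Omega>" "add (restrict_scalars \<beta> \<Omega>) = add \<Omega>"
    "q \<odot>\<^bsub>restrict_scalars \<beta> \<Omega>\<^esub> w = \<beta> q \<odot>\<^bsub>\<Omega>\<^esub> w" for q w
    by (simp_all add: restrict_scalars_def)
  have \<Phi>c: "fst (\<Phi> w) \<in> carrier P" "snd (\<Phi> w) \<in> carrier PM" if "w \<in> carrier \<Omega>" for w
    using \<Phi>.f_im[OF that] by (auto simp: L_simps)
  have \<Phi>_bij: "bij_betw \<Phi> (carrier \<Omega>) (carrier P \<times> carrier PM)"
    using \<Phi>_inj \<Phi>_surj by (simp add: bij_betw_def L_simps)
  have hom: "?f \<in> module_hom Kx (restrict_scalars \<beta> \<Omega>) ?T"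
    unfolding module_hom_def
  proof (intro CollectI conjI allI impI, goal_cases)
    case 1 then show ?case using \<Phi>c \<theta>_closed by (auto simp: O T)
  next
    case (2 w w') then show ?case
      using \<Phi>c[of w] \<Phi>c[of w'] by (simp add: O T \<Phi>.f_add L_simps \<theta>_add del: PMod.PM_simps)
  next
    case (3 q w)
    then have bq: "\<beta> q \<in> carrier A" by (auto intro: Ring.ring_hom_closed[OF \<beta>_hom])
    show ?case using 3 \<Phi>c[of w] bq by (simp add: O T \<Phi>.f_smult L_simps c_\<beta> \<theta>_smult)
  qed
  have comp: "?f = map_prod id \<theta> \<circ> \<Phi>" by (auto simp: map_prod_def split_beta)
  have "bij_betw (map_prod id \<theta>) (carrier P \<times> carrier PM) (carrier P \<times> carrier E.T)"
    by (rule bij_betw_map_prod) (use \<theta>_bij in auto)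
  then have b: "bij_betw ?f (carrier (restrict_scalars \<beta> \<Omega>)) (carrier ?T)"
    unfolding comp O T by (rule bij_betw_trans[OF \<Phi>_bij])
  have "?f ` gr\<Omega> i = up_grade S (i - 1) \<times> tensor_grade i" for i
    unfolding comp image_comp[symmetric] \<Phi>_gr grL_eq \<theta>_gr[symmetric] by (auto simp: map_prod_def image_iff)
  then show ?thesis unfolding graded_module_iso_def using hom b by blast
qed

end

section \<open>Dimensions\<close>

text \<open>Spanning is stated through submodules containing \<open>F\<close> instead of linear
  combinations, so that it can be verified by closure arguments.\<close>

lemma fin_dimI:
  assumes V: "vectorspace K V" and F: "finite F" "F \<subseteq> carrier V"
    and gen: "\<And>W. submodule K W V \<Longrightarrow> F \<subseteq> W \<Longrightarrow> carrier V \<subseteq> W"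
  shows "vectorspace.fin_dim K V"
proof -
  interpret vectorspace K V by fact
  have "submodule K (span F) V" by (rule span_is_submodule[OF F(2)])
  moreover have "F \<subseteq> span F" by (rule in_own_span[OF F(2)])
  ultimately have "carrier V \<subseteq> span F" by (rule gen)
  moreover have "span F \<subseteq> carrier V" using F(2) by (metis span_is_subset2)
  ultimately show ?thesis using F unfolding fin_dim_def by blast
qed

lemma fin_dimE:
  assumes V: "vectorspace K V" and fd: "vectorspace.fin_dim K V"
  obtains F where "finite F" "F \<subseteq> carrier V" "\<And>W. submodule K W V \<Longrightarrow> F \<subseteq> W \<Longrightarrow> carrier V \<subseteq> W"
proof -
  interpret vectorspace K V by fact
  obtain F where F: "finite F" "F \<subseteq> carrier V" "span F = carrier V" using fd unfolding fin_dim_def by blast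
  have "carrier V \<subseteq> W" if "submodule K W V" "F \<subseteq> W" for W
    using span_is_subset[OF that(2,1)] F(3) by simp
  then show ?thesis using that F by blast
qed

lemma submoduleI2:
  assumes "module K V" "W \<subseteq> carrier V" "\<zero>\<^bsub>V\<^esub> \<in> W" "\<And>u v. u \<in> W \<Longrightarrow> v \<in> W \<Longrightarrow> u \<oplus>\<^bsub>V\<^esub> v \<in> W"
    "\<And>k v. k \<in> carrier K \<Longrightarrow> v \<in> W \<Longrightarrow> k \<odot>\<^bsub>V\<^esub> v \<in> W"
  shows "submodule K W V"
  unfolding submodule_def using assms by blast

lemma submoduleD:
  assumes "submodule K W V"
  shows "\<zero>\<^bsub>V\<^esub> \<in> W" "\<And>u v. u \<in> W \<Longrightarrow> v \<in> W \<Longrightarrow> u \<oplus>\<^bsub>V\<^esub> v \<in> W" "\<And>k v. k \<in> carrier K \<Longrightarrow> v \<in> W \<Longrightarrow> k \<odot>\<^bsub>V\<^esub> v \<in> W"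
    "W \<subseteq> carrier V"
  using submodule.zero_closed[OF assms] submodule.m_closed[OF assms] submodule.smult_closed[OF assms]
    submodule.subset[OF assms] by auto

lemma linear_mapI: "field K \<Longrightarrow> mod_hom K V W f \<Longrightarrow> linear_map K V W f"
  by (simp add: linear_map_def vectorspace_def mod_hom_def)

text \<open>Since \<open>vdim\<close> distinguishes finite from infinite dimension, finiteness must
  pass in both directions; for this the inverse bijection is shown to be linear too.\<close>

lemma vdim_eq:
  assumes K: "field K" and f: "mod_hom K V W f" and bij: "bij_betw f (carrier V) (carrier W)"
  shows "vdim K V = vdim K W"
proof -
  note h = mod_homD[OF f]
  interpret V: module K V by (rule h(5))
  define g where "g = inv_into (carrier V) f"
  have gc: "g w \<in> carrier V" "f (g w) = w" if "w \<in> carrier W" for w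
    using that bij unfolding g_def by (metis bij_betw_imp_surj_on inv_into_into, metis bij_betw_imp_surj_on f_inv_into_f)
  have gf: "g (f v) = v" if "v \<in> carrier V" for v
    using that bij unfolding g_def by (metis bij_betw_def inv_into_f_f)
  have g: "mod_hom K W V g"
  proof (rule mod_homI[OF h(6,5)])
    fix w w' assume w: "w \<in> carrier W" "w' \<in> carrier W"
    have "g (f (g w \<oplus>\<^bsub>V\<^esub> g w')) = g w \<oplus>\<^bsub>V\<^esub> g w'" using w gc by (intro gf) simp
    then show "g (w \<oplus>\<^bsub>W\<^esub> w') = g w \<oplus>\<^bsub>V\<^esub> g w'" using w gc by (simp add: h(2))
  next
    fix k w assume k: "k \<in> carrier K" and w: "w \<in> carrier W"
    have "g (f (k \<odot>\<^bsub>V\<^esub> g w)) = k \<odot>\<^bsub>V\<^esub> g w" using k w gc by (intro gf) simp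
    then show "g (k \<odot>\<^bsub>W\<^esub> w) = k \<odot>\<^bsub>V\<^esub> g w" using k w gc by (simp add: h(3))
  qed (rule gc(1))
  interpret f: linear_map K V W f by (rule linear_mapI[OF K f])
  interpret g: linear_map K W V g by (rule linear_mapI[OF K g])
  have s: "f ` carrier V = carrier W" "g ` carrier W = carrier V"
    using bij gc gf h(1) by (auto simp: bij_betw_def) (metis image_eqI)
  have fd: "vectorspace.fin_dim K V \<longleftrightarrow> vectorspace.fin_dim K W"
    using f.surj_fin_dim[OF _ s(1)] g.surj_fin_dim[OF _ s(2)] by blast
  show ?thesis
    unfolding vdim_def using fd f.dim_eq[OF _ _ s(1)] bij by (auto simp: bij_betw_def)
qed

lemma direct_sum_simps:
  "carrier (direct_sum V W) = carrier V \<times> carrier W" "\<zero>\<^bsub>direct_sum V W\<^esub> = (\<zero>\<^bsub>V\<^esub>, \<zero>\<^bsub>W\<^esub>)"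
  "u \<oplus>\<^bsub>direct_sum V W\<^esub> v = (fst u \<oplus>\<^bsub>V\<^esub> fst v, snd u \<oplus>\<^bsub>W\<^esub> snd v)"
  "k \<odot>\<^bsub>direct_sum V W\<^esub> u = (k \<odot>\<^bsub>V\<^esub> fst u, k \<odot>\<^bsub>W\<^esub> snd u)"
  by (simp_all add: direct_sum_def)

lemma fin_dim_direct_sum:
  assumes V: "vectorspace K V" "vectorspace.fin_dim K V" and W: "vectorspace K W" "vectorspace.fin_dim K W"
  shows "vectorspace.fin_dim K (direct_sum V W)"
proof -
  interpret V: vectorspace K V by (rule V(1))
  interpret W: vectorspace K W by (rule W(1))
  obtain A where A: "finite A" "A \<subseteq> carrier V" "\<And>U. submodule K U V \<Longrightarrow> A \<subseteq> U \<Longrightarrow> carrier V \<subseteq> U"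
    by (rule fin_dimE[OF V]) blast
  obtain B where B: "finite B" "B \<subseteq> carrier W" "\<And>U. submodule K U W \<Longrightarrow> B \<subseteq> U \<Longrightarrow> carrier W \<subseteq> U"
    by (rule fin_dimE[OF W]) blast
  show ?thesis
  proof (rule fin_dimI[OF direct_sum_is_vs[OF V(1) W(1)], of "A \<times> {\<zero>\<^bsub>W\<^esub>} \<union> {\<zero>\<^bsub>V\<^esub>} \<times> B"])
    fix U assume U: "submodule K U (direct_sum V W)" "A \<times> {\<zero>\<^bsub>W\<^esub>} \<union> {\<zero>\<^bsub>V\<^esub>} \<times> B \<subseteq> U"
    note UD = submoduleD[OF U(1), unfolded direct_sum_simps]
    have "submodule K {v \<in> carrier V. (v, \<zero>\<^bsub>W\<^esub>) \<in> U} V"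
    proof (rule submoduleI2[OF V.module_axioms])
      fix u v assume "u \<in> {v \<in> carrier V. (v, \<zero>\<^bsub>W\<^esub>) \<in> U}" "v \<in> {v \<in> carrier V. (v, \<zero>\<^bsub>W\<^esub>) \<in> U}"
      then show "u \<oplus>\<^bsub>V\<^esub> v \<in> {v \<in> carrier V. (v, \<zero>\<^bsub>W\<^esub>) \<in> U}" using UD(2)[of "(u, \<zero>\<^bsub>W\<^esub>)" "(v, \<zero>\<^bsub>W\<^esub>)"] by simp
    next
      fix k v assume "k \<in> carrier K" "v \<in> {v \<in> carrier V. (v, \<zero>\<^bsub>W\<^esub>) \<in> U}"
      then show "k \<odot>\<^bsub>V\<^esub> v \<in> {v \<in> carrier V. (v, \<zero>\<^bsub>W\<^esub>) \<in> U}" using UD(3)[of k "(v, \<zero>\<^bsub>W\<^esub>)"] by simp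
    qed (use UD(1) in auto)
    then have 1: "carrier V \<subseteq> {v \<in> carrier V. (v, \<zero>\<^bsub>W\<^esub>) \<in> U}" by (rule A(3)) (use U(2) A(2) in auto)
    have "submodule K {w \<in> carrier W. (\<zero>\<^bsub>V\<^esub>, w) \<in> U} W"
    proof (rule submoduleI2[OF W.module_axioms])
      fix u v assume "u \<in> {w \<in> carrier W. (\<zero>\<^bsub>V\<^esub>, w) \<in> U}" "v \<in> {w \<in> carrier W. (\<zero>\<^bsub>V\<^esub>, w) \<in> U}"
      then show "u \<oplus>\<^bsub>W\<^esub> v \<in> {w \<in> carrier W. (\<zero>\<^bsub>V\<^esub>, w) \<in> U}" using UD(2)[of "(\<zero>\<^bsub>V\<^esub>, u)" "(\<zero>\<^bsub>V\<^esub>, v)"] by simp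
    next
      fix k v assume "k \<in> carrier K" "v \<in> {w \<in> carrier W. (\<zero>\<^bsub>V\<^esub>, w) \<in> U}"
      then show "k \<odot>\<^bsub>W\<^esub> v \<in> {w \<in> carrier W. (\<zero>\<^bsub>V\<^esub>, w) \<in> U}" using UD(3)[of k "(\<zero>\<^bsub>V\<^esub>, v)"] by simp
    qed (use UD(1) in auto)
    then have 2: "carrier W \<subseteq> {w \<in> carrier W. (\<zero>\<^bsub>V\<^esub>, w) \<in> U}" by (rule B(3)) (use U(2) B(2) in auto)
    show "carrier (direct_sum V W) \<subseteq> U"
    proof
      fix z assume "z \<in> carrier (direct_sum V W)"
      then obtain v w where z: "z = (v, w)" "v \<in> carrier V" "w \<in> carrier W" by (auto simp: direct_sum_simps)
      have "(v, \<zero>\<^bsub>W\<^esub>) \<in> U" "(\<zero>\<^bsub>V\<^esub>, w) \<in> U" using 1 2 z by auto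
      from UD(2)[OF this] show "z \<in> U" using z by simp
    qed
  qed (use A B in \<open>auto simp: direct_sum_simps\<close>)
qed

text \<open>Rank and nullity of the projection \<open>snd\<close>, whose kernel is a copy of
  \<open>V\<close>.\<close>

lemma vdim_direct_sum:
  assumes V: "vectorspace K V" "vectorspace.fin_dim K V" and W: "vectorspace K W" "vectorspace.fin_dim K W"
  shows "vdim K (direct_sum V W) = vdim K V + vdim K W"
proof -
  interpret V: vectorspace K V by (rule V(1))
  interpret W: vectorspace K W by (rule W(1))
  let ?D = "direct_sum V W"
  note D = direct_sum_is_vs[OF V(1) W(1)]
  have fd: "vectorspace.fin_dim K ?D" by (rule fin_dim_direct_sum[OF V W])
  have K: "field K" by (rule V.field_axioms)
  have "mod_hom K ?D W snd"
    by (rule mod_homI) (use D in \<open>auto simp: vectorspace_def direct_sum_simps W.module_axioms\<close>)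
  then interpret s: linear_map K ?D W snd by (rule linear_mapI[OF K])
  have surj: "snd ` carrier ?D = carrier W" using V.M.zero_closed by (force simp: direct_sum_simps)
  have rn: "vectorspace.dim K (W\<lparr>carrier := s.im\<rparr>) + vectorspace.dim K (?D\<lparr>carrier := s.ker\<rparr>) = vectorspace.dim K ?D"
    by (rule s.rank_nullity[OF fd])
  have im: "W\<lparr>carrier := s.im\<rparr> = W" using surj by (simp add: s.im_def)
  have ker: "s.ker = carrier V \<times> {\<zero>\<^bsub>W\<^esub>}" by (auto simp: s.ker_def direct_sum_simps)
  have vk: "vectorspace K (?D\<lparr>carrier := s.ker\<rparr>)"
    using s.V.subspace_is_vs[OF s.kerT_is_subspace] .
  have "mod_hom K V (?D\<lparr>carrier := s.ker\<rparr>) (\<lambda>v. (v, \<zero>\<^bsub>W\<^esub>))"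
    by (rule mod_homI) (use vk in \<open>auto simp: vectorspace_def direct_sum_simps V.module_axioms ker\<close>)
  then interpret i: linear_map K V "?D\<lparr>carrier := s.ker\<rparr>" "\<lambda>v. (v, \<zero>\<^bsub>W\<^esub>)" by (rule linear_mapI[OF K])
  have "vectorspace.dim K V = vectorspace.dim K (?D\<lparr>carrier := s.ker\<rparr>)"
    by (rule i.dim_eq[OF V(2)]) (auto simp: ker inj_on_def)
  then show ?thesis using rn V(2) W(2) fd by (simp add: vdim_def im)
qed

lemma vdim_zero:
  assumes V: "vectorspace K V" and c: "carrier V = {\<zero>\<^bsub>V\<^esub>}" shows "vdim K V = 0"
proof -
  interpret vectorspace K V by fact
  have g: "gen_set {}" unfolding c by (rule span_empty)
  then have "fin_dim" unfolding fin_dim_def by (intro exI[of _ "{}"]) auto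
  moreover have "dim = 0" unfolding dim_def by (rule Least_eq_0) (use g in \<open>auto intro!: exI[of _ "{}"]\<close>)
  ultimately show ?thesis by (simp add: vdim_def zero_enat_def)
qed

lemma vdim_nonzero:
  assumes V: "vectorspace K V" and v: "v \<in> carrier V" "v \<noteq> \<zero>\<^bsub>V\<^esub>" shows "vdim K V \<noteq> 0"
proof
  interpret vectorspace K V by fact
  assume "vdim K V = 0"
  then have fd: "fin_dim" and d: "dim = 0" by (auto simp: vdim_def zero_enat_def split: if_splits)
  obtain A where A: "finite A" "basis A" using finite_basis_exists[OF fd] by blast
  then have "A = {}" using dim_basis[OF A] d by simp
  then have "carrier V = {\<zero>\<^bsub>V\<^esub>}" using A(2) span_empty unfolding basis_def by simp
  then show False using v by simp
qed

section \<open>Dimensions of the homogeneous components of the differentials\<close>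

context poly_extension
begin

abbreviation "\<Omega>K \<equiv> restrict_scalars \<alpha> \<Omega>"
abbreviation "SK \<equiv> restrict_scalars \<phi> (regular_module S)"

lemma \<Omega>K_module: "module K \<Omega>K"
  by (rule module_restrict_scalars[OF K_cring \<Omega>A.omega_module \<alpha>_hom])

lemma SK_module: "module K SK"
  by (rule module_restrict_scalars[OF K_cring cring_regular_module[OF S_cring] \<phi>_hom])

lemma \<Omega>K_simps: "carrier \<Omega>K = carrier \<Omega>" "add \<Omega>K = add \<Omega>" "zero \<Omega>K = zero \<Omega>"
  "k \<odot>\<^bsub>\<Omega>K\<^esub> w = \<alpha> k \<odot>\<^bsub>\<Omega>\<^esub> w"
  by (simp_all add: restrict_scalars_def)

lemma SK_simps: "carrier SK = carrier S" "add SK = add S" "zero SK = zero S" "k \<odot>\<^bsub>SK\<^esub> s = \<phi> k \<otimes> s"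
  by (simp_all add: restrict_scalars_def regular_module_def)

lemma \<alpha>_closed: "k \<in> carrier K \<Longrightarrow> \<alpha> k \<in> carrier A"
  by (rule \<Omega>A.phi_closed)

lemma \<alpha>_smult_hcL:
  assumes "k \<in> carrier K" "s \<in> carrier S" "m \<in> carrier M"
  shows "\<alpha> k \<odot>\<^bsub>L\<^esub> hcL i s m = hcL i (\<phi> k \<otimes> s) (\<phi> k \<odot>\<^bsub>M\<^esub> m)"
proof -
  have \<phi>k: "\<phi> k \<in> carrier S" by (rule \<Omega>S.phi_closed[OF assms(1)])
  have c\<alpha>: "c (\<alpha> k) = mnm (\<phi> k) 0"
    using c_monom[OF \<phi>k, of 0] assms(1) \<phi>k by (simp add: \<alpha>_eq)
  have 1: "mnm (\<phi> k) 0 \<otimes>\<^bsub>P\<^esub> mnm s j = mnm (\<phi> k \<otimes> s) j" for j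
    using UP.monom_mult[OF \<phi>k assms(2), of 0 j] by (simp del: UP.monom_mult)
  have 2: "mnm (\<phi> k) 0 \<odot>\<^bsub>PM\<^esub> sgl m j = sgl (\<phi> k \<odot>\<^bsub>M\<^esub> m) j" for j
    using PMod.mnm_smult_sgl[OF \<phi>k assms(3), of 0 j] by simp
  have 3: "mnm (\<phi> k) 0 \<odot>\<^bsub>PM\<^esub> \<zero>\<^bsub>PM\<^esub> = \<zero>\<^bsub>PM\<^esub>" by (rule PMod.PM.smult_r_null) (simp add: \<phi>k)
  have 4: "mnm (\<phi> k) 0 \<otimes>\<^bsub>P\<^esub> \<zero>\<^bsub>P\<^esub> = \<zero>\<^bsub>P\<^esub>" by (rule UP.P.r_null) (simp add: \<phi>k)
  show ?thesis unfolding hcL_def L_simps c\<alpha> fst_conv snd_conv by (cases "i \<le> 0"; cases "i < 0") (simp_all only: 1 2 3 4 if_True if_False)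
qed

text \<open>A component is by definition a generated additive group. Closure under scalars is
  visible after applying \<Phi> and is pulled back by injectivity.\<close>

lemma gr\<Omega>_submodule: "submodule K (gr\<Omega> i) \<Omega>K"
proof (rule submoduleI2[OF \<Omega>K_module], unfold \<Omega>K_simps)
  show "gr\<Omega> i \<subseteq> carrier \<Omega>" using gr\<Omega>_closed by blast
  fix k w assume k: "k \<in> carrier K" and w: "w \<in> gr\<Omega> i"
  have "\<Phi> w \<in> grL i" using w \<Phi>_gr_subset by blast
  then obtain s m where sm: "s \<in> carrier S" "m \<in> carrier M" "\<Phi> w = hcL i s m" by (auto simp: grL_def)
  have "\<Phi> (\<alpha> k \<odot>\<^bsub>\<Omega>\<^esub> w) = hcL i (\<phi> k \<otimes> s) (\<phi> k \<odot>\<^bsub>M\<^esub> m)"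
    using \<alpha>_smult_hcL[OF k sm(1,2)] by (simp only: \<Phi>.f_smult[OF \<alpha>_closed[OF k] gr\<Omega>_closed[OF w]] sm(3))
  also have "\<dots> \<in> grL i" unfolding grL_def using \<Omega>S.phi_closed[OF k] sm by blast
  finally have "\<Phi> (\<alpha> k \<odot>\<^bsub>\<Omega>\<^esub> w) \<in> \<Phi> ` gr\<Omega> i" unfolding \<Phi>_gr .
  then obtain w' where w': "w' \<in> gr\<Omega> i" "\<Phi> (\<alpha> k \<odot>\<^bsub>\<Omega>\<^esub> w) = \<Phi> w'" by blast
  have "\<alpha> k \<odot>\<^bsub>\<Omega>\<^esub> w = w'"
    using inj_onD[OF \<Phi>_inj w'(2)] \<Omega>A.\<Omega>.smult_closed[OF \<alpha>_closed[OF k] gr\<Omega>_closed[OF w]] gr\<Omega>_closed[OF w'(1)] by blast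
  then show "\<alpha> k \<odot>\<^bsub>\<Omega>\<^esub> w \<in> gr\<Omega> i" using w'(1) by simp
qed (rule gr\<Omega>_zero, rule gr\<Omega>_add)

abbreviation "Gr i \<equiv> \<Omega>K\<lparr>carrier := gr\<Omega> i\<rparr>"

lemma Gr_module: "module K (Gr i)"
proof -
  interpret \<Omega>K: module K \<Omega>K by (rule \<Omega>K_module)
  show ?thesis by (rule \<Omega>K.submodule_is_module[OF gr\<Omega>_submodule])
qed

text \<open>A common frame for degree zero and positive degrees: \<open>f s m\<close> are the
  coordinates of \<open>hcL i s m\<close> in \<open>U\<close>, read off by \<open>g\<close>.
  Condition \<open>inj\<close> asks for equality of the elements \<open>hcL\<close>, not of the
  arguments, because in degree zero \<open>s\<close> is lost.\<close>

lemma Gr_mod_hom: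
  assumes U: "module K U" and g: "\<And>s m. s \<in> carrier S \<Longrightarrow> m \<in> carrier M \<Longrightarrow> g (hcL i s m) = f s m"
    and fc: "\<And>s m. s \<in> carrier S \<Longrightarrow> m \<in> carrier M \<Longrightarrow> f s m \<in> carrier U"
    and fa: "\<And>s m s' m'. s \<in> carrier S \<Longrightarrow> m \<in> carrier M \<Longrightarrow> s' \<in> carrier S \<Longrightarrow> m' \<in> carrier M \<Longrightarrow>
      f (s \<oplus> s') (m \<oplus>\<^bsub>M\<^esub> m') = f s m \<oplus>\<^bsub>U\<^esub> f s' m'"
    and fs: "\<And>k s m. k \<in> carrier K \<Longrightarrow> s \<in> carrier S \<Longrightarrow> m \<in> carrier M \<Longrightarrow>
      f (\<phi> k \<otimes> s) (\<phi> k \<odot>\<^bsub>M\<^esub> m) = k \<odot>\<^bsub>U\<^esub> f s m"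
    and inj: "\<And>s m s' m'. s \<in> carrier S \<Longrightarrow> m \<in> carrier M \<Longrightarrow> s' \<in> carrier S \<Longrightarrow> m' \<in> carrier M \<Longrightarrow>
      f s m = f s' m' \<Longrightarrow> hcL i s m = hcL i s' m'"
    and surj: "\<And>u. u \<in> carrier U \<Longrightarrow> \<exists>s\<in>carrier S. \<exists>m\<in>carrier M. u = f s m"
  shows "mod_hom K (Gr i) U (\<lambda>w. g (\<Phi> w))" and "bij_betw (\<lambda>w. g (\<Phi> w)) (carrier (Gr i)) (carrier U)"
proof -
  have rep: "\<exists>s m. s \<in> carrier S \<and> m \<in> carrier M \<and> \<Phi> w = hcL i s m" if "w \<in> gr\<Omega> i" for w
    using \<Phi>_gr_subset[OF that] by (auto simp: grL_def)
  have rep': "\<exists>w\<in>gr\<Omega> i. \<Phi> w = hcL i s m" if "s \<in> carrier S" "m \<in> carrier M" for s m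
  proof -
    have "hcL i s m \<in> \<Phi> ` gr\<Omega> i" unfolding \<Phi>_gr grL_def using that by blast
    then show ?thesis by (metis imageE)
  qed
  show "mod_hom K (Gr i) U (\<lambda>w. g (\<Phi> w))"
  proof (rule mod_homI[OF Gr_module U])
    fix w assume "w \<in> carrier (Gr i)"
    then have w: "w \<in> gr\<Omega> i" by simp
    obtain s m where sm: "s \<in> carrier S" "m \<in> carrier M" "\<Phi> w = hcL i s m" using rep[OF w] by blast
    show "g (\<Phi> w) \<in> carrier U" unfolding sm(3) g[OF sm(1,2)] by (rule fc[OF sm(1,2)])
    {
      fix w' assume "w' \<in> carrier (Gr i)"
      then have w': "w' \<in> gr\<Omega> i" by simp
      obtain s' m' where sm': "s' \<in> carrier S" "m' \<in> carrier M" "\<Phi> w' = hcL i s' m'" using rep[OF w'] by blast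
      have "\<Phi> (w \<oplus>\<^bsub>\<Omega>\<^esub> w') = hcL i (s \<oplus> s') (m \<oplus>\<^bsub>M\<^esub> m')"
        unfolding \<Phi>.f_add[OF gr\<Omega>_closed[OF w] gr\<Omega>_closed[OF w']] sm(3) sm'(3)
        by (rule hcL_add[OF sm(1) sm'(1) sm(2) sm'(2), symmetric])
      then have "g (\<Phi> (w \<oplus>\<^bsub>\<Omega>\<^esub> w')) = g (\<Phi> w) \<oplus>\<^bsub>U\<^esub> g (\<Phi> w')"
        using sm sm' by (simp only: g fa UP.R.a_closed \<Omega>S.\<Omega>.M.a_closed)
      then show "g (\<Phi> (w \<oplus>\<^bsub>Gr i\<^esub> w')) = g (\<Phi> w) \<oplus>\<^bsub>U\<^esub> g (\<Phi> w')" by (simp add: \<Omega>K_simps)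
    }
    {
      fix k assume k: "k \<in> carrier K"
      have "\<Phi> (\<alpha> k \<odot>\<^bsub>\<Omega>\<^esub> w) = hcL i (\<phi> k \<otimes> s) (\<phi> k \<odot>\<^bsub>M\<^esub> m)"
        unfolding \<Phi>.f_smult[OF \<alpha>_closed[OF k] gr\<Omega>_closed[OF w]] sm(3) by (rule \<alpha>_smult_hcL[OF k sm(1,2)])
      then have "g (\<Phi> (\<alpha> k \<odot>\<^bsub>\<Omega>\<^esub> w)) = k \<odot>\<^bsub>U\<^esub> g (\<Phi> w)"
        using sm k \<Omega>S.phi_closed[OF k] by (simp only: g fs UP.R.m_closed \<Omega>S.\<Omega>.smult_closed)
      then show "g (\<Phi> (k \<odot>\<^bsub>Gr i\<^esub> w)) = k \<odot>\<^bsub>U\<^esub> g (\<Phi> w)" by (simp add: \<Omega>K_simps)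
    }
  qed
  have "inj_on (\<lambda>w. g (\<Phi> w)) (gr\<Omega> i)"
  proof (rule inj_onI)
    fix w w' assume w: "w \<in> gr\<Omega> i" and w': "w' \<in> gr\<Omega> i" and eq: "g (\<Phi> w) = g (\<Phi> w')"
    obtain s m where sm: "s \<in> carrier S" "m \<in> carrier M" "\<Phi> w = hcL i s m" using rep[OF w] by blast
    obtain s' m' where sm': "s' \<in> carrier S" "m' \<in> carrier M" "\<Phi> w' = hcL i s' m'" using rep[OF w'] by blast
    have "f s m = f s' m'" using eq unfolding sm(3) sm'(3) g[OF sm(1,2)] g[OF sm'(1,2)] .
    then have "\<Phi> w = \<Phi> w'" unfolding sm(3) sm'(3) by (rule inj[OF sm(1,2) sm'(1,2)])
    then show "w = w'" using inj_onD[OF \<Phi>_inj] gr\<Omega>_closed w w' by blast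
  qed
  moreover have "(\<lambda>w. g (\<Phi> w)) ` gr\<Omega> i = carrier U"
  proof (intro subset_antisym subsetI)
    fix u assume "u \<in> (\<lambda>w. g (\<Phi> w)) ` gr\<Omega> i"
    then obtain w where w: "w \<in> gr\<Omega> i" "u = g (\<Phi> w)" by blast
    obtain s m where sm: "s \<in> carrier S" "m \<in> carrier M" "\<Phi> w = hcL i s m" using rep[OF w(1)] by blast
    show "u \<in> carrier U" unfolding w(2) sm(3) g[OF sm(1,2)] by (rule fc[OF sm(1,2)])
  next
    fix u assume "u \<in> carrier U"
    then obtain s m where sm: "s \<in> carrier S" "m \<in> carrier M" "u = f s m" using surj by blast
    obtain w where w: "w \<in> gr\<Omega> i" "\<Phi> w = hcL i s m" using rep'[OF sm(1,2)] by blast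
    have "u = g (\<Phi> w)" unfolding w(2) g[OF sm(1,2)] by (rule sm(3))
    then show "u \<in> (\<lambda>w. g (\<Phi> w)) ` gr\<Omega> i" using w(1) by blast
  qed
  ultimately show "bij_betw (\<lambda>w. g (\<Phi> w)) (carrier (Gr i)) (carrier U)" by (simp add: bij_betw_def)
qed

lemma vdim_Gr_neg:
  assumes K: "field K" and i: "i < 0" shows "vdim K (Gr i) = 0"
proof (rule vdim_zero)
  show "vectorspace K (Gr i)" using Gr_module K by (simp add: vectorspace_def)
  have "w = \<zero>\<^bsub>\<Omega>\<^esub>" if w: "w \<in> gr\<Omega> i" for w
  proof -
    have "\<Phi> w \<in> grL i" by (rule \<Phi>_gr_subset[OF w])
    then have "\<Phi> w = \<Phi> \<zero>\<^bsub>\<Omega>\<^esub>" using i by (auto simp: grL_def hcL_def L_simps)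
    then show ?thesis using inj_onD[OF \<Phi>_inj] gr\<Omega>_closed[OF w] by blast
  qed
  then show "carrier (Gr i) = {\<zero>\<^bsub>Gr i\<^esub>}" using gr\<Omega>_zero by (auto simp: \<Omega>K_simps)
qed

lemma vdim_Gr_0:
  assumes K: "field K" shows "vdim K (Gr 0) = vdim K N"
proof -
  note * = Gr_mod_hom[of N "\<lambda>u. snd u 0" 0 "\<lambda>s m. m", OF N_module]
  show ?thesis
    by (rule vdim_eq[OF K *(1,2)])
      (auto simp: hcL_def single_coeff_def N_simps intro: UP.R.zero_closed)
qed

lemma vdim_Gr_pos:
  assumes K: "field K" and i: "i > 0" shows "vdim K (Gr i) = vdim K (direct_sum SK N)"
proof -
  have D: "module K (direct_sum SK N)" by (rule direct_sum_is_module[OF SK_module N_module])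
  note * = Gr_mod_hom[of "direct_sum SK N" "\<lambda>u. (cf (fst u) (nat (i - 1)), snd u (nat i))" i "\<lambda>s m. (s, m)", OF D]
  show ?thesis
    by (rule vdim_eq[OF K *(1,2)])
      (use i in \<open>auto simp: hcL_def single_coeff_def N_simps SK_simps direct_sum_simps\<close>)
qed

text \<open>The expression \<open>s dt\<close> is bilinear over \<open>K\<close>, so if
  \<open>F\<close> spans \<open>S\<close>, the finitely many \<open>s dt\<close> with
  \<open>s\<close> and \<open>t\<close> in \<open>F\<close> span the differentials. The passage from
  \<open>F\<close> to \<open>S\<close> is made first in \<open>t\<close>, then in
  \<open>s\<close>.\<close>

lemma fin_dim_N:
  assumes K: "field K" and S: "vectorspace.fin_dim K SK" shows "vectorspace.fin_dim K N"
proof -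
  have VS: "vectorspace K SK" "vectorspace K N" using SK_module N_module K by (simp_all add: vectorspace_def)
  obtain F where F: "finite F" "F \<subseteq> carrier S" "\<And>W. submodule K W SK \<Longrightarrow> F \<subseteq> W \<Longrightarrow> carrier S \<subseteq> W"
    by (rule fin_dimE[OF VS(1) S]) (simp add: SK_simps)
  let ?G = "(\<lambda>(s, t). s \<odot>\<^bsub>M\<^esub> dS t) ` (F \<times> F)"
  have ds0: "dS \<zero> = \<zero>\<^bsub>M\<^esub>" by (rule dS_zero)
  have d\<phi>: "dS (\<phi> k \<otimes> t) = \<phi> k \<odot>\<^bsub>M\<^esub> dS t" if "k \<in> carrier K" "t \<in> carrier S" for k t
    using that by (simp add: \<Omega>S.d_mult \<Omega>S.phi_closed \<Omega>S.d_const)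
  show ?thesis
  proof (rule fin_dimI[OF VS(2), of ?G])
    show "finite ?G" using F(1) by simp
    show "?G \<subseteq> carrier N" using F(2) by (auto simp: N_simps)
    fix W assume W: "submodule K W N" "?G \<subseteq> W"
    note WD = submoduleD[OF W(1), unfolded N_simps]
    have W0: "\<zero>\<^bsub>M\<^esub> \<in> W" using WD(1) by (simp add: restrict_scalars_def)
    have 1: "s \<odot>\<^bsub>M\<^esub> dS t \<in> W" if s: "s \<in> F" and t: "t \<in> carrier S" for s t
    proof -
      have sS: "s \<in> carrier S" using s F(2) by blast
      have "submodule K {t \<in> carrier S. s \<odot>\<^bsub>M\<^esub> dS t \<in> W} SK"
      proof (rule submoduleI2[OF SK_module], unfold SK_simps)
        fix u v assume "u \<in> {t \<in> carrier S. s \<odot>\<^bsub>M\<^esub> dS t \<in> W}" "v \<in> {t \<in> carrier S. s \<odot>\<^bsub>M\<^esub> dS t \<in> W}"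
        then show "u \<oplus> v \<in> {t \<in> carrier S. s \<odot>\<^bsub>M\<^esub> dS t \<in> W}"
          using sS WD(2)[of "s \<odot>\<^bsub>M\<^esub> dS u" "s \<odot>\<^bsub>M\<^esub> dS v"] by (simp add: \<Omega>S.d_add \<Omega>S.\<Omega>.smult_r_distr)
      next
        fix k u assume k: "k \<in> carrier K" and u: "u \<in> {t \<in> carrier S. s \<odot>\<^bsub>M\<^esub> dS t \<in> W}"
        have \<phi>k: "\<phi> k \<in> carrier S" by (rule \<Omega>S.phi_closed[OF k])
        have "s \<odot>\<^bsub>M\<^esub> dS (\<phi> k \<otimes> u) = \<phi> k \<odot>\<^bsub>M\<^esub> (s \<odot>\<^bsub>M\<^esub> dS u)"
          using k u sS \<phi>k by (simp add: d\<phi> UP.R.m_comm[of s] flip: \<Omega>S.\<Omega>.smult_assoc1)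
        then show "\<phi> k \<otimes> u \<in> {t \<in> carrier S. s \<odot>\<^bsub>M\<^esub> dS t \<in> W}" using u \<phi>k WD(3)[OF k] by simp
      qed (use sS W0 ds0 in auto)
      moreover have "F \<subseteq> {t \<in> carrier S. s \<odot>\<^bsub>M\<^esub> dS t \<in> W}" using W(2) F(2) s by auto
      ultimately show ?thesis using F(3) t by blast
    qed
    have 2: "s \<odot>\<^bsub>M\<^esub> dS t \<in> W" if t: "t \<in> carrier S" and s: "s \<in> carrier S" for s t
    proof -
      have "submodule K {s \<in> carrier S. s \<odot>\<^bsub>M\<^esub> dS t \<in> W} SK"
      proof (rule submoduleI2[OF SK_module], unfold SK_simps)
        fix u v assume "u \<in> {s \<in> carrier S. s \<odot>\<^bsub>M\<^esub> dS t \<in> W}" "v \<in> {s \<in> carrier S. s \<odot>\<^bsub>M\<^esub> dS t \<in> W}"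
        then show "u \<oplus> v \<in> {s \<in> carrier S. s \<odot>\<^bsub>M\<^esub> dS t \<in> W}"
          using t WD(2)[of "u \<odot>\<^bsub>M\<^esub> dS t" "v \<odot>\<^bsub>M\<^esub> dS t"] by (simp add: \<Omega>S.\<Omega>.smult_l_distr)
      next
        fix k u assume k: "k \<in> carrier K" and u: "u \<in> {s \<in> carrier S. s \<odot>\<^bsub>M\<^esub> dS t \<in> W}"
        then show "\<phi> k \<otimes> u \<in> {s \<in> carrier S. s \<odot>\<^bsub>M\<^esub> dS t \<in> W}"
          using t WD(3)[OF k] \<Omega>S.phi_closed[OF k] by (simp add: \<Omega>S.\<Omega>.smult_assoc1)
      qed (use t W0 in auto)
      moreover have "F \<subseteq> {s \<in> carrier S. s \<odot>\<^bsub>M\<^esub> dS t \<in> W}" using 1 F(2) t by auto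
      ultimately show ?thesis using F(3) s by blast
    qed
    show "carrier N \<subseteq> W"
    proof
      fix w assume "w \<in> carrier N"
      then have "w \<in> carrier M" by (simp add: N_simps)
      then show "w \<in> W"
      proof (induction rule: \<Omega>S.omega_induct)
        case zero then show ?case by (rule W0)
      next
        case (gen a b w) then show ?case using WD(2)[OF 2[OF gen(2,1)] gen(4)] by simp
      qed
    qed
  qed
qed

end

section \<open>Homogeneous fractions\<close>

locale graded_cring = cring A for A :: "('a, 'z) ring_scheme" (structure) +
  fixes G :: "int \<Rightarrow> 'a set"
  assumes one_grade: "\<one> \<in> G 0"
    and mult_grade: "\<And>a b i j. a \<in> G i \<Longrightarrow> b \<in> G j \<Longrightarrow> a \<otimes> b \<in> G (i + j)"
begin

abbreviation "nzd \<equiv> hom_nonzerodivisors A G"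
abbreviation "fr \<equiv> hfrac A G"
abbreviation "Q \<equiv> hom_quotient_ring A G"

lemma nzdD: "b \<in> nzd \<Longrightarrow> b \<in> carrier A" "b \<in> nzd \<Longrightarrow> a \<in> carrier A \<Longrightarrow> a \<otimes> b = \<zero> \<Longrightarrow> a = \<zero>"
  by (auto simp: hom_nonzerodivisors_def)

lemma nzd_one: "\<one> \<in> nzd" using one_grade by (auto simp: hom_nonzerodivisors_def)

lemma nzd_mult: assumes "b \<in> nzd" "c \<in> nzd" shows "b \<otimes> c \<in> nzd"
proof -
  have "a = \<zero>" if a: "a \<in> carrier A" "a \<otimes> (b \<otimes> c) = \<zero>" for a
  proof -
    have "(a \<otimes> b) \<otimes> c = \<zero>" using a assms by (simp add: nzdD(1) m_assoc)
    then have "a \<otimes> b = \<zero>" using nzdD(2)[OF assms(2), of "a \<otimes> b"] nzdD(1)[OF assms(1)] a by blast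
    then show ?thesis using nzdD(2)[OF assms(1)] a by blast
  qed
  moreover obtain i j where "b \<in> G i" "c \<in> G j" using assms unfolding hom_nonzerodivisors_def by blast
  then have "\<exists>e. b \<otimes> c \<in> G e" using mult_grade by blast
  ultimately show ?thesis
    unfolding hom_nonzerodivisors_def using nzdD(1)[OF assms(1)] nzdD(1)[OF assms(2)] by blast
qed

lemma nzd_cancel:
  assumes "b \<in> nzd" "a \<in> carrier A" "c \<in> carrier A" "a \<otimes> b = c \<otimes> b" shows "a = c"
proof -
  have "(a \<ominus> c) \<otimes> b = \<zero>" using assms by (simp add: minus_eq l_distr l_minus r_neg nzdD(1))
  then have "a \<ominus> c = \<zero>" using nzdD(2)[OF assms(1), of "a \<ominus> c"] assms(2,3) by blast
  then show ?thesis using assms(2,3) by simp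
qed

lemma mem_fr: "(a', b') \<in> fr a b \<longleftrightarrow> a' \<in> carrier A \<and> b' \<in> nzd \<and> a \<otimes> b' = a' \<otimes> b"
  by (simp add: hfrac_def)

lemma fr_eq_iff:
  assumes a: "a \<in> carrier A" "a' \<in> carrier A" and b: "b \<in> nzd" "b' \<in> nzd"
  shows "fr a b = fr a' b' \<longleftrightarrow> a \<otimes> b' = a' \<otimes> b"
proof
  assume "fr a b = fr a' b'"
  moreover have "(a', b') \<in> fr a' b'" using assms by (simp add: mem_fr)
  ultimately have "(a', b') \<in> fr a b" by simp
  then show "a \<otimes> b' = a' \<otimes> b" by (simp add: mem_fr)
next
  have *: "(c, e) \<in> fr a' b'"
    if "a \<in> carrier A" "a' \<in> carrier A" "b \<in> nzd" "b' \<in> nzd" and eq: "a \<otimes> b' = a' \<otimes> b" and ce: "(c, e) \<in> fr a b"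
    for a a' b b' c e
  proof -
    note c = nzdD(1)[OF that(3)] nzdD(1)[OF that(4)] that(1,2)
    have ce: "c \<in> carrier A" "e \<in> nzd" "a \<otimes> e = c \<otimes> b" using ce by (auto simp: mem_fr)
    note e = nzdD(1)[OF ce(2)]
    have "(a' \<otimes> e) \<otimes> b = (a' \<otimes> b) \<otimes> e" using c e by (simp add: m_ac)
    also have "\<dots> = (a \<otimes> e) \<otimes> b'" using c e unfolding eq[symmetric] by (simp add: m_ac)
    also have "\<dots> = (c \<otimes> b') \<otimes> b" using c e ce(1) unfolding ce(3) by (simp add: m_ac)
    finally have "a' \<otimes> e = c \<otimes> b'" using nzd_cancel[OF that(3)] c e ce(1) by simp
    then show ?thesis using ce by (simp add: mem_fr)
  qed
  assume "a \<otimes> b' = a' \<otimes> b"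
  then show "fr a b = fr a' b'" using *[of a a' b b'] *[of a' a b' b] assms by auto
qed

lemma Q_simps: "carrier Q = {fr a b | a b. a \<in> carrier A \<and> b \<in> nzd}" "\<one>\<^bsub>Q\<^esub> = fr \<one> \<one>" "\<zero>\<^bsub>Q\<^esub> = fr \<zero> \<one>"
  by (simp_all add: hom_quotient_ring_def)

text \<open>The operations of \<open>Q\<close> are unions over all pairs of representatives. Every
  pair yields the same fraction, so the union is that fraction.\<close>

lemma
  assumes a: "a \<in> carrier A" "c \<in> carrier A" and b: "b \<in> nzd" "e \<in> nzd"
  shows fr_mult: "fr a b \<otimes>\<^bsub>Q\<^esub> fr c e = fr (a \<otimes> c) (b \<otimes> e)"
    and fr_add: "fr a b \<oplus>\<^bsub>Q\<^esub> fr c e = fr (a \<otimes> e \<oplus> c \<otimes> b) (b \<otimes> e)"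
proof -
  note bc = nzdD(1)[OF b(1)] nzdD(1)[OF b(2)]
  have mem: "(a, b) \<in> fr a b" "(c, e) \<in> fr c e" using a b by (simp_all add: mem_fr)
  have "fr (a' \<otimes> c') (b' \<otimes> e') = fr (a \<otimes> c) (b \<otimes> e)"
    "fr (a' \<otimes> e' \<oplus> c' \<otimes> b') (b' \<otimes> e') = fr (a \<otimes> e \<oplus> c \<otimes> b) (b \<otimes> e)"
    if "(a', b') \<in> fr a b" "(c', e') \<in> fr c e" for a' b' c' e'
  proof -
    have *: "a' \<in> carrier A" "b' \<in> nzd" "a' \<otimes> b = a \<otimes> b'" "c' \<in> carrier A" "e' \<in> nzd" "c' \<otimes> e = c \<otimes> e'"
      using that by (auto simp: mem_fr)
    note c = nzdD(1)[OF *(2)] nzdD(1)[OF *(5)] bc a *(1,4)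
    have "(a' \<otimes> c') \<otimes> (b \<otimes> e) = (a' \<otimes> b) \<otimes> (c' \<otimes> e)" using c by (simp add: m_ac)
    also have "\<dots> = (a \<otimes> c) \<otimes> (b' \<otimes> e')" using c unfolding *(3,6) by (simp add: m_ac)
    finally show "fr (a' \<otimes> c') (b' \<otimes> e') = fr (a \<otimes> c) (b \<otimes> e)"
      using a b * by (simp add: fr_eq_iff nzd_mult)
    have "(a' \<otimes> e' \<oplus> c' \<otimes> b') \<otimes> (b \<otimes> e) = (a' \<otimes> b) \<otimes> (e \<otimes> e') \<oplus> (c' \<otimes> e) \<otimes> (b \<otimes> b')"
      using c by (simp add: l_distr r_distr m_ac)
    also have "\<dots> = (a \<otimes> e \<oplus> c \<otimes> b) \<otimes> (b' \<otimes> e')" using c unfolding *(3,6) by (simp add: l_distr r_distr m_ac)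
    finally show "fr (a' \<otimes> e' \<oplus> c' \<otimes> b') (b' \<otimes> e') = fr (a \<otimes> e \<oplus> c \<otimes> b) (b \<otimes> e)"
      using a b * bc c by (simp add: fr_eq_iff nzd_mult)
  qed
  note * = this
  show "fr a b \<otimes>\<^bsub>Q\<^esub> fr c e = fr (a \<otimes> c) (b \<otimes> e)"
  proof -
    have "fr a b \<otimes>\<^bsub>Q\<^esub> fr c e = (\<Union>(a', b')\<in>fr a b. \<Union>(c', e')\<in>fr c e. fr (a' \<otimes> c') (b' \<otimes> e'))"
      by (simp add: hom_quotient_ring_def)
    also have "\<dots> = (\<Union>p\<in>fr a b. \<Union>q\<in>fr c e. fr (a \<otimes> c) (b \<otimes> e))"
      using *(1) by (intro SUP_cong refl) (auto intro!: SUP_cong)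
    finally show ?thesis using mem by auto
  qed
  show "fr a b \<oplus>\<^bsub>Q\<^esub> fr c e = fr (a \<otimes> e \<oplus> c \<otimes> b) (b \<otimes> e)"
  proof -
    have "fr a b \<oplus>\<^bsub>Q\<^esub> fr c e = (\<Union>(a', b')\<in>fr a b. \<Union>(c', e')\<in>fr c e. fr (a' \<otimes> e' \<oplus> c' \<otimes> b') (b' \<otimes> e'))"
      by (simp add: hom_quotient_ring_def)
    also have "\<dots> = (\<Union>p\<in>fr a b. \<Union>q\<in>fr c e. fr (a \<otimes> e \<oplus> c \<otimes> b) (b \<otimes> e))"
      using *(2) by (intro SUP_cong refl) (auto intro!: SUP_cong)
    finally show ?thesis using mem by auto
  qed
qed

lemma fr_closed: "a \<in> carrier A \<Longrightarrow> b \<in> nzd \<Longrightarrow> fr a b \<in> carrier Q"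
  by (auto simp: Q_simps)

lemma cring_hom_quotient_ring: "cring Q"
proof (rule cringI)
  note s = fr_mult fr_add fr_eq_iff nzd_mult nzd_one nzdD(1) Q_simps(2,3) l_distr r_distr m_ac a_ac
  have rep: "\<exists>a\<in>carrier A. \<exists>b\<in>nzd. y = fr a b" if "y \<in> carrier Q" for y using that by (auto simp: Q_simps)
  show "abelian_group Q"
  proof (rule abelian_groupI)
    fix y assume "y \<in> carrier Q"
    then obtain a b where y: "a \<in> carrier A" "b \<in> nzd" "y = fr a b" using rep by blast
    then show "\<exists>z\<in>carrier Q. z \<oplus>\<^bsub>Q\<^esub> y = \<zero>\<^bsub>Q\<^esub>"
      by (intro bexI[of _ "fr (\<ominus> a) b"] fr_closed) (simp_all add: s l_minus r_minus r_neg l_neg)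
    show "\<zero>\<^bsub>Q\<^esub> \<oplus>\<^bsub>Q\<^esub> y = y" using y by (simp add: s)
    fix y' assume "y' \<in> carrier Q"
    then obtain a' b' where y': "a' \<in> carrier A" "b' \<in> nzd" "y' = fr a' b'" using rep by blast
    show "y \<oplus>\<^bsub>Q\<^esub> y' \<in> carrier Q" using y y' by (simp add: fr_add fr_closed nzd_mult nzdD(1))
    show "y \<oplus>\<^bsub>Q\<^esub> y' = y' \<oplus>\<^bsub>Q\<^esub> y" using y y' by (simp add: s)
    fix z assume "z \<in> carrier Q"
    then obtain c e where z: "c \<in> carrier A" "e \<in> nzd" "z = fr c e" using rep by blast
    show "y \<oplus>\<^bsub>Q\<^esub> y' \<oplus>\<^bsub>Q\<^esub> z = y \<oplus>\<^bsub>Q\<^esub> (y' \<oplus>\<^bsub>Q\<^esub> z)" using y y' z by (simp add: s)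
  next
    show "\<zero>\<^bsub>Q\<^esub> \<in> carrier Q" unfolding Q_simps(3) by (simp add: fr_closed nzd_one)
  qed
  show "Group.comm_monoid Q"
  proof (rule comm_monoidI)
    fix y assume "y \<in> carrier Q"
    then obtain a b where y: "a \<in> carrier A" "b \<in> nzd" "y = fr a b" using rep by blast
    show "\<one>\<^bsub>Q\<^esub> \<otimes>\<^bsub>Q\<^esub> y = y" using y by (simp add: s)
    fix y' assume "y' \<in> carrier Q"
    then obtain a' b' where y': "a' \<in> carrier A" "b' \<in> nzd" "y' = fr a' b'" using rep by blast
    show "y \<otimes>\<^bsub>Q\<^esub> y' \<in> carrier Q" using y y' by (simp add: fr_mult fr_closed nzd_mult)
    show "y \<otimes>\<^bsub>Q\<^esub> y' = y' \<otimes>\<^bsub>Q\<^esub> y" using y y' by (simp add: s)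
    fix z assume "z \<in> carrier Q"
    then obtain c e where z: "c \<in> carrier A" "e \<in> nzd" "z = fr c e" using rep by blast
    show "y \<otimes>\<^bsub>Q\<^esub> y' \<otimes>\<^bsub>Q\<^esub> z = y \<otimes>\<^bsub>Q\<^esub> (y' \<otimes>\<^bsub>Q\<^esub> z)" using y y' z by (simp add: s)
  next
    show "\<one>\<^bsub>Q\<^esub> \<in> carrier Q" unfolding Q_simps(2) by (simp add: fr_closed nzd_one)
  qed
  fix y y' z assume "y \<in> carrier Q" "y' \<in> carrier Q" "z \<in> carrier Q"
  then obtain a b a' b' c e where *: "a \<in> carrier A" "b \<in> nzd" "y = fr a b" "a' \<in> carrier A" "b' \<in> nzd" "y' = fr a' b'"
    "c \<in> carrier A" "e \<in> nzd" "z = fr c e" using rep by meson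
  then show "(y \<oplus>\<^bsub>Q\<^esub> y') \<otimes>\<^bsub>Q\<^esub> z = y \<otimes>\<^bsub>Q\<^esub> z \<oplus>\<^bsub>Q\<^esub> y' \<otimes>\<^bsub>Q\<^esub> z" by (simp add: s)
qed

lemma grade_subset:
  assumes "\<And>i. G i \<subseteq> carrier A" shows "hom_quotient_grade A G d \<subseteq> carrier Q"
  using assms by (fastforce simp: hom_quotient_grade_def Q_simps)

lemma truncated_closure:
  assumes "\<And>i. G i \<subseteq> carrier A"
  shows "cring (truncated_closure A G)" "subring (carrier (truncated_closure A G)) Q"
proof -
  interpret Q: cring Q by (rule cring_hom_quotient_ring)
  have sub: "(\<Union>d\<in>{0..}. hom_quotient_grade A G d) \<subseteq> carrier Q" using grade_subset[OF assms] by blast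
  note sr = Q.generate_ring_is_subring[OF sub]
  show "subring (carrier (truncated_closure A G)) Q" using sr by (simp add: truncated_closure_def)
  show "cring (truncated_closure A G)" unfolding truncated_closure_def
    using Q.subcring_iff[OF Q.generate_ring_incl[OF sub]] Q.subcringI'[OF sr] by simp
qed

end

section \<open>The coordinate ring and its truncated integral closure\<close>

lemma poly_grade_mult: "p \<in> poly_grade n i \<Longrightarrow> q \<in> poly_grade n j \<Longrightarrow> p * q \<in> poly_grade n (i + j)"
proof (unfold poly_grade_def, safe)
  fix m assume p: "p \<in> pcar n" "\<forall>m\<in>Poly_Mapping.keys p. int (mdegree m) = i"
    and q: "q \<in> pcar n" "\<forall>m\<in>Poly_Mapping.keys q. int (mdegree m) = j"
  show "p * q \<in> pcar n" using p q by (simp add: pcar_closed)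
  assume "m \<in> Poly_Mapping.keys (p * q)"
  then obtain a b where "a \<in> Poly_Mapping.keys p" "b \<in> Poly_Mapping.keys q" "m = a + b"
    using keys_mult[of p q] by blast
  then show "int (mdegree m) = i + j" using p q by (auto simp: mdegree_add)
qed

context zero_dim_scheme
begin

abbreviation "Pn \<equiv> poly_ring n :: 'k mpoly ring"
abbreviation "R \<equiv> coord_ring n I"
abbreviation "cl \<equiv> coord_class n I"

sublocale Pr: cring Pn by (rule cring_poly_ring)
sublocale Pi: ideal I Pn using I_ideal by (simp add: ideal_poly_ring)

lemma Pn_minus: assumes "p \<in> pcar n" "q \<in> pcar n" shows "p \<ominus>\<^bsub>Pn\<^esub> q = p - q"
proof -
  have "\<ominus>\<^bsub>Pn\<^esub> q = - q" by (rule Pr.minus_equality) (use assms in \<open>simp_all add: pcar_closed\<close>)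
  then show ?thesis by (simp add: a_minus_def)
qed

lemma cl_eq_iff: "p \<in> pcar n \<Longrightarrow> q \<in> pcar n \<Longrightarrow> cl p = cl q \<longleftrightarrow> p - q \<in> I"
  using Pr.quotient_eq_iff_same_a_r_cos[OF Pi.ideal_axioms, of p q] by (simp add: Pn_minus coord_class_def)

lemma R_carrier: "carrier R = cl ` pcar n"
  by (auto simp: coord_ring_def coord_class_def FactRing_def A_RCOSETS_def')

lemma cl_closed: "p \<in> pcar n \<Longrightarrow> cl p \<in> carrier R" by (simp add: R_carrier)

lemma cl_hom: "cl \<in> Ring.ring_hom Pn R"
  using Pi.rcos_ring_hom unfolding coord_ring_def coord_class_def by simp

lemma cl_mult: "p \<in> pcar n \<Longrightarrow> q \<in> pcar n \<Longrightarrow> cl p \<otimes>\<^bsub>R\<^esub> cl q = cl (p * q)"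
  and cl_add: "p \<in> pcar n \<Longrightarrow> q \<in> pcar n \<Longrightarrow> cl p \<oplus>\<^bsub>R\<^esub> cl q = cl (p + q)"
  using Ring.ring_hom_mult[OF cl_hom, of p q] Ring.ring_hom_add[OF cl_hom, of p q] by simp_all

lemma cl_one: "\<one>\<^bsub>R\<^esub> = cl 1" using Ring.ring_hom_one[OF cl_hom] by simp

lemma cring_R: "cring R" unfolding coord_ring_def by (rule Pi.quotient_is_cring[OF Pr.cring_axioms])

lemma cl_zero: "\<zero>\<^bsub>R\<^esub> = cl 0"
  using ring_hom_zero[OF cl_hom Pr.ring_axioms cring.axioms(1)[OF cring_R]] by simp

lemma cl_eq_0: "p \<in> pcar n \<Longrightarrow> cl p = \<zero>\<^bsub>R\<^esub> \<longleftrightarrow> p \<in> I"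
  using cl_eq_iff[of p 0] by (simp add: cl_zero pcar_closed)

sublocale FR: graded_cring R "coord_grade n I"
proof (intro graded_cring.intro cring_R graded_cring_axioms.intro)
  show "\<one>\<^bsub>R\<^esub> \<in> coord_grade n I 0"
    using poly_grade_nat[of "1 :: 'k mpoly" n 0] by (auto simp: coord_grade_def cl_one homog_1 pcar_closed)
  fix a b i j assume "a \<in> coord_grade n I i" "b \<in> coord_grade n I j"
  then obtain p q where *: "p \<in> poly_grade n i" "q \<in> poly_grade n j" "a = cl p" "b = cl q"
    by (auto simp: coord_grade_def)
  then have "a \<otimes>\<^bsub>R\<^esub> b = cl (p * q)" by (simp add: cl_mult poly_grade_def)
  then show "a \<otimes>\<^bsub>R\<^esub> b \<in> coord_grade n I (i + j)" using poly_grade_mult[OF *(1,2)] by (simp add: coord_grade_def)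
qed

lemma grade_carrier: "coord_grade n I d \<subseteq> carrier R"
  by (auto simp: coord_grade_def poly_grade_def cl_closed)

lemma X0_in_pcar: "X 0 \<in> pcar n" "X 0 ^ k \<in> pcar n"
  by (simp_all add: X_in_pcar pcar_closed)

lemma X0_power_nonzerodivisor: "f \<in> pcar n \<Longrightarrow> X 0 ^ k * f \<in> I \<Longrightarrow> f \<in> I"
proof (induction k)
  case (Suc k)
  have "X 0 * (X 0 ^ k * f) \<in> I" using Suc.prems by (simp add: mult.assoc)
  then show ?case using X0_nonzerodivisor[of "X 0 ^ k * f"] Suc by (simp add: pcar_closed X0_in_pcar)
qed simp

lemma X0_power_nzd: "cl (X 0 ^ k) \<in> FR.nzd"
proof -
  have "a = \<zero>\<^bsub>R\<^esub>" if a: "a \<in> carrier R" "a \<otimes>\<^bsub>R\<^esub> cl (X 0 ^ k) = \<zero>\<^bsub>R\<^esub>" for a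
  proof -
    obtain p where p: "p \<in> pcar n" "a = cl p" using a R_carrier by auto
    have "X 0 ^ k * p \<in> I" using a(2) p by (simp add: cl_mult cl_eq_0 X0_in_pcar pcar_closed mult.commute)
    then show ?thesis using p X0_power_nonzerodivisor by (simp add: cl_eq_0)
  qed
  moreover have "cl (X 0 ^ k) \<in> coord_grade n I (int k)"
    unfolding coord_grade_def by (rule imageI) (simp add: poly_grade_nat X0_in_pcar homog_X_power)
  ultimately show ?thesis unfolding hom_nonzerodivisors_def using cl_closed[OF X0_in_pcar(2)] by blast
qed

section \<open>Fractions whose denominator is a power of \<open>x0\<close>\<close>

definition x0_frac :: "'k mpoly \<Rightarrow> nat \<Rightarrow> 'k frac" where
  "x0_frac q k = FR.fr (cl q) (cl (X 0 ^ k))"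

lemma x0_frac_eq_iff:
  "p \<in> pcar n \<Longrightarrow> q \<in> pcar n \<Longrightarrow> x0_frac p k = x0_frac q l \<longleftrightarrow> p * X 0 ^ l - q * X 0 ^ k \<in> I"
  by (simp add: x0_frac_def FR.fr_eq_iff X0_power_nzd cl_closed cl_mult X0_in_pcar cl_eq_iff pcar_closed)

lemma x0_frac_mult: "p \<in> pcar n \<Longrightarrow> q \<in> pcar n \<Longrightarrow> x0_frac p k \<otimes>\<^bsub>FR.Q\<^esub> x0_frac q l = x0_frac (p * q) (k + l)"
  by (simp add: x0_frac_def FR.fr_mult X0_power_nzd cl_closed cl_mult X0_in_pcar power_add)

lemma x0_frac_add: "p \<in> pcar n \<Longrightarrow> q \<in> pcar n \<Longrightarrow> x0_frac p k \<oplus>\<^bsub>FR.Q\<^esub> x0_frac q l = x0_frac (p * X 0 ^ l + q * X 0 ^ k) (k + l)"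
  by (simp add: x0_frac_def FR.fr_add X0_power_nzd cl_closed cl_mult cl_add X0_in_pcar power_add pcar_closed)

lemma x0_frac_add_same: "p \<in> pcar n \<Longrightarrow> q \<in> pcar n \<Longrightarrow> x0_frac p k \<oplus>\<^bsub>FR.Q\<^esub> x0_frac q k = x0_frac (p + q) k"
  by (simp add: x0_frac_add x0_frac_eq_iff X0_in_pcar pcar_closed power_add algebra_simps I_closed)

lemma x0_frac_one: "\<one>\<^bsub>FR.Q\<^esub> = x0_frac 1 0" and x0_frac_zero: "\<zero>\<^bsub>FR.Q\<^esub> = x0_frac 0 0"
  by (simp_all add: x0_frac_def FR.Q_simps cl_one cl_zero)

lemma x0_frac_0: "x0_frac 0 k = x0_frac 0 0"
  by (simp add: x0_frac_eq_iff pcar_closed I_closed)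

lemma x0_frac_eq_0: "p \<in> pcar n \<Longrightarrow> x0_frac p k = \<zero>\<^bsub>FR.Q\<^esub> \<longleftrightarrow> p \<in> I"
  by (simp add: x0_frac_zero x0_frac_eq_iff pcar_closed)

lemma x0_frac_in_grade: "p \<in> poly_grade n (d + int k) \<Longrightarrow> x0_frac p k \<in> hom_quotient_grade R (coord_grade n I) d"
  unfolding hom_quotient_grade_def x0_frac_def mem_Collect_eq
  by (intro exI[of _ "cl p"] exI[of _ "cl (X 0 ^ k)"] exI[of _ "int k"])
    (auto simp: coord_grade_def X0_power_nzd intro!: imageI, simp add: poly_grade_nat X0_in_pcar homog_X_power)

text \<open>A homogeneous denominator \<open>\<beta>\<close> divides some \<open>X 0 ^ k\<close>
  modulo \<open>I\<close>, with a homogeneous cofactor \<open>c\<close>; expanding the fraction by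
  \<open>c\<close> gives the denominator \<open>X 0 ^ k\<close> without changing the degree.\<close>

lemma grade_rep:
  assumes y: "y \<in> hom_quotient_grade R (coord_grade n I) d"
  shows "\<exists>p k. p \<in> poly_grade n (d + int k) \<and> y = x0_frac p k"
proof -
  obtain a b e where ab: "y = FR.fr a b" "a \<in> coord_grade n I (d + e)" "b \<in> coord_grade n I e" "b \<in> FR.nzd"
    using y by (auto simp: hom_quotient_grade_def)
  obtain \<alpha> \<beta> where *: "a = cl \<alpha>" "\<alpha> \<in> poly_grade n (d + e)" "b = cl \<beta>" "\<beta> \<in> poly_grade n e"
    using ab by (auto simp: coord_grade_def)
  have \<alpha>: "\<alpha> \<in> pcar n" and \<beta>: "\<beta> \<in> pcar n" using * by (auto simp: poly_grade_def)
  have nzd: "s \<in> I" if "s \<in> pcar n" "\<beta> * s \<in> I" for s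
    using FR.nzdD(2)[OF ab(4), of "cl s"] that \<beta>
    by (simp add: *(3) cl_closed cl_mult cl_eq_0 pcar_closed mult.commute)
  \<comment> \<open>In negative degree the denominator would be zero, which is a non-zerodivisor
    only if \<open>1\<close> lies in \<open>I\<close>.\<close>
  have "e \<ge> 0"
  proof (rule ccontr)
    assume "\<not> e \<ge> 0"
    then have "\<beta> = 0" using *(4) poly_grade_neg[of e \<beta> n] by simp
    then have "1 \<in> I" using nzd[of 1] by (simp add: pcar_closed I_closed)
    then show False using one_notin_deh I_subset_deh by blast
  qed
  then obtain e' where e': "e = int e'" by (metis nonneg_int_cases)
  then have "homog e' \<beta>" using *(4) by (simp add: poly_grade_nat)
  then obtain k c where kc: "e' \<le> k" "c \<in> pcar n" "homog (k - e') c" "X 0 ^ k - \<beta> * c \<in> I"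
    using nonzerodivisor_dvd_X0_power[OF \<beta> _ nzd] by blast
  have "c \<in> poly_grade n (int (k - e'))" unfolding poly_grade_nat using kc(2,3) by simp
  then have "\<alpha> * c \<in> poly_grade n (d + e + int (k - e'))" by (rule poly_grade_mult[OF *(2)])
  then have "\<alpha> * c \<in> poly_grade n (d + int k)" using kc(1) e' by (simp add: of_nat_diff)
  moreover have "\<alpha> * X 0 ^ k - \<alpha> * c * \<beta> \<in> I"
    using I_closed(3)[OF \<alpha> kc(4)] by (simp add: algebra_simps)
  then have "y = x0_frac (\<alpha> * c) k" unfolding ab(1) x0_frac_def
    using \<alpha> \<beta> kc ab(4) by (simp add: *(1,3) FR.fr_eq_iff X0_power_nzd cl_closed cl_mult pcar_closed X0_in_pcar cl_eq_iff)
  ultimately show ?thesis by blast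
qed

abbreviation "A \<equiv> closure_ring n I"

lemma A_simps: "mult A = mult FR.Q" "add A = add FR.Q" "one A = one FR.Q" "zero A = zero FR.Q"
  by (simp_all add: closure_ring_def truncated_closure_def)

lemma cring_A: "cring A" and A_subring: "subring (carrier A) FR.Q"
  using FR.truncated_closure[OF grade_carrier] by (simp_all add: closure_ring_def)

lemma grade_subset_A: "d \<ge> 0 \<Longrightarrow> hom_quotient_grade R (coord_grade n I) d \<subseteq> carrier A"
  by (auto simp: closure_ring_def truncated_closure_def intro!: generate_ring.incl)

section \<open>The affine ring as a quotient of the polynomial ring, and its embedding into the
  closure\<close>

abbreviation "S \<equiv> affine_ring n I"

definition affine_class :: "'k mpoly \<Rightarrow> 'k mpoly set set" where
  "affine_class p = affine_ideal n I +>\<^bsub>R\<^esub> cl p"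

lemma affine_ideal_eq: "affine_ideal n I = {cl (r * (X 0 - 1)) | r. r \<in> pcar n}"
proof -
  have "cl (X 0) \<ominus>\<^bsub>R\<^esub> \<one>\<^bsub>R\<^esub> = cl (X 0 - 1)"
  proof -
    have "\<ominus>\<^bsub>R\<^esub> cl 1 = cl (- 1)"
      by (rule FR.minus_equality) (simp_all add: cl_add cl_zero cl_closed pcar_closed)
    then show ?thesis by (simp add: a_minus_def cl_one cl_add X0_in_pcar pcar_closed)
  qed
  then have "affine_ideal n I = PIdl\<^bsub>R\<^esub> (cl (X 0 - 1))"
    using FR.cgenideal_eq_genideal[OF cl_closed[OF X0_minus_1]] by (simp add: affine_ideal_def)
  also have "\<dots> = {cl r \<otimes>\<^bsub>R\<^esub> cl (X 0 - 1) | r. r \<in> pcar n}" by (auto simp: cgenideal_def R_carrier)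
  also have "\<dots> = {cl (r * (X 0 - 1)) | r. r \<in> pcar n}"
    using cl_mult[OF _ X0_minus_1] by (metis (no_types, lifting))
  finally show ?thesis .
qed

lemma ideal_affine: "ideal (affine_ideal n I) R"
  unfolding affine_ideal_def
  by (rule FR.genideal_ideal) (simp add: cl_closed X0_in_pcar)

sublocale Ai: ideal "affine_ideal n I" R by (rule ideal_affine)

text \<open>Merges the two quotient steps leading to \<open>S\<close> into one, so that computations
  in \<open>S\<close> become membership questions about polynomials.\<close>

lemma cl_in_affine_ideal: assumes p: "p \<in> pcar n" shows "cl p \<in> affine_ideal n I \<longleftrightarrow> p \<in> deh_ideal n I"
proof -
  have "cl p \<in> affine_ideal n I \<longleftrightarrow> (\<exists>r\<in>pcar n. p - r * (X 0 - 1) \<in> I)"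
  proof -
    have "cl p = cl (r * (X 0 - 1)) \<longleftrightarrow> p - r * (X 0 - 1) \<in> I" if "r \<in> pcar n" for r
      by (rule cl_eq_iff[OF p pcar_closed(3)[OF that X0_minus_1]])
    then show ?thesis unfolding affine_ideal_eq by blast
  qed
  also have "\<dots> \<longleftrightarrow> p \<in> deh_ideal n I"
  proof
    assume "\<exists>r\<in>pcar n. p - r * (X 0 - 1) \<in> I"
    then obtain r where "r \<in> pcar n" "p - r * (X 0 - 1) \<in> I" by blast
    then show "p \<in> deh_ideal n I" unfolding deh_ideal_def mem_Collect_eq
      by (intro exI[of _ "p - r * (X 0 - 1)"] exI[of _ r]) (simp add: algebra_simps)
  next
    assume "p \<in> deh_ideal n I"
    then obtain a r where "p = a + (X 0 - 1) * r" "a \<in> I" "r \<in> pcar n" by (auto simp: deh_ideal_def)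
    then show "\<exists>r\<in>pcar n. p - r * (X 0 - 1) \<in> I" by (intro bexI[of _ r]) (simp_all add: algebra_simps)
  qed
  finally show ?thesis .
qed

lemma affine_class_eq_iff: assumes "p \<in> pcar n" "q \<in> pcar n" shows "affine_class p = affine_class q \<longleftrightarrow> p - q \<in> deh_ideal n I"
proof -
  have "\<ominus>\<^bsub>R\<^esub> cl q = cl (- q)"
    by (rule FR.minus_equality) (use assms in \<open>simp_all add: cl_add cl_zero cl_closed pcar_closed\<close>)
  then have "cl p \<ominus>\<^bsub>R\<^esub> cl q = cl (p - q)" using assms by (simp add: a_minus_def cl_add pcar_closed)
  then show ?thesis
    using FR.quotient_eq_iff_same_a_r_cos[OF ideal_affine, of "cl p" "cl q"] assms
    by (simp add: affine_class_def cl_closed cl_in_affine_ideal pcar_closed)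
qed

lemma S_carrier: "carrier S = affine_class ` pcar n"
  by (auto simp: affine_ring_def affine_class_def FactRing_def A_RCOSETS_def' R_carrier)

lemma affine_class_closed: "p \<in> pcar n \<Longrightarrow> affine_class p \<in> carrier S" by (simp add: S_carrier)

lemma cring_S: "cring S" unfolding affine_ring_def by (rule Ai.quotient_is_cring[OF cring_R])

lemma affine_class_mult: "p \<in> pcar n \<Longrightarrow> q \<in> pcar n \<Longrightarrow> affine_class p \<otimes>\<^bsub>S\<^esub> affine_class q = affine_class (p * q)"
  and affine_class_add: "p \<in> pcar n \<Longrightarrow> q \<in> pcar n \<Longrightarrow> affine_class p \<oplus>\<^bsub>S\<^esub> affine_class q = affine_class (p + q)"
  and affine_class_one: "\<one>\<^bsub>S\<^esub> = affine_class 1"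
  using Ring.ring_hom_mult[OF Ai.rcos_ring_hom, of "cl p" "cl q"] Ring.ring_hom_add[OF Ai.rcos_ring_hom, of "cl p" "cl q"]
    Ring.ring_hom_one[OF Ai.rcos_ring_hom]
  by (simp_all add: affine_ring_def affine_class_def cl_closed cl_mult cl_add cl_one)

lemma affine_class_zero: "\<zero>\<^bsub>S\<^esub> = affine_class 0"
  using ring_hom_zero[OF Ai.rcos_ring_hom FR.ring_axioms, folded affine_ring_def, OF cring.axioms(1)[OF cring_S]]
  by (simp add: cl_zero affine_class_def)

lemma affine_const: "affine_const n I c = affine_class (Const c)" by (simp add: affine_const_def affine_class_def)

lemma affine_class_homog_rep:
  assumes "s \<in> carrier S"
  shows "\<exists>N. \<forall>D\<ge>N. \<exists>q. q \<in> pcar n \<and> homog D q \<and> s = affine_class q"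
proof -
  obtain p where p: "p \<in> pcar n" "s = affine_class p" using assms S_carrier by auto
  obtain N where N: "\<And>D. D \<ge> N \<Longrightarrow> \<exists>q r. q \<in> pcar n \<and> homog D q \<and> r \<in> pcar n \<and> q - p = (X 0 - 1) * r"
    using homogenize[OF p(1)] by blast
  have "\<exists>q. q \<in> pcar n \<and> homog D q \<and> s = affine_class q" if D: "D \<ge> N" for D
  proof -
    obtain q r where qr: "q \<in> pcar n" "homog D q" "r \<in> pcar n" "q - p = (X 0 - 1) * r" using N[OF D] by blast
    have "q - p \<in> deh_ideal n I" unfolding deh_ideal_def qr(4) using qr(3) I_closed(1) by force
    then have "affine_class q = affine_class p" using p qr by (simp add: affine_class_eq_iff)
    then show ?thesis using qr p by metis
  qed
  then show ?thesis by blast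
qed

lemma X0_power_deh:
  assumes "p \<in> pcar n" shows "p * X 0 ^ k - p \<in> deh_ideal n I"
proof -
  obtain r :: "'k mpoly" where r: "r \<in> pcar n" "X 0 ^ k - 1 = (X 0 - 1) * r" using X0_power_minus_1 by blast
  have "p * X 0 ^ k - p = (X 0 ^ k - 1) * p" by (simp add: algebra_simps)
  also have "\<dots> = 0 + (X 0 - 1) * (r * p)" unfolding r(2) by (simp add: mult.assoc)
  finally have "p * X 0 ^ k - p = 0 + (X 0 - 1) * (r * p)" .
  then show ?thesis unfolding deh_ideal_def using assms r(1) I_closed(1) pcar_closed(3)[of r n p] by blast
qed

text \<open>Well-definedness of the embedding of \<open>S\<close>. The polynomial
  \<open>p * X 0 ^ l - q * X 0 ^ k\<close> lies in \<open>deh_ideal n I\<close> and is homogeneous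
  of degree \<open>k + l\<close>, so it lies in \<open>I\<close> by
  \<open>homog_in_deh\<close>.\<close>

lemma x0_frac_unique:
  assumes "p \<in> pcar n" "homog k p" "q \<in> pcar n" "homog l q" "affine_class p = affine_class q"
  shows "x0_frac p k = x0_frac q l"
proof -
  have "p - q \<in> deh_ideal n I" using assms by (simp add: affine_class_eq_iff)
  then have "(p * X 0 ^ l - p) - (q * X 0 ^ k - q) + (p - q) \<in> deh_ideal n I"
    using X0_power_deh[OF assms(1)] X0_power_deh[OF assms(3)] by (metis deh_closed(2,5))
  then have "p * X 0 ^ l - q * X 0 ^ k \<in> deh_ideal n I" by simp
  moreover have "homog (k + l) (p * X 0 ^ l - q * X 0 ^ k)"
    using homog_mult[OF assms(2) homog_X_power, of l 0] homog_mult[OF assms(4) homog_X_power, of k 0]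
    by (intro homog_diff) (simp_all add: add.commute)
  ultimately show ?thesis using homog_in_deh assms by (simp add: x0_frac_eq_iff)
qed

text \<open>The class of a homogeneous \<open>q\<close> of degree \<open>k\<close> is sent to \<open>q/x\<^sub>0\<^sup>k\<close>; this inverts \<open>f \<mapsto> f\<^bsup>deh\<^esup>\<close> in degree zero.\<close>

definition affine_embed :: "'k mpoly set set \<Rightarrow> 'k frac" where
  "affine_embed s = (SOME y. \<exists>q k. q \<in> pcar n \<and> homog k q \<and> s = affine_class q \<and> y = x0_frac q k)"

lemma affine_embed_eq: assumes "q \<in> pcar n" "homog k q" shows "affine_embed (affine_class q) = x0_frac q k"
  unfolding affine_embed_def
proof (rule some_equality)
  show "\<exists>p l. p \<in> pcar n \<and> homog l p \<and> affine_class q = affine_class p \<and> x0_frac q k = x0_frac p l" using assms by blast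
  fix y assume "\<exists>p l. p \<in> pcar n \<and> homog l p \<and> affine_class q = affine_class p \<and> y = x0_frac p l"
  then show "y = x0_frac q k" using x0_frac_unique assms by metis
qed

lemma x0_frac_in_A: "p \<in> pcar n \<Longrightarrow> homog (k + i) p \<Longrightarrow> x0_frac p k \<in> carrier A"
  using grade_subset_A[of "int i"] x0_frac_in_grade[of p "int i" k] poly_grade_nat[of p n "k + i"]
  by (auto simp: add.commute)

lemma affine_embed_hom: "affine_embed \<in> Ring.ring_hom S A"
proof (rule Ring.ring_hom_memI)
  fix s assume s: "s \<in> carrier S"
  obtain k q where q: "q \<in> pcar n" "homog k q" "s = affine_class q" using affine_class_homog_rep[OF s] by blast
  show "affine_embed s \<in> carrier A" unfolding q(3) affine_embed_eq[OF q(1,2)] using q x0_frac_in_A[of q k 0] by simp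
  fix t assume t: "t \<in> carrier S"
  obtain N where N: "\<And>k. k \<ge> N \<Longrightarrow> \<exists>q. q \<in> pcar n \<and> homog k q \<and> s = affine_class q" using affine_class_homog_rep[OF s] by blast
  obtain N' where N': "\<And>k. k \<ge> N' \<Longrightarrow> \<exists>q. q \<in> pcar n \<and> homog k q \<and> t = affine_class q" using affine_class_homog_rep[OF t] by blast
  \<comment> \<open>With representatives of one common degree the two fractions share their
    denominator, and their sum needs no expansion.\<close>
  obtain p q where p: "p \<in> pcar n" "homog (max N N') p" "s = affine_class p" and q: "q \<in> pcar n" "homog (max N N') q" "t = affine_class q"
    using N[of "max N N'"] N'[of "max N N'"] by auto
  show "affine_embed (s \<otimes>\<^bsub>S\<^esub> t) = affine_embed s \<otimes>\<^bsub>A\<^esub> affine_embed t"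
    unfolding p(3) q(3) affine_class_mult[OF p(1) q(1)] affine_embed_eq[OF p(1,2)] affine_embed_eq[OF q(1,2)] A_simps x0_frac_mult[OF p(1) q(1)]
    by (rule affine_embed_eq[OF pcar_closed(3)[OF p(1) q(1)] homog_mult[OF p(2) q(2)]])
  show "affine_embed (s \<oplus>\<^bsub>S\<^esub> t) = affine_embed s \<oplus>\<^bsub>A\<^esub> affine_embed t"
    unfolding p(3) q(3) affine_class_add[OF p(1) q(1)] affine_embed_eq[OF p(1,2)] affine_embed_eq[OF q(1,2)] A_simps x0_frac_add_same[OF p(1) q(1)]
    by (rule affine_embed_eq[OF pcar_closed(6)[OF p(1) q(1)] homog_add[OF p(2) q(2)]])
next
  show "affine_embed \<one>\<^bsub>S\<^esub> = \<one>\<^bsub>A\<^esub>" unfolding affine_class_one A_simps x0_frac_one by (rule affine_embed_eq) (simp_all add: pcar_closed homog_1)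
qed

section \<open>The closure as the polynomial ring over \<open>S\<close> in \<open>x0\<close>\<close>

abbreviation "x0 \<equiv> closure_class n I (X 0)"

lemma closure_class_eq: "closure_class n I p = x0_frac p 0"
  by (simp add: closure_class_def x0_frac_def cl_one)

lemma x0_closed: "x0 \<in> carrier A"
  unfolding closure_class_eq by (rule x0_frac_in_A[of _ 0 1]) (simp_all add: X0_in_pcar homog_X[unfolded One_nat_def])

sublocale A: cring A by (rule cring_A)
sublocale S: cring S by (rule cring_S)
sublocale affine_embed: ring_hom_cring S A affine_embed by (rule ring_hom_cringI) (simp_all add: cring_S cring_A affine_embed_hom)
sublocale US: UP_cring S "UP S" unfolding UP_cring_def by (simp_all add: cring_S)
sublocale ev: UP_pre_univ_prop S A affine_embed "UP S" ..

lemma x0_power: "x0 [^]\<^bsub>A\<^esub> i = x0_frac (X 0 ^ i) 0"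
  unfolding closure_class_eq
proof (induction i)
  case 0 then show ?case by (simp add: A_simps x0_frac_one)
next
  case (Suc i) then show ?case by (simp add: A_simps x0_frac_mult X0_in_pcar mult.commute)
qed

lemma affine_embed_x0_power: "q \<in> pcar n \<Longrightarrow> homog k q \<Longrightarrow> affine_embed (affine_class q) \<otimes>\<^bsub>A\<^esub> x0 [^]\<^bsub>A\<^esub> i = x0_frac (q * X 0 ^ i) k"
  unfolding x0_power affine_embed_eq A_simps by (simp add: x0_frac_mult X0_in_pcar)

abbreviation "ev0 \<equiv> UnivPoly.eval S A affine_embed x0"

text \<open>All coefficients receive numerators of the same degree \<open>k\<close>, so the value at
  \<open>x0\<close> is a single fraction over \<open>X 0 ^ k\<close>. The summands of its numerator
  have the distinct degrees \<open>k + i\<close> and can be separated again.\<close>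

lemma ev0_rep:
  assumes p: "p \<in> carrier (UP S)"
  shows "\<exists>k N q. (\<forall>i. q i \<in> pcar n \<and> homog k (q i)) \<and> (\<forall>i\<le>N. up_ring.coeff (UP S) p i = affine_class (q i)) \<and>
    (\<forall>i>N. up_ring.coeff (UP S) p i = \<zero>\<^bsub>S\<^esub>) \<and> ev0 p = x0_frac (\<Sum>i\<le>N. q i * X 0 ^ i) k"
proof -
  let ?c = "up_ring.coeff (UP S) p"
  define N where "N = deg S p"
  have c: "?c i \<in> carrier S" for i using p by simp
  obtain B where B: "\<And>i k. k \<ge> B i \<Longrightarrow> \<exists>q. q \<in> pcar n \<and> homog k q \<and> ?c i = affine_class q"
    using affine_class_homog_rep[OF c] by metis
  \<comment> \<open>The sum bounds each \<open>B i\<close>, so every coefficient has a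
    representative of degree \<open>k\<close>.\<close>
  define k where "k = (\<Sum>i\<le>N. B i)"
  have "\<exists>q. q \<in> pcar n \<and> homog k q \<and> (i \<le> N \<longrightarrow> ?c i = affine_class q)" for i
  proof (cases "i \<le> N")
    case True
    then have "B i \<le> k" unfolding k_def using member_le_sum[of i "{..N}" B] by simp
    then show ?thesis using B by blast
  qed (auto intro!: exI[of _ 0] simp: homog_0 pcar_closed)
  then obtain q where q: "\<And>i. q i \<in> pcar n" "\<And>i. homog k (q i)" "\<And>i. i \<le> N \<Longrightarrow> ?c i = affine_class (q i)" by metis
  let ?f = "\<lambda>i. affine_embed (?c i) \<otimes>\<^bsub>A\<^esub> x0 [^]\<^bsub>A\<^esub> i"
  have fc: "?f i \<in> carrier A" for i by (intro A.m_closed affine_embed.hom_closed c A.nat_pow_closed x0_closed)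
  have qc: "(\<Sum>i\<le>m. q i * X 0 ^ i) \<in> pcar n" for m
    by (intro pcar_closed(8) pcar_closed(3) q X0_in_pcar)
  have "finsum A ?f {..m} = x0_frac (\<Sum>i\<le>m. q i * X 0 ^ i) k" if "m \<le> N" for m
    using that
  proof (induction m)
    case 0
    have "finsum A ?f {..0} = ?f 0" by (rule A.finsum_0) (use fc in blast)
    then show ?case using affine_embed_x0_power[OF q(1,2), of 0 0] q(3)[of 0] by simp
  next
    case (Suc m)
    have "finsum A ?f {..Suc m} = ?f (Suc m) \<oplus>\<^bsub>A\<^esub> finsum A ?f {..m}"
      by (rule A.finsum_Suc) (use fc in blast)
    also have "?f (Suc m) = x0_frac (q (Suc m) * X 0 ^ Suc m) k"
      unfolding q(3)[OF Suc.prems] by (rule affine_embed_x0_power[OF q(1,2)])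
    also have "finsum A ?f {..m} = x0_frac (\<Sum>i\<le>m. q i * X 0 ^ i) k" using Suc by simp
    finally show ?case
      unfolding A_simps x0_frac_add_same[OF pcar_closed(3)[OF q(1) X0_in_pcar(2)] qc] by (simp add: add.commute)
  qed
  then have "ev0 p = x0_frac (\<Sum>i\<le>N. q i * X 0 ^ i) k" unfolding US.eval_on_carrier[OF p] N_def[symmetric] by simp
  moreover have "\<forall>i>N. ?c i = \<zero>\<^bsub>S\<^esub>" using US.deg_aboveD[OF _ p] by (simp add: N_def)
  ultimately show ?thesis using q by blast
qed

lemma ev0_hom: "ev0 \<in> Ring.ring_hom (UP S) A" by (rule ev.eval_ring_hom[OF x0_closed])

text \<open>The summand with index \<open>i\<close> has degree \<open>k + i\<close>, so at most one
  contributes. The bound on \<open>d\<close> ensures that for \<open>d\<close> at least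
  \<open>k\<close> the index \<open>d - k\<close> occurs in the sum.\<close>

lemma homog_sum_components:
  assumes q: "\<And>i. homog k (q i)" and d: "d < k \<or> d \<le> k + N"
  shows "hcomp d (\<Sum>i\<le>N. q i * X 0 ^ i) = (if d < k then 0 else q (d - k) * X 0 ^ (d - k))"
proof -
  have "hcomp d (q i * X 0 ^ i) = (if d = k + i then q i * X 0 ^ i else 0)" for i
    by (rule hcomp_homog[OF homog_mult[OF q homog_X_power]])
  then have *: "hcomp d (\<Sum>i\<le>N. q i * X 0 ^ i) = (\<Sum>i\<le>N. if d = k + i then q i * X 0 ^ i else 0)"
    by (simp add: hcomp_sum)
  show ?thesis
  proof (cases "d < k")
    case True then show ?thesis unfolding * by (intro trans[OF sum.neutral]) auto
  next
    case False
    then have "(\<Sum>i\<le>N. if d = k + i then q i * X 0 ^ i else 0) = (\<Sum>i\<le>N. if i = d - k then q i * X 0 ^ i else 0)"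
      by (intro sum.cong) auto
    then show ?thesis unfolding * using False d by simp
  qed
qed

text \<open>If the numerator lies in \<open>I\<close>, so does each homogeneous component
  \<open>q i * X 0 ^ i\<close>; cancelling \<open>X 0\<close> puts \<open>q i\<close> into
  \<open>I\<close>, so its class in \<open>S\<close> vanishes.\<close>

lemma ev0_eq_0:
  assumes p: "p \<in> carrier (UP S)" and 0: "ev0 p = \<zero>\<^bsub>A\<^esub>" shows "p = \<zero>\<^bsub>UP S\<^esub>"
proof (rule US.up_eqI)
  obtain k N q where q: "\<And>i. q i \<in> pcar n" "\<And>i. homog k (q i)"
    "\<And>i. i \<le> N \<Longrightarrow> up_ring.coeff (UP S) p i = affine_class (q i)"
    "\<And>i. i > N \<Longrightarrow> up_ring.coeff (UP S) p i = \<zero>\<^bsub>S\<^esub>" "ev0 p = x0_frac (\<Sum>i\<le>N. q i * X 0 ^ i) k"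
    using ev0_rep[OF p] by blast
  have "(\<Sum>i\<le>N. q i * X 0 ^ i) \<in> pcar n" by (intro pcar_closed(8) pcar_closed(3) q(1) X0_in_pcar)
  then have I: "(\<Sum>i\<le>N. q i * X 0 ^ i) \<in> I" using 0 x0_frac_eq_0 unfolding q(5) A_simps by blast
  fix i
  have "up_ring.coeff (UP S) p i = \<zero>\<^bsub>S\<^esub>"
  proof (cases "i \<le> N")
    case True
    have "q i * X 0 ^ i \<in> I"
      using hcomp_in_I[OF I, of "k + i"] homog_sum_components[of k q "k + i" N, OF q(2)] True by simp
    then have "q i \<in> I" using X0_power_nonzerodivisor[OF q(1)] by (simp add: mult.commute)
    then have "q i \<in> deh_ideal n I" using I_subset_deh by blast
    then have "affine_class (q i) = affine_class 0" using q(1) by (simp add: affine_class_eq_iff pcar_closed)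
    then show ?thesis using q(3)[OF True] by (simp add: affine_class_zero)
  qed (use q(4) in simp)
  then show "up_ring.coeff (UP S) p i = up_ring.coeff (UP S) \<zero>\<^bsub>UP S\<^esub> i" by simp
qed (use p in simp_all)

lemma ev0_monom: "s \<in> carrier S \<Longrightarrow> ev0 (up_ring.monom (UP S) s i) = affine_embed s \<otimes>\<^bsub>A\<^esub> x0 [^]\<^bsub>A\<^esub> i"
  by (rule ev.eval_monom) (simp_all add: x0_closed)

text \<open>A fraction \<open>p / x0^k\<close> of degree \<open>d\<close> has a numerator of degree
  \<open>k + d\<close>. It equals \<open>p / x0^(k+d)\<close> times \<open>x0^d\<close>, and the
  first factor is the image of the class of \<open>p\<close>.\<close>

lemma closure_component:
  assumes d: "d \<ge> 0"
  shows "hom_quotient_grade R (coord_grade n I) d = {affine_embed s \<otimes>\<^bsub>A\<^esub> x0 [^]\<^bsub>A\<^esub> nat d | s. s \<in> carrier S}"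
proof (intro subset_antisym subsetI)
  fix y assume "y \<in> hom_quotient_grade R (coord_grade n I) d"
  then obtain p k where pk: "p \<in> poly_grade n (d + int k)" "y = x0_frac p k" using grade_rep by blast
  have "d + int k = int (nat d + k)" using d by simp
  then have p: "p \<in> pcar n" "homog (nat d + k) p" using pk(1) poly_grade_nat by metis+
  have "affine_embed (affine_class p) \<otimes>\<^bsub>A\<^esub> x0 [^]\<^bsub>A\<^esub> nat d = y"
    unfolding affine_embed_x0_power[OF p] pk(2)
    using p by (simp add: x0_frac_eq_iff pcar_closed X0_in_pcar power_add I_closed algebra_simps)
  then show "y \<in> {affine_embed s \<otimes>\<^bsub>A\<^esub> x0 [^]\<^bsub>A\<^esub> nat d | s. s \<in> carrier S}" using affine_class_closed[OF p(1)] by blast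
next
  fix y assume "y \<in> {affine_embed s \<otimes>\<^bsub>A\<^esub> x0 [^]\<^bsub>A\<^esub> nat d | s. s \<in> carrier S}"
  then obtain s where s: "s \<in> carrier S" "y = affine_embed s \<otimes>\<^bsub>A\<^esub> x0 [^]\<^bsub>A\<^esub> nat d" by blast
  obtain k q where q: "q \<in> pcar n" "homog k q" "s = affine_class q" using affine_class_homog_rep[OF s(1)] by blast
  have "d + int k = int (k + nat d)" using d by simp
  then have "q * X 0 ^ nat d \<in> poly_grade n (d + int k)"
    using q homog_mult[OF q(2) homog_X_power] by (metis poly_grade_nat pcar_closed(3) X0_in_pcar(2))
  then show "y \<in> hom_quotient_grade R (coord_grade n I) d"
    unfolding s(2) q(3) affine_embed_x0_power[OF q(1,2)] by (rule x0_frac_in_grade)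
qed

lemma ev0_bij: "bij_betw ev0 (carrier (UP S)) (carrier A)"
  unfolding bij_betw_def
proof
  interpret E: ring_hom_cring "UP S" A ev0
    by (rule ring_hom_cringI) (simp_all add: US.UP_cring cring_A ev0_hom)
  show "inj_on ev0 (carrier (UP S))"
  proof (rule inj_onI)
    fix p q assume *: "p \<in> carrier (UP S)" "q \<in> carrier (UP S)" "ev0 p = ev0 q"
    then have "ev0 (p \<ominus>\<^bsub>UP S\<^esub> q) = \<zero>\<^bsub>A\<^esub>" by (simp add: a_minus_def A.r_neg)
    then have "p \<ominus>\<^bsub>UP S\<^esub> q = \<zero>\<^bsub>UP S\<^esub>" using * by (intro ev0_eq_0) simp_all
    then show "p = q" using * by simp
  qed
  show "ev0 ` carrier (UP S) = carrier A"
  proof (intro subset_antisym subsetI)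
    fix y assume "y \<in> ev0 ` carrier (UP S)"
    then show "y \<in> carrier A" by auto
  next
    interpret Q: cring FR.Q by (rule FR.cring_hom_quotient_ring)
    fix y assume "y \<in> carrier A"
    then have "y \<in> generate_ring FR.Q (\<Union>d\<in>{0..}. hom_quotient_grade R (coord_grade n I) d)"
      by (simp add: closure_ring_def truncated_closure_def)
    then show "y \<in> ev0 ` carrier (UP S)"
    proof (induction rule: generate_ring.induct)
      case one
      show ?case by (rule image_eqI[of _ _ "\<one>\<^bsub>UP S\<^esub>"]) (simp_all flip: A_simps(3))
    next
      case (incl y)
      then obtain d where "d \<ge> 0" "y \<in> hom_quotient_grade R (coord_grade n I) d" by auto
      then obtain s where "s \<in> carrier S" "y = affine_embed s \<otimes>\<^bsub>A\<^esub> x0 [^]\<^bsub>A\<^esub> nat d" using closure_component by blast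
      then show ?case by (intro image_eqI[of _ _ "up_ring.monom (UP S) s (nat d)"]) (simp_all add: ev0_monom)
    next
      \<comment> \<open>The generated ring takes negatives in \<open>Q\<close>; by uniqueness of
        inverses they are the images of negatives in \<open>UP S\<close>.\<close>
      case (a_inv y)
      then obtain p where p: "p \<in> carrier (UP S)" "y = ev0 p" by blast
      have "ev0 p \<oplus>\<^bsub>A\<^esub> ev0 (\<ominus>\<^bsub>UP S\<^esub> p) = \<zero>\<^bsub>A\<^esub>" using p by (simp add: A.r_neg)
      then have 0: "ev0 (\<ominus>\<^bsub>UP S\<^esub> p) \<oplus>\<^bsub>FR.Q\<^esub> ev0 p = \<zero>\<^bsub>FR.Q\<^esub>"
        using p by (simp add: A.a_comm flip: A_simps)
      have "carrier A \<subseteq> carrier FR.Q" using subringE(1)[OF A_subring] .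
      then have "\<ominus>\<^bsub>FR.Q\<^esub> ev0 p = ev0 (\<ominus>\<^bsub>UP S\<^esub> p)"
        using p by (intro Q.minus_equality[OF 0]) auto
      moreover have "\<ominus>\<^bsub>UP S\<^esub> p \<in> carrier (UP S)" using p(1) by simp
      ultimately show ?case unfolding p(2) by (metis image_eqI)
    next
      case (eng_add y z)
      then obtain p q where pq: "p \<in> carrier (UP S)" "y = ev0 p" "q \<in> carrier (UP S)" "z = ev0 q" by blast
      then have "ev0 (p \<oplus>\<^bsub>UP S\<^esub> q) = y \<oplus>\<^bsub>FR.Q\<^esub> z" by (simp flip: A_simps)
      moreover have "p \<oplus>\<^bsub>UP S\<^esub> q \<in> carrier (UP S)" using pq by simp
      ultimately show ?case by (metis image_eqI)
    next
      case (eng_mult y z)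
      then obtain p q where pq: "p \<in> carrier (UP S)" "y = ev0 p" "q \<in> carrier (UP S)" "z = ev0 q" by blast
      then have "ev0 (p \<otimes>\<^bsub>UP S\<^esub> q) = y \<otimes>\<^bsub>FR.Q\<^esub> z" by (simp flip: A_simps)
      moreover have "p \<otimes>\<^bsub>UP S\<^esub> q \<in> carrier (UP S)" using pq by simp
      ultimately show ?case by (metis image_eqI)
    qed
  qed
qed

text \<open>A value of a polynomial at \<open>x0\<close> has, over \<open>X 0 ^ l\<close>, a
  numerator with all degrees at least \<open>l\<close>. After cross-multiplication the numerator of
  a fraction of degree \<open>d < 0\<close> sits strictly below all of them; comparing components
  modulo \<open>I\<close> kills it.\<close>

lemma closure_component_neg:
  assumes d: "d < 0"
  shows "closure_grade n I d = {\<zero>\<^bsub>A\<^esub>}"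
proof -
  have "y = \<zero>\<^bsub>A\<^esub>" if y: "y \<in> carrier A" "y \<in> hom_quotient_grade R (coord_grade n I) d" for y
  proof -
    obtain p k where pk: "p \<in> poly_grade n (d + int k)" "y = x0_frac p k" using grade_rep[OF y(2)] by blast
    have p: "p \<in> pcar n" using pk(1) by (simp add: poly_grade_def)
    obtain P where P: "P \<in> carrier (UP S)" "y = ev0 P" using y(1) ev0_bij by (auto simp: bij_betw_def)
    obtain l N q where q: "\<And>i. q i \<in> pcar n" "\<And>i. homog l (q i)" "ev0 P = x0_frac (\<Sum>i\<le>N. q i * X 0 ^ i) l"
      using ev0_rep[OF P(1)] by blast
    have sum: "(\<Sum>i\<le>N. q i * X 0 ^ i) \<in> pcar n" by (intro pcar_closed(8) pcar_closed(3) q(1) X0_in_pcar)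
    have "x0_frac p k = x0_frac (\<Sum>i\<le>N. q i * X 0 ^ i) l" using pk(2) P(2) q(3) by simp
    then have I: "p * X 0 ^ l - (\<Sum>i\<le>N. q i * X 0 ^ i) * X 0 ^ k \<in> I" using x0_frac_eq_iff[OF p sum] by simp
    show ?thesis
    proof (cases "d + int k < 0")
      case True
      then have "p = 0" using pk(1) poly_grade_neg by blast
      then show ?thesis unfolding pk(2) A_simps x0_frac_zero using x0_frac_0 by simp
    next
      case False
      then obtain e where e: "d + int k = int e" by (metis linorder_not_less nonneg_int_cases)
      then have hp: "homog e p" using pk(1) by (simp add: poly_grade_nat)
      have "hcomp (e + l) (p * X 0 ^ l) = p * X 0 ^ l"
        using hcomp_homog[OF homog_mult[OF hp homog_X_power]] by simp
      moreover have "hcomp (e + l) ((\<Sum>i\<le>N. q i * X 0 ^ i) * X 0 ^ k) = 0"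
      proof -
        have "hcomp (e + l) (q i * X 0 ^ i * X 0 ^ k) = 0" for i
          using hcomp_homog[OF homog_mult[OF homog_mult[OF q(2) homog_X_power] homog_X_power], of "e + l"] e d by simp
        then show ?thesis by (simp add: sum_distrib_right hcomp_sum)
      qed
      ultimately have "p * X 0 ^ l \<in> I" using hcomp_in_I[OF I, of "e + l"] by (simp add: hcomp_diff)
      then have "p \<in> I" using X0_power_nonzerodivisor[OF p] by (simp add: mult.commute)
      then show ?thesis unfolding pk(2) A_simps using x0_frac_eq_0[OF p] by simp
    qed
  qed
  moreover have "\<zero>\<^bsub>A\<^esub> \<in> hom_quotient_grade R (coord_grade n I) d"
    unfolding A_simps x0_frac_zero by (rule x0_frac_in_grade) (simp add: poly_grade_def pcar_closed)
  ultimately show ?thesis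
    unfolding closure_grade_def truncated_closure_grade_def closure_ring_def[symmetric] by auto
qed

lemma closure_grade_eq:
  "closure_grade n I d = (if d < 0 then {\<zero>\<^bsub>A\<^esub>} else {affine_embed s \<otimes>\<^bsub>A\<^esub> x0 [^]\<^bsub>A\<^esub> nat d | s. s \<in> carrier S})"
proof (cases "d < 0")
  case False
  then have "hom_quotient_grade R (coord_grade n I) d \<subseteq> carrier A" using grade_subset_A by simp
  then show ?thesis
    using closure_component[of d] False
    unfolding closure_grade_def truncated_closure_grade_def closure_ring_def[symmetric] by auto
qed (simp add: closure_component_neg)

end

text \<open>Finite \<open>w\<close> and nonzero \<open>d\<close> make \<open>h 0\<close> strictly
  smaller than the later values, so no index below \<open>1\<close> qualifies. Two eventual
  constants agree because both are attained at a common large index.\<close>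

lemma hilbert_const_and_regularity:
  assumes "\<And>i. i > 0 \<Longrightarrow> h i = d + w" "h 0 = w" "d \<noteq> 0" "w \<noteq> \<infinity>"
  shows "hilbert_const h = d + w" "regularity_index h = 1"
proof -
  have "\<exists>i0. \<forall>i\<ge>i0. h i = d + w" using assms(1) by (intro exI[of _ 1]) simp
  moreover have "c = d + w" if c: "\<exists>i0. \<forall>i\<ge>i0. h i = c" for c
  proof -
    obtain i0 where "\<forall>i\<ge>i0. h i = c" using c by blast
    then have "h (max i0 1) = c" by simp
    then show ?thesis using assms(1)[of "max i0 1"] by simp
  qed
  ultimately show hc: "hilbert_const h = d + w" unfolding hilbert_const_def by (rule the_equality)
  show "regularity_index h = 1" unfolding regularity_index_def hc
  proof (rule Least_equality)
    show "\<forall>j\<ge>1. h j = d + w" using assms(1) by simp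
    fix i assume i: "\<forall>j\<ge>i. h j = d + w"
    show "1 \<le> i"
    proof (rule ccontr)
      assume "\<not> 1 \<le> i"
      then have "h 0 = d + w" using i by simp
      then show False using assms(2-4) by (cases d; cases w) (auto simp: zero_enat_def)
    qed
  qed
qed

section \<open>Application to the truncated integral closure\<close>

context zero_dim_scheme
begin

lemma affine_const_hom: "affine_const n I \<in> Ring.ring_hom class_ring S"
  by (rule Ring.ring_hom_memI)
    (simp_all add: affine_const class_ring_simps affine_class_closed affine_class_mult affine_class_add affine_class_one Const_in_pcar Const_mult Const_add Const_1)

lemma closure_const_eq: "closure_const n I c = affine_embed (affine_const n I c)"
  by (simp add: closure_const_def closure_class_eq affine_const affine_embed_eq[OF Const_in_pcar homog_Const])

sublocale PE: poly_extension class_ring S A "affine_const n I" "closure_const n I" affine_embed x0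
  by unfold_locales
    (simp_all add: fieldE(1)[OF class_field] cring_S cring_A affine_const_hom affine_embed_hom closure_const_eq x0_closed ev0_bij)

lemma closure_grade_PE: "closure_grade n I = PE.grA"
  by (rule ext) (simp add: closure_grade_eq PE.grA_def)

lemma hilbert_PE: "closure_omega_hilbert n I i = vdim class_ring (PE.Gr i)"
  by (simp add: closure_omega_hilbert_def hilbert_fun_def closure_omega_def closure_omega_grade_def closure_grade_PE)

lemma vectorspace_S: "vectorspace class_ring PE.SK"
  using PE.SK_module class_field by (simp add: vectorspace_def)

lemma fin_dim_S: "vectorspace.fin_dim class_ring PE.SK"
proof -
  obtain F where F: "finite F" "F \<subseteq> pcar n" "pcar n \<subseteq> span_mod F" using finite_span_mod .
  show ?thesis
  proof (rule fin_dimI[OF vectorspace_S, of "affine_class ` F"])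
    show "finite (affine_class ` F)" "affine_class ` F \<subseteq> carrier PE.SK" using F by (auto simp: PE.SK_simps affine_class_closed)
    fix W assume W: "submodule class_ring W PE.SK" "affine_class ` F \<subseteq> W"
    note D = submoduleD[OF W(1), unfolded PE.SK_simps]
    have *: "affine_class (\<Sum>f\<in>F'. Const (c f) * f) \<in> W" if "F' \<subseteq> F" for c F'
      using finite_subset[OF that F(1)] that
    proof (induction rule: finite_induct)
      case empty then show ?case using D(1) by (simp add: restrict_scalars_def regular_module_def affine_class_zero)
    next
      case (insert f F')
      have f: "f \<in> pcar n" "affine_class f \<in> W" using insert.prems F(2) W(2) by auto
      have cf: "Const (c f) * f \<in> pcar n" by (rule pcar_closed(3)[OF Const_in_pcar f(1)])
      have sum: "(\<Sum>f\<in>F'. Const (c f) * f) \<in> pcar n"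
        using insert.prems F(2) by (intro pcar_closed(8) pcar_closed(3) Const_in_pcar) auto
      have "affine_const n I (c f) \<otimes>\<^bsub>S\<^esub> affine_class f \<in> W" by (rule D(3)[OF _ f(2)]) (simp add: class_ring_simps)
      then have "affine_class (Const (c f) * f) \<in> W" unfolding affine_const affine_class_mult[OF Const_in_pcar f(1)] .
      from D(2)[OF this insert.IH] show ?case
        using insert.hyps insert.prems by (simp add: affine_class_add[OF cf sum])
    qed
    show "carrier PE.SK \<subseteq> W"
    proof
      fix s assume "s \<in> carrier PE.SK"
      then obtain p where p: "p \<in> pcar n" "s = affine_class p" by (auto simp: PE.SK_simps S_carrier)
      obtain c where c: "p - (\<Sum>f\<in>F. Const (c f) * f) \<in> deh_ideal n I"
        using p(1) F(3) unfolding span_mod_def by blast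
      have "(\<Sum>f\<in>F. Const (c f) * f) \<in> pcar n"
        using F(2) by (intro pcar_closed(8) pcar_closed(3) Const_in_pcar) auto
      then have "s = affine_class (\<Sum>f\<in>F. Const (c f) * f)" using c p by (simp add: affine_class_eq_iff)
      then show "s \<in> W" using *[OF subset_refl] by simp
    qed
  qed
qed

lemma scheme_degree_nonzero: "scheme_degree n I \<noteq> 0"
  unfolding scheme_degree_def
proof (rule vdim_nonzero[OF vectorspace_S])
  show "affine_class 1 \<in> carrier PE.SK" by (simp add: PE.SK_simps affine_class_closed pcar_closed)
  show "affine_class 1 \<noteq> \<zero>\<^bsub>PE.SK\<^esub>"
    using one_notin_deh by (simp add: restrict_scalars_def regular_module_def affine_class_zero affine_class_eq_iff pcar_closed)
qed

lemma vectorspace_omega: "vectorspace class_ring (affine_omega n I)"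
  using PE.N_module class_field by (simp add: vectorspace_def affine_omega_def)

lemma fin_dim_omega: "vectorspace.fin_dim class_ring (affine_omega n I)"
  unfolding affine_omega_def by (rule PE.fin_dim_N[OF class_field fin_dim_S])

lemma hilbert_closure_omega:
  "i < 0 \<Longrightarrow> closure_omega_hilbert n I i = 0"
  "closure_omega_hilbert n I 0 = vdim class_ring (affine_omega n I)"
  "i > 0 \<Longrightarrow> closure_omega_hilbert n I i = scheme_degree n I + vdim class_ring (affine_omega n I)"
proof -
  show "i < 0 \<Longrightarrow> closure_omega_hilbert n I i = 0"
    unfolding hilbert_PE by (rule PE.vdim_Gr_neg[OF class_field])
  show "closure_omega_hilbert n I 0 = vdim class_ring (affine_omega n I)"
    unfolding hilbert_PE affine_omega_def by (rule PE.vdim_Gr_0[OF class_field])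
  assume i: "i > 0"
  show "closure_omega_hilbert n I i = scheme_degree n I + vdim class_ring (affine_omega n I)"
    unfolding hilbert_PE PE.vdim_Gr_pos[OF class_field i] scheme_degree_def affine_omega_def[symmetric]
    by (rule vdim_direct_sum[OF vectorspace_S fin_dim_S vectorspace_omega fin_dim_omega])
qed

lemma closure_omega_iso:
  "\<exists>f. graded_module_iso K_poly (closure_omega_Kpoly n I) (closure_omega_grade n I)
     (direct_sum (dx0_module n I) (omega_tensor_module n I))
     (\<lambda>i. dx0_grade n I i \<times> omega_tensor_grade n I i) f"
  using PE.omega_graded_iso
  unfolding closure_omega_Kpoly_def closure_omega_grade_def closure_omega_def closure_grade_PE dx0_module_def
    dx0_grade_def omega_tensor_module_def omega_tensor_grade_def affine_omega_def PE.\<psi>_def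
  by blast

lemma hilbert_const_regularity:
  "hilbert_const (closure_omega_hilbert n I) = scheme_degree n I + vdim class_ring (affine_omega n I)"
  "regularity_index (closure_omega_hilbert n I) = 1"
  using hilbert_const_and_regularity[where h = "closure_omega_hilbert n I" and d = "scheme_degree n I",
      OF hilbert_closure_omega(3,2) scheme_degree_nonzero] fin_dim_omega
  by (simp_all add: vdim_def)

end

theorem proposition3p7:
  fixes n :: nat and I :: "'k::field mpoly set"
  assumes "perfect_field TYPE('k)"
    and "n \<ge> 1"
    and "scheme_ideal n I"
    and "zero_dimensional n I"
    and "\<forall>p\<in>scheme_points n I. X 0 \<notin> p"
  shows "(\<exists>f. graded_module_iso K_poly
            (closure_omega_Kpoly n I) (closure_omega_grade n I)
            (direct_sum (dx0_module n I) (omega_tensor_module n I))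
            (\<lambda>i. dx0_grade n I i \<times> omega_tensor_grade n I i) f)
    \<and> ((\<forall>i<0. closure_omega_hilbert n I i = 0)
       \<and> closure_omega_hilbert n I 0 = vdim class_ring (affine_omega n I)
       \<and> (\<forall>i>0. closure_omega_hilbert n I i
                  = scheme_degree n I + vdim class_ring (affine_omega n I)))
    \<and> (hilbert_const (closure_omega_hilbert n I)
         = scheme_degree n I + vdim class_ring (affine_omega n I)
       \<and> regularity_index (closure_omega_hilbert n I) = 1)"
proof -
  interpret zero_dim_scheme n I using assms by unfold_locales
  show ?thesis
    using closure_omega_iso hilbert_closure_omega hilbert_const_regularity by blast
qed

end
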